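(* Let $0<T<\infty$, $1\leq p<\infty$ and let $\Omega\subset\mathbb{R}^d$ be an open set. Let $\rho:\mathbb{R}^d\to\mathbb{R}$ be a nonnegative smooth radial function with compact support, not identically zero, and set $\rho_n(x)=n^d\rho(nx)$ for $n\ge 1$. Let $\{f_n\}_{n\geq 1}$ be a sequence of functions in $L^p((0,T)\times\Omega)$ for which there is a constant $M$, independent of $n$, such that for all $n\geq 1$ $$\int_0^T\int_\Omega |f_n(t,x)|^p\,dx\,dt\leq M$$ and $$n^p\int_0^T\int_\Omega\int_\Omega \rho_n(x-y)\,|f_n(t,x)-f_n(t,y)|^p\,dx\,dy\,dt\leq M.$$ 1. If $\{f_n\}_{n\geq 1}$ converges weakly in $L^p((0,T)\times\Omega)$ to $f$, then $f\in L^p((0,T),W^{1,p}(\Omega))$ if $p>1$, and $f\in L^1((0,T),BV(\Omega))$ if $p=1$. 2. Let $p>1$. Assume in addition that $\Omega$ is a smooth bounded domain in $\mathbb{R}^d$, that $\rho(x)\geq\rho(y)$ whenever $|x|\leq|y|$, and that $$\|\partial_t f_n\|_{L^p((0,T),W^{-1,p}(\Omega))}\leq M\quad\text{for all } n\geq 1.$$ Then $\{f_n\}_{n\geq 1}$ is relatively compact in $L^p((0,T)\times\Omega)$.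
   Context: $W^{-1,p}(\Omega)$ is the dual of $W^{1,p'}_0(\Omega)$, where $1/p+1/p'=1$; $BV(\Omega)$ is the space of functions of bounded variation on $\Omega$; $\partial_t f_n$ is the distributional time derivative. *)

theory Defs
  imports "HOL-Analysis.Analysis"
begin

section \<open>Differentiability classes and test functions\<close>

primrec C_k :: "nat \<Rightarrow> ('a::euclidean_space \<Rightarrow> 'b::euclidean_space) \<Rightarrow> bool" where
  "C_k 0 f \<longleftrightarrow> continuous_on UNIV f"
| "C_k (Suc k) f \<longleftrightarrow>
     (\<forall>x. f differentiable (at x)) \<and> (\<forall>v. C_k k (\<lambda>x. frechet_derivative f (at x) v))"

definition smooth :: "('a::euclidean_space \<Rightarrow> 'b::euclidean_space) \<Rightarrow> bool" where
  "smooth f \<longleftrightarrow> (\<forall>k. C_k k f)"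

definition supp :: "('a::euclidean_space \<Rightarrow> 'b::euclidean_space) \<Rightarrow> 'a set" where
  "supp f = closure {x. f x \<noteq> 0}"

definition C_k_c :: "nat \<Rightarrow> 'a::euclidean_space set \<Rightarrow> ('a \<Rightarrow> 'b::euclidean_space) set" where
  "C_k_c k \<Omega> = {\<phi>. C_k k \<phi> \<and> compact (supp \<phi>) \<and> supp \<phi> \<subseteq> \<Omega>}"

definition test_functions :: "'a::euclidean_space set \<Rightarrow> ('a \<Rightarrow> real) set" where
  "test_functions \<Omega> = {\<phi>. smooth \<phi> \<and> compact (supp \<phi>) \<and> supp \<phi> \<subseteq> \<Omega>}"

section \<open>Spaces of functions with a norm\<close>

text \<open>
  A normed space is given by a set \<open>X\<close> of real-valued functions, closed under pointwise linear
  combinations, and a map \<open>N\<close> that is a seminorm on \<open>X\<close>. Functions are not identified when they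
  agree almost everywhere, so \<open>N\<close> may vanish on nonzero functions and the topology below need
  not be Hausdorff; it is the pullback of the topology of the quotient by the kernel of \<open>N\<close>.
  The values of \<open>N\<close> outside \<open>X\<close> carry no meaning.
\<close>

definition norm_topology :: "('e \<Rightarrow> real) set \<Rightarrow> (('e \<Rightarrow> real) \<Rightarrow> real) \<Rightarrow> ('e \<Rightarrow> real) topology" where
  "norm_topology X N = topology (\<lambda>U. U \<subseteq> X \<and>
     (\<forall>u\<in>U. \<exists>e>0. \<forall>v\<in>X. N (\<lambda>x. v x - u x) < e \<longrightarrow> v \<in> U))"

lemma openin_norm_topology:
  "openin (norm_topology X N) U \<longleftrightarrow>
     U \<subseteq> X \<and> (\<forall>u\<in>U. \<exists>e>0. \<forall>v\<in>X. N (\<lambda>x. v x - u x) < e \<longrightarrow> v \<in> U)"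
proof -
  let ?P = "\<lambda>U. U \<subseteq> X \<and> (\<forall>u\<in>U. \<exists>e>0. \<forall>v\<in>X. N (\<lambda>x. v x - u x) < e \<longrightarrow> v \<in> U)"
  have "istopology ?P"
    unfolding istopology_def
  proof (intro conjI allI impI)
    fix S T assume S: "?P S" and T: "?P T"
    show "S \<inter> T \<subseteq> X" using S by blast
    show "\<forall>u\<in>S \<inter> T. \<exists>e>0. \<forall>v\<in>X. N (\<lambda>x. v x - u x) < e \<longrightarrow> v \<in> S \<inter> T"
    proof
      fix u assume u: "u \<in> S \<inter> T"
      obtain d where d: "d > 0" "\<forall>v\<in>X. N (\<lambda>x. v x - u x) < d \<longrightarrow> v \<in> S" using S u by blast
      obtain e where e: "e > 0" "\<forall>v\<in>X. N (\<lambda>x. v x - u x) < e \<longrightarrow> v \<in> T" using T u by blast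
      have "min d e > 0 \<and> (\<forall>v\<in>X. N (\<lambda>x. v x - u x) < min d e \<longrightarrow> v \<in> S \<inter> T)"
        using d e by auto
      then show "\<exists>e>0. \<forall>v\<in>X. N (\<lambda>x. v x - u x) < e \<longrightarrow> v \<in> S \<inter> T" by blast
    qed
  next
    fix \<K> assume K: "\<forall>S\<in>\<K>. ?P S"
    show "\<Union> \<K> \<subseteq> X" using K by blast
    show "\<forall>u\<in>\<Union> \<K>. \<exists>e>0. \<forall>v\<in>X. N (\<lambda>x. v x - u x) < e \<longrightarrow> v \<in> \<Union> \<K>"
    proof
      fix u assume "u \<in> \<Union> \<K>"
      then obtain S where S: "S \<in> \<K>" "u \<in> S" by blast
      then obtain e where "e > 0" "\<forall>v\<in>X. N (\<lambda>x. v x - u x) < e \<longrightarrow> v \<in> S" using K by blast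
      then show "\<exists>e>0. \<forall>v\<in>X. N (\<lambda>x. v x - u x) < e \<longrightarrow> v \<in> \<Union> \<K>" using S by blast
    qed
  qed
  then show ?thesis by (simp add: norm_topology_def topology_inverse')
qed

definition relatively_compact_in ::
    "('e \<Rightarrow> real) set \<Rightarrow> (('e \<Rightarrow> real) \<Rightarrow> real) \<Rightarrow> ('e \<Rightarrow> real) set \<Rightarrow> bool" where
  "relatively_compact_in X N S \<longleftrightarrow>
     S \<subseteq> X \<and> compactin (norm_topology X N) (norm_topology X N closure_of S)"

definition dual_space :: "('e \<Rightarrow> real) set \<Rightarrow> (('e \<Rightarrow> real) \<Rightarrow> real) \<Rightarrow> (('e \<Rightarrow> real) \<Rightarrow> real) set" where
  "dual_space X N = {F.
     (\<forall>u\<in>X. \<forall>v\<in>X. \<forall>a b. F (\<lambda>x. a * u x + b * v x) = a * F u + b * F v) \<and>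
     (\<exists>C. \<forall>u\<in>X. \<bar>F u\<bar> \<le> C * N u)}"

definition dual_norm :: "('e \<Rightarrow> real) set \<Rightarrow> (('e \<Rightarrow> real) \<Rightarrow> real) \<Rightarrow> (('e \<Rightarrow> real) \<Rightarrow> real) \<Rightarrow> real" where
  "dual_norm X N F = (SUP u\<in>{u\<in>X. N u \<le> 1}. \<bar>F u\<bar>)"

definition weakly_converges_in ::
    "('e \<Rightarrow> real) set \<Rightarrow> (('e \<Rightarrow> real) \<Rightarrow> real) \<Rightarrow> (nat \<Rightarrow> 'e \<Rightarrow> real) \<Rightarrow> ('e \<Rightarrow> real) \<Rightarrow> bool" where
  "weakly_converges_in X N f g \<longleftrightarrow>
     g \<in> X \<and> (\<forall>F\<in>dual_space X N. (\<lambda>n. F (f n)) \<longlonglongrightarrow> F g)"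

section \<open>Lebesgue and Bochner spaces\<close>

definition Lp_space :: "real \<Rightarrow> 'e measure \<Rightarrow> ('e \<Rightarrow> 'b::euclidean_space) set" where
  "Lp_space p M = {f \<in> borel_measurable M. integrable M (\<lambda>x. norm (f x) powr p)}"

definition Lp_norm :: "real \<Rightarrow> 'e measure \<Rightarrow> ('e \<Rightarrow> 'b::euclidean_space) \<Rightarrow> real" where
  "Lp_norm p M f = (\<integral>x. norm (f x) powr p \<partial>M) powr (1 / p)"

definition strongly_measurable ::
    "'t measure \<Rightarrow> ('e \<Rightarrow> real) set \<Rightarrow> (('e \<Rightarrow> real) \<Rightarrow> real) \<Rightarrow> ('t \<Rightarrow> 'e \<Rightarrow> real) \<Rightarrow> bool" where
  "strongly_measurable M X N u \<longleftrightarrow>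
     (AE t in M. u t \<in> X) \<and>
     (\<exists>s :: nat \<Rightarrow> 't \<Rightarrow> 'e \<Rightarrow> real.
        (\<forall>k. simple_function M (s k) \<and> s k ` space M \<subseteq> X) \<and>
        (AE t in M. (\<lambda>k. N (\<lambda>x. s k t x - u t x)) \<longlonglongrightarrow> 0))"

definition bochner_space ::
    "real \<Rightarrow> 't measure \<Rightarrow> ('e \<Rightarrow> real) set \<Rightarrow> (('e \<Rightarrow> real) \<Rightarrow> real) \<Rightarrow> ('t \<Rightarrow> 'e \<Rightarrow> real) set" where
  "bochner_space p M X N =
     {u. strongly_measurable M X N u \<and> integrable M (\<lambda>t. N (u t) powr p)}"

definition bochner_norm ::
    "real \<Rightarrow> 't measure \<Rightarrow> (('e \<Rightarrow> real) \<Rightarrow> real) \<Rightarrow> ('t \<Rightarrow> 'e \<Rightarrow> real) \<Rightarrow> real" where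
  "bochner_norm p M N u = (\<integral>t. N (u t) powr p \<partial>M) powr (1 / p)"

section \<open>Sobolev spaces\<close>

definition locally_integrable_on ::
    "'a::euclidean_space set \<Rightarrow> ('a \<Rightarrow> 'b::euclidean_space) \<Rightarrow> bool" where
  "locally_integrable_on \<Omega> u \<longleftrightarrow>
     (\<forall>K. compact K \<and> K \<subseteq> \<Omega> \<longrightarrow> integrable (lebesgue_on K) u)"

definition has_weak_gradient ::
    "(real^'d) set \<Rightarrow> (real^'d \<Rightarrow> real) \<Rightarrow> (real^'d \<Rightarrow> real^'d) \<Rightarrow> bool" where
  "has_weak_gradient \<Omega> u G \<longleftrightarrow>
     locally_integrable_on \<Omega> u \<and> locally_integrable_on \<Omega> G \<and>
     (\<forall>\<phi>\<in>test_functions \<Omega>. \<forall>i.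
        (\<integral>x. u x * frechet_derivative \<phi> (at x) (axis i 1) \<partial>lebesgue_on \<Omega>) =
        - (\<integral>x. G x $ i * \<phi> x \<partial>lebesgue_on \<Omega>))"

text \<open>The weak gradient is unique up to null sets, so the choice does not affect the norm.\<close>

definition weak_gradient :: "(real^'d) set \<Rightarrow> (real^'d \<Rightarrow> real) \<Rightarrow> (real^'d \<Rightarrow> real^'d)" where
  "weak_gradient \<Omega> u = (SOME G. has_weak_gradient \<Omega> u G)"

definition W1_space :: "real \<Rightarrow> (real^'d) set \<Rightarrow> (real^'d \<Rightarrow> real) set" where
  "W1_space p \<Omega> = {u \<in> Lp_space p (lebesgue_on \<Omega>).
     \<exists>G\<in>Lp_space p (lebesgue_on \<Omega>). has_weak_gradient \<Omega> u G}"

definition W1_norm :: "real \<Rightarrow> (real^'d) set \<Rightarrow> (real^'d \<Rightarrow> real) \<Rightarrow> real" where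
  "W1_norm p \<Omega> u =
     ((\<integral>x. \<bar>u x\<bar> powr p \<partial>lebesgue_on \<Omega>) +
      (\<integral>x. norm (weak_gradient \<Omega> u x) powr p \<partial>lebesgue_on \<Omega>)) powr (1 / p)"

definition W1_0_space :: "real \<Rightarrow> (real^'d) set \<Rightarrow> (real^'d \<Rightarrow> real) set" where
  "W1_0_space p \<Omega> = norm_topology (W1_space p \<Omega>) (W1_norm p \<Omega>) closure_of test_functions \<Omega>"

definition conjugate_exponent :: "real \<Rightarrow> real" where
  "conjugate_exponent p = p / (p - 1)"

text \<open>Meaningful for \<open>p > 1\<close> only, since division by zero makes the conjugate exponent of 1 equal to 0.\<close>

definition W_neg1_space :: "real \<Rightarrow> (real^'d) set \<Rightarrow> ((real^'d \<Rightarrow> real) \<Rightarrow> real) set" where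
  "W_neg1_space p \<Omega> =
     dual_space (W1_0_space (conjugate_exponent p) \<Omega>) (W1_norm (conjugate_exponent p) \<Omega>)"

definition W_neg1_norm :: "real \<Rightarrow> (real^'d) set \<Rightarrow> ((real^'d \<Rightarrow> real) \<Rightarrow> real) \<Rightarrow> real" where
  "W_neg1_norm p \<Omega> =
     dual_norm (W1_0_space (conjugate_exponent p) \<Omega>) (W1_norm (conjugate_exponent p) \<Omega>)"

text \<open>
  A map \<open>F\<close> from \<open>(0,T)\<close> to \<open>W\<^sup>-\<^sup>1\<^sup>,\<^sup>p\<close> is identified with the distribution on \<open>(0,T) \<times> \<Omega>\<close> that sends
  \<open>\<phi>\<close> to the integral over \<open>(0,T)\<close> of the duality pairing of \<open>F t\<close> and \<open>\<phi>(t,\<cdot>)\<close>.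
\<close>

definition has_distributional_time_derivative ::
    "real \<Rightarrow> (real^'d) set \<Rightarrow> (real \<times> (real^'d) \<Rightarrow> real) \<Rightarrow>
     (real \<Rightarrow> (real^'d \<Rightarrow> real) \<Rightarrow> real) \<Rightarrow> bool" where
  "has_distributional_time_derivative T \<Omega> f F \<longleftrightarrow>
     (\<forall>\<phi>\<in>test_functions ({0<..<T} \<times> \<Omega>).
        (\<integral>z. f z * frechet_derivative \<phi> (at z) (1, 0) \<partial>lebesgue_on ({0<..<T} \<times> \<Omega>)) =
        - (\<integral>t. F t (\<lambda>x. \<phi> (t, x)) \<partial>lebesgue_on {0<..<T}))"

section \<open>Functions of bounded variation\<close>

definition divergence :: "(real^'d \<Rightarrow> real^'d) \<Rightarrow> real^'d \<Rightarrow> real" where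
  "divergence \<phi> x = (\<Sum>i\<in>UNIV. frechet_derivative \<phi> (at x) (axis i 1) $ i)"

definition variations :: "(real^'d) set \<Rightarrow> (real^'d \<Rightarrow> real) \<Rightarrow> real set" where
  "variations \<Omega> u = {\<integral>x. u x * divergence \<phi> x \<partial>lebesgue_on \<Omega> | \<phi>.
     \<phi> \<in> C_k_c 1 \<Omega> \<and> (\<forall>x. norm (\<phi> x) \<le> 1)}"

definition BV_space :: "(real^'d) set \<Rightarrow> (real^'d \<Rightarrow> real) set" where
  "BV_space \<Omega> = {u \<in> Lp_space 1 (lebesgue_on \<Omega>). bdd_above (variations \<Omega> u)}"

definition BV_norm :: "(real^'d) set \<Rightarrow> (real^'d \<Rightarrow> real) \<Rightarrow> real" where
  "BV_norm \<Omega> u = Lp_norm 1 (lebesgue_on \<Omega>) u + Sup (variations \<Omega> u)"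

text \<open>
  As \<open>BV(\<Omega>)\<close> is not separable, strong measurability into \<open>BV(\<Omega>)\<close> is not the appropriate notion:
  the map sending \<open>t\<close> to the indicator function of \<open>{x. x < t}\<close> does not have it. As is usual for
  \<open>L\<^sup>1((0,T), BV(\<Omega>))\<close>, joint measurability of \<open>f\<close> and measurability of the norm are required instead.
\<close>

definition L1_BV_space :: "real \<Rightarrow> (real^'d) set \<Rightarrow> (real \<times> (real^'d) \<Rightarrow> real) set" where
  "L1_BV_space T \<Omega> = {f \<in> Lp_space 1 (lebesgue_on ({0<..<T} \<times> \<Omega>)).
     (AE t in lebesgue_on {0<..<T}. (\<lambda>x. f (t, x)) \<in> BV_space \<Omega>) \<and>
     integrable (lebesgue_on {0<..<T}) (\<lambda>t. BV_norm \<Omega> (\<lambda>x. f (t, x)))}"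

section \<open>Domains and kernels\<close>

text \<open>
  Near each boundary point the domain lies on one side of the graph of a smooth function over
  a hyperplane \<open>e\<^sup>\<bottom>\<close>. The function \<open>\<gamma>\<close> is defined on the whole space, but only its values on
  that hyperplane are used.
\<close>

definition smooth_bounded_domain :: "(real^'d) set \<Rightarrow> bool" where
  "smooth_bounded_domain \<Omega> \<longleftrightarrow>
     open \<Omega> \<and> connected \<Omega> \<and> \<Omega> \<noteq> {} \<and> bounded \<Omega> \<and>
     (\<forall>x0\<in>frontier \<Omega>. \<exists>r>0. \<exists>e. \<exists>\<gamma> :: real^'d \<Rightarrow> real.
        norm e = 1 \<and> smooth \<gamma> \<and>
        \<Omega> \<inter> ball x0 r = {x \<in> ball x0 r. x \<bullet> e > \<gamma> (x - (x \<bullet> e) *\<^sub>R e)})"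

definition radial :: "(real^'d \<Rightarrow> real) \<Rightarrow> bool" where
  "radial \<rho> \<longleftrightarrow> (\<exists>g. \<forall>x. \<rho> x = g (norm x))"

definition rescaled :: "(real^'d \<Rightarrow> real) \<Rightarrow> nat \<Rightarrow> real^'d \<Rightarrow> real" where
  "rescaled \<rho> n x = real n ^ CARD('d) * \<rho> (real n *\<^sub>R x)"

end

theory Submission
  imports Defs
begin

text \<open>Fubini's theorem, translations and joint measurability are at hand for Borel functions
  on \<open>lborel\<close>, whereas the spaces of the statement use completed measures on subsets.
  Hence all functions are replaced by Borel representatives that vanish off (0,T) \<times> \<Omega>.
  Test objects are products of the indicator of a time set and a function of x, so that joint
  identities descend to almost every slice; the exceptional null set depends on the test function,
  which forces uniformly dense countable families of them. In the averaged difference quotient the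
  factor n^2 is split: one n goes with the increment, as in the hypothesis, the other with |x - y|
  \<le> R / n on the support of the kernel. In Part 2 the kernel controls increments only on average
  over directions, and intermediate points have to stay in the domain; a solid cone, with a single
  direction along each chain, meets both demands. The scale \<epsilon> is fixed before n, so that
  only finitely many n are too small for it, and these form classes of their own. Bump functions
  come from the given kernel, restricted to a line.\<close>

abbreviation lint :: "('a::euclidean_space \<Rightarrow> 'b::{banach, second_countable_topology}) \<Rightarrow> 'b" (binder "LI " 10)
  where "lint u \<equiv> integral\<^sup>L lborel u"

abbreviation nint :: "('a::euclidean_space \<Rightarrow> ennreal) \<Rightarrow> ennreal" (binder "NI " 10)
  where "nint u \<equiv> integral\<^sup>N lborel u"
text \<open>
  Part 1. The averaged difference quotients \<open>kgrad\<close> of \<open>f\<^sub>n\<close> are bounded in \<open>L\<^sup>p\<close>, by Jensen's inequality and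
  the second hypothesis. Transposing the kernel and expanding a test function to first order shows that
  they converge, against test functions, to a diagonal multiple of the distributional gradient of \<open>f\<close>:
  radiality kills the off-diagonal second moments of \<open>\<rho>\<close>. For \<open>p > 1\<close> uniform convexity makes bounded
  sets weakly closed and the limit is an \<open>L\<^sup>p\<close> function; for \<open>p = 1\<close> the bound passes to the variation,
  the supremum over test fields being reduced to a countable family.

  Part 2. Near each point of its closure the domain contains, with every \<open>x\<close>, a fixed truncated cone with
  vertex \<open>x\<close>. Averaging \<open>f\<^sub>n\<close> over the cone scaled by \<open>\<epsilon>\<close> changes it by at most \<open>C \<epsilon>\<close> in \<open>L\<^sup>p\<close> once
  \<open>n \<epsilon>\<close> is bounded below: an increment of length \<open>\<epsilon>\<close> telescopes into about \<open>n \<epsilon>\<close> increments of length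
  \<open>1 / n\<close>, and each of these is controlled since \<open>\<rho>\<close> is bounded below near 0. The averaged functions are
  determined, up to a small error, by finitely many pairings with test functions of \<open>x\<close>. These are
  functions of \<open>t\<close> which are bounded and equi-Hoelder by the bound on the time derivative, hence totally
  bounded.
\<close>

abbreviation Bm :: "('a::topological_space \<Rightarrow> 'b::topological_space) set"
  where "Bm \<equiv> borel_measurable borel"

abbreviation ind :: "'a set \<Rightarrow> 'a \<Rightarrow> 'b::zero_neq_one" where "ind \<equiv> indicator"

abbreviation en :: "real \<Rightarrow> ennreal" where "en \<equiv> ennreal"

abbreviation fder :: "('a::real_normed_vector \<Rightarrow> 'b::real_normed_vector) \<Rightarrow> 'a filter \<Rightarrow> 'a \<Rightarrow> 'b"
  where "fder \<equiv> frechet_derivative"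

abbreviation cts :: "('a::topological_space \<Rightarrow> 'b::topological_space) \<Rightarrow> bool" where "cts \<equiv> continuous_on UNIV"

abbreviation intl :: "('a::euclidean_space \<Rightarrow> 'b::{banach, second_countable_topology}) \<Rightarrow> bool"
  where "intl \<equiv> integrable lborel"

abbreviation leb :: "'a::euclidean_space set \<Rightarrow> 'a measure" where "leb \<equiv> lebesgue_on"

abbreviation tests :: "'a::euclidean_space set \<Rightarrow> ('a \<Rightarrow> real) set" where "tests \<equiv> test_functions"

abbreviation smult :: "real \<Rightarrow> 'a::real_vector \<Rightarrow> 'a" (infixr "*R" 75) where "a *R x \<equiv> a *\<^sub>R x"

lemmas bm_contI = borel_measurable_continuous_onI
lemmas lint_cong = Bochner_Integration.integral_cong
lemmas lint_bound = Bochner_Integration.integrable_bound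
section \<open>Integrals of powers\<close>

text \<open>Young's inequality for \<open>y\<close> and \<open>a powr (p - 1)\<close>, whose
  conjugate power is again \<open>a powr p\<close>. This tangent form is the source of the convexity
  and Jensen inequalities below.\<close>

lemma powr_tangent_le:
 fixes a y p :: real
 assumes "1 <= p" "0 <= a" "0 <= y"
 shows "a powr p + p * a powr (p - 1) * (y - a) <= y powr p"
proof (cases "p = 1")
 case True
 \<comment> \<open>For \<open>a = 0\<close> the slope contains \<open>0 powr 0\<close>, which is 0,
   and the inequality survives.\<close>
 thus ?thesis using assms by (cases "a = 0") auto
next
 case False
 hence p: "p > 1" using assms by simp
 define q where "q = p / (p - 1)"
 have q: "q > 1" "1 / p + 1 / q = 1" using p by (auto simp: q_def field_simps)
 have "y * a powr (p - 1) <= y powr p / p + (a powr (p - 1)) powr q / q"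
  by (rule Youngs_inequality) (use p q assms in auto)
 moreover have "(a powr (p - 1)) powr q = a powr p"
  using p by (simp add: powr_powr q_def)
 ultimately have "y * a powr (p - 1) <= y powr p / p + a powr p * (p - 1) / p"
  using p by (simp add: q_def)
 hence "p * (y * a powr (p - 1)) <= p * (y powr p / p + a powr p * (p - 1) / p)"
  using p by (intro mult_left_mono) auto
 also have "... = y powr p + (p - 1) * a powr p" using p by (simp add: field_simps)
 finally have 1: "p * (y * a powr (p - 1)) <= y powr p + (p - 1) * a powr p" .
 have 2: "a powr (p - 1) * a = a powr p"
  using assms p by (cases "a = 0") (auto simp: powr_diff)
 have "p * a powr (p - 1) * (y - a) = p * (y * a powr (p - 1)) - p * (a powr (p - 1) * a)"
  by (simp add: algebra_simps)
 thus ?thesis using 1 2 by (simp add: algebra_simps)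
qed

text \<open>The tangents at the convex combination are averaged, and their linear parts
  cancel.\<close>

lemma powr_convex_combination:
 fixes s t p l :: real
 assumes "1 <= p" "0 <= s" "0 <= t" "0 <= l" "l <= 1"
 shows "(l * s + (1 - l) * t) powr p <= l * s powr p + (1 - l) * t powr p"
proof -
 define m where "m = l * s + (1 - l) * t"
 have m: "0 <= m" using assms by (simp add: m_def)
 have "l * (m powr p + p * m powr (p - 1) * (s - m)) + (1 - l) * (m powr p + p * m powr (p - 1) * (t - m))
  <= l * s powr p + (1 - l) * t powr p"
  by (intro add_mono mult_left_mono powr_tangent_le) (use assms m in auto)
 also have "l * (m powr p + p * m powr (p - 1) * (s - m)) + (1 - l) * (m powr p + p * m powr (p - 1) * (t - m))
  = m powr p + p * m powr (p - 1) * (l * s + (1 - l) * t - m)" by (simp add: algebra_simps)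
 finally show ?thesis by (simp add: m_def)
qed

lemma norm_add_powr_le:
 fixes a b :: "'b::real_normed_vector"
 assumes "0 <= p"
 shows "norm (a + b) powr p <= 2 powr p * (norm a powr p + norm b powr p)"
proof -
 have "norm (a + b) <= 2 * max (norm a) (norm b)" using norm_triangle_ineq[of a b] by linarith
 hence "norm (a + b) powr p <= (2 * max (norm a) (norm b)) powr p"
  using assms by (intro powr_mono2) auto
 also have "... = 2 powr p * max (norm a) (norm b) powr p" by (simp add: powr_mult)
 also have "max (norm a) (norm b) powr p <= norm a powr p + norm b powr p"
  by (auto simp: max_def)
 finally show ?thesis by simp
qed

lemma norm_diff_powr_le:
 fixes a b c :: "'b::real_normed_vector"
 assumes "0 <= p"
 shows "norm (a - c) powr p <= 2 powr p * (norm (a - b) powr p + norm (b - c) powr p)"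
 using norm_add_powr_le[OF assms, of "a - b" "b - c"] by simp

text \<open>The p-th power of the Lp norm, kept in \<open>ennreal\<close>: estimates need neither
  roots nor integrability, at the price of the factor \<open>2 powr p\<close> in the triangle
  inequality.\<close>

definition pint :: "real => 'e measure => ('e => 'b::real_normed_vector) => ennreal" where
 "pint p N u = (\<integral>\<^sup>+x. en (norm (u x) powr p) \<partial>N)"

abbreviation pil :: "real => ('a::euclidean_space => 'b::real_normed_vector) => ennreal" where "pil p u \<equiv> pint p lborel u"

lemma Lp_space_iff:
 "f : Lp_space p N \<longleftrightarrow> f : borel_measurable N & pint p N f < \<infinity>"
 unfolding Lp_space_def pint_def
 by (auto simp: integrable_iff_bounded)

lemma integral_eq_pint:
 fixes f :: "'e => 'b::euclidean_space"
 assumes "f : borel_measurable N"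
 shows "(\<integral>x. norm (f x) powr p \<partial>N) = enn2real (pint p N f)"
 unfolding pint_def using assms by (intro integral_eq_nn_integral) auto

lemma pint_eq_integral:
 fixes f :: "'e => 'b::euclidean_space"
 assumes "f : Lp_space p N"
 shows "pint p N f = en (\<integral>x. norm (f x) powr p \<partial>N)"
 using assms unfolding Lp_space_def pint_def by (intro nn_integral_eq_integral) auto

lemma pint_add_le:
 fixes u v :: "'e => 'b::euclidean_space"
 assumes [measurable]: "u : borel_measurable N" "v : borel_measurable N" and "0 <= p"
 shows "pint p N (%x. u x + v x) <= en (2 powr p) * (pint p N u + pint p N v)"
proof -
 have "pint p N (%x. u x + v x) <=
  (\<integral>\<^sup>+x. en (2 powr p) * (en (norm (u x) powr p) + en (norm (v x) powr p)) \<partial>N)"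
  unfolding pint_def
  using norm_add_powr_le[OF assms(3)]
  by (intro nn_integral_mono) (simp add: ennreal_mult[symmetric] ennreal_plus[symmetric] del: ennreal_plus)
 also have "... = en (2 powr p) * (pint p N u + pint p N v)"
  by (simp add: pint_def nn_integral_cmult nn_integral_add)
 finally show ?thesis .
qed

lemma pint_minus: "pint p N (%x. - u x) = pint p N u"
 by (simp add: pint_def)

lemma pint_diff_le:
 fixes u v :: "'e => 'b::euclidean_space"
 assumes [measurable]: "u : borel_measurable N" "v : borel_measurable N" and "0 <= p"
 shows "pint p N (%x. u x - v x) <= en (2 powr p) * (pint p N u + pint p N v)"
 using pint_add_le[of u N "%x. - v x" p] assms by (simp add: pint_minus)

lemma pint_triangle:
 fixes u v w :: "'e => 'b::euclidean_space"
 assumes [measurable]: "u : borel_measurable N" "v : borel_measurable N" "w : borel_measurable N" and "0 <= p"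
 shows "pint p N (%x. u x - w x) <=
  en (2 powr p) * (pint p N (%x. u x - v x) + pint p N (%x. v x - w x))"
 using pint_add_le[of "%x. u x - v x" N "%x. v x - w x" p] assms by simp

lemma pint_cmult:
 fixes u :: "'e => 'b::euclidean_space"
 assumes [measurable]: "u : borel_measurable N"
 shows "pint p N (%x. c *R u x) = en (\<bar>c\<bar> powr p) * pint p N u"
 by (simp add: pint_def powr_mult ennreal_mult nn_integral_cmult)

lemma pint_commute: "pint p N (%x. u x - v x) = pint p N (%x. v x - u x)"
 by (simp add: pint_def norm_minus_commute)

lemma Lp_space_lincomb:
 fixes u v :: "'e => 'b::euclidean_space"
 assumes "u : Lp_space p N" "v : Lp_space p N" "0 <= p"
 shows "(%x. a *R u x + b *R v x) : Lp_space p N"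
proof -
 have m[measurable]: "u : borel_measurable N" "v : borel_measurable N"
  using assms by (auto simp: Lp_space_iff)
 have "pint p N (%x. a *R u x + b *R v x) <=
  en (2 powr p) * (pint p N (%x. a *R u x) + pint p N (%x. b *R v x))"
  by (intro pint_add_le assms) auto
 also have "... < \<infinity>"
  using assms by (auto simp: pint_cmult Lp_space_iff ennreal_mult_less_top)
 finally show ?thesis by (auto simp: Lp_space_iff)
qed

lemma Lp_space_add:
 fixes u v :: "'e => 'b::euclidean_space"
 assumes "u : Lp_space p N" "v : Lp_space p N" "0 <= p"
 shows "(%x. u x + v x) : Lp_space p N"
 using Lp_space_lincomb[OF assms, of 1 1] by simp

lemma Lp_space_diff:
 fixes u v :: "'e => 'b::euclidean_space"
 assumes "u : Lp_space p N" "v : Lp_space p N" "0 <= p"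
 shows "(%x. u x - v x) : Lp_space p N"
 using Lp_space_lincomb[OF assms, of 1 "-1"] by simp

text \<open>The tangent inequality at the mean is integrated. An upper bound \<open>m\<close> for
  the mass suffices, because after integration the mass carries the coefficient
  \<open>- (p - 1) * a powr p\<close>, which is at most 0.\<close>

lemma jensen_powr:
 fixes F :: "'e => 'b::{banach, second_countable_topology}"
 assumes [measurable]: "F : borel_measurable N" and p: "1 <= p"
  and m: "emeasure N (space N) <= en m"
 shows "en (norm (\<integral>x. F x \<partial>N) powr p) <=
  en (m powr (p - 1)) * (\<integral>\<^sup>+x. en (norm (F x) powr p) \<partial>N)"
proof (cases "integrable N F & m > 0")
 case False
 \<comment> \<open>The integral of a non-integrable function is 0 by convention; a bound
   \<open>m\<close> that is not positive means mass 0.\<close>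
 have "(\<integral>x. F x \<partial>N) = 0"
 proof (cases "integrable N F")
  case True
  hence "emeasure N (space N) = 0" using False m by (simp add: ennreal_neg not_less)
  hence "AE x in N. F x = 0" by (intro AE_I[where N="space N"]) auto
  thus ?thesis by (rule integral_eq_zero_AE)
 qed (simp add: not_integrable_integral_eq)
 thus ?thesis using p by simp
next
 case True
 hence int: "integrable N (%x. norm (F x))" and m0: "m > 0" by auto
 interpret finite_measure N using m by (intro finite_measureI) (auto simp: top_unique)
 show ?thesis
 proof (cases "(\<integral>\<^sup>+x. en (norm (F x) powr p) \<partial>N) = \<infinity>")
  case True
  thus ?thesis using m0 by (simp add: ennreal_mult_top)
 next
  case False
  hence intp: "integrable N (%x. norm (F x) powr p)"
  by (intro integrableI_bounded) (auto simp: top.not_eq_extremum)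
  define I where "I = (\<integral>x. norm (F x) \<partial>N)"
  define a where "a = I / m"
  have I0: "I >= 0" and a0: "a >= 0" using m0 by (auto simp: I_def a_def)
  have me: "measure N (space N) <= m"
  using m m0 by (simp add: measure_def enn2real_leI)
  have "(\<integral>x. a powr p + p * a powr (p - 1) * (norm (F x) - a) \<partial>N) <= (\<integral>x. norm (F x) powr p \<partial>N)"
  using int intp p a0 by (intro integral_mono powr_tangent_le) auto
  also have "(\<integral>x. a powr p + p * a powr (p - 1) * (norm (F x) - a) \<partial>N)
  = a powr p * measure N (space N) + p * a powr (p - 1) * (I - a * measure N (space N))"
  using int by (simp add: I_def)
  also have "... = p * (a powr (p - 1)) * I - (p * (a powr (p - 1) * a) - a powr p) * measure N (space N)"
  by (simp add: algebra_simps)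
  also have aa: "a powr (p - 1) * a = a powr p" using a0 p by (cases "a = 0") (auto simp: powr_diff)
  also have "p * a powr p - a powr p = (p - 1) * a powr p" by (simp add: algebra_simps)
  finally have "p * a powr (p - 1) * I - (p - 1) * a powr p * measure N (space N) <= (\<integral>x. norm (F x) powr p \<partial>N)" .
  moreover have "(p - 1) * a powr p * measure N (space N) <= (p - 1) * a powr p * m"
  using p me by (intro mult_left_mono) auto
  moreover have "a powr (p - 1) * I = a powr p * m"
  using m0 aa by (simp add: a_def field_simps)
  hence "p * a powr (p - 1) * I = p * (a powr p * m)" by (simp only: mult.assoc)
  moreover have "(p - 1) * a powr p * m = p * (a powr p * m) - a powr p * m" by (simp add: algebra_simps)
  ultimately have "a powr p * m <= (\<integral>x. norm (F x) powr p \<partial>N)" by linarith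
  hence "m powr (p - 1) * (a powr p * m) <= m powr (p - 1) * (\<integral>x. norm (F x) powr p \<partial>N)"
  by (intro mult_left_mono) auto
  also have "m powr (p - 1) * (a powr p * m) = I powr p"
  using m0 I0 by (simp add: a_def powr_divide powr_diff)
  finally have 1: "I powr p <= m powr (p - 1) * (\<integral>x. norm (F x) powr p \<partial>N)" .
  have "norm (\<integral>x. F x \<partial>N) powr p <= I powr p"
  using p by (intro powr_mono2) (auto simp: I_def)
  hence "en (norm (\<integral>x. F x \<partial>N) powr p) <= en (m powr (p - 1) * (\<integral>x. norm (F x) powr p \<partial>N))"
  using 1 by (intro ennreal_leI) auto
  also have "... = en (m powr (p - 1)) * (\<integral>\<^sup>+x. en (norm (F x) powr p) \<partial>N)"
  using intp by (simp add: ennreal_mult nn_integral_eq_integral)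
  finally show ?thesis .
 qed
qed

lemma jensen_powr_support:
 fixes F :: "'e => 'b::{banach, second_countable_topology}"
 assumes [measurable]: "F : borel_measurable N" "A : sets N" and p: "1 <= p"
  and m: "emeasure N A <= en m" and F0: "!!x. x : space N ==> x ~: A ==> F x = 0"
 shows "en (norm (\<integral>x. F x \<partial>N) powr p) <= en (m powr (p - 1)) * pint p N F"
proof -
 have A: "A \<inter> space N = A" "A \<inter> space N : sets N" using sets.sets_into_space[OF assms(2)] by auto
 have "en (norm (\<integral>x. F x \<partial>restrict_space N A) powr p) <=
  en (m powr (p - 1)) * (\<integral>\<^sup>+x. en (norm (F x) powr p) \<partial>restrict_space N A)"
  by (intro jensen_powr measurable_restrict_space1 p)
  (use m A in \<open>auto simp: space_restrict_space emeasure_restrict_space\<close>)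
 also have "(\<integral>\<^sup>+x. en (norm (F x) powr p) \<partial>restrict_space N A) = pint p N F"
  unfolding pint_def using A F0 by (subst nn_integral_restrict_space) (auto intro!: nn_integral_cong simp: indicator_def)
 also have "(\<integral>x. F x \<partial>restrict_space N A) = (\<integral>x. F x \<partial>N)"
  using A F0 by (subst integral_restrict_space) (auto intro!: lint_cong simp: indicator_def)
 finally show ?thesis .
qed

text \<open>On the support the norm is at most 1 plus its p-th power, and both have finite
  integral.\<close>

lemma integrable_Lp_support:
 fixes F :: "'e => 'b::{banach, second_countable_topology}"
 assumes [measurable]: "F : borel_measurable N" "A : sets N" and p: "1 <= p"
  and m: "emeasure N A < \<infinity>" and F0: "!!x. x : space N ==> x ~: A ==> F x = 0"
  and fin: "pint p N F < \<infinity>"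
 shows "integrable N F"
proof (rule integrableI_bounded)
 have "(\<integral>\<^sup>+x. en (norm (F x)) \<partial>N) <= (\<integral>\<^sup>+x. ind A x + en (norm (F x) powr p) \<partial>N)"
 proof (intro nn_integral_mono)
  fix x assume x: "x : space N"
  have *: "r <= 1 + r powr p" if "r >= 0" for r :: real
  proof (cases "r <= 1")
  case False
  hence "r powr 1 <= r powr p" using p by (intro powr_mono) auto
  thus ?thesis using False by simp
  qed (auto intro: add_increasing2)
  show "en (norm (F x)) <= ind A x + en (norm (F x) powr p)"
  proof (cases "x : A")
  case True
  have "en (norm (F x)) <= en (1 + norm (F x) powr p)" by (intro ennreal_leI *) auto
  thus ?thesis using True by simp
  qed (use x F0 in auto)
 qed
 also have "... = emeasure N A + pint p N F" by (simp add: nn_integral_add pint_def)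
 also have "... < \<infinity>" using m fin by simp
 finally show "(\<integral>\<^sup>+x. en (norm (F x)) \<partial>N) < \<infinity>" .
qed simp

section \<open>Minkowski's inequality and completeness of Lp\<close>

lemma Lp_norm_powr:
 fixes u :: "'e => 'b::euclidean_space"
 assumes "1 <= p" shows "Lp_norm p N u powr p = (\<integral>x. norm (u x) powr p \<partial>N)"
 using assms by (simp add: Lp_norm_def powr_powr)

lemma Lp_norm_nonneg: "0 <= Lp_norm p N u"
 by (simp add: Lp_norm_def)

text \<open>Minkowski from convexity alone: u + v is A + B times a convex combination of u / A and v
  / B, with weights proportional to \<open>A\<close> and \<open>B\<close>.\<close>

lemma Lp_norm_triangle:
 fixes u v :: "'e => 'b::euclidean_space"
 assumes p: "1 <= p" and u: "u : Lp_space p N" and v: "v : Lp_space p N"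
 shows "Lp_norm p N (%x. u x + v x) <= Lp_norm p N u + Lp_norm p N v"
proof (rule field_le_epsilon)
 fix e :: real assume e: "e > 0"
 \<comment> \<open>The extra \<open>e / 2\<close> makes \<open>A\<close> and \<open>B\<close>
   positive, so that dividing by them is legitimate even when a norm vanishes.\<close>
 define A where "A = Lp_norm p N u + e / 2"
 define B where "B = Lp_norm p N v + e / 2"
 have A: "A > 0" and B: "B > 0" using e Lp_norm_nonneg[of p N u] Lp_norm_nonneg[of p N v] by (auto simp: A_def B_def)
 have iu: "integrable N (%x. norm (u x) powr p)" and iv: "integrable N (%x. norm (v x) powr p)"
  using u v by (auto simp: Lp_space_def)
 have iuv: "integrable N (%x. norm (u x + v x) powr p)"
  using Lp_space_add[OF u v] p by (auto simp: Lp_space_def)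
 have uA: "(\<integral>x. norm (u x) powr p \<partial>N) <= A powr p"
  using p e unfolding Lp_norm_powr[OF p, symmetric] A_def by (intro powr_mono2) (auto simp: Lp_norm_nonneg)
 have vB: "(\<integral>x. norm (v x) powr p \<partial>N) <= B powr p"
  using p e unfolding Lp_norm_powr[OF p, symmetric] B_def by (intro powr_mono2) (auto simp: Lp_norm_nonneg)
 define l where "l = A / (A + B)"
 have l: "0 <= l" "l <= 1" "1 - l = B / (A + B)" using A B by (auto simp: l_def field_simps)
 have pt: "norm (u x + v x) powr p <=
  (A + B) powr p * (l * (norm (u x) powr p / A powr p) + (1 - l) * (norm (v x) powr p / B powr p))" for x
 proof -
  have "norm (u x + v x) <= norm (u x) + norm (v x)" by (rule norm_triangle_ineq)
  also have "... = ((A + B) * l) * norm (u x) / A + ((A + B) * (1 - l)) * norm (v x) / B"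
  proof -
  have "(A + B) * l = A" "(A + B) * (1 - l) = B" unfolding l(3) using A B by (auto simp: l_def)
  thus ?thesis using A B by simp
  qed
  also have "... = (A + B) * (l * (norm (u x) / A) + (1 - l) * (norm (v x) / B))"
  by (simp add: algebra_simps)
  finally have "norm (u x + v x) powr p <= ((A + B) * (l * (norm (u x) / A) + (1 - l) * (norm (v x) / B))) powr p"
  using p by (intro powr_mono2) auto
  also have "... = (A + B) powr p * (l * (norm (u x) / A) + (1 - l) * (norm (v x) / B)) powr p"
  by (rule powr_mult)
  also have "... <= (A + B) powr p * (l * (norm (u x) / A) powr p + (1 - l) * (norm (v x) / B) powr p)"
  using p A B l by (intro mult_left_mono powr_convex_combination) auto
  finally show ?thesis using A B by (simp add: powr_divide)
 qed
 have "(\<integral>x. norm (u x + v x) powr p \<partial>N) <=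
  (\<integral>x. (A + B) powr p * (l * (norm (u x) powr p / A powr p) + (1 - l) * (norm (v x) powr p / B powr p)) \<partial>N)"
  using iu iv iuv pt by (intro integral_mono) auto
 also have "... = (A + B) powr p * (l * ((\<integral>x. norm (u x) powr p \<partial>N) / A powr p) + (1 - l) * ((\<integral>x. norm (v x) powr p \<partial>N) / B powr p))"
  using iu iv by simp
 also have "... <= (A + B) powr p * (l * 1 + (1 - l) * 1)"
  using uA vB l A B by (intro mult_left_mono add_mono) auto
 finally have "(\<integral>x. norm (u x + v x) powr p \<partial>N) <= (A + B) powr p" by simp
 hence "Lp_norm p N (%x. u x + v x) <= ((A + B) powr p) powr (1 / p)"
  unfolding Lp_norm_def using p by (intro powr_mono2) auto
 also have "... = A + B" using A B p by (simp add: powr_powr)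
 finally show "Lp_norm p N (%x. u x + v x) <= Lp_norm p N u + Lp_norm p N v + e"
  by (simp add: A_def B_def)
qed

text \<open>Every term of the series is at most its finite sum, so the weights force geometric decay
  of \<open>a k\<close> with ratio 1/2.\<close>

lemma summable_ennreal_powr_bound:
 fixes a :: "nat => real"
 assumes p: "1 <= p" and a: "!!k. 0 <= a k"
  and fin: "(\<Sum>k. en (2 powr (real k * p)) * en (a k powr p)) < \<infinity>"
 shows "summable a"
proof -
 define C where "C = enn2real (\<Sum>k. en (2 powr (real k * p)) * en (a k powr p))"
 have C: "(\<Sum>k. en (2 powr (real k * p)) * en (a k powr p)) = en C"
  using fin by (simp add: C_def)
 have C0: "C >= 0" by (simp add: C_def)
 have b: "a k <= C powr (1 / p) * (1 / 2) ^ k" for k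
 proof -
  have "en (2 powr (real k * p)) * en (a k powr p) <= en C"
  unfolding C[symmetric]
  using sum_le_suminf[OF summableI, of "{k}" "%k. en (2 powr (real k * p)) * en (a k powr p)"] by simp
  hence "2 powr (real k * p) * a k powr p <= C"
  using C0 by (simp add: ennreal_mult[symmetric])
  hence "(2 powr real k * a k) powr p <= C"
  using C0 a by (simp add: powr_mult powr_powr)
  hence "((2 powr real k * a k) powr p) powr (1 / p) <= C powr (1 / p)"
  using p by (intro powr_mono2) auto
  hence "2 powr real k * a k <= C powr (1 / p)" using p a by (simp add: powr_powr)
  thus ?thesis by (simp add: powr_realpow field_simps)
 qed
 show ?thesis
  by (rule summable_comparison_test'[of "%k. C powr (1 / p) * (1 / 2) ^ k"])
  (use a b in \<open>auto intro!: summable_mult summable_geometric\<close>)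
qed

text \<open>The Riesz-Fischer argument. Along a subsequence whose increments have norm at most 4^-k,
  the series weighted by 2^(kp) is still integrable; its finiteness gives absolute convergence
  almost everywhere, and Fatou's lemma turns this into norm convergence of the whole
  sequence.\<close>

lemma Lp_complete:
 fixes u :: "nat => 'e => 'b::euclidean_space"
 assumes p: "1 <= p" and meas[measurable]: "!!n. u n : borel_measurable N"
  and cauchy: "!!e. 0 < e ==> EX n0. ALL m>=n0. ALL n>=n0. pint p N (%x. u n x - u m x) <= en e"
 obtains v where "v : borel_measurable N"
  "!!e. 0 < e ==> EX n0. ALL n>=n0. pint p N (%x. u n x - v x) <= en e"
proof -
 have "EX n0. ALL m>=n0. ALL n>=n0. pint p N (%x. u n x - u m x) <= en ((1 / 4) powr (real k * p))" for k :: nat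
  by (rule cauchy) simp
 then obtain n0 where n0: "!!k m n. m >= n0 k ==> n >= n0 k ==>
  pint p N (%x. u n x - u m x) <= en ((1 / 4) powr (real k * p))" by metis
 \<comment> \<open>Summing the thresholds makes \<open>r\<close> monotone and at least
   \<open>n0 k\<close>; adding \<open>k\<close> makes it unbounded.\<close>
 define r where "r k = (\<Sum>i\<le>k. n0 i) + k" for k
 have rn0: "n0 k <= r k" for k unfolding r_def
  by (rule trans_le_add1) (rule member_le_sum, auto)
 have rS: "r k <= r (Suc k)" for k by (simp add: r_def)
 have rk: "k <= r k" for k by (simp add: r_def)
 define D where "D k x = norm (u (r (Suc k)) x - u (r k) x)" for k x
 have [measurable]: "D k : borel_measurable N" for k unfolding D_def by measurable
 have Dint: "(\<integral>\<^sup>+x. en (2 powr (real k * p)) * en (D k x powr p) \<partial>N) <= en ((1 / 2) ^ k)" for k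
 proof -
  have "(\<integral>\<^sup>+x. en (2 powr (real k * p)) * en (D k x powr p) \<partial>N)
  = en (2 powr (real k * p)) * pint p N (%x. u (r (Suc k)) x - u (r k) x)"
  by (simp add: nn_integral_cmult pint_def D_def)
  also have "... <= en (2 powr (real k * p)) * en ((1 / 4) powr (real k * p))"
  by (intro mult_left_mono n0 rn0 order_trans[OF rn0 rS]) auto
  also have "... = en ((1 / 2) powr (real k * p))"
  by (simp add: ennreal_mult[symmetric] powr_mult[symmetric])
  also have "... <= en ((1 / 2) powr real k)"
  using p by (intro ennreal_leI powr_mono') (auto simp: mult_le_cancel_left1)
  finally show ?thesis by (simp add: powr_realpow)
 qed
 have "(\<integral>\<^sup>+x. (\<Sum>k. en (2 powr (real k * p)) * en (D k x powr p)) \<partial>N)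
  = (\<Sum>k. \<integral>\<^sup>+x. en (2 powr (real k * p)) * en (D k x powr p) \<partial>N)"
  by (rule nn_integral_suminf) simp
 also have "... <= (\<Sum>k. en ((1 / 2) ^ k))"
  by (intro suminf_le Dint) auto
 also have "... = en (\<Sum>k. (1 / 2) ^ k)"
  by (intro suminf_ennreal2) (auto intro: summable_geometric)
 finally have "(\<integral>\<^sup>+x. (\<Sum>k. en (2 powr (real k * p)) * en (D k x powr p)) \<partial>N) ~= \<infinity>"
  by (auto simp: top_unique)
 hence "AE x in N. (\<Sum>k. en (2 powr (real k * p)) * en (D k x powr p)) ~= \<infinity>"
  by (intro nn_integral_PInf_AE) auto
 hence conv: "AE x in N. (%k. u (r k) x) \<longlonglongrightarrow> lim (%k. u (r k) x)"
 proof eventually_elim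
  case (elim x)
  have "summable (%k. D k x)"
  using elim by (intro summable_ennreal_powr_bound[OF p]) (auto simp: D_def less_top)
  hence "summable (%k. u (r (Suc k)) x - u (r k) x)"
  unfolding D_def by (rule summable_norm_cancel)
  hence "convergent (%n. \<Sum>k<n. u (r (Suc k)) x - u (r k) x)"
  by (rule summable_iff_convergent[THEN iffD1])
  hence "convergent (%n. u (r n) x - u (r 0) x)"
  by (simp add: sum_lessThan_telescope[of "%n. u (r n) x"])
  hence "convergent (%n. u (r n) x)" by (simp add: convergent_diff_const_right_iff)
  thus ?case by (simp add: convergent_LIMSEQ_iff)
 qed
 define v where "v x = lim (%k. u (r k) x)" for x
 have v[measurable]: "v : borel_measurable N" unfolding v_def by measurable
 have lim: "EX n0. ALL n>=n0. pint p N (%x. u n x - v x) <= en e" if e: "0 < e" for e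
 proof -
  obtain n1 where n1: "!!m n. m >= n1 ==> n >= n1 ==> pint p N (%x. u n x - u m x) <= en e"
  using cauchy[OF e] by blast
  have "pint p N (%x. u n x - v x) <= en e" if n: "n >= n1" for n
  proof -
  have "pint p N (%x. u n x - v x) = (\<integral>\<^sup>+x. liminf (%k. en (norm (u n x - u (r k) x) powr p)) \<partial>N)"
  unfolding pint_def
  proof (rule nn_integral_cong_AE, use conv in eventually_elim)
  case (elim x)
  have "(%k. norm (u n x - u (r k) x) powr p) \<longlonglongrightarrow> norm (u n x - v x) powr p"
  unfolding v_def using p by (intro tendsto_powr' tendsto_intros elim) auto
  hence "(%k. en (norm (u n x - u (r k) x) powr p)) \<longlonglongrightarrow> en (norm (u n x - v x) powr p)"
  by (rule tendsto_ennrealI)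
  thus ?case by (intro lim_imp_Liminf[symmetric]) auto
  qed
  also have "... <= liminf (%k. pint p N (%x. u n x - u (r k) x))"
  unfolding pint_def by (rule nn_integral_liminf) simp
  also have "... <= en e"
  proof -
  have "liminf (%k. pint p N (%x. u n x - u (r k) x)) <= liminf (%k::nat. en e)"
  by (rule Liminf_mono, rule eventually_sequentiallyI[of n1])
  (rule n1[OF order_trans[OF _ rk] n])
  thus ?thesis by (simp add: Liminf_const)
  qed
  finally show ?thesis .
  qed
  thus ?thesis by blast
 qed
 show ?thesis by (rule that[OF v lim])
qed

section \<open>Uniform convexity and weak closedness\<close>

text \<open>The mean value theorem on both halves of the interval, and the strictly increasing
  derivative. On the left half only differentiability in the interior is used, because
  \<open>s\<close> may be 0.\<close>

lemma powr_strict_midpoint: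
 fixes s t p :: real
 assumes p: "1 < p" and "0 <= s" "s < t"
 shows "((s + t) / 2) powr p < (s powr p + t powr p) / 2"
proof -
 define m where "m = (s + t) / 2"
 have m: "s < m" "m < t" "t - m = m - s" using assms by (auto simp: m_def field_simps)
 have d: "DERIV (%x. x powr p) x :> p * x powr (p - 1)" if "x > 0" for x
  using that by (auto intro!: derivative_eq_intros simp: )
 have c: "continuous_on {a..b} (%x. x powr p)" if "a >= 0" for a b
  using that p by (intro continuous_on_powr') auto
 obtain xi where xi: "m < xi" "xi < t" "t powr p - m powr p = (t - m) * (p * xi powr (p - 1))"
  using MVT2[of m t "%x. x powr p" "%x. p * x powr (p - 1)"] m assms d by auto
 have dif: "(%x. x powr p) differentiable (at x)" if "s < x" "x < m" for x
  using d[of x] that assms by (auto simp: real_differentiable_def)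
 obtain l et where et: "s < et" "et < m" "DERIV (%x. x powr p) et :> l" "m powr p - s powr p = (m - s) * l"
  using MVT[OF m(1) c[OF assms(2)] dif] by auto
 have l: "l = p * et powr (p - 1)" using DERIV_unique[OF et(3) d] et assms by auto
 have "et powr (p - 1) < xi powr (p - 1)"
  using et xi p assms by (intro powr_less_mono2) auto
 hence "(m - s) * (p * et powr (p - 1)) < (m - s) * (p * xi powr (p - 1))"
  using p m by simp
 hence "m powr p - s powr p < t powr p - m powr p"
  using xi et l m by simp
 thus ?thesis by (simp add: m_def field_simps)
qed

text \<open>For equal norms strictness comes from the equality case of the triangle inequality, for
  different norms from strict convexity of the scalar power.\<close>

lemma norm_powr_strict_midpoint:
 fixes a b :: "'b::euclidean_space"
 assumes p: "1 < p" and ne: "a ~= b"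
 shows "norm ((a + b) /\<^sub>R 2) powr p < (norm a powr p + norm b powr p) / 2"
proof -
 have tri: "norm ((a + b) /\<^sub>R 2) <= (norm a + norm b) / 2"
  using norm_triangle_ineq[of a b] by simp
 show ?thesis
 proof (cases "norm a = norm b")
  case True
  have "norm (a + b) ~= norm a + norm b"
  using ne True norm_triangle_eq[of a b] by auto
  hence "norm ((a + b) /\<^sub>R 2) < norm a" using tri True by (auto simp: norm_triangle_ineq less_le)
  thus ?thesis using True p by (simp add: powr_less_mono2)
 next
  case False
  have "norm ((a + b) /\<^sub>R 2) powr p <= ((norm a + norm b) / 2) powr p"
  using tri p by (intro powr_mono2) auto
  also have "... < (norm a powr p + norm b powr p) / 2"
  using powr_strict_midpoint[OF p, of "norm a" "norm b"] powr_strict_midpoint[OF p, of "norm b" "norm a"] False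
  by (cases "norm a < norm b") (auto simp: add.commute)
  finally show ?thesis .
 qed
qed

text \<open>A pointwise substitute for Clarkson's inequalities that treats all p > 1 alike. By
  homogeneity it is enough to consider normalised pairs whose distance is bounded below; they form a
  compact set, on which the midpoint defect has a positive minimum.\<close>

lemma uniform_convexity_powr:
 assumes p: "1 < p" and e: "0 < e"
 obtains C where "0 < C"
  "!!a b :: 'b::euclidean_space. norm (a - b) powr p <= e * (norm a powr p + norm b powr p)
  + C * ((norm a powr p + norm b powr p) / 2 - norm ((a + b) /\<^sub>R 2) powr p)"
proof -
 define S :: "('b \<times> 'b) set" where
  "S = {z. norm (fst z) powr p + norm (snd z) powr p = 1 & e <= norm (fst z - snd z) powr p}"
 define D :: "'b \<times> 'b => real" where
  "D z = (norm (fst z) powr p + norm (snd z) powr p) / 2 - norm ((fst z + snd z) /\<^sub>R 2) powr p" for z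
 have cont: "cts (%z. norm (h z) powr p)" if "cts h"
  for h :: "'b \<times> 'b => 'b"
  using that p by (intro continuous_on_powr' continuous_intros) auto
 have contD: "continuous_on S D" unfolding D_def
  by (rule continuous_on_subset[of UNIV])
  (intro continuous_on_diff continuous_on_divide continuous_on_add continuous_on_const cont
  continuous_on_scaleR continuous_on_fst continuous_on_snd continuous_on_id, auto)
 have "closed S" unfolding S_def
  by (intro closed_Collect_conj closed_Collect_eq closed_Collect_le continuous_intros cont)
 moreover have "S <= cball 0 1 \<times> cball 0 1"
 proof
  fix z assume "z : S"
  hence "norm (fst z) powr p + norm (snd z) powr p = 1" by (simp add: S_def)
  hence z: "norm (fst z) powr p <= 1" "norm (snd z) powr p <= 1"
  using powr_ge_zero[of "norm (fst z)" p] powr_ge_zero[of "norm (snd z)" p] by linarith+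
  have "r <= 1" if "r powr p <= 1" "r >= 0" for r :: real
  using that p powr_less_mono2[of p 1 r] by (auto simp: not_le[symmetric])
  with z show "z : cball 0 1 \<times> cball 0 1" by (cases z) auto
 qed
 hence "bounded S" by (rule bounded_subset[rotated]) (intro bounded_Times bounded_cball)
 ultimately have compS: "compact S" by (simp add: compact_eq_bounded_closed)
 have Dpos: "D z > 0" if "z : S" for z
 proof -
  have "fst z ~= snd z" using that e by (auto simp: S_def)
  thus ?thesis using that norm_powr_strict_midpoint[OF p, of "fst z" "snd z"]
  by (auto simp: D_def S_def)
 qed
 obtain de where de: "de > 0" "!!z. z : S ==> de <= D z"
 proof (cases "S = {}")
  case True thus ?thesis using that[of 1] by auto
 next
  case False
  thus ?thesis using continuous_attains_inf[OF compS False contD] Dpos that by blast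
 qed
 \<comment> \<open>|a - b|^p is at most 2^p times the normalising power, and for separated pairs the
   latter is at most the defect divided by \<open>de\<close>.\<close>
 define C where "C = 2 powr p / de"
 have C: "C > 0" using de by (simp add: C_def)
 have Dnn: "D z >= 0" for z
  using norm_powr_strict_midpoint[OF p, of "fst z" "snd z"]
  by (cases "fst z = snd z") (auto simp: D_def scaleR_2[symmetric])
 have "norm (a - b) powr p <= e * (norm a powr p + norm b powr p) + C * D (a, b)" for a b :: 'b
 proof (cases "norm a powr p + norm b powr p = 0")
  case True
  hence "a = 0 & b = 0" using p
  by (metis add_nonneg_eq_0_iff norm_eq_zero powr_eq_0_iff powr_ge_zero)
  thus ?thesis using True p by (simp add: D_def)
 next
  case False
  define s where "s = (norm a powr p + norm b powr p) powr (1 / p)"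
  have s0: "s > 0" using False by (auto simp: s_def less_le)
  have sp: "s powr p = norm a powr p + norm b powr p" using p by (simp add: s_def powr_powr)
  have sc: "norm (x /\<^sub>R s) powr p = norm x powr p / s powr p" for x :: 'b
  using s0 by (simp add: powr_mult powr_divide divide_inverse powr_minus inverse_powr)
  have Dsc: "D (a /\<^sub>R s, b /\<^sub>R s) = D (a, b) / s powr p"
  proof -
  have half: "(a /\<^sub>R s + b /\<^sub>R s) /\<^sub>R 2 = ((a + b) /\<^sub>R 2) /\<^sub>R s" by (simp add: scaleR_right_distrib mult.commute)
  thus ?thesis unfolding D_def fst_conv snd_conv half sc by (simp add: add_divide_distrib diff_divide_distrib)
  qed
  have sub: "norm (a /\<^sub>R s - b /\<^sub>R s) powr p = norm (a - b) powr p / s powr p"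
  using sc[of "a - b"] by (simp only: scaleR_diff_right)
  show ?thesis
  proof (cases "norm (a - b) powr p <= e * s powr p")
  case True
  have "0 <= C * D (a, b)" using Dnn C by simp
  thus ?thesis using True unfolding sp by linarith
  next
  case False
  have "norm (a /\<^sub>R s) powr p + norm (b /\<^sub>R s) powr p = 1"
  using s0 False sp unfolding sc by (simp add: add_divide_distrib[symmetric] \<open>norm a powr p + norm b powr p ~= 0\<close>)
  moreover have "e <= norm (a /\<^sub>R s - b /\<^sub>R s) powr p"
  using False s0 unfolding sub by (simp add: field_simps)
  ultimately have "de <= D (a /\<^sub>R s, b /\<^sub>R s)" by (intro de) (simp add: S_def)
  hence 1: "de * s powr p <= D (a, b)" unfolding Dsc using s0 by (simp add: field_simps)
  have "norm (a - b) powr p <= 2 powr p * s powr p"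
  using norm_add_powr_le[of p a "- b"] p by (simp add: sp)
  also have "... = C * (de * s powr p)" using de by (simp add: C_def)
  also have "... <= C * D (a, b)" using 1 C by (intro mult_left_mono) auto
  also have "... <= e * (norm a powr p + norm b powr p) + C * D (a, b)" using e by simp
  finally show ?thesis .
  qed
 qed
 thus ?thesis using that[OF C] by (simp add: D_def)
qed

text \<open>
  The limit functional is represented without duality theory: near-minimisers of \<open>J\<close> over the decreasing
  convex sets \<open>K n\<close>, which contain the tails of the sequence, converge by uniform convexity.
\<close>

lemma weak_closedness:
 fixes G :: "nat => 'e => 'b::euclidean_space" and ph :: "'i => 'e => 'b"
 assumes p: "1 < p" and meas[measurable]: "!!n. G n : borel_measurable N"
  and bound: "!!n. pint p N (G n) <= en B"
  and ph[measurable]: "!!i. i : I ==> ph i : borel_measurable N"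
  and ph_bound: "!!i. i : I ==> EX K. ALL x. norm (ph i x) <= K"
  and ph_supp: "!!i. i : I ==> EX A:sets N. emeasure N A < \<infinity> & (ALL x:space N - A. ph i x = 0)"
  and lim: "!!i. i : I ==> (%n. \<integral>x. G n x \<bullet> ph i x \<partial>N) \<longlonglongrightarrow> L i"
 obtains g where "g : Lp_space p N" "!!i. i : I ==> (\<integral>x. g x \<bullet> ph i x \<partial>N) = L i"
proof -
 \<comment> \<open>\<open>K n\<close> collects the functions whose pairings err by no more than
   those of the tail from \<open>n\<close> on. It is an intersection of convex slabs, and every
   element of that tail belongs to it.\<close>
 define K where "K n = {h : Lp_space p N. ALL i:I. ALL c. (ALL m>=n. \<bar>(\<integral>x. G m x \<bullet> ph i x \<partial>N) - L i\<bar> <= c) -->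
  \<bar>(\<integral>x. h x \<bullet> ph i x \<partial>N) - L i\<bar> <= c}" for n
 define J where "J h = (\<integral>x. norm (h x) powr p \<partial>N)" for h :: "'e => 'b"
 have J0: "0 <= J h" for h by (simp add: J_def)
 have GLp: "G n : Lp_space p N" for n
  using bound[of n] by (auto simp: Lp_space_iff intro: le_less_trans)
 have GK: "G m : K n" if "n <= m" for m n using that GLp by (auto simp: K_def)
 have JG: "J (G n) <= max B 0" for n
  using bound[of n] unfolding pint_eq_integral[OF GLp] J_def[symmetric]
  by (cases "B >= 0") (auto simp: ennreal_neg J0 antisym)
 \<comment> \<open>Boundedness and support of finite measure make each pairing continuous on Lp, by
   Jensen's inequality in the role of Hoelder's.\<close>
 have pairing: "EX C>=0. ALL h:Lp_space p N. integrable N (%x. h x \<bullet> ph i x) &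
  \<bar>\<integral>x. h x \<bullet> ph i x \<partial>N\<bar> powr p <= C * J h" if i: "i : I" for i
 proof -
  obtain k where k: "!!x. norm (ph i x) <= k" using ph_bound[OF i] by blast
  obtain A where A[measurable]: "A : sets N" and Af: "emeasure N A < \<infinity>"
  and A0: "!!x. x : space N ==> x ~: A ==> ph i x = 0" using ph_supp[OF i] by blast
  have k0: "k >= 0" using k[of undefined] norm_ge_zero order_trans by blast
  have mA: "emeasure N A <= en (enn2real (emeasure N A))" using Af by simp
  have [measurable]: "ph i : borel_measurable N" using ph[OF i] .
  show ?thesis
  proof (intro exI[of _ "enn2real (emeasure N A) powr (p - 1) * k powr p"] conjI ballI)
  fix h :: "'e => 'b" assume h: "h : Lp_space p N"
  hence [measurable]: "h : borel_measurable N" by (simp add: Lp_space_iff)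
  have le: "norm (h x \<bullet> ph i x) powr p <= k powr p * norm (h x) powr p" for x
  proof -
  have "norm (h x \<bullet> ph i x) <= norm (h x) * norm (ph i x)" by (simp add: Cauchy_Schwarz_ineq2)
  also have "... <= norm (h x) * k" by (intro mult_left_mono k) auto
  finally have "norm (h x \<bullet> ph i x) powr p <= (norm (h x) * k) powr p" using p by (intro powr_mono2) auto
  thus ?thesis by (simp add: powr_mult mult.commute)
  qed
  have ple: "pint p N (%x. h x \<bullet> ph i x) <= en (k powr p) * pint p N h"
  unfolding pint_def using le
  by (subst nn_integral_cmult[symmetric]) (auto intro!: nn_integral_mono simp: ennreal_mult[symmetric])
  also have "... < \<infinity>" using h by (simp add: Lp_space_iff ennreal_mult_less_top)
  finally show "integrable N (%x. h x \<bullet> ph i x)"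
  using p A0 Af by (intro integrable_Lp_support[where A = A and p = p]) auto
  have "en (norm (\<integral>x. h x \<bullet> ph i x \<partial>N) powr p) <=
  en (enn2real (emeasure N A) powr (p - 1)) * pint p N (%x. h x \<bullet> ph i x)"
  using p A0 by (intro jensen_powr_support[where A = A] mA) auto
  also have "... <= en (enn2real (emeasure N A) powr (p - 1)) * (en (k powr p) * pint p N h)"
  by (intro mult_left_mono ple) auto
  also have "... = en (enn2real (emeasure N A) powr (p - 1) * k powr p * J h)"
  by (simp add: pint_eq_integral[OF h] J_def[symmetric] ennreal_mult'' J0 mult.assoc)
  finally show "\<bar>\<integral>x. h x \<bullet> ph i x \<partial>N\<bar> powr p <= enn2real (emeasure N A) powr (p - 1) * k powr p * J h"
  by (simp add: J0)
  qed simp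
 qed
 then obtain C where C0: "!!i. i : I ==> C i >= 0" and
  int: "!!i h. i : I ==> h : Lp_space p N ==> integrable N (%x. h x \<bullet> ph i x)" and
  C: "!!i h. i : I ==> h : Lp_space p N ==> \<bar>\<integral>x. h x \<bullet> ph i x \<partial>N\<bar> powr p <= C i * J h"
  by metis
 \<comment> \<open>The infima increase with \<open>n\<close>, as the sets shrink, and are bounded by
   the energies of the sequence; so they converge.\<close>
 define d where "d n = Inf (J ` K n)" for n
 have bdd: "bdd_below (J ` K n)" for n using J0 by (intro bdd_belowI[of _ 0]) auto
 have Kmono: "K m <= K n" if "n <= m" for m n unfolding K_def using that by auto
 have dmono: "d n <= d m" if "n <= m" for m n
  unfolding d_def using Kmono[OF that] GK[of m m] bdd by (intro cInf_superset_mono) auto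
 have dle: "d n <= max B 0" for n
  unfolding d_def using GK[of n n] JG[of n] by (intro cInf_lower2[OF _ _ bdd]) auto
 obtain D where D: "d \<longlonglongrightarrow> D"
  by (rule incseq_convergent[of d "max B 0"]) (use dmono dle in \<open>auto simp: incseq_def\<close>)
 have "EX h:K n. J h < d n + inverse (real (Suc n))" for n
 proof -
  have "Inf (J ` K n) < d n + inverse (real (Suc n))" by (simp add: d_def)
  thus ?thesis using GK[of n n] cInf_lessD[of "J ` K n"] by blast
 qed
 then obtain h where hK: "!!n. h n : K n" and hJ: "!!n. J (h n) < d n + inverse (real (Suc n))" by metis
 have hLp: "h n : Lp_space p N" for n using hK[of n] by (simp add: K_def)
 have hm[measurable]: "h n : borel_measurable N" for n using hLp[of n] by (simp add: Lp_space_iff)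
 have midK: "(%x. (h m x + h n x) /\<^sub>R 2) : K n" if "n <= m" for m n
 proof -
  have hmn: "h m : K n" "h n : K n" using hK Kmono[OF that] by auto
  have Lp: "(%x. (h m x + h n x) /\<^sub>R 2) : Lp_space p N"
  using Lp_space_lincomb[OF hLp[of m] hLp[of n], of "1/2" "1/2"] p by (simp add: scaleR_right_distrib)
  have "\<bar>(\<integral>x. ((h m x + h n x) /\<^sub>R 2) \<bullet> ph i x \<partial>N) - L i\<bar> <= c"
  if i: "i : I" and c: "ALL k>=n. \<bar>(\<integral>x. G k x \<bullet> ph i x \<partial>N) - L i\<bar> <= c" for i c
  proof -
  have "(\<integral>x. ((h m x + h n x) /\<^sub>R 2) \<bullet> ph i x \<partial>N)
  = (\<integral>x. (h m x \<bullet> ph i x + h n x \<bullet> ph i x) / 2 \<partial>N)"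
  by (intro lint_cong) (auto simp: inner_add_left)
  also have "... = ((\<integral>x. h m x \<bullet> ph i x \<partial>N) + (\<integral>x. h n x \<bullet> ph i x \<partial>N)) / 2"
  using int[OF i hLp] by simp
  finally have e: "(\<integral>x. ((h m x + h n x) /\<^sub>R 2) \<bullet> ph i x \<partial>N) =
  ((\<integral>x. h m x \<bullet> ph i x \<partial>N) + (\<integral>x. h n x \<bullet> ph i x \<partial>N)) / 2" .
  have "\<bar>(\<integral>x. h m x \<bullet> ph i x \<partial>N) - L i\<bar> <= c" "\<bar>(\<integral>x. h n x \<bullet> ph i x \<partial>N) - L i\<bar> <= c"
  using hmn i c by (auto simp: K_def)
  thus ?thesis unfolding e by (auto simp: abs_le_iff field_simps)
  qed
  with Lp show ?thesis by (simp add: K_def)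
 qed
 define de where "de n m = (J (h m) + J (h n)) / 2 - d n" for n m
 have cauchy_aux: "EX n0. ALL n>=n0. ALL m>=n. J (%x. h m x - h n x) <= e" if e: "0 < e" for e
 proof -
  define S where "S = max B 0 + 1"
  have S: "S > 0" "J (h n) <= S" for n
  proof -
  have "inverse (real (Suc n)) <= 1" by (simp add: field_simps)
  thus "J (h n) <= S" using hJ[of n] dle[of n] unfolding S_def by linarith
  qed (simp add: S_def)
  obtain Cu where Cu: "0 < Cu" "!!a b :: 'b. norm (a - b) powr p <= (e / (4 * S)) * (norm a powr p + norm b powr p)
  + Cu * ((norm a powr p + norm b powr p) / 2 - norm ((a + b) /\<^sub>R 2) powr p)"
  using uniform_convexity_powr[OF p, of "e / (4 * S)"] e S by auto
  \<comment> \<open>The midpoint of \<open>h m\<close> and \<open>h n\<close> lies in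
    \<open>K n\<close> and costs at least \<open>d n\<close>; uniform convexity then bounds the
    distance by the remaining defect \<open>de n m\<close>.\<close>
  have key: "J (%x. h m x - h n x) <= e / 2 + Cu * de n m" if "n <= m" for m n
  proof -
  have i1: "integrable N (%x. norm (h m x) powr p)" for m using hLp[of m] by (simp add: Lp_space_def)
  have i2: "integrable N (%x. norm ((h m x + h n x) /\<^sub>R 2) powr p)"
  using midK[OF that] by (simp add: K_def Lp_space_def)
  have i3: "integrable N (%x. norm (h m x - h n x) powr p)"
  using Lp_space_diff[OF hLp[of m] hLp[of n]] p by (simp add: Lp_space_def)
  have "J (%x. h m x - h n x) <= (\<integral>x. (e / (4 * S)) * (norm (h m x) powr p + norm (h n x) powr p)
  + Cu * ((norm (h m x) powr p + norm (h n x) powr p) / 2 - norm ((h m x + h n x) /\<^sub>R 2) powr p) \<partial>N)"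
  unfolding J_def using i1 i2 i3 Cu(2) by (intro integral_mono) auto
  also have "... = (e / (4 * S)) * (J (h m) + J (h n)) + Cu * ((J (h m) + J (h n)) / 2 - J (%x. (h m x + h n x) /\<^sub>R 2))"
  unfolding J_def using i1 i2 by simp
  also have "... <= (e / (4 * S)) * (S + S) + Cu * de n m"
  proof (intro add_mono mult_left_mono S)
  have "d n <= J (%x. (h m x + h n x) /\<^sub>R 2)"
  unfolding d_def using midK[OF that] bdd by (intro cInf_lower) auto
  thus "(J (h m) + J (h n)) / 2 - J (%x. (h m x + h n x) /\<^sub>R 2) <= de n m"
  by (simp add: de_def)
  qed (use Cu S e in auto)
  also have "(e / (4 * S)) * (S + S) = e / 2" using S by (simp add: field_simps)
  finally show ?thesis .
  qed
  define t where "t = e / (4 * Cu)"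
  have t: "t > 0" using e Cu by (simp add: t_def)
  obtain n1 where n1: "!!n. n >= n1 ==> \<bar>d n - D\<bar> < t / 4" using LIMSEQ_D[OF D, of "t / 4"] t by auto
  obtain n2 where n2: "inverse (real (Suc n2)) < t / 2" using reals_Archimedean[of "t / 2"] t by auto
  have "J (%x. h m x - h n x) <= e" if "n >= max n1 n2" "m >= n" for n m
  proof -
  have "inverse (real (Suc k)) < t / 2" if "k >= n2" for k
  proof -
  have "inverse (real (Suc k)) <= inverse (real (Suc n2))" using that by (intro le_imp_inverse_le) auto
  thus ?thesis using n2 by linarith
  qed
  hence "inverse (real (Suc m)) < t / 2" "inverse (real (Suc n)) < t / 2" using that by auto
  moreover have "\<bar>d m - D\<bar> < t / 4" "\<bar>d n - D\<bar> < t / 4" using n1 that by auto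
  moreover have "(Jm + Jn) / 2 - dn <= t"
  if "im < t / 2" "i < t / 2" "\<bar>dm - D\<bar> < t / 4" "\<bar>dn - D\<bar> < t / 4" "Jm < dm + im" "Jn < dn + i"
  for Jm Jn dm dn im i
  proof -
  have "dm < D + t / 4" "D < dn + t / 4" using that(3,4) by (simp_all only: abs_less_iff, linarith+)
  thus ?thesis using that(1,2,5,6) t by argo
  qed
  ultimately have "de n m <= t" using hJ[of m] hJ[of n] unfolding de_def by blast
  hence "Cu * de n m <= Cu * t" using Cu by (intro mult_left_mono) auto
  also have "Cu * t = e / 4" using Cu by (simp add: t_def)
  finally show ?thesis using key[OF \<open>m >= n\<close>] e by linarith
  qed
  thus ?thesis by blast
 qed
 have pJ: "pint p N (%x. h m x - h n x) = en (J (%x. h m x - h n x))" for m n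
  using p unfolding J_def by (intro pint_eq_integral Lp_space_diff hLp) auto
 obtain g where gm[measurable]: "g : borel_measurable N" and
  g: "!!e. 0 < e ==> EX n0. ALL n>=n0. pint p N (%x. h n x - g x) <= en e"
 proof (rule Lp_complete[of p h N])
  show "1 <= p" using p by simp
  fix e :: real assume "0 < e"
  then obtain n0 where n0: "!!n m. n >= n0 ==> m >= n ==> J (%x. h m x - h n x) <= e"
  using cauchy_aux by blast
  have "pint p N (%x. h n x - h m x) <= en e" if "m >= n0" "n >= n0" for m n
  proof (cases "n <= m")
  case True
  thus ?thesis using n0[of n m] that
  by (subst pint_commute) (simp add: pJ ennreal_leI)
  next
  case False
  thus ?thesis using n0[of m n] that by (simp add: pJ ennreal_leI)
  qed
  thus "EX n0. ALL m>=n0. ALL n>=n0. pint p N (%x. h n x - h m x) <= en e" by blast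
 qed auto
 have gdiff: "EX n0. ALL n>=n0. (%x. h n x - g x) : Lp_space p N & J (%x. h n x - g x) <= e" if "0 < e" for e
 proof -
  obtain n0 where n0: "!!n. n >= n0 ==> pint p N (%x. h n x - g x) <= en e" using g[OF \<open>0 < e\<close>] by blast
  have "(%x. h n x - g x) : Lp_space p N & J (%x. h n x - g x) <= e" if "n >= n0" for n
  proof -
  have L: "(%x. h n x - g x) : Lp_space p N"
  using n0[OF that] by (auto simp: Lp_space_iff intro: le_less_trans)
  thus ?thesis using n0[OF that] \<open>0 < e\<close> unfolding pint_eq_integral[OF L] J_def[symmetric]
  by simp
  qed
  thus ?thesis by blast
 qed
 obtain n0 where "(%x. h n0 x - g x) : Lp_space p N" using gdiff[of 1] by auto
 hence gLp: "g : Lp_space p N"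
  using Lp_space_diff[OF hLp[of n0], of "%x. h n0 x - g x"] p by simp
 have "(\<integral>x. g x \<bullet> ph i x \<partial>N) = L i" if i: "i : I" for i
 proof -
  have a: "(%n. \<integral>x. h n x \<bullet> ph i x \<partial>N) \<longlonglongrightarrow> (\<integral>x. g x \<bullet> ph i x \<partial>N)"
  proof (rule LIMSEQ_I)
  fix r :: real assume r: "0 < r"
  define e where "e = (r / 2) powr p / (C i + 1)"
  have e: "e > 0" using r C0[OF i] by (simp add: e_def)
  obtain n1 where n1: "!!n. n >= n1 ==> (%x. h n x - g x) : Lp_space p N & J (%x. h n x - g x) <= e"
  using gdiff[OF e] by blast
  have "norm ((\<integral>x. h n x \<bullet> ph i x \<partial>N) - (\<integral>x. g x \<bullet> ph i x \<partial>N)) < r" if "n >= n1" for n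
  proof -
  have "(\<integral>x. h n x \<bullet> ph i x \<partial>N) - (\<integral>x. g x \<bullet> ph i x \<partial>N) = (\<integral>x. (h n x - g x) \<bullet> ph i x \<partial>N)"
  using int[OF i hLp[of n]] int[OF i gLp] by (simp add: inner_diff_left)
  hence "\<bar>(\<integral>x. h n x \<bullet> ph i x \<partial>N) - (\<integral>x. g x \<bullet> ph i x \<partial>N)\<bar> powr p <= C i * J (%x. h n x - g x)"
  using C[OF i, of "%x. h n x - g x"] n1[OF that] by simp
  also have "... <= C i * e" using n1[OF that] C0[OF i] by (intro mult_left_mono) auto
  also have "... <= (C i + 1) * e" using e by simp
  also have "... = (r / 2) powr p" using C0[OF i] by (simp add: e_def)
  finally have "\<bar>(\<integral>x. h n x \<bullet> ph i x \<partial>N) - (\<integral>x. g x \<bullet> ph i x \<partial>N)\<bar> <= r / 2"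
  using p r by (meson not_le powr_less_mono2 less_le_trans linorder_not_less order_less_imp_le half_gt_zero less_trans zero_less_one)
  thus ?thesis using r by simp
  qed
  thus "EX n0. ALL n>=n0. norm ((\<integral>x. h n x \<bullet> ph i x \<partial>N) - (\<integral>x. g x \<bullet> ph i x \<partial>N)) < r" by blast
  qed
  \<comment> \<open>\<open>h n\<close> lies in \<open>K n\<close>, so it inherits every bound valid
    for the tail of the original sequence.\<close>
  have b: "(%n. \<integral>x. h n x \<bullet> ph i x \<partial>N) \<longlonglongrightarrow> L i"
  proof (rule LIMSEQ_I)
  fix r :: real assume r: "0 < r"
  obtain n1 where n1: "!!n. n >= n1 ==> norm ((\<integral>x. G n x \<bullet> ph i x \<partial>N) - L i) < r / 2"
  using LIMSEQ_D[OF lim[OF i], of "r / 2"] r by auto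
  have "norm ((\<integral>x. h n x \<bullet> ph i x \<partial>N) - L i) < r" if "n >= n1" for n
  proof -
  have "ALL m>=n. \<bar>(\<integral>x. G m x \<bullet> ph i x \<partial>N) - L i\<bar> <= r / 2"
  using n1 that by (auto intro: less_imp_le)
  hence "\<bar>(\<integral>x. h n x \<bullet> ph i x \<partial>N) - L i\<bar> <= r / 2" using hK[of n] i unfolding K_def by blast
  thus ?thesis using r by simp
  qed
  thus "EX n0. ALL n>=n0. norm ((\<integral>x. h n x \<bullet> ph i x \<partial>N) - L i) < r" by blast
  qed
  show ?thesis by (rule LIMSEQ_unique[OF a b])
 qed
 thus ?thesis by (rule that[OF gLp])
qed

section \<open>Relative compactness from total boundedness\<close>

lemma topspace_norm_topology: "topspace (norm_topology X N) = X"
proof -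
 have "openin (norm_topology X N) X" unfolding openin_norm_topology by (auto intro: exI[of _ 1])
 moreover have "U <= X" if "openin (norm_topology X N) U" for U
  using that unfolding openin_norm_topology by blast
 ultimately show ?thesis by (metis openin_subset openin_topspace subset_antisym)
qed

text \<open>The topology is abstract and need not be Hausdorff, so compactness is proved directly. A
  set whose closure has no finite subcover is cut repeatedly into small pieces, one of which stays
  bad. A Cauchy sequence through the nested pieces has a limit, and one open set around it swallows
  the closure of a late piece.\<close>

lemma relatively_compact_inI:
 assumes S: "S <= X"
  and refl: "!!u. u : X ==> N (%x. u x - u x) = 0"
  and sym: "!!u v. u : X ==> v : X ==> N (%x. u x - v x) = N (%x. v x - u x)"
  and tri: "!!u v w. u : X ==> v : X ==> w : X ==>
  N (%x. u x - w x) <= N (%x. u x - v x) + N (%x. v x - w x)"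
  and complete: "!!a. (!!n::nat. a n : X) ==>
  (!!e. 0 < e ==> EX n0. ALL m>=n0. ALL n>=n0. N (%x. a n x - a m x) < e) ==>
  EX l:X. ALL e>0. EX n0. ALL n>=n0. N (%x. a n x - l x) < e"
  and tb: "!!e. 0 < e ==> EX \<C>. finite \<C> & S <= \<Union>\<C> &
  (ALL C:\<C>. ALL u:C \<inter> S. ALL v:C \<inter> S. N (%x. u x - v x) <= e)"
 shows "relatively_compact_in X N S"
proof -
 let ?T = "norm_topology X N"
 define d where "d u v = N (%x. u x - v x)" for u v
 have ball_open: "openin ?T {v : X. d u v < e}" if u: "u : X" for u e
  unfolding openin_norm_topology
 proof (intro conjI ballI)
  fix v assume "v : {v : X. d u v < e}"
  hence v: "v : X" "d u v < e" by auto
  have "d u w < e" if "w : X" "N (%x. w x - v x) < e - d u v" for w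
  using tri[OF u v(1) that(1)] sym[OF that(1) v(1)] that(2) by (simp add: d_def)
  thus "EX r>0. ALL w:X. N (%x. w x - v x) < r --> w : {v : X. d u v < e}"
  using v by (intro exI[of _ "e - d u v"]) auto
 qed auto
 have near: "EX b:A. d v b < e" if "v : ?T closure_of A" "0 < e" for v A e
 proof -
  have v: "v : X" using that(1) by (simp add: in_closure_of topspace_norm_topology)
  have "v : {w : X. d v w < e}" using v refl[OF v] that(2) by (simp add: d_def)
  moreover from that(1) have "ALL U. v : U & openin ?T U --> (EX y. y : A & y : U)"
  unfolding in_closure_of by (rule conjunct2)
  ultimately have "EX y. y : A & y : {w : X. d v w < e}" using ball_open[OF v, of e] by meson
  thus ?thesis by auto
 qed
 have "compactin ?T (?T closure_of S)"
  unfolding compactin_def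
 proof (intro conjI allI impI)
  show "?T closure_of S <= topspace ?T" by (rule closure_of_subset_topspace)
  fix \<U> assume \<U>: "(ALL U:\<U>. openin ?T U) & ?T closure_of S <= \<Union>\<U>"
  define bad where "bad A \<longleftrightarrow> ~ (EX \<F>. finite \<F> & \<F> <= \<U> & ?T closure_of A <= \<Union>\<F>)" for A
  have split: "EX A'. (bad A' & A' <= S) & A' <= A & (ALL u:A'. ALL v:A'. d u v <= e)"
  if A: "bad A & A <= S" and e: "0 < e" for A e
  proof (rule ccontr)
  assume no: "~ ?thesis"
  obtain \<C> where \<C>0: "finite \<C> & S <= \<Union>\<C> & (ALL C:\<C>. ALL u:C \<inter> S. ALL v:C \<inter> S. d u v <= e)"
  using tb[OF e] unfolding d_def ..
  hence \<C>: "finite \<C>" "S <= \<Union>\<C>" "!!C u v. C : \<C> ==> u : C \<inter> S ==> v : C \<inter> S ==> d u v <= e"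
  by simp_all
  have "~ bad (A \<inter> C)" if "C : \<C>" for C
  proof
  assume "bad (A \<inter> C)"
  moreover have AS: "A \<inter> C <= S" "A \<inter> C <= A" using A by auto
  moreover have "ALL u:A \<inter> C. ALL v:A \<inter> C. d u v <= e"
  by (intro ballI \<C>(3)[OF that]) (use AS in auto)
  ultimately have "(bad (A \<inter> C) & A \<inter> C <= S) & A \<inter> C <= A & (ALL u:A \<inter> C. ALL v:A \<inter> C. d u v <= e)"
  by (intro conjI)
  thus False by (rule notE[OF no exI])
  qed
  hence "ALL C:\<C>. EX F. finite F & F <= \<U> & ?T closure_of (A \<inter> C) <= \<Union>F"
  unfolding bad_def not_not by (intro ballI)
  from bchoice[OF this] obtain F where F0: "ALL C:\<C>. finite (F C) & F C <= \<U> & ?T closure_of (A \<inter> C) <= \<Union>(F C)"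
  by (elim exE)
  hence F: "finite (F C) & F C <= \<U> & ?T closure_of (A \<inter> C) <= \<Union>(F C)" if "C : \<C>" for C
  using that by (rule bspec)
  have "A = \<Union>((%C. A \<inter> C) ` \<C>)" using A \<C>(2) by blast
  hence "?T closure_of A = (\<Union>B\<in>(%C. A \<inter> C) ` \<C>. ?T closure_of B)"
  using closure_of_Union[of "(%C. A \<inter> C) ` \<C>" ?T] \<C>(1) by simp
  also have "... <= \<Union>(\<Union>C\<in>\<C>. F C)"
  proof clarsimp
  fix x C assume "C : \<C>" "x : ?T closure_of (A \<inter> C)"
  hence "x : \<Union>(F C)" using F[of C] by auto
  thus "EX D:\<C>. EX U:F D. x : U" using \<open>C : \<C>\<close> by blast
  qed
  finally have "?T closure_of A <= \<Union>(\<Union>C\<in>\<C>. F C)" .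
  moreover have "finite (\<Union>C\<in>\<C>. F C)" using F \<C>(1) by (intro finite_UN_I) auto
  moreover have "(\<Union>C\<in>\<C>. F C) <= \<U>" using F by (intro UN_least) auto
  ultimately have "~ bad A" unfolding bad_def by (intro notI) auto
  thus False using A by simp
  qed
  show "EX \<F>. finite \<F> & \<F> <= \<U> & ?T closure_of S <= \<Union>\<F>"
  proof (rule ccontr)
  assume "~ ?thesis"
  hence bS: "bad S" by (simp add: bad_def)
  have "EX A. ALL k. (bad (A k) & A k <= S) &
  (A (Suc k) <= A k & (ALL u:A (Suc k). ALL v:A (Suc k). d u v <= 1 / real (Suc k)))"
  proof (rule dependent_nat_choice)
  show "EX A. bad A & A <= S" using bS by (intro exI[of _ S] conjI order_refl)
  show "EX A'. (bad A' & A' <= S) & A' <= A & (ALL u:A'. ALL v:A'. d u v <= 1 / real (Suc k))"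
  if "bad A & A <= S" for A k by (rule split[OF that]) simp
  qed
  then obtain A where A0: "ALL k. (bad (A k) & A k <= S) &
  (A (Suc k) <= A k & (ALL u:A (Suc k). ALL v:A (Suc k). d u v <= 1 / real (Suc k)))"
  by (elim exE)
  have A: "bad (A k) & A k <= S" for k using A0 by simp
  have step: "A (Suc k) <= A k & (ALL u:A (Suc k). ALL v:A (Suc k). d u v <= 1 / real (Suc k))" for k
  using A0 by simp
  have anti: "A n <= A m" if "m <= n" for m n
  by (rule lift_Suc_antimono_le[of A, OF conjunct1[OF step] that])
  define a where "a k = (SOME u. u : A k)" for k
  have a: "a k : A k" for k
  proof -
  have "A k ~= {}"
  using A[of k] by (auto simp: bad_def intro: exI[of _ "{}"])
  thus ?thesis unfolding a_def by (rule some_in_eq[THEN iffD2])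
  qed
  have aX: "a k : X" for k using a[of k] A[of k] S by auto
  have small: "d u v <= 1 / real (Suc k)" if "u : A n" "v : A m" "n >= Suc k" "m >= Suc k" for u v n m k
  proof -
  have "u : A (Suc k)" "v : A (Suc k)" using that anti[of "Suc k" n] anti[of "Suc k" m] by auto
  thus ?thesis using step[of k] by simp
  qed
  have "EX l:X. ALL e>0. EX n0. ALL n>=n0. N (%x. a n x - l x) < e"
  proof (rule complete[OF aX])
  fix e :: real assume "0 < e"
  then obtain k where k: "1 / real (Suc k) < e" using nat_approx_posE by blast
  show "EX n0. ALL m>=n0. ALL n>=n0. N (%x. a n x - a m x) < e"
  using small[OF a a] k unfolding d_def by (intro exI[of _ "Suc k"]) (meson le_less_trans)
  qed
  then obtain l where l: "l : X" "!!e. 0 < e ==> EX n0. ALL n>=n0. d (a n) l < e" unfolding d_def by blast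
  have "l : ?T closure_of S"
  unfolding in_closure_of
  proof (intro conjI allI impI)
  show "l : topspace ?T" using l by (simp add: topspace_norm_topology)
  fix U assume U: "l : U & openin ?T U"
  then obtain e where e: "0 < e" "!!v. v : X ==> d v l < e ==> v : U"
  unfolding openin_norm_topology d_def by blast
  obtain n where "d (a n) l < e" using l(2)[OF e(1)] by blast
  hence "a n : U" by (rule e(2)[OF aX])
  thus "EX y. y : S & y : U" using a[of n] A[of n] by auto
  qed
  then obtain U where U: "U : \<U>" "l : U" using \<U> by blast
  hence "openin ?T U" using \<U> by simp
  hence "ALL u:U. EX e>0. ALL v:X. d v u < e --> v : U"
  unfolding openin_norm_topology d_def by (rule conjunct2)
  from bspec[OF this U(2)] obtain e where e: "0 < e" "!!v. v : X ==> d v l < e ==> v : U" by auto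
  obtain k where k: "1 / real (Suc k) < e / 3" using nat_approx_posE[of "e / 3"] e by auto
  obtain n0 where n0: "!!n. n >= n0 ==> d (a n) l < e / 3" using l(2)[of "e / 3"] e by auto
  \<comment> \<open>A third of \<open>e\<close> each is spent on approximating a point of the
    closure, on the diameter of \<open>A n\<close> and on the distance from \<open>a n\<close> to
    \<open>l\<close>.\<close>
  define n where "n = max n0 (Suc k)"
  have "?T closure_of (A n) <= U"
  proof
  fix v assume v: "v : ?T closure_of (A n)"
  hence vX: "v : X" by (simp add: in_closure_of topspace_norm_topology)
  obtain b where b: "b : A n" "d v b < e / 3" using near[OF v, of "e / 3"] e by auto
  have bX: "b : X" using b A[of n] S by auto
  have "d b (a n) <= 1 / real (Suc k)" using b a by (intro small[of _ n _ n]) (auto simp: n_def)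
  moreover have "d (a n) l < e / 3" by (rule n0) (simp add: n_def)
  ultimately have "d v l < e"
  using tri[OF vX bX l(1)] tri[OF bX aX[of n] l(1)] b(2) k unfolding d_def by simp
  thus "v : U" by (rule e(2)[OF vX])
  qed
  hence "~ bad (A n)" unfolding bad_def using U by (intro notI) (auto dest!: spec[of _ "{U}"])
  thus False using A[of n] by simp
  qed
 qed
 thus ?thesis using S by (simp add: relatively_compact_in_def)
qed

lemma Lp_norm_le_iff:
 fixes u :: "'e => 'b::euclidean_space"
 assumes "1 <= p" "0 <= e" "u : Lp_space p N"
 shows "Lp_norm p N u <= e \<longleftrightarrow> pint p N u <= en (e powr p)"
proof -
 have "Lp_norm p N u <= e \<longleftrightarrow> Lp_norm p N u powr p <= e powr p"
  using assms powr_mono2[of p "Lp_norm p N u" e] powr_less_mono2[of p e "Lp_norm p N u"]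
  by (auto simp: Lp_norm_nonneg not_le[symmetric])
 thus ?thesis using assms by (simp add: Lp_norm_powr pint_eq_integral)
qed

text \<open>A finite code whose fibres have small diameter is total boundedness of the image. The
  requirement is put on indices, so that codes obtained from different pieces of information can be
  combined.\<close>

lemma Lp_relatively_compact:
 fixes f :: "nat => 'e => real"
 assumes p: "1 <= p" and f: "!!n. n : I ==> f n : Lp_space p N"
  and codes: "!!e. 0 < e ==> EX c :: nat => 'c. finite (c ` I) &
  (ALL m:I. ALL n:I. c m = c n --> pint p N (%x. f m x - f n x) <= en e)"
 shows "relatively_compact_in (Lp_space p N) (Lp_norm p N) (f ` I)"
proof (rule relatively_compact_inI)
 show "f ` I <= Lp_space p N" using f by auto
 show "Lp_norm p N (%x. u x - u x) = 0" for u :: "'e => real" using p by (simp add: Lp_norm_def)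
 show "Lp_norm p N (%x. u x - v x) = Lp_norm p N (%x. v x - u x)" for u v :: "'e => real"
  by (simp add: Lp_norm_def abs_minus_commute)
 show "Lp_norm p N (%x. u x - w x) <= Lp_norm p N (%x. u x - v x) + Lp_norm p N (%x. v x - w x)"
  if "u : Lp_space p N" "v : Lp_space p N" "w : Lp_space p N" for u v w :: "'e => real"
  using Lp_norm_triangle[OF p Lp_space_diff[OF that(1,2)] Lp_space_diff[OF that(2,3)]] p by simp
 show "EX l:Lp_space p N. ALL e>0. EX n0. ALL n>=n0. Lp_norm p N (%x. a n x - l x) < e"
  if a: "!!n::nat. a n : Lp_space p N"
  and c: "!!e. 0 < e ==> EX n0. ALL m>=n0. ALL n>=n0. Lp_norm p N (%x. a n x - a m x) < e"
  for a :: "nat => 'e => real"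
 proof -
  have ad: "(%x. a n x - a m x) : Lp_space p N" for m n using Lp_space_diff[OF a a] p by simp
  obtain v where vm: "v : borel_measurable N" and
  v: "!!e. 0 < e ==> EX n0. ALL n>=n0. pint p N (%x. a n x - v x) <= en e"
  proof (rule Lp_complete[OF p, of a N])
  show "a n : borel_measurable N" for n using a[of n] by (simp add: Lp_space_iff)
  fix e :: real assume e: "0 < e"
  hence "0 < e powr (1 / p)" by simp
  then obtain n0 where "!!m n. m >= n0 ==> n >= n0 ==> Lp_norm p N (%x. a n x - a m x) <= e powr (1 / p)"
  using c by (meson less_imp_le)
  hence "!!m n. m >= n0 ==> n >= n0 ==> pint p N (%x. a n x - a m x) <= en e"
  using Lp_norm_le_iff[OF p _ ad] p e by (simp add: powr_powr)
  thus "EX n0. ALL m>=n0. ALL n>=n0. pint p N (%x. a n x - a m x) <= en e" by blast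
  qed auto
  have vd: "(%x. a n x - v x) : Lp_space p N" if "pint p N (%x. a n x - v x) <= en e" for n e
  using that vm a[of n] by (auto simp: Lp_space_iff intro: le_less_trans)
  obtain n1 where "pint p N (%x. a n1 x - v x) <= en 1" using v[of 1] by auto
  hence vL: "v : Lp_space p N" using Lp_space_diff[OF a[of n1] vd[of n1 1]] p by simp
  have "EX n0. ALL n>=n0. Lp_norm p N (%x. a n x - v x) < e" if e: "0 < e" for e
  proof -
  obtain n0 where n0: "!!n. n >= n0 ==> pint p N (%x. a n x - v x) <= en ((e / 2) powr p)"
  using v[of "(e / 2) powr p"] e by auto
  have "Lp_norm p N (%x. a n x - v x) <= e / 2" if "n >= n0" for n
  using Lp_norm_le_iff[where e = "e / 2", OF p _ vd[OF n0[OF that]]] n0[OF that] e by simp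
  hence "Lp_norm p N (%x. a n x - v x) < e" if "n >= n0" for n
  by (rule le_less_trans) (use that e in auto)
  thus ?thesis by blast
  qed
  thus ?thesis using vL by blast
 qed
 fix e :: real assume e: "0 < e"
 obtain c :: "nat => 'c" where c: "finite (c ` I)"
  "!!m n. m : I ==> n : I ==> c m = c n ==> pint p N (%x. f m x - f n x) <= en (e powr p)"
  using codes[of "e powr p"] e by auto
 have *: "Lp_norm p N (%x. f m x - f n x) <= e" if "m : I" "n : I" "c m = c n" for m n
  using c(2)[OF that] Lp_norm_le_iff[OF p _ Lp_space_diff[OF f f], OF _ that(1,2)] e p by simp
 have "finite ((%k. f ` {n : I. c n = k}) ` c ` I)" using c by simp
 moreover have "f ` I <= \<Union>((%k. f ` {n : I. c n = k}) ` c ` I)" by blast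
 moreover have "Lp_norm p N (%x. u x - v x) <= e"
  if C: "C : (%k. f ` {n : I. c n = k}) ` c ` I" and uv: "u : C" "v : C" for C u v
 proof -
  obtain k where "C = f ` {n : I. c n = k}" using C by auto
  then obtain m n where "m : I" "n : I" "c m = k" "c n = k" "u = f m" "v = f n" using uv by auto
  thus ?thesis using *[of m n] by simp
 qed
 ultimately show "EX \<C>. finite \<C> & f ` I <= \<Union>\<C> &
  (ALL C:\<C>. ALL u:C \<inter> f ` I. ALL v:C \<inter> f ` I. Lp_norm p N (%x. u x - v x) <= e)"
  by (intro exI[of _ "(%k. f ` {n : I. c n = k}) ` c ` I"] conjI ballI) blast+
qed

section \<open>Smooth functions of compact support\<close>

lemma C_k_SucI:
 assumes "!!x. (f has_derivative f' x) (at x)" "!!v. C_k k (%x. f' x v)"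
 shows "C_k (Suc k) f"
proof -
 have "fder f (at x) = f' x" for x
  using frechet_derivative_at[OF assms(1)] by simp
 thus ?thesis using assms by (auto simp: differentiable_def)
qed

lemma C_k_SucD:
 assumes "C_k (Suc k) f"
 shows "(f has_derivative fder f (at x)) (at x)" "C_k k (%x. fder f (at x) v)"
 using assms by (auto simp: frechet_derivative_works[symmetric])

lemma C_k_mono_Suc: "C_k (Suc k) f ==> C_k k f"
proof (induction k arbitrary: f)
 case 0
 thus ?case
  by (auto simp: continuous_on_eq_continuous_at intro: differentiable_imp_continuous_within)
next
 case (Suc k)
 thus ?case by (auto simp del: C_k.simps simp: C_k.simps(2)[of _ f])
qed

lemma C_k_mono: "C_k m f ==> k <= m ==> C_k k f"
proof (induction m)
 case (Suc m)
 show ?case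
 proof (cases "k = Suc m")
  case False
  thus ?thesis using Suc.IH[OF C_k_mono_Suc[OF Suc.prems(1)]] Suc.prems(2) by simp
 qed (use Suc.prems in simp)
qed simp

lemma C_k_continuous: "C_k k f ==> cts f"
 using C_k_mono[of k f 0] by simp

lemma C_k_const: "C_k k (%x. c)"
proof (induction k arbitrary: c)
 case (Suc k)
 thus ?case by (intro C_k_SucI[where f' = "%x v. 0"]) auto
qed simp

lemma C_k_add: "C_k k f ==> C_k k g ==> C_k k (%x. f x + g x)"
proof (induction k arbitrary: f g)
 case (Suc k)
 show ?case
  by (rule C_k_SucI) (rule has_derivative_add C_k_SucD Suc)+
qed (auto intro: continuous_on_add)

lemma C_k_bounded_linear_compose:
 assumes L: "bounded_linear L"
 shows "C_k k f ==> C_k k (%x. L (f x))"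
proof (induction k arbitrary: f)
 case (Suc k)
 show ?case
  by (rule C_k_SucI) (rule bounded_linear.has_derivative[OF L] C_k_SucD Suc)+
qed (auto intro: bounded_linear.continuous_on[OF L])

lemma C_k_affine_compose:
 assumes L: "bounded_linear L"
 shows "C_k k f ==> C_k k (%x. f (c + L x))"
proof (induction k arbitrary: f)
 case 0
 thus ?case
  by (auto intro!: continuous_on_compose2[of UNIV f] continuous_intros bounded_linear.continuous_on[OF L])
next
 case (Suc k)
 have "((%x. f (c + L x)) has_derivative (%v. fder f (at (c + L x)) (L v))) (at x)" for x
 proof -
  have 1: "((%x. c + L x) has_derivative L) (at x)"
  using bounded_linear.has_derivative[OF L has_derivative_ident] has_derivative_add[OF has_derivative_const]
  by fastforce
  show ?thesis using diff_chain_at[OF 1 C_k_SucD(1)[OF Suc.prems]] by (simp add: o_def)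
 qed
 thus ?case
  by (rule C_k_SucI) (rule Suc.IH C_k_SucD Suc.prems)+
qed

lemma C_k_mult:
 fixes f g :: "'a::euclidean_space => real"
 shows "C_k k f ==> C_k k g ==> C_k k (%x. f x * g x)"
proof (induction k arbitrary: f g)
 case (Suc k)
 show ?case
 proof (rule C_k_SucI)
  show "((%x. f x * g x) has_derivative (%v. f x * fder g (at x) v + fder f (at x) v * g x)) (at x)" for x
  by (rule has_derivative_mult[OF C_k_SucD(1)[OF Suc.prems(1)] C_k_SucD(1)[OF Suc.prems(2)]])
  show "C_k k (%x. f x * fder g (at x) v + fder f (at x) v * g x)" for v
  by (intro C_k_add Suc.IH C_k_SucD Suc.prems C_k_mono_Suc[OF Suc.prems(1)] C_k_mono_Suc[OF Suc.prems(2)])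
 qed
qed (auto intro: continuous_on_mult)

lemma C_k_cmult: "C_k k f ==> C_k k (%x. c * f x)" for f :: "'a::euclidean_space => real"
 by (intro C_k_mult C_k_const)

lemma C_k_prod:
 fixes f :: "'i => 'a::euclidean_space => real"
 assumes "finite I" "!!i. i : I ==> C_k k (f i)"
 shows "C_k k (%x. \<Prod>i\<in>I. f i x)"
 using assms by (induction I rule: finite_induct) (auto intro: C_k_const C_k_mult)

lemma C_k_antiderivative:
 fixes j J :: "real => real"
 assumes "C_k k j" "!!x. (J has_real_derivative j x) (at x)"
 shows "C_k (Suc k) J"
proof (rule C_k_SucI)
 show "(J has_derivative (%v. v * j x)) (at x)" for x
  by (rule has_derivative_eq_rhs[OF assms(2)[of x, unfolded has_field_derivative_def]]) (auto simp: fun_eq_iff)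
 show "C_k k (%x. v * j x)" for v by (rule C_k_cmult[OF assms(1)])
qed

lemma smooth_C_k: "smooth f ==> C_k k f" by (simp add: smooth_def)

lemma smooth_const: "smooth (%x. c)" by (simp add: smooth_def C_k_const)
lemma smooth_add: "smooth f ==> smooth g ==> smooth (%x. f x + g x)" by (simp add: smooth_def C_k_add)
lemma smooth_mult: "smooth f ==> smooth g ==> smooth (%x. f x * g x)" for f g :: "'a::euclidean_space => real"
 by (simp add: smooth_def C_k_mult)
lemma smooth_diff: "smooth f ==> smooth g ==> smooth (%x. f x - g x)" for f g :: "'a::euclidean_space => real"
 using smooth_add[of f "%x. (-1) * g x"] smooth_mult[OF smooth_const[of "-1"], of g] by simp
lemma smooth_prod:
 fixes f :: "'i => 'a::euclidean_space => real"
 shows "finite I ==> (!!i. i : I ==> smooth (f i)) ==> smooth (%x. \<Prod>i\<in>I. f i x)"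
 by (simp add: smooth_def C_k_prod)
lemma smooth_affine_compose: "bounded_linear L ==> smooth f ==> smooth (%x. f (c + L x))"
 by (simp add: smooth_def C_k_affine_compose)
lemma smooth_antiderivative:
 fixes j J :: "real => real"
 assumes "smooth j" "!!x. (J has_real_derivative j x) (at x)"
 shows "smooth J"
 using C_k_antiderivative[OF _ assms(2)] C_k_mono_Suc assms(1) unfolding smooth_def by blast

lemma smooth_has_derivative: "smooth f ==> (f has_derivative fder f (at x)) (at x)"
 using C_k_SucD(1)[OF smooth_C_k] .

lemma smooth_continuous: "smooth f ==> cts f"
 using C_k_continuous[OF smooth_C_k[of f 0]] .

lemma supp_subsetI: "closed S ==> (!!x. x ~: S ==> f x = 0) ==> supp f <= S"
 unfolding supp_def by (intro closure_minimal) auto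

lemma not_in_supp: "x ~: supp f ==> f x = 0"
 unfolding supp_def using closure_subset[of "{x. f x ~= 0}"] by auto

lemma closed_supp: "closed (supp f)" by (simp add: supp_def)

lemma compact_suppI:
 assumes "compact K" "!!x. x ~: K ==> f x = 0"
 shows "compact (supp f)" "supp f <= K"
proof -
 show "supp f <= K" by (intro supp_subsetI compact_imp_closed assms)
 thus "compact (supp f)" using compact_Int_closed[OF assms(1) closed_supp[of f]] by (simp add: Int_absorb1)
qed

lemma test_functionI:
 assumes "smooth ph" "compact K" "K <= Om" "!!x. x ~: K ==> ph x = 0"
 shows "ph : tests Om"
 using compact_suppI[of K ph] assms unfolding test_functions_def by auto

lemma frechet_derivative_outside_supp:
 assumes "x ~: supp f"
 shows "fder f (at x) v = 0"
proof -
 have "((%x. 0) has_derivative (%v. 0)) (at x)" by simp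
 hence "(f has_derivative (%v. 0)) (at x)"
  by (rule has_derivative_transform_within_open[of _ _ _ _ "- supp f"])
  (use assms closed_supp[of f] in \<open>auto simp: not_in_supp\<close>)
 thus ?thesis using frechet_derivative_at by metis
qed

section \<open>Bumps and cut-offs\<close>

definition unit_bump :: "(real => real) => bool" where
 "unit_bump j \<longleftrightarrow> smooth j & (ALL s. 0 <= j s) & (ALL s. 1 <= \<bar>s\<bar> --> j s = 0) & (LI s. j s) = 1"

text \<open>The kernel itself supplies the bump: along a line through the origin it is smooth with
  compact support, and radiality guarantees a point of the line where it does not vanish.\<close>

lemma unit_bump_exists:
 fixes rh :: "real^'d => real"
 assumes "!!x. 0 <= rh x" "smooth rh" "radial rh" "compact (supp rh)" "EX x. rh x ~= 0"
 obtains j where "unit_bump j"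
proof -
 obtain g where g: "!!x. rh x = g (norm x)" using assms(3) by (auto simp: radial_def)
 obtain x0 where x0: "rh x0 ~= 0" using assms(5) by blast
 obtain e :: "real^'d" where e: "norm e = 1" using vector_choose_size[of 1] by auto
 obtain R where R: "R > 0" "!!x. x : supp rh ==> norm x <= R"
  using compact_imp_bounded[OF assms(4)] by (auto simp: bounded_pos)
 \<comment> \<open>With \<open>R + 1\<close> in place of \<open>R\<close> the parameters |s| \<ge> 1
   lie strictly beyond the support radius.\<close>
 define h where "h s = rh (s *R ((R + 1) *R e))" for s
 have bl: "bounded_linear (%s. s *R ((R + 1) *R e))" by (rule bounded_linear_scaleR_left)
 have sh: "smooth h" unfolding h_def using smooth_affine_compose[OF bl assms(2), of 0] by simp
 have h0: "h s = 0" if "1 <= \<bar>s\<bar>" for s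
 proof (rule ccontr)
  assume "h s ~= 0"
  hence "norm (s *R ((R + 1) *R e)) <= R" using R not_in_supp unfolding h_def by blast
  moreover have "R + 1 <= norm (s *R ((R + 1) *R e))"
  using mult_right_mono[OF that, of "R + 1"] e R by (simp add: abs_mult)
  ultimately show False by linarith
 qed
 have hc: "cts h" by (rule smooth_continuous[OF sh])
 have hpos: "h (norm x0 / (R + 1)) > 0"
  using x0 assms(1)[of x0] e R unfolding h_def g by simp
 have hint: "intl h"
 proof -
  have "intl (%s. ind {-1..1} s *R h s)"
  by (rule borel_integrable_compact) (use hc continuous_on_subset in auto)
  moreover have "(%s. ind {-1..1} s *R h s) = h"
  proof (rule ext)
  fix s show "ind {-1..1} s *R h s = h s"
  using h0[of s] by (cases "s : {-1..1}") auto
  qed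
  ultimately show ?thesis by simp
 qed
 have hn: "0 <= h s" for s using assms(1) by (simp add: h_def)
 have I: "(LI s. h s) > 0"
 proof -
  have "(LI s. h s) ~= 0"
  proof
  assume "(LI s. h s) = 0"
  hence "AE s in lborel. h s = 0"
  using integral_nonneg_eq_0_iff_AE[OF hint] hn by simp
  hence "AE s in lborel. s ~: {s. h s > 0}" by eventually_elim simp
  moreover have op: "open {s. h s > 0}" using hc by (intro open_Collect_less) auto
  ultimately have "{s. h s > 0} : null_sets lborel"
  by (subst AE_iff_null_sets) auto
  hence "negligible {s. h s > 0}"
  unfolding negligible_iff_null_sets by (rule null_sets_completionI)
  hence "{s. h s > 0} = {}" using op open_not_negligible by auto
  thus False using hpos by blast
  qed
  moreover have "(LI s. h s) >= 0" using hn by simp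
  ultimately show ?thesis by simp
 qed
 define j where "j s = inverse (LI s. h s) * h s" for s
 have "smooth j" unfolding j_def by (intro smooth_mult smooth_const sh)
 moreover have "(LI s. j s) = 1" unfolding j_def using I by simp
 moreover have "0 <= j s" "1 <= \<bar>s\<bar> ==> j s = 0" for s
  using I hn h0 by (simp_all add: j_def)
 ultimately have "unit_bump j" by (simp add: unit_bump_def)
 thus ?thesis by (rule that)
qed

lemma unit_bump_integrable:
 assumes "unit_bump j" shows "intl j"
 using assms not_integrable_integral_eq[of lborel j] by (auto simp: unit_bump_def)

text \<open>A smooth cut-off from 0 to 1; for \<open>s < -1\<close> the interval is empty and the
  integral 0.\<close>

definition unit_step :: "(real => real) => real => real" where
 "unit_step j s = integral {-1..s} j"

lemma unit_step_derivative:
 assumes j: "unit_bump j"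
 shows "(unit_step j has_real_derivative j s) (at s)"
proof -
 have c: "continuous_on S j" for S
  using j smooth_continuous continuous_on_subset unfolding unit_bump_def by blast
 show ?thesis
 proof (cases "s > -1")
  case True
  have "((%u. integral {-1..u} j) has_real_derivative j s) (at s within {-1..s+1})"
  by (rule integral_has_real_derivative[OF c]) (use True in auto)
  hence "((%u. integral {-1..u} j) has_real_derivative j s) (at s within {-1<..<s+1})"
  by (rule DERIV_subset) auto
  hence "((%u. integral {-1..u} j) has_real_derivative j s) (at s)"
  using at_within_open[of s "{-1<..<s+1}"] True by simp
  thus ?thesis unfolding unit_step_def .
 next
  case False
  have z: "unit_step j u = 0" if "u <= -1" for u
  using that by (cases "u = -1") (auto simp: unit_step_def)
  show ?thesis
  proof (cases "s = -1")
  case False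
  hence "s < -1" using \<open>~ s > -1\<close> by simp
  have "((%u. 0) has_real_derivative 0) (at s)" by simp
  hence "(unit_step j has_real_derivative 0) (at s)"
  by (rule has_field_derivative_transform_within_open[of _ _ _ "{..<-1}"]) (use \<open>s < -1\<close> in \<open>auto simp: z\<close>)
  moreover have "j s = 0" using j \<open>s < -1\<close> by (auto simp: unit_bump_def)
  ultimately show ?thesis by simp
  next
  \<comment> \<open>At the left end point the integral from -1 gives only a one-sided derivative.
    Starting at -2, where \<open>j\<close> vanishes, gives the same function and a two-sided
    derivative.\<close>
  case True
  have "((%u. integral {-2..u} j) has_real_derivative j s) (at s within {-2..0})"
  by (rule integral_has_real_derivative[OF c]) (use True in auto)
  hence "((%u. integral {-2..u} j) has_real_derivative j s) (at s within {-2<..<0})"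
  by (rule DERIV_subset) auto
  hence d: "((%u. integral {-2..u} j) has_real_derivative j s) (at s)"
  using at_within_open[of s "{-2<..<0}"] True by simp
  have i0: "integral {-2..u} j = 0" if "u <= -1" for u
  proof -
  have "integral {-2..u} j = integral {-2..u} (%_. 0)"
  using j that by (intro integral_cong) (auto simp: unit_bump_def)
  thus ?thesis by simp
  qed
  have "integral {-2..u} j = unit_step j u" for u
  proof (cases "u <= -1")
  case False
  have "j integrable_on {-2..u}" by (rule integrable_continuous_real[OF c])
  from Henstock_Kurzweil_Integration.integral_combine[OF _ _ this, of "-1"] show ?thesis using False i0[of "-1"]
  by (simp add: unit_step_def)
  qed (simp add: i0 z)
  thus ?thesis using d by simp
  qed
 qed
qed

lemma unit_step_props:
 assumes j: "unit_bump j"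
 shows "smooth (unit_step j)" "s <= -1 ==> unit_step j s = 0" "1 <= s ==> unit_step j s = 1"
  "0 <= unit_step j s" "unit_step j s <= 1"
proof -
 show "smooth (unit_step j)"
  by (rule smooth_antiderivative[OF _ unit_step_derivative[OF j]]) (use j in \<open>simp add: unit_bump_def\<close>)
 show z: "unit_step j s = 0" if "s <= -1" for s
  using that by (cases "s = -1") (auto simp: unit_step_def)
 have mono: "unit_step j a <= unit_step j b" if "a <= b" for a b
  by (rule DERIV_nonneg_imp_nondecreasing[OF that])
  (use j unit_step_derivative[OF j] in \<open>auto simp: unit_bump_def\<close>)
 show one: "unit_step j s = 1" if "1 <= s" for s
 proof -
  have e: "(%x. ind {-1..s} x *R j x) = j"
  proof (rule ext)
  fix x
  show "ind {-1..s} x *R j x = j x"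
  proof (cases "x : {-1..s}")
  case False
  hence "1 <= \<bar>x\<bar>" using that by auto
  thus ?thesis using j by (simp add: unit_bump_def)
  qed simp
  qed
  have "set_integrable lborel {-1..s} j" using unit_bump_integrable[OF j] by (simp add: set_integrable_def e del: real_scaleR_def)
  from set_borel_integral_eq_integral(2)[OF this] show ?thesis
  using j by (simp add: set_lebesgue_integral_def e unit_step_def unit_bump_def del: real_scaleR_def)
 qed
 show "0 <= unit_step j s" using mono[of "min s (-1)" s] z[of "min s (-1)"] by simp
 show "unit_step j s <= 1" using mono[of s "max s 1"] one[of "max s 1"] by simp
qed

text \<open>A smooth approximation from inside to the indicator of the open box: each factor
  vanishes at its face and beyond, and is 1 at distance \<open>2 / n\<close> or more inside.\<close>

definition box_bump :: "(real => real) => 'a::euclidean_space => 'a => nat => 'a => real" where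
 "box_bump j a b n x = (\<Prod>i\<in>Basis. unit_step j (real n * (x \<bullet> i - a \<bullet> i) - 1) * unit_step j (real n * (b \<bullet> i - x \<bullet> i) - 1))"

lemma box_bump_props:
 fixes a b :: "'a::euclidean_space"
 assumes j: "unit_bump j"
 shows "smooth (box_bump j a b n)" "0 <= box_bump j a b n x" "box_bump j a b n x <= 1"
  "x ~: box a b ==> box_bump j a b n x = 0"
  "(%n. box_bump j a b n x) \<longlonglongrightarrow> ind (box a b) x"
proof -
 note u = unit_step_props[OF j]
 have s1: "smooth (%x. unit_step j ((- real n * (a \<bullet> i) - 1) + (real n *R x) \<bullet> i))" for i :: 'a
  by (rule smooth_affine_compose[OF _ u(1)]) (intro bounded_linear_inner_left_comp bounded_linear_scaleR_right)
 have s2: "smooth (%x. unit_step j ((real n * (b \<bullet> i) - 1) + ((- real n) *R x) \<bullet> i))" for i :: 'a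
  by (rule smooth_affine_compose[OF _ u(1)]) (intro bounded_linear_inner_left_comp bounded_linear_scaleR_right)
 show "smooth (box_bump j a b n)"
  unfolding box_bump_def[abs_def]
  using s1 s2 by (intro smooth_prod smooth_mult) (auto simp: algebra_simps)
 show "0 <= box_bump j a b n x" unfolding box_bump_def by (intro prod_nonneg mult_nonneg_nonneg u ballI)
 show "box_bump j a b n x <= 1" unfolding box_bump_def by (intro prod_le_1 conjI mult_nonneg_nonneg mult_le_one u)
 show z: "box_bump j a b n x = 0" if out: "x ~: box a b" for n
 proof -
  obtain i :: 'a where i: "i : Basis" "x \<bullet> i <= a \<bullet> i \<or> b \<bullet> i <= x \<bullet> i" using out by (auto simp: mem_box not_less)
  have "real n * (x \<bullet> i - a \<bullet> i) <= 0 \<or> real n * (b \<bullet> i - x \<bullet> i) <= 0"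
  using i(2) by (auto simp: mult_le_0_iff)
  thus ?thesis unfolding box_bump_def using i(1) u(2) by (intro prod_zero bexI[of _ i]) auto
 qed
 show "(%n. box_bump j a b n x) \<longlonglongrightarrow> ind (box a b) x"
 proof (cases "x : box a b")
  case True
  have ev: "\<forall>\<^sub>F n in sequentially. unit_step j (real n * r - 1) = 1" if "r > 0" for r
  proof -
  obtain N :: nat where N: "2 / r <= real N" using real_arch_simple by blast
  have "unit_step j (real n * r - 1) = 1" if "n >= N" for n
  proof (rule u(3))
  have "2 / r <= real n" using N that by linarith
  thus "1 <= real n * r - 1" using \<open>r > 0\<close> by (simp add: field_simps)
  qed
  thus ?thesis by (rule eventually_sequentiallyI)
  qed
  have "\<forall>\<^sub>F n in sequentially. ALL i:Basis. unit_step j (real n * (x \<bullet> i - a \<bullet> i) - 1) * unit_step j (real n * (b \<bullet> i - x \<bullet> i) - 1) = 1"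
  proof (intro eventually_ball_finite ballI finite_Basis)
  fix i :: 'a assume "i : Basis"
  hence "x \<bullet> i - a \<bullet> i > 0" "b \<bullet> i - x \<bullet> i > 0" using True by (auto simp: mem_box)
  from ev[OF this(1)] ev[OF this(2)]
  show "\<forall>\<^sub>F n in sequentially. unit_step j (real n * (x \<bullet> i - a \<bullet> i) - 1) * unit_step j (real n * (b \<bullet> i - x \<bullet> i) - 1) = 1"
  by eventually_elim simp
  qed
  hence "\<forall>\<^sub>F n in sequentially. box_bump j a b n x = 1"
  by eventually_elim (simp add: box_bump_def)
  thus ?thesis using True by (simp add: tendsto_eventually)
 next
  case False
  thus ?thesis using z by simp
 qed
qed

section \<open>Weak gradients\<close>

lemma AE_lebesgue_on_iff:
 fixes S :: "'a::euclidean_space set"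
 assumes "S : sets borel"
 shows "(AE x in leb S. P x) \<longleftrightarrow> (AE x in lborel. x : S --> P x)"
proof -
 have "S : sets lebesgue" using assms sets_completionI_sets by fastforce
 thus ?thesis by (simp add: AE_restrict_space_iff AE_completion_iff)
qed

lemma sets_lebesgue_borel: "S : sets borel ==> S : sets lebesgue"
 using sets_completionI_sets[of S lborel] by simp

lemma nn_integral_lebesgue_on:
 fixes S :: "'a::euclidean_space set"
 assumes "S : sets borel"
 shows "(\<integral>\<^sup>+x. f x \<partial>leb S) = (NI x. f x * ind S x)"
 using sets_lebesgue_borel[OF assms] by (simp add: nn_integral_restrict_space nn_integral_completion)

lemma borel_measurable_lebesgue_of_borel:
 "g : Bm ==> g : borel_measurable lebesgue"
 by (intro measurable_completion) simp

text \<open>The passage from completed measures to \<open>lborel\<close>: estimates are made for the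
  Borel function \<open>g\<close> and carried back to \<open>f\<close> by these three facts.\<close>

lemma lebesgue_on_AE_eq:
 fixes S :: "'a::euclidean_space set" and f g :: "'a => 'b::euclidean_space"
 assumes S: "S : sets borel" and g: "g : Bm"
  and ae: "AE x in lborel. x : S --> f x = g x"
 shows "f : borel_measurable (leb S)"
  "integral\<^sup>L (leb S) f = (LI x. ind S x *R g x)"
  "integrable (leb S) f \<longleftrightarrow> intl (%x. ind S x *R g x)"
proof -
 note S' = sets_lebesgue_borel[OF S]
 have gS: "(%x. ind S x *R g x) : Bm" using S g by simp
 have aeL: "AE x in lebesgue. ind S x *R g x = ind S x *R f x"
  by (rule AE_completion) (use ae in \<open>eventually_elim, auto simp: indicator_def\<close>)
 have m1: "(%x. ind S x *R f x) : borel_measurable lebesgue"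
  by (rule borel_measurable_AE[OF borel_measurable_lebesgue_of_borel[OF gS] aeL])
 have mg: "(%x. ind S x *R g x) : borel_measurable lebesgue"
  by (rule borel_measurable_lebesgue_of_borel[OF gS])
 have aeL': "AE x in lebesgue. ind S x *R f x = ind S x *R g x"
  using aeL by eventually_elim (rule sym)
 show "f : borel_measurable (leb S)"
  using m1 S' by (simp add: borel_measurable_restrict_space_iff)
 have "integral\<^sup>L (leb S) f = (\<integral>x. ind S x *R f x \<partial>lebesgue)"
  using S' by (simp add: integral_restrict_space)
 also have "... = (\<integral>x. ind S x *R g x \<partial>lebesgue)"
  by (rule integral_cong_AE[OF m1 mg aeL'])
 also have "... = (LI x. ind S x *R g x)"
  using gS by (intro integral_completion) simp
 finally show "integral\<^sup>L (leb S) f = (LI x. ind S x *R g x)" .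
 have "integrable (leb S) f \<longleftrightarrow> integrable lebesgue (%x. ind S x *R f x)"
  using S' by (simp add: integrable_restrict_space)
 also have "... \<longleftrightarrow> integrable lebesgue (%x. ind S x *R g x)"
  by (rule integrable_cong_AE[OF m1 mg aeL'])
 also have "... \<longleftrightarrow> intl (%x. ind S x *R g x)"
  using gS by (intro integrable_completion) simp
 finally show "integrable (leb S) f \<longleftrightarrow> intl (%x. ind S x *R g x)" .
qed

text \<open>Vanishing off \<open>S\<close> lets integrals over \<open>S\<close> be written over the
  whole space.\<close>

lemma borel_representative_real:
 fixes S :: "'a::euclidean_space set" and f :: "'a => real"
 assumes S: "S : sets borel" and f: "f : borel_measurable (leb S)"
 obtains g where "g : Bm" "!!x. x ~: S ==> g x = 0"
  "AE x in lborel. x : S --> f x = g x"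
proof -
 have "(%x. ind S x *R f x) : borel_measurable lebesgue"
  using f sets_lebesgue_borel[OF S] by (simp add: borel_measurable_restrict_space_iff)
 then obtain g where g: "g : borel_measurable lborel" "AE x in lborel. ind S x *R f x = g x"
  using completion_ex_borel_measurable_real[of "%x. ind S x *R f x" lborel] by auto
 show ?thesis
 proof (rule that[of "%x. ind S x * g x"])
  show "AE x in lborel. x : S --> f x = ind S x * g x"
  using g(2) by eventually_elim auto
 qed (use g S in auto)
qed

section \<open>The fundamental lemma of the calculus of variations\<close>

text \<open>The positive and the negative part of \<open>v\<close> define measures that agree on
  boxes, a generator stable under intersection; so the measures coincide, and so do their
  densities.\<close>

lemma AE_zero_box_integrals:
 fixes v :: "'a::euclidean_space => real"
 assumes v: "intl v" and z: "!!a b. (LI x. ind (box a b) x * v x) = 0"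
 shows "AE x in lborel. v x = 0"
proof -
 have [measurable]: "v : Bm" using v by auto
 define M where "M = density lborel (%x. en (v x))"
 define N where "N = density lborel (%x. en (- v x))"
 have fin: "(NI x. en (w x)) < \<infinity>" if "intl w" for w :: "'a => real"
 proof -
  have "(NI x. en (w x)) <= (NI x. en (norm (w x)))"
  by (intro nn_integral_mono ennreal_leI) auto
  also have "... < \<infinity>" using that by (simp add: integrable_iff_bounded)
  finally show ?thesis .
 qed
 have eq: "emeasure M (box a b) = emeasure N (box a b)" and finM: "emeasure M (box a b) ~= \<infinity>" for a b
 proof -
  define w where "w x = ind (box a b) x * v x" for x
  have w: "intl w" unfolding w_def
  using integrable_mult_indicator[OF _ v, of "box a b"] by simp
  hence w': "intl (%x. - w x)" by simp
  have M: "emeasure M (box a b) = (NI x. en (w x))"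
  unfolding M_def by (subst emeasure_density) (auto intro!: nn_integral_cong simp: w_def indicator_def)
  have N: "emeasure N (box a b) = (NI x. en (- w x))"
  unfolding N_def by (subst emeasure_density) (auto intro!: nn_integral_cong simp: w_def indicator_def)
  have "integral\<^sup>L lborel w = 0" using z[of a b] by (simp add: w_def[abs_def])
  hence "enn2real (NI x. en (w x)) = enn2real (NI x. en (- w x))"
  using real_lebesgue_integral_def[OF w] by simp
  thus "emeasure M (box a b) = emeasure N (box a b)"
  unfolding M N using fin[OF w] fin[OF w'] by (metis ennreal_enn2real infinity_ennreal_def)
  show "emeasure M (box a b) ~= \<infinity>" unfolding M using fin[OF w] by simp
 qed
 have "M = N"
 proof (rule measure_eqI_generator_eq[where E = "range (%(a, b). box a b)" and \<Omega> = UNIV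
  and A = "%n. box (- (real n *R One)) (real n *R One)"])
  show "Int_stable (range (%(a, b). box a b :: 'a set))"
  by (auto simp: Int_stable_def box_Int_box)
  show "sets M = sigma_sets UNIV (range (%(a, b). box a b))" "sets N = sigma_sets UNIV (range (%(a, b). box a b))"
  by (simp_all add: M_def N_def borel_eq_box)
  show "(\<Union>n. box (- (real n *R One)) (real n *R One)) = (UNIV :: 'a set)"
  by (rule UN_box_eq_UNIV)
 qed (use eq finM in auto)
 hence "AE x in lborel. en (v x) = en (- v x)"
  unfolding M_def N_def
  by (intro finite_density_unique[THEN iffD1, rotated 5]) (use fin[OF v] in auto)
 thus ?thesis
 proof eventually_elim
  case (elim x)
  show ?case
  proof (cases "0 <= v x")
  case True
  hence "en (v x) = 0" using elim by (simp add: ennreal_neg)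
  thus ?thesis using True by (simp add: ennreal_eq_0_iff)
  next
  case False
  hence "en (- v x) = 0" using elim by (simp add: ennreal_neg)
  thus ?thesis using False by (simp add: ennreal_eq_0_iff)
  qed
 qed
qed

lemma integrable_lebesgue_on_times_support:
 fixes u :: "'a::euclidean_space => 'b::euclidean_space" and ph :: "'a => real"
 assumes u: "locally_integrable_on Om u" and Om: "open Om" and ph: "cts ph"
  and K: "compact K" "K <= Om" and K0: "!!x. x ~: K ==> ph x = 0"
 shows "integrable (leb Om) (%x. ph x *R u x)"
proof -
 have uK: "integrable (leb K) u" using u K by (simp add: locally_integrable_on_def)
 have Kb: "K : sets lebesgue" "Om : sets lebesgue"
  using sets_lebesgue_borel[OF borel_compact[OF K(1)]] sets_lebesgue_borel[OF borel_open[OF Om]] by simp_all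
 have iK: "integrable lebesgue (%x. ind K x *R u x)"
  using uK Kb by (simp add: integrable_restrict_space)
 obtain B where B: "!!x. x : K ==> norm (ph x) <= B"
  using compact_imp_bounded[OF compact_continuous_image[OF continuous_on_subset[OF ph] K(1)]]
  by (auto simp: bounded_iff)
 have "integrable lebesgue (%x. ph x *R (ind K x *R u x))"
 proof (rule lint_bound[where f = "%x. B *R (ind K x *R u x)"])
  show "integrable lebesgue (%x. B *R (ind K x *R u x))" by (rule integrable_scaleR_right) (rule iK)
  have "ph : Bm" using ph by (rule bm_contI)
  thus "(%x. ph x *R (ind K x *R u x)) : borel_measurable lebesgue"
  by (intro borel_measurable_scaleR borel_measurable_integrable[OF iK] borel_measurable_lebesgue_of_borel)
  show "AE x in lebesgue. norm (ph x *R (ind K x *R u x)) <= norm (B *R (ind K x *R u x))"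
  proof (rule AE_I2)
  fix x
  show "norm (ph x *R (ind K x *R u x)) <= norm (B *R (ind K x *R u x))"
  using B[of x] by (cases "x : K") (auto intro!: mult_right_mono)
  qed
 qed
 moreover have "ph x *R (ind K x *R u x) = ind Om x *R (ph x *R u x)" for x
  using K(2) K0[of x] by (cases "x : K") (auto simp: subset_iff)
 ultimately have "integrable lebesgue (%x. ind Om x *R (ph x *R u x))" by (simp only:)
 thus ?thesis using Kb(2) integrable_restrict_space[of Om lebesgue "%x. ph x *R u x"] by simp
qed

text \<open>Dominated convergence along \<open>box_bump\<close> gives vanishing integrals over boxes
  compactly inside the domain, hence \<open>u = 0\<close> almost everywhere there; countably many
  such boxes cover the domain.\<close>

lemma fundamental_lemma:
 fixes u :: "'a::euclidean_space => real"
 assumes j: "unit_bump j" and Om: "open Om" and u: "locally_integrable_on Om u"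
  and z: "!!ph. ph : tests Om ==> (\<integral>x. u x * ph x \<partial>leb Om) = 0"
 shows "AE x in leb Om. u x = 0"
proof -
 have Omb: "Om : sets borel" using Om by simp
 have box_case: "AE x in lborel. x : box a b --> u x = 0" if ab: "cbox a b <= Om" for a b
 proof -
  have Kb: "cbox a b : sets borel" by simp
  have uK: "integrable (leb (cbox a b)) u"
  using u ab by (simp add: locally_integrable_on_def)
  obtain g where g[measurable]: "g : Bm" and g0: "!!x. x ~: cbox a b ==> g x = 0"
  and ae: "AE x in lborel. x : cbox a b --> u x = g x"
  using borel_representative_real[OF Kb borel_measurable_integrable[OF uK]] by blast
  have gg: "(%x. ind (cbox a b) x *R g x) = g" using g0 by (auto simp: indicator_def fun_eq_iff)
  have gi: "intl g"
  using uK lebesgue_on_AE_eq(3)[OF Kb g ae] unfolding gg by simp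
  have key: "(LI x. ind (box c d) x * g x) = 0" if cd: "cbox c d <= cbox a b" for c d
  proof -
  have bump: "(LI x. box_bump j c d n x * g x) = 0" for n
  proof -
  have bm[measurable]: "box_bump j c d n : Bm"
  by (intro bm_contI smooth_continuous box_bump_props(1)[OF j])
  have "box_bump j c d n : tests Om"
  proof (rule test_functionI[OF box_bump_props(1)[OF j], of "cbox c d"])
  show "box_bump j c d n x = 0" if "x ~: cbox c d" for x
  by (rule box_bump_props(4)[OF j]) (use that box_subset_cbox[of c d] in auto)
  qed (use cd ab in auto)
  hence "0 = (\<integral>x. u x * box_bump j c d n x \<partial>leb Om)" by (rule z[symmetric])
  also have "... = (LI x. ind Om x *R (g x * box_bump j c d n x))"
  proof (rule lebesgue_on_AE_eq(2)[OF Omb])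
  show "AE x in lborel. x : Om --> u x * box_bump j c d n x = g x * box_bump j c d n x"
  using ae
  proof eventually_elim
  case (elim x)
  show ?case
  proof (cases "x : box c d")
  case True
  hence "x : cbox a b" using cd box_subset_cbox[of c d] by auto
  thus ?thesis using elim by simp
  qed (simp add: box_bump_props(4)[OF j])
  qed
  qed simp
  also have "... = (LI x. box_bump j c d n x * g x)"
  using g0 ab by (intro lint_cong) (auto simp: indicator_def)
  finally show ?thesis by simp
  qed
  have "(%n. (LI x. box_bump j c d n x * g x)) \<longlonglongrightarrow> (LI x. ind (box c d) x * g x)"
  proof (rule integral_dominated_convergence[where w = "%x. norm (g x)"])
  show "(%x. box_bump j c d n x * g x) : borel_measurable lborel" for n
  using smooth_continuous[OF box_bump_props(1)[OF j]]
  by (intro borel_measurable_times) (auto intro: bm_contI)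
  show "AE x in lborel. (%n. box_bump j c d n x * g x) \<longlonglongrightarrow> ind (box c d) x * g x"
  by (intro AE_I2 tendsto_mult box_bump_props(5)[OF j] tendsto_const)
  show "AE x in lborel. norm (box_bump j c d n x * g x) <= norm (g x)" for n
  by (intro AE_I2) (auto simp: abs_mult abs_of_nonneg[OF box_bump_props(2)[OF j]] box_bump_props(2,3)[OF j] intro!: mult_left_le_one_le)
  qed (use gi in auto)
  thus ?thesis by (simp add: bump LIMSEQ_const_iff)
  qed
  have "AE x in lborel. ind (box a b) x * g x = 0"
  proof (rule AE_zero_box_integrals)
  show "intl (%x. ind (box a b) x * g x)"
  using integrable_mult_indicator[OF _ gi, of "box a b"] by simp
  fix c d
  \<comment> \<open>Boxes intersect in boxes, so the truncation to \<open>box a b\<close> again has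
    vanishing integrals over all boxes.\<close>
  obtain c' d' where cd: "box c d \<inter> box a b = box c' d'" by (rule that[OF box_Int_box])
  show "(LI x. ind (box c d) x * (ind (box a b) x * g x)) = 0"
  proof (cases "box c' d' = {}")
  case True
  hence "ind (box c d) x * (ind (box a b) x * g x) = 0" for x
  using cd by (auto simp: indicator_def)
  thus ?thesis by (intro integral_eq_zero_AE AE_I2)
  next
  case False
  have "box c' d' <= cbox a b" using cd box_subset_cbox[of a b] by blast
  hence "cbox c' d' <= cbox a b" using False
  by (metis closed_cbox closure_box closure_minimal)
  moreover have "ind (box c d) x * (ind (box a b) x * g x) = ind (box c' d') x * g x" for x
  unfolding cd[symmetric] by (simp add: indicator_inter_arith)
  ultimately show ?thesis using key[of c' d'] by (simp only:)
  qed
  qed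
  with ae show ?thesis
  proof eventually_elim
  case (elim x)
  thus ?case using box_subset_cbox[of a b] by (auto simp: indicator_def split: if_splits)
  qed
 qed
 obtain D where D: "countable D" "D <= Pow Om" "!!X. X : D ==> EX a b. X = cbox a b" "\<Union>D = Om"
  using open_countable_Union_open_cbox[OF Om] by metis
 have "AE x in lborel. ALL X:D. x : X --> u x = 0"
 proof (rule AE_ball_countable[THEN iffD2, OF _ ballI])
  fix X assume X: "X : D"
  obtain a b where ab: "X = cbox a b" using D(3)[OF X] by blast
  \<comment> \<open>The cover consists of closed boxes while \<open>box_case\<close> treats open
    ones; the faces are null.\<close>
  have "cbox a b - box a b : null_sets lborel"
  by (simp add: null_sets_def emeasure_Diff box_subset_cbox emeasure_lborel_cbox_eq emeasure_lborel_box_eq)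
  hence "AE x in lborel. x ~: cbox a b - box a b" by (rule AE_not_in)
  moreover have "AE x in lborel. x : box a b --> u x = 0"
  using D(2) X ab by (intro box_case) auto
  ultimately show "AE x in lborel. x : X --> u x = 0"
  by eventually_elim (use ab in auto)
 qed (rule D(1))
 thus ?thesis
  unfolding AE_lebesgue_on_iff[OF Omb] by eventually_elim (use D(4) in blast)
qed

section \<open>Uniqueness, linearity and measurability of weak gradients\<close>

lemma locally_integrable_on_component:
 fixes G :: "real^'d => real^'d"
 assumes "locally_integrable_on Om G" shows "locally_integrable_on Om (%x. G x $ i)"
 using assms unfolding locally_integrable_on_def
 by (auto intro!: integrable_bounded_linear[OF bounded_linear_vec_nth])

lemma locally_integrable_on_lincomb:
 assumes "locally_integrable_on Om u" "locally_integrable_on Om v"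
 shows "locally_integrable_on Om (%x. a *R u x + b *R v x)"
 using assms unfolding locally_integrable_on_def by auto

lemma test_function_times_integrable:
 fixes u :: "'a::euclidean_space => real"
 assumes "open Om" "locally_integrable_on Om u" "ph : tests Om"
 shows "integrable (leb Om) (%x. u x * ph x)"
  "integrable (leb Om) (%x. u x * fder ph (at x) v)"
proof -
 have ph: "smooth ph" "compact (supp ph)" "supp ph <= Om" using assms(3) by (auto simp: test_functions_def)
 show "integrable (leb Om) (%x. u x * ph x)"
  using integrable_lebesgue_on_times_support[OF assms(2,1) smooth_continuous[OF ph(1)] ph(2,3) not_in_supp[of _ ph]]
  by (simp add: mult.commute)
 have "cts (%x. fder ph (at x) v)"
  using C_k_SucD(2)[OF smooth_C_k[OF ph(1)]] C_k_continuous by blast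
 from integrable_lebesgue_on_times_support[OF assms(2,1) this ph(2,3) frechet_derivative_outside_supp[of _ ph v]]
 show "integrable (leb Om) (%x. u x * fder ph (at x) v)"
  by (simp add: mult.commute)
qed

lemma has_weak_gradient_unique:
 fixes u :: "real^'d => real"
 assumes j: "unit_bump j" and Om: "open Om"
  and G: "has_weak_gradient Om u G" and H: "has_weak_gradient Om u H"
 shows "AE x in leb Om. G x = H x"
proof -
 have lG: "locally_integrable_on Om (%x. G x $ i)" and lH: "locally_integrable_on Om (%x. H x $ i)" for i
  using G H by (auto simp: has_weak_gradient_def intro: locally_integrable_on_component)
 have "AE x in leb Om. 1 *R G x $ i + (-1) *R H x $ i = 0" for i
 proof (rule fundamental_lemma[OF j Om locally_integrable_on_lincomb[OF lG lH]])
  fix ph assume ph: "ph : tests Om"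
  have "(\<integral>x. (1 *R G x $ i + (-1) *R H x $ i) * ph x \<partial>leb Om)
  = (\<integral>x. G x $ i * ph x - H x $ i * ph x \<partial>leb Om)"
  by (simp add: algebra_simps)
  also have "... = (\<integral>x. G x $ i * ph x \<partial>leb Om) - (\<integral>x. H x $ i * ph x \<partial>leb Om)"
  using test_function_times_integrable(1)[OF Om lG ph] test_function_times_integrable(1)[OF Om lH ph] by simp
  also have "... = 0"
  proof -
  have "(\<integral>x. u x * fder ph (at x) (axis i 1) \<partial>leb Om) = - (\<integral>x. F x $ i * ph x \<partial>leb Om)"
  if "has_weak_gradient Om u F" for F using that ph unfolding has_weak_gradient_def by simp
  from this[OF G] this[OF H] show ?thesis by simp
  qed
  finally show "(\<integral>x. (1 *R G x $ i + (-1) *R H x $ i) * ph x \<partial>leb Om) = 0" .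
 qed
 hence "AE x in leb Om. ALL i:UNIV. 1 *R G x $ i + (-1) *R H x $ i = 0"
  by (intro AE_ball_countable[THEN iffD2]) (auto intro: countable_finite)
 thus ?thesis by eventually_elim (simp add: vec_eq_iff)
qed

lemma has_weak_gradient_lincomb:
 fixes u v :: "real^'d => real"
 assumes Om: "open Om" and G: "has_weak_gradient Om u G" and H: "has_weak_gradient Om v H"
 shows "has_weak_gradient Om (%x. a * u x + b * v x) (%x. a *R G x + b *R H x)"
 unfolding has_weak_gradient_def
proof (intro conjI ballI allI)
 have lu: "locally_integrable_on Om u" and lv: "locally_integrable_on Om v"
  and lG: "locally_integrable_on Om G" and lH: "locally_integrable_on Om H"
  using G H by (auto simp: has_weak_gradient_def)
 show "locally_integrable_on Om (%x. a * u x + b * v x)"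
  using locally_integrable_on_lincomb[OF lu lv, of a b] by simp
 show "locally_integrable_on Om (%x. a *R G x + b *R H x)"
  by (rule locally_integrable_on_lincomb[OF lG lH])
 fix ph i assume ph: "ph : tests Om"
 let ?d = "%x. fder ph (at x) (axis i 1)"
 note t = test_function_times_integrable[OF Om _ ph]
 have "(\<integral>x. (a * u x + b * v x) * ?d x \<partial>leb Om)
  = (\<integral>x. a * (u x * ?d x) + b * (v x * ?d x) \<partial>leb Om)" by (simp add: algebra_simps)
 also have "... = a * (\<integral>x. u x * ?d x \<partial>leb Om) + b * (\<integral>x. v x * ?d x \<partial>leb Om)"
  using t(2)[OF lu] t(2)[OF lv] by simp
 also have "... = a * - (\<integral>x. G x $ i * ph x \<partial>leb Om) + b * - (\<integral>x. H x $ i * ph x \<partial>leb Om)"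
  using G H ph by (simp add: has_weak_gradient_def)
 also have "... = - (\<integral>x. a * (G x $ i * ph x) + b * (H x $ i * ph x) \<partial>leb Om)"
  using t(1)[OF locally_integrable_on_component[OF lG]] t(1)[OF locally_integrable_on_component[OF lH]] by simp
 finally show "(\<integral>x. (a * u x + b * v x) * ?d x \<partial>leb Om)
  = - (\<integral>x. (a *R G x + b *R H x) $ i * ph x \<partial>leb Om)" by (simp add: algebra_simps)
qed

text \<open>Local integrability yields measurability on compact sets only; preimages are glued over
  a countable cover by closed boxes.\<close>

lemma has_weak_gradient_measurable:
 fixes G :: "real^'d => real^'d"
 assumes "open Om" "has_weak_gradient Om u G"
 shows "G : borel_measurable (leb Om)"
proof -
 obtain D where D: "countable D" "D <= Pow Om" "!!X. X : D ==> EX a b. X = cbox a b" "\<Union>D = Om"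
  using open_countable_Union_open_cbox[OF assms(1)] by metis
 show ?thesis
 proof (rule measurableI)
  fix B :: "(real^'d) set" assume B: "B : sets borel"
  have "G -` B \<inter> X : sets lebesgue" if X: "X : D" for X
  proof -
  obtain a b where ab: "X = cbox a b" using D(3)[OF X] by blast
  have "integrable (leb X) G"
  using assms(2) D(2) X ab unfolding has_weak_gradient_def locally_integrable_on_def by auto
  hence "G : borel_measurable (leb X)" by (rule borel_measurable_integrable)
  from measurable_sets[OF this B] have "G -` B \<inter> X : sets (leb X)" by simp
  thus ?thesis using ab by (subst (asm) sets_restrict_space_iff) (auto intro: sets_lebesgue_borel)
  qed
  hence "(\<Union>X\<in>D. G -` B \<inter> X) : sets lebesgue" using D(1) by (intro sets.countable_UN') auto
  moreover have "(\<Union>X\<in>D. G -` B \<inter> X) = G -` B \<inter> Om" using D(4) by blast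
  ultimately show "G -` B \<inter> space (leb Om) : sets (leb Om)"
  using assms(1) by (subst sets_restrict_space_iff) (auto intro: sets_lebesgue_borel)
 qed simp
qed

text \<open>Uniqueness almost everywhere replaces the gradient chosen by
  \<open>weak_gradient\<close> with any available one.\<close>

lemma W1_norm_powr:
 fixes u :: "real^'d => real"
 assumes j: "unit_bump j" and Om: "open Om" and p: "1 <= p"
  and G: "has_weak_gradient Om u G"
 shows "W1_norm p Om u powr p =
  (\<integral>x. \<bar>u x\<bar> powr p \<partial>leb Om) + (\<integral>x. norm (G x) powr p \<partial>leb Om)"
proof -
 have W: "has_weak_gradient Om u (weak_gradient Om u)"
  unfolding weak_gradient_def by (rule someI[where P = "has_weak_gradient Om u", OF G])
 have m[measurable]: "weak_gradient Om u : borel_measurable (leb Om)" "G : borel_measurable (leb Om)"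
  using has_weak_gradient_measurable[OF Om] W G by auto
 have "(\<integral>x. norm (weak_gradient Om u x) powr p \<partial>leb Om) = (\<integral>x. norm (G x) powr p \<partial>leb Om)"
 proof (rule integral_cong_AE)
  show "AE x in leb Om. norm (weak_gradient Om u x) powr p = norm (G x) powr p"
  using has_weak_gradient_unique[OF j Om W G] by eventually_elim simp
 qed measurable
 thus ?thesis using p unfolding W1_norm_def by (simp add: powr_powr)
qed

section \<open>Density and separability\<close>

lemma uniformly_continuous_bounded_support:
 fixes ph :: "'a::euclidean_space => 'b::euclidean_space"
 assumes c: "cts ph" and r: "!!x. r < norm x ==> ph x = 0" and e: "0 < e"
 obtains d where "0 < d" "!!x y. dist x y < d ==> dist (ph x) (ph y) < e"
proof -
 have "uniformly_continuous_on (cball 0 (r + 1)) ph"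
  by (intro compact_uniformly_continuous continuous_on_subset[OF c]) auto
 then obtain d where d: "0 < d" "!!x y. x : cball 0 (r + 1) ==> y : cball 0 (r + 1) ==> dist y x < d ==> dist (ph y) (ph x) < e"
  unfolding uniformly_continuous_on_def using e by meson
 show ?thesis
 proof (rule that[of "min d 1"])
  fix x y :: 'a assume xy: "dist x y < min d 1"
  have n: "norm x <= norm y + dist x y" "norm y <= norm x + dist x y"
  using norm_triangle_ineq2[of x y] norm_triangle_ineq2[of y x] by (auto simp: dist_norm norm_minus_commute)
  show "dist (ph x) (ph y) < e"
  proof (cases "norm x <= r + 1 & norm y <= r + 1")
  case True
  thus ?thesis using d(2)[of y x] xy by simp
  next
  case False
  hence "r < norm x" "r < norm y" using n xy by auto
  thus ?thesis using r e by simp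
  qed
 qed (use d in auto)
qed

text \<open>A separability argument that stays inside the family: members are coded by support
  radius, modulus of continuity and approximate values on a finite net, and one member is chosen for
  each code that occurs. The radius \<open>r\<close> does not depend on \<open>e\<close>, because
  the functions are later integrated against merely locally integrable ones.\<close>

lemma countable_uniformly_dense:
 fixes Ph :: "'i => 'a::euclidean_space => 'b::euclidean_space"
 assumes c: "!!i. i : S ==> cts (Ph i)"
  and b: "!!i. i : S ==> EX r. ALL x. r < norm x --> Ph i x = 0"
 obtains S' where "countable S'" "S' <= S"
  "!!i. i : S ==> EX r. ALL e>0. EX j:S'. (ALL x. dist (Ph i x) (Ph j x) < e) & (ALL x. r < norm x --> Ph i x = 0 & Ph j x = 0)"
proof -
 obtain D :: "'b set" where D: "countable D" "!!U. open U ==> U ~= {} ==> EX d:D. d : U"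
  using countable_dense_exists by metis
 have Dn: "EX d:D. dist y d < e" if "0 < e" for y and e :: real
  using D(2)[of "ball y e"] that by (auto simp: ball_eq_empty)
 have "EX xs. cball (0::'a) (real N) <= (\<Union>x\<in>set xs. ball x (1 / real (Suc k)))" for N k
 proof -
  have "compact (cball (0::'a) (real N))" by simp
  then obtain F where "finite F" "cball (0::'a) (real N) <= (\<Union>x\<in>F. ball x (1 / real (Suc k)))"
  using seq_compact_imp_totally_bounded[of "cball (0::'a) (real N)"] compact_imp_seq_compact
  by (metis of_nat_0_less_iff zero_less_Suc zero_less_divide_1_iff)
  moreover then obtain xs where "set xs = F" using finite_list by blast
  ultimately show ?thesis by auto
 qed
 then obtain xs where xs: "!!N k. cball (0::'a) (real N) <= (\<Union>x\<in>set (xs N k). ball x (1 / real (Suc k)))"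
  by metis
 \<comment> \<open>The code consists of the radius \<open>N\<close>, the mesh 1 / (k + 1), the
   accuracy 1 / (m + 1) and the values \<open>ys\<close> at the net points, taken from a countable
   dense set.\<close>
 define P where "P i cd \<longleftrightarrow> (case cd of (N, k, m, ys) => length ys = length (xs N k) &
  (ALL q<length ys. dist (Ph i (xs N k ! q)) (ys ! q) < 1 / real (Suc m)) &
  (ALL x. real N < norm x --> Ph i x = 0) &
  (ALL x y. dist x y < 1 / real (Suc k) --> dist (Ph i x) (Ph i y) < 1 / real (Suc m)))"
  for i and cd :: "nat \<times> nat \<times> nat \<times> 'b list"
 define Cd where "Cd = {cd : (UNIV :: nat set) \<times> (UNIV :: nat set) \<times> (UNIV :: nat set) \<times> lists D. EX i:S. P i cd}"
 define ch where "ch cd = (SOME i. i : S & P i cd)" for cd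
 have ch: "ch cd : S" "P (ch cd) cd" if "cd : Cd" for cd
  using that someI_ex[of "%i. i : S & P i cd"] unfolding Cd_def ch_def by auto
 show ?thesis
 proof (rule that[of "ch ` Cd"])
  show "countable (ch ` Cd)"
  unfolding Cd_def using D(1) by (intro countable_image countable_Collect countable_SIGMA countable_lists) auto
  show "ch ` Cd <= S" using ch by auto
  fix i assume i: "i : S"
  obtain r where r: "!!x. r < norm x ==> Ph i x = 0" using b[OF i] by blast
  obtain N :: nat where N: "r <= real N" using real_arch_simple by blast
  have "EX j:ch ` Cd. (ALL x. dist (Ph i x) (Ph j x) < e) & (ALL x. real N < norm x --> Ph i x = 0 & Ph j x = 0)"
  if e: "0 < e" for e
  proof -
  \<comment> \<open>Two members with the same code differ by at most two oscillations and two
    sampling errors, whence the quarter.\<close>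
  obtain m where m: "1 / real (Suc m) < e / 4" using nat_approx_posE[of "e / 4"] e by auto
  obtain d where d: "0 < d" "!!x y. dist x y < d ==> dist (Ph i x) (Ph i y) < 1 / real (Suc m)"
  by (rule uniformly_continuous_bounded_support[OF c[OF i], of r "1 / real (Suc m)"]) (use r that in auto)
  obtain k where k: "1 / real (Suc k) < d" using nat_approx_posE[OF d(1)] by auto
  have "ALL x. EX d. d : D & dist (Ph i x) d < 1 / real (Suc m)"
  using Dn[of "1 / real (Suc m)"] by (simp add: Bex_def)
  from choice[OF this] obtain y where y: "ALL x. y x : D & dist (Ph i x) (y x) < 1 / real (Suc m)"
  by (elim exE)
  define cd where "cd = (N, k, m, map y (xs N k))"
  have Pi: "P i cd" unfolding P_def cd_def using y r N d(2) k by auto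
  hence cd: "cd : Cd" unfolding Cd_def using i y by (auto simp: cd_def)
  define j where "j = ch cd"
  have Pj: "P j cd" using ch(2)[OF cd] by (simp add: j_def)
  have z: "Ph i x = 0 & Ph j x = 0" if "real N < norm x" for x
  using Pi Pj that by (simp add: P_def cd_def)
  have "dist (Ph i x) (Ph j x) < e" for x
  proof (cases "real N < norm x")
  case False
  then obtain q where q: "q < length (xs N k)" "dist (xs N k ! q) x < 1 / real (Suc k)"
  using xs[of N k] by (force simp: in_set_conv_nth subset_iff)
  have "dist (Ph i x) (Ph i (xs N k ! q)) < 1 / real (Suc m)" "dist (Ph i (xs N k ! q)) (y (xs N k ! q)) < 1 / real (Suc m)"
  "dist (Ph j (xs N k ! q)) (y (xs N k ! q)) < 1 / real (Suc m)" "dist (Ph j x) (Ph j (xs N k ! q)) < 1 / real (Suc m)"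
  using Pi Pj q by (auto simp: P_def cd_def dist_commute)
  moreover have "dist (Ph i x) (Ph j x) <= dist (Ph i x) (Ph i (xs N k ! q)) + dist (Ph i (xs N k ! q)) (y (xs N k ! q))
  + dist (Ph j (xs N k ! q)) (y (xs N k ! q)) + dist (Ph j x) (Ph j (xs N k ! q))"
  using dist_triangle[of "Ph i x" "Ph j x" "Ph i (xs N k ! q)"] dist_triangle[of "Ph i (xs N k ! q)" "Ph j x" "y (xs N k ! q)"]
  dist_triangle[of "y (xs N k ! q)" "Ph j x" "Ph j (xs N k ! q)"] by (simp add: dist_commute)
  ultimately show ?thesis using m by linarith
  qed (use z[of x] e in auto)
  thus ?thesis using z cd unfolding j_def by blast
  qed
  thus "EX r. ALL e>0. EX j:ch ` Cd. (ALL x. dist (Ph i x) (Ph j x) < e) & (ALL x. r < norm x --> Ph i x = 0 & Ph j x = 0)"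
  by blast
 qed
qed

section \<open>Density of continuous functions and separability of Lp\<close>

lemma pint_dominated_tendsto:
 fixes h :: "nat => 'e => 'b::euclidean_space"
 assumes p: "1 <= p" and [measurable]: "!!n. h n : borel_measurable N" "w : borel_measurable N"
  and lim: "AE x in N. (%n. h n x) \<longlonglongrightarrow> 0"
  and dom: "!!n. AE x in N. norm (h n x) <= w x" and fin: "(\<integral>\<^sup>+x. en (w x powr p) \<partial>N) < \<infinity>"
 shows "(%n. pint p N (h n)) \<longlonglongrightarrow> 0"
proof -
 have "(%n. \<integral>\<^sup>+x. en (norm (h n x) powr p) \<partial>N) \<longlonglongrightarrow> (\<integral>\<^sup>+x. 0 \<partial>N)"
 proof (rule nn_integral_dominated_convergence[where w = "%x. en (w x powr p)"])
  show "AE x in N. en (norm (h j x) powr p) <= en (w x powr p)" for j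
  using dom[of j] by eventually_elim (use p in \<open>auto intro!: ennreal_leI powr_mono2\<close>)
  show "AE x in N. (%n. en (norm (h n x) powr p)) \<longlonglongrightarrow> 0"
  using lim
  proof eventually_elim
  case (elim x)
  have "(%n. norm (h n x) powr p) \<longlonglongrightarrow> norm (0::'b) powr p"
  using p by (intro tendsto_powr' tendsto_norm elim tendsto_const) auto
  from tendsto_ennrealI[OF this] show ?case by simp
  qed
 qed (use fin in auto)
 thus ?thesis by (simp add: pint_def)
qed

lemma pint_bounded_support_finite:
 fixes h :: "'a::euclidean_space => 'b::euclidean_space"
 assumes p: "1 <= p" and z: "!!x. r < norm x ==> h x = 0" and b: "!!x. norm (h x) <= B"
 shows "pil p h <= en (B powr p) * emeasure lborel (cball (0::'a) r)"
proof -
 have "en (norm (h x) powr p) <= en (B powr p) * ind (cball 0 r) x" for x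
  using z[of x] b[of x] p by (cases "r < norm x") (auto simp: not_less intro!: ennreal_leI powr_mono2)
 hence "pil p h <= (NI (x::'a). en (B powr p) * ind (cball 0 r) x)"
  unfolding pint_def by (intro nn_integral_mono)
 also have "... = en (B powr p) * emeasure lborel (cball (0::'a) r)"
  by (subst nn_integral_cmult_indicator) auto
 finally show ?thesis .
qed

text \<open>Measurability provides continuous functions converging almost everywhere, but no bound
  on them. The retraction \<open>cl\<close> onto a ball and the cut-off \<open>ct\<close> supply the
  domination and do not change the limit \<open>w\<close>.\<close>

lemma continuous_dense_bounded_support:
 fixes w :: "'a::euclidean_space => 'b::euclidean_space" and k :: nat
 assumes p: "1 <= p" and w[measurable]: "w : Bm"
  and wb: "!!x. norm (w x) <= real k" and w0: "!!x. real k < norm x ==> w x = 0" and e: "0 < e"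
 obtains ph where "cts ph" "!!x. real k + 1 < norm x ==> ph x = 0" "pil p (%x. w x - ph x) < en e"
proof -
 have "w measurable_on UNIV"
  using borel_measurable_lebesgue_of_borel[OF w] by (intro lebesgue_measurable_imp_measurable_on) auto
 then obtain Nn g where Nn: "negligible Nn" and g: "!!n. cts (g n)"
  and lim: "!!x. x ~: Nn ==> (%n. g n x) \<longlonglongrightarrow> w x"
  unfolding measurable_on_def by auto
 define K where "K = real k + 1"
 have K: "K > 0" by (simp add: K_def)
 define ct :: "'a => real" where "ct x = max 0 (min 1 (K - norm x))" for x
 define cl where "cl y = (K / max K (norm y)) *R y" for y :: 'b
 define h where "h n x = ct x *R cl (g n x)" for n x
 have clc: "cts cl" unfolding cl_def using K by (intro continuous_intros) (auto simp: max_def)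
 have cln: "norm (cl y) <= K" for y
  unfolding cl_def using K by (auto simp: max_def divide_simps)
 have clw: "cl (w x) = w x" for x using wb[of x] K by (simp add: cl_def K_def max_def)
 have ct01: "0 <= ct x" "ct x <= 1" for x by (auto simp: ct_def)
 have ctw: "ct x *R w x = w x" for x
  using w0[of x] by (cases "real k < norm x") (auto simp: ct_def K_def)
 have hc: "cts (h n)" for n
  unfolding h_def ct_def
  by (intro continuous_intros continuous_on_compose2[OF clc g]) auto
 have h0: "h n x = 0" if "K < norm x" for n x using that by (simp add: h_def ct_def)
 have hm[measurable]: "h n : Bm" for n using hc by (rule bm_contI)
 have hb: "norm (h n x) <= K" for n x
 proof -
  have "norm (h n x) <= 1 * K" unfolding h_def norm_scaleR using ct01[of x] cln by (intro mult_mono) auto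
  thus ?thesis by simp
 qed
 have "(%n. pil p (%x. w x - h n x)) \<longlonglongrightarrow> 0"
 proof (rule pint_dominated_tendsto[OF p, where w = "%x::'a. 2 * K * ind (cball 0 K) x"])
  have "AE x in lebesgue. x ~: Nn" using Nn by (intro AE_not_in) (simp add: negligible_iff_null_sets)
  hence "AE x in lborel. x ~: Nn" by (simp add: AE_completion_iff)
  thus "AE x in lborel. (%n. w x - h n x) \<longlonglongrightarrow> 0"
  proof eventually_elim
  case (elim x)
  have "(%n. cl (g n x)) \<longlonglongrightarrow> cl (w x)"
  using continuous_on_tendsto_compose[OF clc lim[OF elim]] by simp
  hence "(%n. w x - h n x) \<longlonglongrightarrow> w x - ct x *R cl (w x)"
  unfolding h_def by (intro tendsto_intros)
  thus ?case by (simp add: clw ctw)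
  qed
  show "AE x in lborel. norm (w x - h n x) <= 2 * K * ind (cball 0 K) x" for n
  proof (rule AE_I2)
  fix x
  show "norm (w x - h n x) <= 2 * K * ind (cball 0 K) x"
  proof (cases "norm x <= K")
  case True
  have "norm (w x - h n x) <= norm (w x) + norm (h n x)" by (rule norm_triangle_ineq4)
  also have "... <= K + K" using wb[of x] hb[of n x] by (intro add_mono) (auto simp: K_def)
  finally show ?thesis using True by simp
  qed (use h0[of x n] w0[of x] in \<open>auto simp: K_def\<close>)
  qed
  have "(NI (x::'a). en ((2 * K * ind (cball 0 K) x) powr p))
  = (NI (x::'a). en ((2 * K) powr p) * ind (cball 0 K) x)"
  using p by (intro nn_integral_cong) (auto simp: indicator_def)
  also have "... = en ((2 * K) powr p) * emeasure lborel (cball (0::'a) K)"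
  by (subst nn_integral_cmult_indicator) auto
  also have "... < \<infinity>" using emeasure_bounded_finite[of "cball (0::'a) K"] by (simp add: ennreal_mult_less_top)
  finally show "(NI (x::'a). en ((2 * K * ind (cball 0 K) x) powr p)) < \<infinity>" .
  show "(%x::'a. 2 * K * ind (cball 0 K) x) : borel_measurable lborel"
  by (intro borel_measurable_times borel_measurable_const borel_measurable_indicator) simp
 qed auto
 hence "\<forall>\<^sub>F n in sequentially. pil p (%x. w x - h n x) < en e"
  using e by (intro order_tendstoD(2)) auto
 then obtain n where "pil p (%x. w x - h n x) < en e"
  by (auto simp: eventually_sequentially)
 thus ?thesis using that[of "h n"] hc h0 by (auto simp: K_def)
qed

lemma continuous_dense_Lp:
 fixes u :: "'a::euclidean_space => 'b::euclidean_space"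
 assumes p: "1 <= p" and u[measurable]: "u : Bm" and fin: "pil p u < \<infinity>" and e: "0 < e"
 obtains ph r where "cts ph" "!!x. r < norm x ==> ph x = 0" "pil p (%x. u x - ph x) < en e"
proof -
 define B where "B k = {x. norm x <= real k & norm (u x) <= real k}" for k
 have B[measurable]: "B k : sets borel" for k unfolding B_def by measurable
 define uk where "uk k x = ind (B k) x *R u x" for k x
 have [measurable]: "uk k : Bm" for k unfolding uk_def by measurable
 \<comment> \<open>Two errors of \<open>e1\<close> and the constant \<open>2 powr p\<close> of the
   triangle inequality add up to \<open>e / 2\<close>.\<close>
 define e1 where "e1 = e / (4 * 2 powr p)"
 have e1: "e1 > 0" using e by (simp add: e1_def)
 have "(%k. pil p (%x. u x - uk k x)) \<longlonglongrightarrow> 0"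
 proof (rule pint_dominated_tendsto[OF p, where w = "%x. norm (u x)"])
  show "AE x in lborel. (%k. u x - uk k x) \<longlonglongrightarrow> 0"
  proof (rule AE_I2)
  fix x
  obtain k0 :: nat where k0: "max (norm x) (norm (u x)) <= real k0" using real_arch_simple by blast
  have "u x - uk k x = 0" if "k >= k0" for k
  using k0 that by (simp add: uk_def B_def)
  thus "(%k. u x - uk k x) \<longlonglongrightarrow> 0"
  by (intro tendsto_eventually eventually_sequentiallyI[of k0])
  qed
  show "AE x in lborel. norm (u x - uk k x) <= norm (u x)" for k
  by (rule AE_I2) (auto simp: uk_def indicator_def)
 qed (use fin in \<open>auto simp: pint_def\<close>)
 hence "\<forall>\<^sub>F k in sequentially. pil p (%x. u x - uk k x) < en e1"
  using e1 by (intro order_tendstoD(2)) auto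
 then obtain k where k: "pil p (%x. u x - uk k x) < en e1"
  by (auto simp: eventually_sequentially)
 obtain ph where ph: "cts ph" "!!x. real k + 1 < norm x ==> ph x = 0"
  "pil p (%x. uk k x - ph x) < en e1"
  by (rule continuous_dense_bounded_support[OF p, of "uk k" k e1]) (use e1 in \<open>auto simp: uk_def B_def indicator_def\<close>)
 have [measurable]: "ph : Bm" using ph(1) by (rule bm_contI)
 have "pil p (%x. u x - ph x) <= en (2 powr p) *
  (pil p (%x. u x - uk k x) + pil p (%x. uk k x - ph x))"
  using p by (intro pint_triangle) auto
 also have "... <= en (2 powr p) * (en e1 + en e1)"
  using k ph(3) by (intro mult_left_mono add_mono) auto
 also have "... = en (e / 2)"
  using e1 by (simp add: ennreal_plus[symmetric] ennreal_mult[symmetric] e1_def del: ennreal_plus)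
 also have "... < en e" using e by (intro ennreal_lessI) auto
 finally have fin: "pil p (%x. u x - ph x) < en e" .
 show ?thesis by (rule that[OF ph(1) _ fin]) (rule ph(2))
qed

lemma Lp_separable:
 assumes p: "1 <= p"
 obtains C :: "('a::euclidean_space => 'b::euclidean_space) set" where "countable C"
  "C <= Bm"
  "ALL u:Bm. ALL e>0. pil p u < \<infinity> --> (EX c:C. pil p (%x. u x - c x) < en e)"
proof -
 define S where "S = {ph :: 'a => 'b. cts ph & (EX r. ALL x. r < norm x --> ph x = 0)}"
 obtain C where C: "countable C" "C <= S"
  "!!ph. ph : S ==> EX r. ALL e>0. EX c:C. (ALL x. dist (ph x) (c x) < e) & (ALL x. r < norm x --> ph x = 0 & c x = 0)"
  by (rule countable_uniformly_dense[of S "%ph. ph"]) (auto simp: S_def)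
 show ?thesis
 proof (rule that[OF C(1)], goal_cases)
  case 1
  show ?case using C(2) by (auto simp: S_def intro: bm_contI)
 next
  case 2
  have cm: "c : Bm" if "c : C" for c
  using C(2) that by (auto simp: S_def intro: bm_contI)
  show ?case
  proof (intro ballI allI impI)
  fix u :: "'a => 'b" and e :: real
  assume u: "u : Bm" "pil p u < \<infinity>" and e: "0 < e"
  define e1 where "e1 = e / (4 * 2 powr p)"
  have e1: "e1 > 0" using e by (simp add: e1_def)
  obtain ph r0 where ph: "cts ph" "!!x. r0 < norm x ==> ph x = 0" "pil p (%x. u x - ph x) < en e1"
  using continuous_dense_Lp[OF p u e1] by blast
  have "ph : S" using ph by (auto simp: S_def)
  from C(3)[OF this] obtain r where "ALL e>0. EX c:C. (ALL x. dist (ph x) (c x) < e) & (ALL x. r < norm x --> ph x = 0 & c x = 0)"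
  by (elim exE)
  hence r: "EX c:C. (ALL x. dist (ph x) (c x) < e) & (ALL x. r < norm x --> ph x = 0 & c x = 0)" if "e > 0" for e
  using that by (elim allE impE)
  define v where "v = measure lborel (cball (0::'a) r)"
  have v: "emeasure lborel (cball (0::'a) r) = en v"
  using emeasure_bounded_finite[of "cball (0::'a) r"] unfolding v_def
  by (intro emeasure_eq_ennreal_measure) auto
  define d where "d = (e1 / (v + 1)) powr (1 / p)"
  have v0: "v >= 0" by (simp add: v_def)
  have d: "d > 0" using e1 v0 by (simp add: d_def)
  obtain c where c: "c : C" "!!x. dist (ph x) (c x) < d" "!!x. r < norm x ==> ph x = 0 & c x = 0"
  using r[OF d] by blast
  have "pil p (%x. ph x - c x) <= en (d powr p) * emeasure lborel (cball (0::'a) r)"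
  by (rule pint_bounded_support_finite[OF p]) (use c in \<open>auto simp: dist_norm intro: less_imp_le\<close>)
  also have "... = en (e1 / (v + 1) * v)"
  using p e1 v0 by (simp add: v d_def powr_powr ennreal_mult[symmetric])
  also have "... <= en e1" using e1 v0 by (intro ennreal_leI) (simp add: field_simps)
  finally have 2: "pil p (%x. ph x - c x) <= en e1" .
  have "pil p (%x. u x - c x) <= en (2 powr p) *
  (pil p (%x. u x - ph x) + pil p (%x. ph x - c x))"
  using p u(1) cm[OF c(1)] bm_contI[OF ph(1)] by (intro pint_triangle) auto
  also have "... <= en (2 powr p) * (en e1 + en e1)"
  using 2 ph(3) by (intro mult_left_mono add_mono) auto
  also have "... = en (e / 2)"
  using e1 by (simp add: ennreal_plus[symmetric] ennreal_mult[symmetric] e1_def del: ennreal_plus)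
  also have "... < en e" using e by (intro ennreal_lessI) auto
  finally show "EX c:C. pil p (%x. u x - c x) < en e" by (rule bexI[OF _ c(1)])
  qed
 qed
qed

text \<open>Separability is inherited by subfamilies, with the dense sequence taken from the family
  itself. It supplies the values of the simple functions in the proof of strong
  measurability.\<close>

lemma dense_sequence_in_Lp_family:
 fixes W :: "'t => 'a::euclidean_space => 'b::euclidean_space"
 assumes p: "1 <= p" and A: "A ~= {}"
  and W: "!!t. t : A ==> W t : Bm" "!!t. t : A ==> pil p (W t) < \<infinity>"
 obtains ta :: "nat => 't" where "!!k. ta k : A"
  "!!t e. t : A ==> 0 < e ==> EX k. pil p (%x. W (ta k) x - W t x) < en e"
proof -
 obtain C :: "('a => 'b) set" where C: "countable C" "C <= Bm"
  "ALL u:Bm. ALL e>0. pil p u < \<infinity> --> (EX c:C. pil p (%x. u x - c x) < en e)"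
  by (rule Lp_separable[OF p])
 define Q where "Q c m t \<longleftrightarrow> t : A & pil p (%x. W t x - c x) < en (1 / real (Suc m))" for c m t
 define I where "I = {(c, m). c : C & (EX t. Q c m t)}"
 have cI: "countable I"
  by (rule countable_subset[of _ "C \<times> UNIV"]) (use C(1) in \<open>auto simp: I_def\<close>)
 define ch where "ch i = (SOME t. Q (fst i) (snd i) t)" for i
 have ch: "Q c m (ch (c, m))" if "(c, m) : I" for c m
  using that someI_ex[of "Q c m"] by (auto simp: I_def ch_def)
 have dense: "EX i:I. pil p (%x. W (ch i) x - W t x) < en e" if t: "t : A" and e: "0 < e" for t e
 proof -
  define e1 where "e1 = e / (4 * 2 powr p)"
  have e1: "e1 > 0" using e by (simp add: e1_def)
  obtain m where m: "1 / real (Suc m) < e1" using nat_approx_posE[OF e1] by auto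
  obtain c where c: "c : C" "pil p (%x. W t x - c x) < en (1 / real (Suc m))"
  using bspec[OF C(3) W(1)[OF t]] W(2)[OF t] by (elim allE[of _ "1 / real (Suc m)"]) auto
  have i: "(c, m) : I" using c t by (auto simp: I_def Q_def)
  have q: "ch (c, m) : A" "pil p (%x. W (ch (c, m)) x - c x) < en (1 / real (Suc m))"
  using ch[OF i] by (auto simp: Q_def)
  have "pil p (%x. W (ch (c, m)) x - W t x) <= en (2 powr p) *
  (pil p (%x. W (ch (c, m)) x - c x) + pil p (%x. c x - W t x))"
  using p W(1)[OF t] W(1)[OF q(1)] subsetD[OF C(2) c(1)] by (intro pint_triangle) auto
  also have "... <= en (2 powr p) * (en e1 + en e1)"
  proof (intro mult_left_mono add_mono)
  have le: "en (1 / real (Suc m)) <= en e1" using m by (intro ennreal_leI) simp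
  show "pil p (%x. W (ch (c, m)) x - c x) <= en e1" using q(2) le by (rule order_trans[OF less_imp_le])
  show "pil p (%x. c x - W t x) <= en e1"
  unfolding pint_commute[of p lborel c] using c(2) le by (rule order_trans[OF less_imp_le])
  qed auto
  also have "... = en (e / 2)"
  using e1 by (simp add: ennreal_plus[symmetric] ennreal_mult[symmetric] e1_def del: ennreal_plus)
  also have "... < en e" using e by (intro ennreal_lessI) auto
  finally show ?thesis by (rule bexI[OF _ i])
 qed
 obtain t0 where t0: "t0 : A" using A by blast
 have Ine: "I ~= {}" using dense[OF t0, of 1] by auto
 show ?thesis
 proof (rule that[of "%k. ch (from_nat_into I k)"])
  show "ch (from_nat_into I k) : A" for k
  using from_nat_into[OF Ine, of k] ch by (cases "from_nat_into I k") (auto simp: Q_def)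
  fix t and e :: real assume "t : A" "0 < e"
  then obtain i where i: "i : I" "pil p (%x. W (ch i) x - W t x) < en e" using dense by blast
  thus "EX k. pil p (%x. W (ch (from_nat_into I k)) x - W t x) < en e"
  using from_nat_into_to_nat_on[OF cI i(1)] by metis
 qed
qed

section \<open>Averaged difference quotients\<close>

lemma nn_integral_lborel_affine:
 fixes f :: "'a::euclidean_space => ennreal"
 assumes [measurable]: "f : Bm" and c: "c ~= 0"
 shows "(NI x. f x) = en (\<bar>c\<bar> ^ DIM('a)) * (NI x. f (t + c *R x))"
 by (subst lborel_affine[OF c, of t])
  (simp add: nn_integral_density nn_integral_distr nn_integral_cmult)

lemma integral_lborel_affine:
 fixes f :: "'a::euclidean_space => 'b::{banach, second_countable_topology}"
 assumes [measurable]: "f : Bm" and c: "c ~= 0"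
 shows "(LI x. f x) = \<bar>c\<bar> ^ DIM('a) *R (LI x. f (t + c *R x))"
 by (subst lborel_affine[OF c, of t])
  (simp add: integral_density integral_distr)

lemma integrable_lborel_affine:
 fixes f :: "'a::euclidean_space => 'b::{banach, second_countable_topology}"
 assumes f: "intl f" and c: "c ~= 0"
 shows "intl (%x. f (t + c *R x))"
proof -
 have [measurable]: "f : Bm" using f by auto
 have "en (\<bar>c\<bar> ^ DIM('a)) * (NI x. en (norm (f (t + c *R x)))) < \<infinity>"
  using f nn_integral_lborel_affine[of "%x. en (norm (f x))" c t] c by (simp add: integrable_iff_bounded)
 hence "(NI x. en (norm (f (t + c *R x)))) < \<infinity>"
 proof -
  have "~ \<bar>c\<bar> ^ DIM('a) <= 0" using c by (simp add: not_le)
  with \<open>_ < \<infinity>\<close> show ?thesis by (auto simp: ennreal_mult_less_top ennreal_eq_0_iff)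
 qed
 thus ?thesis by (intro integrableI_bounded) auto
qed

lemma bounded_times_integrable:
 fixes g :: "'a::euclidean_space => real" and u :: "'a => 'b::euclidean_space"
 assumes g: "g : Bm" and u: "intl (%x. ind K x *R u x)"
  and B: "!!x. \<bar>g x\<bar> <= B" and z: "!!x. x ~: K ==> g x = 0"
 shows "intl (%x. g x *R u x)"
proof -
 have "intl (%x. g x *R (ind K x *R u x))"
 proof (rule lint_bound[where f = "%x. B *R (ind K x *R u x)"])
  show "intl (%x. B *R (ind K x *R u x))" by (rule integrable_scaleR_right) (rule u)
  show "(%x. g x *R (ind K x *R u x)) : borel_measurable lborel"
  by (intro borel_measurable_scaleR borel_measurable_integrable[OF u]) (use g in simp)
  show "AE x in lborel. norm (g x *R (ind K x *R u x)) <= norm (B *R (ind K x *R u x))"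
  proof (rule AE_I2)
  fix x show "norm (g x *R (ind K x *R u x)) <= norm (B *R (ind K x *R u x))"
  using B[of x] by (cases "x : K") (auto intro!: mult_right_mono)
  qed
 qed
 moreover have "g x *R (ind K x *R u x) = g x *R u x" for x
  using z[of x] by (cases "x : K") auto
 ultimately show ?thesis by (simp only:)
qed

section \<open>Second moments of radial kernels\<close>

definition is_kernel :: "(real^'d => real) => real => bool" where
 "is_kernel rh R \<longleftrightarrow> (ALL x. 0 <= rh x) & cts rh & radial rh & 0 < R &
  (ALL x. R < norm x --> rh x = 0) & (EX x. rh x ~= 0)"

lemma kernel_props:
 assumes k: "is_kernel rh R"
 shows "0 <= rh x" "cts rh" "rh : Bm" "0 < R" "R < norm x ==> rh x = 0"
  "norm x = norm y ==> rh x = rh y" "EX B>0. ALL x. rh x <= B"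
proof -
 show "0 <= rh x" and c: "cts rh" and "0 < R" and z: "!!x. R < norm x ==> rh x = 0"
  using k by (auto simp: is_kernel_def)
 thus "rh : Bm" by (intro bm_contI)
 show "norm x = norm y ==> rh x = rh y" using k by (auto simp: is_kernel_def radial_def)
 have "bounded (rh ` cball 0 R)"
  by (intro compact_imp_bounded compact_continuous_image continuous_on_subset[OF c]) auto
 then obtain B where B: "B > 0" "!!x. x : cball 0 R ==> norm (rh x) <= B" by (auto simp: bounded_pos)
 have "rh x <= B" for x
  using B(1) B(2)[of x] z[of x] by (cases "R < norm x") (auto simp: not_less)
 thus "EX B>0. ALL x. rh x <= B" using B(1) by blast
qed

lemma integrable_bounded_support:
 fixes h :: "'a::euclidean_space => 'b::{banach, second_countable_topology}"
 assumes h: "h : Bm" and b: "!!x. norm (h x) <= B" and z: "!!x. r < norm x ==> h x = 0"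
 shows "intl h"
proof (rule integrableI_bounded)
 show "h : borel_measurable lborel" using h by simp
 have "en (norm (h x)) <= en B * ind (cball 0 r) x" for x
  using z[of x] b[of x] by (cases "r < norm x") (auto simp: not_less intro!: ennreal_leI)
 hence "(NI x. en (norm (h x))) <= (NI (x::'a). en B * ind (cball 0 r) x)"
  by (intro nn_integral_mono)
 also have "... = en B * emeasure lborel (cball (0::'a) r)"
  by (subst nn_integral_cmult_indicator) auto
 also have "... < \<infinity>" using emeasure_bounded_finite[of "cball (0::'a) r"] by (simp add: ennreal_mult_less_top)
 finally show "(NI x. en (norm (h x))) < \<infinity>" .
qed

lemma kernel_moment_integrable:
 fixes h :: "real^'d => 'b::{banach, second_countable_topology}"
 assumes k: "is_kernel rh R" and h: "cts h"
 shows "intl (%z. rh z *R h z)"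
proof -
 obtain B where B: "B > 0" "!!x. rh x <= B" using kernel_props(7)[OF k] by blast
 have "bounded (h ` cball 0 R)"
  by (intro compact_imp_bounded compact_continuous_image continuous_on_subset[OF h]) auto
 then obtain C where C: "C > 0" "!!x. x : cball 0 R ==> norm (h x) <= C" by (auto simp: bounded_pos)
 show ?thesis
 proof (rule integrable_bounded_support[where B = "B * C" and r = R])
  show "(%z. rh z *R h z) : Bm"
  using kernel_props(2)[OF k] h by (intro bm_contI continuous_intros)
  show "norm (rh x *R h x) <= B * C" for x
  proof (cases "R < norm x")
  case False
  thus ?thesis using B C(1) C(2)[of x] kernel_props(1)[OF k, of x]
  by (simp add: not_less mult_mono)
  qed (use B C kernel_props(5)[OF k] in simp)
  show "rh x *R h x = 0" if "R < norm x" for x using kernel_props(5)[OF k that] by simp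
 qed
qed

lemma kernel_odd:
 fixes h :: "real^'d => 'b::{banach, second_countable_topology}"
 assumes k: "is_kernel rh R" and h: "cts h" and odd: "!!z. h (- z) = - h z"
 shows "(LI z. rh z *R h z) = 0"
proof -
 have m: "(%z. rh z *R h z) : Bm"
  using kernel_props(2)[OF k] h by (intro bm_contI continuous_intros)
 have "(LI z. rh z *R h z) = (LI z. rh (- z) *R h (- z))"
  using integral_lborel_affine[OF m, of "-1" 0] by simp
 also have "... = (LI z. - (rh z *R h z))"
 proof (rule lint_cong[OF refl])
  fix z :: "real^'d"
  have "rh (- z) = rh z" by (rule kernel_props(6)[OF k]) simp
  thus "rh (- z) *R h (- z) = - (rh z *R h z)" by (simp add: odd)
 qed
 also have "... = - (LI z. rh z *R h z)" by simp
 finally have "(LI z. rh z *R h z) = - (LI z. rh z *R h z)" .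
 hence "2 *R (LI z. rh z *R h z) = 0"
  by (metis add.right_inverse scaleR_2)
 thus ?thesis by simp
qed

definition kernel_moment :: "(real^'d => real) => 'd => real" where
 "kernel_moment rh i = (LI z. rh z * (z $ i)\<^sup>2)"

text \<open>Radiality moves a point of positivity to the i-th axis, or continuity does so if that
  point is the origin. A nonnegative continuous integrand that is positive somewhere has positive
  integral.\<close>

lemma kernel_moment_pos:
 fixes rh :: "real^'d => real"
 assumes k: "is_kernel rh R" shows "0 < kernel_moment rh i"
proof -
 have c: "cts (%z. rh z * (z $ i)\<^sup>2)" using kernel_props(2)[OF k] by (intro continuous_intros)
 have int: "intl (%z. rh z * (z $ i)\<^sup>2)"
 proof -
  have "cts (%z::real^'d. (z $ i)\<^sup>2)" by (intro continuous_intros)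
  from kernel_moment_integrable[OF k this] show ?thesis by simp
 qed
 obtain x where x: "rh x ~= 0" using k by (auto simp: is_kernel_def)
 have "EX y. rh y ~= 0 & y $ i ~= 0"
 proof (cases "x = 0")
  case False
  have "rh (norm x *R axis i 1) = rh x" by (rule kernel_props(6)[OF k]) simp
  thus ?thesis using x False by (intro exI[of _ "norm x *R axis i 1"]) (simp add: axis_def)
 next
  case True
  have "isCont rh 0" using kernel_props(2)[OF k] by (simp add: continuous_on_eq_continuous_at)
  then obtain d where d: "d > 0" "!!y. dist y 0 < d ==> dist (rh y) (rh 0) < rh 0"
  using x True kernel_props(1)[OF k, of 0] unfolding continuous_at_eps_delta by (metis less_le)
  define y :: "real^'d" where "y = (d / 2) *R axis i 1"
  have "dist y 0 < d" using d by (simp add: y_def)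
  from d(2)[OF this] have "rh y ~= 0" by (auto simp: dist_real_def)
  thus ?thesis using d by (intro exI[of _ y]) (simp add: y_def axis_def)
 qed
 then obtain y where y: "rh y ~= 0" "y $ i ~= 0" by blast
 have nn: "0 <= rh z * (z $ i)\<^sup>2" for z using kernel_props(1)[OF k] by simp
 have "kernel_moment rh i ~= 0"
 proof
  assume "kernel_moment rh i = 0"
  hence "AE z in lborel. rh z * (z $ i)\<^sup>2 = 0"
  using integral_nonneg_eq_0_iff_AE[OF int] nn by (simp add: kernel_moment_def)
  hence "AE z in lborel. z ~: {z. rh z * (z $ i)\<^sup>2 > 0}" by eventually_elim (metis mem_Collect_eq less_irrefl)
  moreover have op: "open {z. rh z * (z $ i)\<^sup>2 > 0}" using c by (intro open_Collect_less) auto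
  ultimately have "{z. rh z * (z $ i)\<^sup>2 > 0} : null_sets lborel" by (subst AE_iff_null_sets) auto
  hence "negligible {z. rh z * (z $ i)\<^sup>2 > 0}"
  unfolding negligible_iff_null_sets by (rule null_sets_completionI)
  hence "{z. rh z * (z $ i)\<^sup>2 > 0} = {}" using op open_not_negligible by auto
  moreover have "rh y * (y $ i)\<^sup>2 > 0" using y nn[of y] by (simp add: less_le)
  ultimately show False by blast
 qed
 moreover have "kernel_moment rh i >= 0" unfolding kernel_moment_def using nn by simp
 ultimately show ?thesis by simp
qed

text \<open>The map is diagonal with entry -1 at \<open>i\<close> and 1 elsewhere, so its
  determinant has modulus 1.\<close>

lemma lborel_integral_reflect:
 fixes h :: "real^'d => real"
 assumes m: "h : Bm"
 shows "(LI z. h z) = (LI z. h (z - (2 * z $ i) *R axis i 1))"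
proof -
 define c :: "real^'d => real" where "c b = (if b = axis i 1 then -1 else 1)" for b
 define T :: "real^'d => real^'d" where "T x = 0 + (\<Sum>j\<in>Basis. (c j * (x \<bullet> j)) *R j)" for x
 have T: "T z = z - (2 * z $ i) *R axis i 1" for z
 proof -
  have ax: "axis i 1 : (Basis :: (real^'d) set)" by (simp add: axis_in_Basis_iff)
  have "(c j * (z \<bullet> j)) *R j = (z \<bullet> j) *R j - (if j = axis i 1 then (2 * z $ i) *R axis i 1 else 0)" for j
  by (auto simp: c_def inner_axis scaleR_left_distrib[symmetric] algebra_simps)
  hence "T z = (\<Sum>j\<in>Basis. (z \<bullet> j) *R j - (if j = axis i 1 then (2 * z $ i) *R axis i 1 else 0))"
  by (simp add: T_def)
  also have "... = (\<Sum>j\<in>Basis. (z \<bullet> j) *R j) - (2 * z $ i) *R axis i 1"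
  using ax by (simp add: sum_subtractf sum.delta)
  finally show ?thesis by (simp add: euclidean_representation)
 qed
 have Tm: "T : Bm" unfolding T_def by measurable
 have "lborel = density (distr lborel borel T) (%_. (\<Prod>j\<in>Basis. \<bar>c j\<bar>))"
  unfolding T_def by (rule lborel_affine_euclidean) (simp add: c_def)
 moreover have "(\<Prod>j\<in>Basis. \<bar>c j\<bar>) = 1" by (rule prod.neutral) (simp add: c_def)
 ultimately have l: "lborel = distr lborel borel T" by (simp add: density_1)
 have "(LI z. h z) = (\<integral>z. h z \<partial>distr lborel borel T)" using l by simp
 also have "... = (LI z. h (T z))" using Tm m by (intro integral_distr) auto
 finally show ?thesis by (simp add: T)
qed

text \<open>Reflecting the i-th coordinate preserves the radial kernel and changes the sign of the
  integrand.\<close>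

lemma kernel_moment_offdiag:
 fixes rh :: "real^'d => real"
 assumes k: "is_kernel rh R" and ne: "i ~= j"
 shows "(LI z. rh z * (z $ i * z $ j)) = 0"
proof -
 have m: "(%z. rh z * (z $ i * z $ j)) : Bm"
  using kernel_props(2)[OF k] by (intro bm_contI continuous_intros)
 have "norm (z - (2 * z $ i) *R axis i 1) = norm z" for z :: "real^'d"
 proof -
  have "(z - (2 * z $ i) *R axis i 1) \<bullet> (z - (2 * z $ i) *R axis i 1) = z \<bullet> z"
  by (simp add: inner_diff_left inner_diff_right inner_axis inner_commute[of "axis i 1"] power2_eq_square algebra_simps)
  thus ?thesis by (simp add: norm_eq_sqrt_inner)
 qed
 hence r: "rh (z - (2 * z $ i) *R axis i 1) = rh z" for z by (rule kernel_props(6)[OF k])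
 have "(LI z. rh z * (z $ i * z $ j)) =
  (LI z. rh (z - (2 * z $ i) *R axis i 1) * ((z - (2 * z $ i) *R axis i 1) $ i * (z - (2 * z $ i) *R axis i 1) $ j))"
  by (rule lborel_integral_reflect[OF m])
 also have "... = (LI z. - (rh z * (z $ i * z $ j)))"
 proof (rule lint_cong[OF refl])
  fix z :: "real^'d"
  have "(z - (2 * z $ i) *R axis i 1) $ i = - z $ i" "(z - (2 * z $ i) *R axis i 1) $ j = z $ j"
  using ne by (auto simp: axis_def)
  thus "rh (z - (2 * z $ i) *R axis i 1) * ((z - (2 * z $ i) *R axis i 1) $ i * (z - (2 * z $ i) *R axis i 1) $ j)
  = - (rh z * (z $ i * z $ j))" unfolding r by simp
 qed
 also have "... = - (LI z. rh z * (z $ i * z $ j))" by simp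
 finally show ?thesis by simp
qed

section \<open>The averaged gradient and its pairing with test fields\<close>

text \<open>To first order \<open>u x - u y\<close> is the gradient applied to \<open>x - y\<close>;
  multiplied by \<open>x - y\<close> and averaged it gives second moments of size n^-2, and the
  factor n^2 restores them. So \<open>kgrad\<close> models a diagonal multiple of the gradient of
  \<open>u\<close>.\<close>

definition kgrad :: "(real^'d => real) => (real^'d) set => nat => (real^'d => real) => real^'d => real^'d" where
 "kgrad rh Om n u y = (LI x. (ind Om x * ind Om y * (real n)\<^sup>2 * rescaled rh n (x - y) * (u x - u y)) *R (x - y))"

definition kenergy :: "real => (real^'d => real) => (real^'d) set => nat => (real^'d => real) => ennreal" where
 "kenergy p rh Om n u = (NI y. (NI x. ind Om x * ind Om y * en (rescaled rh n (x - y) * \<bar>u x - u y\<bar> powr p)))"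

lemma rescaled_measurable: "rh : Bm ==> rescaled rh n : Bm"
 unfolding rescaled_def[abs_def]
 by (intro borel_measurable_times borel_measurable_const measurable_compose[of "%x. real n *R x" borel borel rh]) auto

lemma rescaled_nonneg: "is_kernel rh R ==> 0 <= rescaled rh n x"
 using kernel_props(1)[of rh R "real n *R x"] by (simp add: rescaled_def)

lemma rescaled_zero: "is_kernel rh R ==> 0 < n ==> R / real n < norm x ==> rescaled rh n x = 0"
 using kernel_props(5)[of rh R "real n *R x"] by (simp add: rescaled_def field_simps)

lemma nn_integral_rescaled:
 fixes rh :: "real^'d => real"
 assumes k: "is_kernel rh R" and n: "0 < n"
 shows "(NI x. en (rescaled rh n (x - y))) = en (LI z. rh z)"
proof -
 have [measurable]: "rh : Bm" by (rule kernel_props[OF k])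
 have [measurable]: "rescaled rh n : Bm" by (rule rescaled_measurable) simp
 have int: "intl rh" using kernel_moment_integrable[OF k, of "%_. 1::real"] by simp
 have "(NI x. en (rescaled rh n (x - y)))
  = en (\<bar>1 / real n\<bar> ^ DIM(real^'d)) * (NI z. en (rescaled rh n ((y + (1 / real n) *R z) - y)))"
  using n by (intro nn_integral_lborel_affine) auto
 also have "... = en ((1 / real n) ^ CARD('d)) * (NI z. en (real n ^ CARD('d)) * en (rh z))"
  using n kernel_props(1)[OF k] by (simp add: rescaled_def ennreal_mult)
 also have "... = (NI z. en (rh z))"
  using n by (simp add: nn_integral_cmult mult.assoc[symmetric] ennreal_mult[symmetric] power_mult_distrib[symmetric])
 also have "... = en (LI z. rh z)"
  using int kernel_props(1)[OF k] by (intro nn_integral_eq_integral) auto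
 finally show ?thesis .
qed

text \<open>Jensen's inequality for the measure with density \<open>rescaled rh n\<close>, whose
  mass is the integral of \<open>rh\<close>. On its support n |x - y| is at most \<open>R\<close>,
  which leaves a single factor n on the increment.\<close>

lemma kgrad_bound:
 fixes rh :: "real^'d => real"
 assumes k: "is_kernel rh R" and n: "0 < n" and p: "1 <= p"
  and Om[measurable]: "Om : sets borel" and u[measurable]: "u : Bm"
 shows "pil p (kgrad rh Om n u) <=
  en ((LI z. rh z) powr (p - 1) * R powr p) * (en (real n powr p) * kenergy p rh Om n u)"
proof -
 define m where "m = (LI z. rh z)"
 have R: "R > 0" and [measurable]: "rh : Bm" by (rule kernel_props[OF k])+
 have [measurable]: "rescaled rh n : Bm" by (rule rescaled_measurable) simp
 have pt: "en (norm (kgrad rh Om n u y) powr p) <= en (m powr (p - 1) * R powr p * real n powr p) *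
  (NI x. ind Om x * ind Om y * en (rescaled rh n (x - y) * \<bar>u x - u y\<bar> powr p))" for y
 proof -
  define N where "N = density lborel (%x. en (rescaled rh n (x - y)))"
  define F where "F x = (ind Om x * ind Om y * (real n)\<^sup>2 * (u x - u y)) *R (x - y)" for x
  have Fm[measurable]: "F : Bm" unfolding F_def by measurable
  have mass: "emeasure N (space N) <= en m"
  unfolding N_def m_def using nn_integral_rescaled[OF k n, of y] by (subst emeasure_density) auto
  have F: "kgrad rh Om n u y = (\<integral>x. F x \<partial>N)"
  proof -
  have "(\<integral>x. F x \<partial>N) = (LI x. rescaled rh n (x - y) *R F x)"
  unfolding N_def using rescaled_nonneg[OF k] by (intro integral_density) auto
  also have "... = kgrad rh Om n u y" unfolding kgrad_def F_def
  by (intro lint_cong) (auto simp: algebra_simps)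
  finally show ?thesis by simp
  qed
  have "en (norm (kgrad rh Om n u y) powr p) <= en (m powr (p - 1)) * (\<integral>\<^sup>+x. en (norm (F x) powr p) \<partial>N)"
  unfolding F using p mass by (intro jensen_powr) (auto simp: N_def)
  also have "(\<integral>\<^sup>+x. en (norm (F x) powr p) \<partial>N) = (NI x. en (rescaled rh n (x - y)) * en (norm (F x) powr p))"
  unfolding N_def by (intro nn_integral_density) auto
  also have "... <= (NI x. en (R powr p * real n powr p) * (ind Om x * ind Om y * en (rescaled rh n (x - y) * \<bar>u x - u y\<bar> powr p)))"
  proof (rule nn_integral_mono)
  fix x
  show "en (rescaled rh n (x - y)) * en (norm (F x) powr p) <=
  en (R powr p * real n powr p) * (ind Om x * ind Om y * en (rescaled rh n (x - y) * \<bar>u x - u y\<bar> powr p))"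
  proof (cases "R / real n < norm (x - y) \<or> x ~: Om \<or> y ~: Om")
  case True
  thus ?thesis using rescaled_zero[OF k n, of "x - y"] p by (auto simp: F_def)
  next
  case False
  have "norm (F x) = real n * (real n * norm (x - y)) * \<bar>u x - u y\<bar>"
  using False by (simp add: F_def abs_mult power2_eq_square)
  also have "... <= real n * R * \<bar>u x - u y\<bar>"
  using False n by (intro mult_right_mono mult_left_mono) (auto simp: field_simps)
  finally have "norm (F x) powr p <= (real n * R * \<bar>u x - u y\<bar>) powr p" using p by (intro powr_mono2) auto
  hence "norm (F x) powr p <= R powr p * real n powr p * \<bar>u x - u y\<bar> powr p"
  using R n by (simp add: powr_mult mult.commute)
  hence "rescaled rh n (x - y) * norm (F x) powr p <= rescaled rh n (x - y) * (R powr p * real n powr p * \<bar>u x - u y\<bar> powr p)"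
  by (intro mult_left_mono rescaled_nonneg[OF k])
  hence "en (rescaled rh n (x - y) * norm (F x) powr p) <= en ((R powr p * real n powr p) * (rescaled rh n (x - y) * \<bar>u x - u y\<bar> powr p))"
  by (intro ennreal_leI) (simp add: algebra_simps)
  thus ?thesis using False rescaled_nonneg[OF k, of n "x - y"] by (simp add: ennreal_mult)
  qed
  qed
  also have "... = en (R powr p * real n powr p) * (NI x. (ind Om x * ind Om y * en (rescaled rh n (x - y) * \<bar>u x - u y\<bar> powr p)))"
  by (intro nn_integral_cmult) measurable
  finally show ?thesis by (simp add: ennreal_mult mult.assoc mult_left_mono)
 qed
 have "pil p (kgrad rh Om n u) <= (NI y. en (m powr (p - 1) * R powr p * real n powr p) *
  (NI x. ind Om x * ind Om y * en (rescaled rh n (x - y) * \<bar>u x - u y\<bar> powr p)))"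
  unfolding pint_def by (intro nn_integral_mono pt)
 also have "... = en (m powr (p - 1) * R powr p * real n powr p) * kenergy p rh Om n u"
  unfolding kenergy_def by (intro nn_integral_cmult) measurable
 finally show ?thesis by (simp add: m_def ennreal_mult mult.assoc)
qed

text \<open>The transpose of \<open>kgrad\<close>; up to the sign it tends to the divergence weighted by the second moments of the kernel.\<close>

definition ktheta :: "(real^'d => real) => nat => (real^'d => real^'d) => real^'d => real" where
 "ktheta rh n ph x = - real n * (LI z. rh z * (z \<bullet> ph (x + (1 / real n) *R z)))"

text \<open>Once the neighbourhood of \<open>K\<close> of radius \<open>R / n\<close> lies in the
  domain the indicators disappear, oddness removes the term with \<open>u y\<close>, and Fubini's
  theorem moves the average onto \<open>ph\<close>.\<close>

lemma kgrad_pairing: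
 fixes rh :: "real^'d => real" and u :: "real^'d => real" and ph :: "real^'d => real^'d"
 assumes k: "is_kernel rh R" and n: "0 < n"
  and Om[measurable]: "Om : sets borel" and u[measurable]: "u : Bm"
  and u0: "!!x. x ~: Om ==> u x = 0"
  and uint: "!!r. intl (%x. ind (cball 0 r) x *R u x)"
  and ph: "cts ph" and phK: "!!x. x ~: K ==> ph x = 0" and K: "compact K"
  and inner: "!!x y. y : K ==> norm (x - y) <= R / real n ==> x : Om"
 shows "(LI y. kgrad rh Om n u y \<bullet> ph y) = (LI x. u x * ktheta rh n ph x)"
proof -
 have R: "R > 0" and rc: "cts rh" and [measurable]: "rh : Bm" by (rule kernel_props[OF k])+
 have [measurable]: "rescaled rh n : Bm" by (rule rescaled_measurable) simp
 have [measurable]: "ph : Bm" using ph by (rule bm_contI)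
 have resc: "cts (%z. rescaled rh n (h z))" if "cts h" for h :: "'z::topological_space => real^'d"
  unfolding rescaled_def using that
  by (intro continuous_intros continuous_on_compose2[OF rc]) auto
 obtain b where b: "b > 0" "!!x. x : K ==> norm x <= b" using compact_imp_bounded[OF K] by (auto simp: bounded_pos)
 define A where "A y x = (real n)\<^sup>2 * rescaled rh n (x - y) * ((x - y) \<bullet> ph y)" for y x
 have Ac: "cts (%z. A (fst z) (snd z))"
  unfolding A_def
  by (intro continuous_intros resc continuous_on_compose2[OF ph]) auto
 have Am: "(%z. A (fst z) (snd z)) : borel_measurable (borel \<Otimes>\<^sub>M borel)"
  unfolding borel_prod by (rule bm_contI[OF Ac])
 have [measurable]: "case_prod A : borel_measurable (borel \<Otimes>\<^sub>M borel)"
  using Am by (simp add: case_prod_unfold)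
 define r where "r = b + R / real n"
 have Az: "A y x = 0" if "y ~: K \<or> R / real n < norm (x - y)" for y x
  using that rescaled_zero[OF k n, of "x - y"] phK[of y] by (auto simp: A_def)
 have Asupp: "A y x = 0" if "r < norm x \<or> b < norm y" for y x
 proof (rule Az, rule ccontr)
  assume "~ (y ~: K \<or> R / real n < norm (x - y))"
  hence "norm y <= b" "norm (x - y) <= R / real n" using b by auto
  moreover have "norm x <= norm y + norm (x - y)" using norm_triangle_ineq2[of x y] by simp
  ultimately show False using that unfolding r_def by linarith
 qed
 have "bounded ((%z. A (fst z) (snd z)) ` (cball 0 b \<times> cball 0 r))"
  by (intro compact_imp_bounded compact_continuous_image continuous_on_subset[OF Ac] compact_Times) auto
 then obtain B where B: "B > 0" "!!y x. norm y <= b ==> norm x <= r ==> \<bar>A y x\<bar> <= B"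
  by (force simp: bounded_pos)
 have Ab: "\<bar>A y x\<bar> <= B" for y x
  using B Asupp[of x y] by (cases "r < norm x \<or> b < norm y") (auto simp: not_less)
 have int1: "intl (%x. A y x * u x)" for y
 proof -
  have "intl (%x. A y x *R u x)"
  by (rule bounded_times_integrable[OF _ uint[of r] Ab]) (use Asupp in auto)
  thus ?thesis by simp
 qed
 have int2: "intl (%x. A y x)" for y
  by (rule integrable_bounded_support[where B = B and r = r]) (use Ab Asupp in auto)
 have odd: "(LI x. A y x) = 0" for y
 proof -
  have "(LI x. A y x) = \<bar>1 / real n\<bar> ^ DIM(real^'d) *R (LI z. A y (y + (1 / real n) *R z))"
  using n by (intro integral_lborel_affine) auto
  also have "(LI z. A y (y + (1 / real n) *R z)) = (LI z. rh z *R (real n * real n ^ CARD('d) * (z \<bullet> ph y)))"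
  using n by (intro lint_cong) (auto simp: A_def rescaled_def power2_eq_square)
  also have "... = 0" by (rule kernel_odd[OF k]) (auto intro!: continuous_intros)
  finally show ?thesis by simp
 qed
 have step: "kgrad rh Om n u y \<bullet> ph y = (LI x. A y x * u x)" for y
 proof (cases "y : K")
  case False
  thus ?thesis using phK[of y] Az[of y] by simp
 next
  case True
  have yOm: "y : Om" using inner[OF True, of y] R n by simp
  define G where "G x = (ind Om x * ind Om y * (real n)\<^sup>2 * rescaled rh n (x - y) * (u x - u y)) *R (x - y)" for x
  have GOm: "G x = ((real n)\<^sup>2 * rescaled rh n (x - y) * (u x - u y)) *R (x - y)" for x
  using inner[OF True, of x] yOm rescaled_zero[OF k n, of "x - y"] by (cases "x : Om") (auto simp: G_def not_le[symmetric])
  have Gi: "intl G"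
  proof -
  obtain Br where Br: "!!x. rh x <= Br" using kernel_props(7)[OF k] by blast
  have zero: "rescaled rh n (x - y) = 0" if "x ~: cball 0 r" for x
  proof (rule rescaled_zero[OF k n])
  have "norm x <= norm y + norm (x - y)" using norm_triangle_ineq2[of x y] by simp
  thus "R / real n < norm (x - y)" using that b(2)[OF True] unfolding r_def by simp
  qed
  have vint: "intl (%x. ind (cball 0 r) x *R (u x - u y))"
  proof -
  have "intl (%x::real^'d. ind (cball 0 r) x *R u y)"
  by (rule integrable_bounded_support[where B = "\<bar>u y\<bar>" and r = r]) (auto simp: indicator_def)
  hence "intl (%x. ind (cball 0 r) x *R u x - ind (cball 0 r) x *R u y)"
  by (intro Bochner_Integration.integrable_diff uint)
  thus ?thesis by (simp add: algebra_simps)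
  qed
  have "intl (%x. ((real n)\<^sup>2 * rescaled rh n (x - y) * ((x - y) \<bullet> e)) *R (u x - u y))" for e
  proof -
  have hc: "cts (%x. (real n)\<^sup>2 * rescaled rh n (x - y) * ((x - y) \<bullet> e))"
  by (intro continuous_intros resc)
  have "bounded ((%x. (real n)\<^sup>2 * rescaled rh n (x - y) * ((x - y) \<bullet> e)) ` cball 0 r)"
  by (intro compact_imp_bounded compact_continuous_image continuous_on_subset[OF hc]) auto
  then obtain Bh where Bh: "Bh > 0" "!!x. x : cball 0 r ==> \<bar>(real n)\<^sup>2 * rescaled rh n (x - y) * ((x - y) \<bullet> e)\<bar> <= Bh"
  by (auto simp: bounded_pos)
  show ?thesis
  proof (rule bounded_times_integrable[OF _ vint])
  show "(%x. (real n)\<^sup>2 * rescaled rh n (x - y) * ((x - y) \<bullet> e)) : Bm"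
  using hc by (rule bm_contI)
  show "\<bar>(real n)\<^sup>2 * rescaled rh n (x - y) * ((x - y) \<bullet> e)\<bar> <= Bh" for x
  using Bh zero[of x] by (cases "x : cball 0 r") auto
  qed (use zero in auto)
  qed
  hence "intl (%x. \<Sum>e\<in>Basis. (((real n)\<^sup>2 * rescaled rh n (x - y) * ((x - y) \<bullet> e)) *R (u x - u y)) *R e)"
  by (intro Bochner_Integration.integrable_sum integrable_scaleR_left) auto
  moreover have "(\<Sum>e\<in>Basis. (((real n)\<^sup>2 * rescaled rh n (x - y) * ((x - y) \<bullet> e)) *R (u x - u y)) *R e) = G x" for x
  proof -
  have "(\<Sum>e\<in>Basis. (((real n)\<^sup>2 * rescaled rh n (x - y) * ((x - y) \<bullet> e)) *R (u x - u y)) *R e)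
  = (\<Sum>e\<in>Basis. (G x \<bullet> e) *R e)"
  by (intro sum.cong) (auto simp: GOm algebra_simps)
  thus ?thesis by (simp add: euclidean_representation)
  qed
  ultimately show ?thesis by (simp only:)
  qed
  have "kgrad rh Om n u y \<bullet> ph y = (LI x. G x \<bullet> ph y)"
  unfolding kgrad_def G_def[symmetric] using Gi by (intro integral_inner_left[symmetric])
  also have "... = (LI x. A y x * u x - u y * A y x)"
  by (intro lint_cong) (auto simp: GOm A_def algebra_simps)
  also have "... = (LI x. A y x * u x) - u y * (LI x. A y x)"
  using int1 int2 by simp
  finally show ?thesis by (simp add: odd)
 qed
 have pint: "integrable (lborel \<Otimes>\<^sub>M lborel) (%(x, y). A y x * u x)"
 proof (rule integrableI_bounded)
  have m: "(%(x, y). A y x * u x) : borel_measurable (borel \<Otimes>\<^sub>M borel)" by measurable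
  thus "(%(x, y). A y x * u x) : borel_measurable (lborel \<Otimes>\<^sub>M lborel)" by (simp add: lborel_prod borel_prod)
  have m': "(%z. en (norm (case z of (x, y) => A y x * u x))) : borel_measurable (lborel \<Otimes>\<^sub>M lborel)"
  using m by (simp add: lborel_prod borel_prod)
  have "(\<integral>\<^sup>+z. en (norm (case z of (x, y) => A y x * u x)) \<partial>(lborel \<Otimes>\<^sub>M lborel))
  = (NI x. (NI y. en \<bar>A y x * u x\<bar>))"
  by (subst lborel.nn_integral_fst[symmetric, OF m']) simp
  also have "... <= (NI (x::real^'d). (NI (y::real^'d). (en B * en (norm (ind (cball 0 r) x *R u x))) * ind (cball 0 b) y))"
  proof (intro nn_integral_mono)
  fix x y :: "real^'d"
  show "en \<bar>A y x * u x\<bar> <= (en B * en (norm (ind (cball 0 r) x *R u x))) * ind (cball 0 b) y"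
  proof (cases "r < norm x \<or> b < norm y")
  case True
  thus ?thesis using Asupp[of x y] by auto
  next
  case False
  have "\<bar>A y x * u x\<bar> <= B * \<bar>u x\<bar>" unfolding abs_mult by (intro mult_right_mono Ab) auto
  thus ?thesis using False B(1) by (auto simp: ennreal_mult[symmetric] not_less intro!: ennreal_leI)
  qed
  qed
  also have "... = (NI (x::real^'d). (en B * en (norm (ind (cball 0 r) x *R u x))) * emeasure lborel (cball (0::real^'d) b))"
  by (subst nn_integral_cmult_indicator) auto
  also have "... = en B * (NI x. en (norm (ind (cball 0 r) x *R u x))) * emeasure lborel (cball (0::real^'d) b)"
  proof -
  have [measurable]: "cball (0::real^'d) r : sets borel" by simp
  show ?thesis by (simp add: nn_integral_cmult nn_integral_multc)
  qed
  also have "... < \<infinity>"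
  using uint[of r] emeasure_bounded_finite[of "cball (0::real^'d) b"]
  by (auto simp: integrable_iff_bounded ennreal_mult_less_top)
  finally show "(\<integral>\<^sup>+z. en (norm (case z of (x, y) => A y x * u x)) \<partial>(lborel \<Otimes>\<^sub>M lborel)) < \<infinity>" .
 qed
 have "(LI y. kgrad rh Om n u y \<bullet> ph y) = (LI y. (LI x. A y x * u x))" by (simp add: step)
 also have "... = (LI x. (LI y. A y x * u x))"
  by (rule lborel_pair.Fubini_integral[OF pint])
 also have "... = (LI x. u x * ktheta rh n ph x)"
 proof (rule lint_cong[OF refl])
  fix x
  have "(LI y. A y x) = \<bar>1 / real n\<bar> ^ DIM(real^'d) *R (LI z. A (x + (1 / real n) *R z) x)"
  using n by (intro integral_lborel_affine) auto
  also have "(LI z. A (x + (1 / real n) *R z) x) = (LI z. (- real n * real n ^ CARD('d)) * (rh z * (z \<bullet> ph (x + (1 / real n) *R z))))"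
  proof (rule lint_cong[OF refl])
  fix z :: "real^'d"
  \<comment> \<open>Here \<open>x - y\<close> is minus z / n. The kernel is even and absorbs the
    sign, the other factor turns it into the minus in \<open>ktheta\<close>.\<close>
  have "rh (- z) = rh z" by (rule kernel_props(6)[OF k]) simp
  thus "A (x + (1 / real n) *R z) x = (- real n * real n ^ CARD('d)) * (rh z * (z \<bullet> ph (x + (1 / real n) *R z)))"
  using n by (simp add: A_def rescaled_def power2_eq_square)
  qed
  also have "... = (- real n * real n ^ CARD('d)) * (LI z. rh z * (z \<bullet> ph (x + (1 / real n) *R z)))"
  by (rule integral_mult_right_zero)
  finally have "(LI y. A y x) = ktheta rh n ph x" using n by (simp add: ktheta_def field_simps)
  thus "(LI y. A y x * u x) = u x * ktheta rh n ph x" by simp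
 qed
 finally show ?thesis .
qed

lemma linear_vec_expansion:
 fixes f :: "real^'d => 'b::real_vector"
 assumes "linear f" shows "f x = (\<Sum>i\<in>UNIV. x $ i *R f (axis i 1))"
proof -
 have "x = (\<Sum>i\<in>UNIV. x $ i *R axis i 1)"
  by (simp add: vec_eq_iff axis_def if_distrib sum.delta cong: if_cong)
 hence "f x = f (\<Sum>i\<in>UNIV. x $ i *R axis i 1)" by simp
 also have "... = (\<Sum>i\<in>UNIV. x $ i *R f (axis i 1))"
  using assms by (simp add: linear_sum linear_scale)
 finally show ?thesis .
qed

definition weighted_div :: "(real^'d => real) => (real^'d => real^'d) => real^'d => real" where
 "weighted_div rh ph x = (\<Sum>i\<in>UNIV. kernel_moment rh i * fder ph (at x) (axis i 1) $ i)"

lemma C1_derivative: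
 fixes ph :: "'a::euclidean_space => 'b::euclidean_space"
 assumes ph: "C_k 1 ph" and z: "!!x. r < norm x ==> ph x = 0"
 shows "(ph has_derivative fder ph (at x)) (at x)"
  "cts (%x. fder ph (at x) v)"
  "r < norm x ==> fder ph (at x) v = 0"
proof -
 have C: "C_k (Suc 0) ph" using ph by simp
 show "(ph has_derivative fder ph (at x)) (at x)" by (rule C_k_SucD(1)[OF C])
 show "cts (%x. fder ph (at x) v)" using C_k_SucD(2)[OF C] by simp
 show "r < norm x ==> fder ph (at x) v = 0"
 proof (rule frechet_derivative_outside_supp)
  assume "r < norm x"
  moreover have "supp ph <= cball 0 r" by (rule supp_subsetI) (use z in auto)
  ultimately show "x ~: supp ph" by auto
 qed
qed

text \<open>Taylor expansion of \<open>ph\<close>: the constant term is odd and integrates to 0, in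
  the linear term only the diagonal second moments survive, and the remainder is uniformly small by
  uniform continuity of the derivative.\<close>

lemma ktheta_uniform:
 fixes rh :: "real^'d => real" and ph :: "real^'d => real^'d"
 assumes k: "is_kernel rh R" and ph: "C_k 1 ph" and z: "!!x. r < norm x ==> ph x = 0" and e: "0 < e"
 obtains N where "0 < N" "!!n x. n >= N ==> \<bar>ktheta rh n ph x + weighted_div rh ph x\<bar> <= e"
proof -
 have R: "R > 0" and rc: "cts rh" by (rule kernel_props[OF k])+
 note D = C1_derivative[OF ph z]
 have phc: "cts ph" by (rule C_k_continuous[OF ph])
 define I where "I = (LI z. rh z)"
 have I: "I >= 0" unfolding I_def using kernel_props(1)[OF k] by simp
 \<comment> \<open>The remainder contributes at most the product of \<open>I\<close>, R^2, the
   dimension and \<open>e1\<close>; \<open>I + 1\<close> keeps the division safe.\<close>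
 define e1 where "e1 = e / (R\<^sup>2 * (I + 1) * real CARD('d))"
 have dpos: "real CARD('d) > 0" by simp
 have e1: "e1 > 0" using e R I dpos by (simp add: e1_def)
 have "EX d>0. ALL x y. dist x y < d --> dist (fder ph (at x) (axis i 1)) (fder ph (at y) (axis i 1)) < e1" for i
  by (rule uniformly_continuous_bounded_support[OF D(2), where e = e1]) (use D(3) e1 in auto)
 then obtain d where d: "!!i. d i > 0" "!!i x y. dist x y < d i ==>
  dist (fder ph (at x) (axis i 1)) (fder ph (at y) (axis i 1)) < e1" by metis
 define de where "de = Min (range d)"
 have de: "de > 0" "!!i. de <= d i" unfolding de_def using d(1) by auto
 have on: "onorm (%v. fder ph (at y) v - fder ph (at x) v) <= real CARD('d) * e1"
  if "dist y x < de" for x y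
 proof (rule onorm_bound)
  show "0 <= real CARD('d) * e1" using e1 by simp
  fix v :: "real^'d"
  have lin: "linear (%v. fder ph (at y) v - fder ph (at x) v)"
  using D(1) by (intro linear_compose_sub has_derivative_linear) auto
  have "norm (fder ph (at y) v - fder ph (at x) v)
  = norm (\<Sum>i\<in>UNIV. v $ i *R (fder ph (at y) (axis i 1) - fder ph (at x) (axis i 1)))"
  by (subst linear_vec_expansion[OF lin]) simp
  also have "... <= (\<Sum>i\<in>(UNIV :: 'd set). norm v * e1)"
  proof (rule sum_norm_le)
  fix i :: 'd
  have "dist y x < d i" using that de(2)[of i] by linarith
  from d(2)[OF this] show "norm (v $ i *R (fder ph (at y) (axis i 1) - fder ph (at x) (axis i 1))) <= norm v * e1"
  using component_le_norm_cart[of v i] by (simp add: dist_norm mult_mono)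
  qed
  also have "... = real CARD('d) * e1 * norm v" by simp
  finally show "norm (fder ph (at y) v - fder ph (at x) v) <= real CARD('d) * e1 * norm v" .
 qed
 obtain N :: nat where N: "R / de < real N" using reals_Archimedean2 by blast
 have N0: "N > 0" using N R de(1) by (metis divide_pos_pos less_asym of_nat_0 neq0_conv)
 have main: "\<bar>ktheta rh n ph x + weighted_div rh ph x\<bar> <= e" if n: "n >= N" for n x
 proof -
  have n0: "real n > 0" using n N0 by simp
  have Rn: "R / real n < de"
  proof -
  have "R / de < real n" using N n by linarith
  thus ?thesis using n0 de(1) by (simp add: field_simps)
  qed
  let ?D = "fder ph (at x)"
  define rem where "rem z = ph (x + (1 / real n) *R z) - ph x - (1 / real n) *R ?D z" for z
  have linD: "linear ?D" using D(1) by (rule has_derivative_linear)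
  have Dc: "cts ?D" using linD by (simp add: linear_continuous_on linear_conv_bounded_linear)
  have pc: "cts (%z. ph (x + (1 / real n) *R z))"
  by (intro continuous_on_compose2[OF phc] continuous_intros) auto
  have i1: "intl (%z. rh z * (z \<bullet> ph (x + (1 / real n) *R z)))"
  using kernel_moment_integrable[OF k, of "%z. z \<bullet> ph (x + (1 / real n) *R z)"] pc
  by (simp add: continuous_intros)
  have i2: "intl (%z. rh z * (z \<bullet> ph x))"
  using kernel_moment_integrable[OF k, of "%z. z \<bullet> ph x"] by (simp add: continuous_intros)
  have i3: "intl (%z. rh z * (z \<bullet> ?D z))"
  using kernel_moment_integrable[OF k, of "%z. z \<bullet> ?D z"] Dc by (simp add: continuous_intros)
  have i4: "intl (%z. rh z * (z $ i * z $ j))" for i j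
  proof -
  have "cts (%z::real^'d. z $ i * z $ j)" by (intro continuous_intros)
  from kernel_moment_integrable[OF k this] show ?thesis by simp
  qed
  have z2: "(LI z. rh z * (z \<bullet> ph x)) = 0"
  using kernel_odd[OF k, of "%z. z \<bullet> ph x"] by (simp add: continuous_intros)
  have w3: "(LI z. rh z * (z \<bullet> ?D z)) = weighted_div rh ph x"
  proof -
  have "rh z * (z \<bullet> ?D z) = (\<Sum>j\<in>UNIV. \<Sum>i\<in>UNIV. (?D (axis j 1) $ i) * (rh z * (z $ i * z $ j)))" for z
  proof -
  have "z \<bullet> ?D z = (\<Sum>j\<in>UNIV. z $ j * (z \<bullet> ?D (axis j 1)))"
  by (subst linear_vec_expansion[OF linD]) (simp add: inner_sum_right)
  also have "... = (\<Sum>j\<in>UNIV. \<Sum>i\<in>UNIV. (?D (axis j 1) $ i) * (z $ i * z $ j))"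
  by (simp add: inner_vec_def sum_distrib_left algebra_simps)
  finally show ?thesis by (simp add: sum_distrib_left algebra_simps)
  qed
  hence "(LI z. rh z * (z \<bullet> ?D z))
  = (LI z. (\<Sum>j\<in>UNIV. \<Sum>i\<in>UNIV. (?D (axis j 1) $ i) * (rh z * (z $ i * z $ j))))" by (simp only:)
  also have "... = (\<Sum>j\<in>UNIV. \<Sum>i\<in>UNIV. (?D (axis j 1) $ i) * (LI z. rh z * (z $ i * z $ j)))"
  using i4 by (simp add: Bochner_Integration.integral_sum)
  also have "... = (\<Sum>j\<in>UNIV. \<Sum>i\<in>UNIV. if i = j then (?D (axis j 1) $ j) * kernel_moment rh j else 0)"
  using kernel_moment_offdiag[OF k] by (intro sum.cong refl) (auto simp: kernel_moment_def power2_eq_square)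
  also have "... = weighted_div rh ph x" by (simp add: weighted_div_def mult.commute)
  finally show ?thesis .
  qed
  have km: "ktheta rh n ph x + weighted_div rh ph x = - real n * (LI z. rh z * (z \<bullet> rem z))"
  proof -
  have "(LI z. rh z * (z \<bullet> rem z)) = (LI z. rh z * (z \<bullet> ph (x + (1 / real n) *R z)) - rh z * (z \<bullet> ph x) - (1 / real n) * (rh z * (z \<bullet> ?D z)))"
  by (simp add: rem_def inner_diff_right algebra_simps)
  also have "... = (LI z. rh z * (z \<bullet> ph (x + (1 / real n) *R z))) - 0 - (1 / real n) * weighted_div rh ph x"
  using i1 i2 i3 z2 w3 by simp
  finally show ?thesis using n0 unfolding ktheta_def by (simp add: field_simps)
  qed
  have bd: "\<bar>(LI z. rh z * (z \<bullet> rem z))\<bar> <= (LI z. rh z * (R * (R / real n * (real CARD('d) * e1))))"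
  proof (rule integral_abs_bound_integral)
  have "cts (%z. z \<bullet> rem z)" unfolding rem_def by (intro continuous_intros pc Dc)
  from kernel_moment_integrable[OF k this] show "intl (%z. rh z * (z \<bullet> rem z))" by simp
  have "cts (%z::real^'d. R * (R / real n * (real CARD('d) * e1)))" by (intro continuous_intros)
  from kernel_moment_integrable[OF k this] show "intl (%z. rh z * (R * (R / real n * (real CARD('d) * e1))))" by simp
  fix z
  show "\<bar>rh z * (z \<bullet> rem z)\<bar> <= rh z * (R * (R / real n * (real CARD('d) * e1)))"
  proof (cases "R < norm z")
  case True
  thus ?thesis using kernel_props(5)[OF k True] by simp
  next
  case False
  define h where "h = (1 / real n) *R z"
  have h: "norm h <= R / real n" using False n0 by (simp add: h_def field_simps)
  have hd: "norm h < de" using h Rn by linarith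
  have Dh: "(1 / real n) *R ?D z = ?D ((x + h) - x)" using linD by (simp add: h_def linear_scale)
  have "norm (ph (x + h) - ph x - ?D ((x + h) - x)) <= norm ((x + h) - x) * (real CARD('d) * e1)"
  proof (rule differentiable_bound_linearization[where S = "ball x de" and f' = "%y. fder ph (at y)"])
  show "x + t *R (x + h - x) : ball x de" if "t : {0..1}" for t
  proof -
  have "t * norm h <= 1 * norm h" using that by (intro mult_right_mono) auto
  thus ?thesis using hd that by (simp add: dist_norm)
  qed
  show "(ph has_derivative fder ph (at y)) (at y within ball x de)" for y
  by (rule has_derivative_at_withinI[OF D(1)])
  show "onorm (fder ph (at y) - ?D) <= real CARD('d) * e1" if "y : ball x de" for y
  using on[of y x] that by (simp add: fun_diff_def dist_commute)
  show "x : ball x de" using de(1) by simp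
  qed
  hence "norm (rem z) <= norm h * (real CARD('d) * e1)"
  unfolding rem_def h_def[symmetric] Dh by simp
  also have "... <= R / real n * (real CARD('d) * e1)" using h e1 by (intro mult_right_mono) auto
  finally have rz: "norm (rem z) <= R / real n * (real CARD('d) * e1)" .
  have "\<bar>z \<bullet> rem z\<bar> <= norm z * norm (rem z)" by (rule Cauchy_Schwarz_ineq2)
  also have "... <= R * (R / real n * (real CARD('d) * e1))" using False rz R by (intro mult_mono) auto
  finally have zr: "\<bar>z \<bullet> rem z\<bar> <= R * (R / real n * (real CARD('d) * e1))" .
  show ?thesis unfolding abs_mult abs_of_nonneg[OF kernel_props(1)[OF k]]
  by (rule mult_left_mono[OF zr kernel_props(1)[OF k]])
  qed
  qed
  also have "(LI z. rh z * (R * (R / real n * (real CARD('d) * e1)))) = I * (R * (R / real n * (real CARD('d) * e1)))"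
  unfolding I_def by (rule integral_mult_left_zero)
  finally have bd2: "\<bar>(LI z. rh z * (z \<bullet> rem z))\<bar> <= I * (R * (R / real n * (real CARD('d) * e1)))" .
  have "\<bar>ktheta rh n ph x + weighted_div rh ph x\<bar> = real n * \<bar>(LI z. rh z * (z \<bullet> rem z))\<bar>"
  unfolding km using n0 by (simp add: abs_mult)
  also have "... <= real n * (I * (R * (R / real n * (real CARD('d) * e1))))"
  by (rule mult_left_mono[OF bd2]) (use n0 in simp)
  also have "... = I * (R\<^sup>2 * real CARD('d) * e1)" using n0 by (simp add: power2_eq_square)
  also have "... <= (I + 1) * (R\<^sup>2 * real CARD('d) * e1)" using e1 by (intro mult_right_mono) auto
  also have "... = (R\<^sup>2 * (I + 1) * real CARD('d)) * e1" by (simp only: mult_ac)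
  also have "... = e"
  proof -
  have "R\<^sup>2 * (I + 1) * real CARD('d) ~= 0" using R I by simp
  thus ?thesis unfolding e1_def by simp
  qed
  finally show ?thesis .
 qed
 show ?thesis by (rule that[OF N0 main])
qed

lemma ktheta_support:
 fixes ph :: "real^'d => real^'d"
 assumes k: "is_kernel rh R" and z: "!!x. r < norm x ==> ph x = 0" and n: "0 < n" and x: "r + R < norm x"
 shows "ktheta rh n ph x = 0"
proof -
 have "rh z * (z \<bullet> ph (x + (1 / real n) *R z)) = 0" for z
 proof (cases "R < norm z")
  case True
  thus ?thesis using kernel_props(5)[OF k True] by simp
 next
  case False
  have "norm ((1 / real n) *R z) <= 1 * norm z" unfolding norm_scaleR using n by (intro mult_right_mono) auto
  hence "norm ((1 / real n) *R z) <= R" using False by simp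
  moreover have "norm x <= norm (x + (1 / real n) *R z) + norm ((1 / real n) *R z)"
  using norm_triangle_ineq4[of "x + (1 / real n) *R z" "(1 / real n) *R z"] by simp
  ultimately have "r < norm (x + (1 / real n) *R z)" using x by linarith
  thus ?thesis using z by simp
 qed
 hence "(LI z. rh z * (z \<bullet> ph (x + (1 / real n) *R z))) = 0"
  by (intro integral_eq_zero_AE AE_I2)
 thus ?thesis by (simp add: ktheta_def)
qed

lemma ktheta_measurable:
 fixes ph :: "real^'d => real^'d"
 assumes k: "is_kernel rh R" and ph[measurable]: "ph : Bm"
 shows "ktheta rh n ph : Bm"
proof -
 have [measurable]: "rh : Bm" by (rule kernel_props[OF k])
 show ?thesis unfolding ktheta_def[abs_def] by measurable
qed

section \<open>Space-time versions of the averaged gradient\<close>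

lemma pint_prod:
 fixes h :: "real \<times> 'a::euclidean_space => 'b::euclidean_space"
 assumes "h : Bm"
 shows "pil p h = (NI t. pil p (%x. h (t, x)))"
proof -
 have [measurable]: "h : borel_measurable (lborel \<Otimes>\<^sub>M lborel)" using assms by (simp add: lborel_prod)
 have "pil p h = (\<integral>\<^sup>+z. en (norm (h z) powr p) \<partial>(lborel \<Otimes>\<^sub>M lborel))"
  by (simp add: pint_def lborel_prod)
 also have "... = (NI t. (NI x. en (norm (h (t, x)) powr p)))"
  by (subst lborel.nn_integral_fst[symmetric]) auto
 finally show ?thesis by (simp add: pint_def)
qed

lemma slice_measurable:
 fixes h :: "'t::euclidean_space \<times> 'a::euclidean_space => 'b::euclidean_space"
 assumes "h : Bm"
 shows "(%x. h (t, x)) : Bm"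
proof -
 have "h : borel_measurable (borel \<Otimes>\<^sub>M borel)" using assms by (simp add: borel_prod)
 thus ?thesis by measurable
qed

lemma pint_slice_measurable:
 fixes h :: "real \<times> 'a::euclidean_space => 'b::euclidean_space"
 assumes "h : Bm"
 shows "(%t. pil p (%x. h (t, x))) : Bm"
proof -
 have [measurable]: "h : borel_measurable (borel \<Otimes>\<^sub>M lborel)"
  using assms by (simp add: borel_prod[symmetric] cong: measurable_cong_sets)
 show ?thesis unfolding pint_def by measurable
qed

lemma AE_slice_finite:
 fixes h :: "real \<times> 'a::euclidean_space => 'b::euclidean_space"
 assumes h: "h : Bm" and fin: "pil p h < \<infinity>"
 shows "AE t in lborel. pil p (%x. h (t, x)) < \<infinity>"
proof -
 have "AE t in lborel. pil p (%x. h (t, x)) ~= \<infinity>"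
  using fin pint_slice_measurable[OF h, of p] unfolding pint_prod[OF h]
  by (intro nn_integral_PInf_AE) auto
 thus ?thesis by eventually_elim (simp add: top.not_eq_extremum)
qed

lemma integrable_bounded_region:
 fixes u :: "'a::euclidean_space => 'b::euclidean_space"
 assumes u: "u : Bm" and p: "1 <= p" and fin: "pil p u < \<infinity>"
 shows "intl (%x. ind (cball 0 r) x *R u x)"
proof (rule integrable_Lp_support[where A = "cball 0 r" and p = p])
 have [measurable]: "cball (0::'a) r : sets borel" by simp
 show "(%x. ind (cball 0 r) x *R u x) : borel_measurable lborel" using u by simp
 have "pil p (%x. ind (cball 0 r) x *R u x) <= pil p u"
  unfolding pint_def using p by (intro nn_integral_mono ennreal_leI powr_mono2) (auto simp: indicator_def)
 thus "pil p (%x. ind (cball 0 r) x *R u x) < \<infinity>" using fin by simp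
 show "emeasure lborel (cball (0::'a) r) < \<infinity>" by (rule emeasure_bounded_finite) simp
qed (use p in auto)

definition kgradt :: "(real^'d => real) => (real^'d) set => nat => (real \<times> (real^'d) => real) => real \<times> (real^'d) => real^'d" where
 "kgradt rh Om n f z = kgrad rh Om n (%x. f (fst z, x)) (snd z)"

lemma kgradt_measurable:
 assumes k: "is_kernel rh R" and Om[measurable]: "Om : sets borel" and f: "f : Bm"
 shows "kgradt rh Om n f : Bm"
proof -
 have [measurable]: "f : borel_measurable (borel \<Otimes>\<^sub>M borel)" using f by (simp add: borel_prod)
 have [measurable]: "rescaled rh n : Bm"
  by (rule rescaled_measurable) (rule kernel_props[OF k])
 have "kgradt rh Om n f : borel_measurable (borel \<Otimes>\<^sub>M borel)"
  unfolding kgradt_def[abs_def] kgrad_def by measurable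
 thus ?thesis by (simp add: borel_prod)
qed

lemma kgradt_bound:
 fixes rh :: "real^'d => real"
 assumes k: "is_kernel rh R" and n: "0 < n" and p: "1 <= p"
  and Om: "Om : sets borel" and f: "f : Bm"
 shows "pil p (kgradt rh Om n f) <= en ((LI z. rh z) powr (p - 1) * R powr p) *
  (en (real n powr p) * (NI t. kenergy p rh Om n (%x. f (t, x))))"
proof -
 have [measurable]: "f : borel_measurable (borel \<Otimes>\<^sub>M borel)" using f by (simp add: borel_prod)
 have [measurable]: "rescaled rh n : Bm"
  by (rule rescaled_measurable) (rule kernel_props[OF k])
 have em: "(%t. kenergy p rh Om n (%x. f (t, x))) : Bm"
  using Om unfolding kenergy_def by measurable
 have "pil p (kgradt rh Om n f) = (NI t. pil p (kgrad rh Om n (%x. f (t, x))))"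
  by (subst pint_prod[OF kgradt_measurable[OF k Om f]]) (simp add: kgradt_def)
 also have "... <= (NI t. en ((LI z. rh z) powr (p - 1) * R powr p) *
  (en (real n powr p) * kenergy p rh Om n (%x. f (t, x))))"
  by (intro nn_integral_mono kgrad_bound[OF k n p Om] slice_measurable f)
 also have "... = en ((LI z. rh z) powr (p - 1) * R powr p) *
  (en (real n powr p) * (NI t. kenergy p rh Om n (%x. f (t, x))))"
  using em by (simp add: nn_integral_cmult)
 finally show ?thesis .
qed

lemma integral_prod_fst:
 fixes h :: "real \<times> 'a::euclidean_space => 'b::euclidean_space"
 assumes h: "intl h"
 shows "(LI z. h z) = (LI t. (LI x. h (t, x)))"
  "AE t in lborel. intl (%x. h (t, x))"
  "intl (%t. (LI x. h (t, x)))"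
proof -
 have "integrable (lborel \<Otimes>\<^sub>M lborel) (case_prod (%t x. h (t, x)))" using h by (simp add: lborel_prod)
 from lborel_pair.integral_fst'[of h] lborel_pair.AE_integrable_fst'[of h] lborel_pair.integrable_fst'[of h]
 show "(LI z. h z) = (LI t. (LI x. h (t, x)))"
  "AE t in lborel. intl (%x. h (t, x))"
  "intl (%t. (LI x. h (t, x)))"
  using h by (simp_all add: lborel_prod)
qed

lemma integrable_Lp_times_bounded:
 fixes h :: "'a::euclidean_space => 'b::euclidean_space" and w :: "'a => real"
 assumes p: "1 <= p" and h: "h : Bm" and fin: "pil p h < \<infinity>"
  and w: "w : Bm" and wb: "!!x. \<bar>w x\<bar> <= B" and w0: "!!x. r < norm x ==> w x = 0"
 shows "intl (%x. w x *R h x)"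
 by (rule bounded_times_integrable[OF w integrable_bounded_region[OF h p fin, of r] wb]) (use w0 in auto)

text \<open>The spatial identity holds for almost every t, namely where the slice has finite norm;
  integrability of both joint integrands allows it to be integrated over \<open>A\<close>.\<close>

lemma kgradt_pairing:
 fixes rh :: "real^'d => real" and f :: "real \<times> (real^'d) => real" and ph :: "real^'d => real^'d"
 assumes k: "is_kernel rh R" and n: "0 < n" and p: "1 <= p"
  and Om: "Om : sets borel" and f: "f : Bm"
  and f0: "!!t x. x ~: Om ==> f (t, x) = 0" and fp: "pil p f < \<infinity>"
  and Hp: "pil p (kgradt rh Om n f) < \<infinity>"
  and ph: "cts ph" and phK: "!!x. x ~: K ==> ph x = 0" and K: "compact K"
  and inner: "!!x y. y : K ==> norm (x - y) <= R / real n ==> x : Om"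
  and A[measurable]: "A : sets borel" and Ab: "A <= cball 0 a"
  and thb: "!!x. \<bar>ktheta rh n ph x\<bar> <= B"
 shows "(LI z. kgradt rh Om n f z \<bullet> (ind A (fst z) *R ph (snd z)))
  = (LI z. f z * (ind A (fst z) * ktheta rh n ph (snd z)))"
proof -
 have R: "R > 0" by (rule kernel_props[OF k])
 have phm[measurable]: "ph : Bm" using ph by (rule bm_contI)
 have tm[measurable]: "ktheta rh n ph : Bm" by (rule ktheta_measurable[OF k phm])
 obtain b where b: "b > 0" "!!x. x : K ==> norm x <= b" using compact_imp_bounded[OF K] by (auto simp: bounded_pos)
 have ph0: "ph x = 0" if "b < norm x" for x using that b(2)[of x] phK[of x] by force
 obtain C where C: "!!x. norm (ph x) <= C"
 proof -
  have "bounded (ph ` cball 0 b)"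
  by (intro compact_imp_bounded compact_continuous_image continuous_on_subset[OF ph]) auto
  then obtain C where "C > 0" "!!x. x : cball 0 b ==> norm (ph x) <= C" by (auto simp: bounded_pos)
  hence "norm (ph x) <= C" for x using ph0[of x] by (cases "b < norm x") (auto simp: not_less)
  thus ?thesis by (rule that)
 qed
 have far: "t ~: A \<or> c < norm x" if "a + c < norm (t, x)" for c t and x :: "real^'d"
 proof (rule ccontr)
  assume "~ ?thesis"
  hence "norm t <= a" "norm x <= c" using Ab by auto
  thus False using that norm_Pair_le[of t x] by simp
 qed
 have prodm: "(%z. h1 (fst z) * h2 (snd z)) : Bm"
  if "h1 : Bm" "h2 : Bm" for h1 :: "real => real" and h2 :: "real^'d => real"
 proof -
  note that[measurable]
  have "(%z. h1 (fst z) * h2 (snd z)) : borel_measurable (borel \<Otimes>\<^sub>M borel)" by measurable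
  thus ?thesis by (simp add: borel_prod)
 qed
 have int1: "intl (%z. (ind A (fst z) * ktheta rh n ph (snd z)) *R f z)"
 proof (rule integrable_Lp_times_bounded[OF p f fp, where B = "\<bar>B\<bar>" and r = "a + (b + R)"])
  show "(%z. ind A (fst z) * ktheta rh n ph (snd z)) : Bm"
  by (rule prodm) measurable
  show "\<bar>ind A (fst x) * ktheta rh n ph (snd x)\<bar> <= \<bar>B\<bar>" for x
  using thb[of "snd x"] by (auto simp: indicator_def)
  show "ind A (fst x) * ktheta rh n ph (snd x) = 0" if "a + (b + R) < norm x" for x
  using far[of "b + R" "fst x" "snd x"] that ktheta_support[OF k, of b ph n "snd x"] ph0 n by auto
 qed
 have eq1: "(LI x. (ind A (fst (t, x)) * ktheta rh n ph (snd (t, x))) *R f (t, x))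
  = ind A t * (LI x. f (t, x) * ktheta rh n ph x)" for t
 proof -
  have "(LI x. (ind A (fst (t, x)) * ktheta rh n ph (snd (t, x))) *R f (t, x))
  = (LI x. ind A t * (f (t, x) * ktheta rh n ph x))"
  by (intro lint_cong) (auto simp: mult_ac)
  thus ?thesis by simp
 qed
 have int2: "intl (%z. kgradt rh Om n f z \<bullet> (ind A (fst z) *R ph (snd z)))"
 proof -
  have "intl (%z. ((ind A (fst z) * (ph (snd z) \<bullet> e)) *R kgradt rh Om n f z) \<bullet> e)" for e
  proof (rule integrable_inner_left, rule integrable_Lp_times_bounded[OF p kgradt_measurable[OF k Om f] Hp, where B = "C * norm e" and r = "a + b"])
  show "(%z. ind A (fst z) * (ph (snd z) \<bullet> e)) : Bm"
  by (rule prodm[of "ind A" "%x. ph x \<bullet> e"]) measurable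
  show "\<bar>ind A (fst x) * (ph (snd x) \<bullet> e)\<bar> <= C * norm e" for x
  proof -
  have "\<bar>ph (snd x) \<bullet> e\<bar> <= norm (ph (snd x)) * norm e" by (rule Cauchy_Schwarz_ineq2)
  also have "... <= C * norm e" by (intro mult_right_mono C) auto
  finally show ?thesis using order_trans[OF norm_ge_zero C] by (auto simp: indicator_def)
  qed
  show "ind A (fst x) * (ph (snd x) \<bullet> e) = 0" if "a + b < norm x" for x
  using far[of b "fst x" "snd x"] that ph0[of "snd x"] by auto
  qed
  hence "intl (%z. \<Sum>e\<in>Basis. ((ind A (fst z) * (ph (snd z) \<bullet> e)) *R kgradt rh Om n f z) \<bullet> e)"
  by (intro Bochner_Integration.integrable_sum)
  moreover have "(\<Sum>e\<in>Basis. ((ind A (fst z) * (ph (snd z) \<bullet> e)) *R kgradt rh Om n f z) \<bullet> e)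
  = kgradt rh Om n f z \<bullet> (ind A (fst z) *R ph (snd z))" for z
  by (subst (2) euclidean_inner) (simp add: algebra_simps)
  ultimately show ?thesis by (simp only:)
 qed
 have "(LI z. kgradt rh Om n f z \<bullet> (ind A (fst z) *R ph (snd z)))
  = (LI t. ind A t * (LI y. kgrad rh Om n (%x. f (t, x)) y \<bullet> ph y))"
  by (subst integral_prod_fst(1)[OF int2]) (simp add: kgradt_def)
 also have "... = (LI t. ind A t * (LI x. f (t, x) * ktheta rh n ph x))"
 proof (rule integral_cong_AE)
  have "(%t. (LI x. kgradt rh Om n f (t, x) \<bullet> (ind A (fst (t, x)) *R ph (snd (t, x))))) : borel_measurable lborel"
  by (rule borel_measurable_integrable[OF integral_prod_fst(3)[OF int2]])
  thus "(%t. ind A t * (LI y. kgrad rh Om n (%x. f (t, x)) y \<bullet> ph y)) : borel_measurable lborel"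
  by (simp add: kgradt_def)
  have "(%t. (LI x. (ind A (fst (t, x)) * ktheta rh n ph (snd (t, x))) *R f (t, x))) : borel_measurable lborel"
  by (rule borel_measurable_integrable[OF integral_prod_fst(3)[OF int1]])
  thus "(%t. ind A t * (LI x. f (t, x) * ktheta rh n ph x)) : borel_measurable lborel"
  by (simp only: eq1)
  show "AE t in lborel. ind A t * (LI y. kgrad rh Om n (%x. f (t, x)) y \<bullet> ph y)
  = ind A t * (LI x. f (t, x) * ktheta rh n ph x)"
  using AE_slice_finite[OF f fp]
  proof eventually_elim
  case (elim t)
  show ?case
  by (subst kgrad_pairing[OF k n Om slice_measurable[OF f] _ _ ph phK K inner])
  (use f0 integrable_bounded_region[OF slice_measurable[OF f] p elim] in auto)
  qed
 qed
 also have "... = (LI z. (ind A (fst z) * ktheta rh n ph (snd z)) *R f z)"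
  by (subst integral_prod_fst(1)[OF int1]) (simp only: eq1)
 finally show ?thesis by (simp add: mult.commute)
qed

lemma measurable_fst_snd:
 fixes h1 :: "real => real" and h2 :: "'a::euclidean_space => 'b::euclidean_space"
 assumes [measurable]: "h1 : Bm" "h2 : Bm"
 shows "(%z. h1 (fst z) *R h2 (snd z)) : Bm"
proof -
 have "(%z. h1 (fst z) *R h2 (snd z)) : borel_measurable (borel \<Otimes>\<^sub>M borel)" by measurable
 thus ?thesis by (simp add: borel_prod)
qed

lemma support_fst_snd:
 fixes t :: real and x :: "'a::euclidean_space"
 assumes "A <= cball 0 a" "a + c < norm (t, x)" "t : A"
 shows "c < norm x"
proof (rule ccontr)
 assume "~ ?thesis"
 moreover have "norm t <= a" using assms by auto
 ultimately show False using assms(2) norm_Pair_le[of t x] by simp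
qed

lemma weighted_div_props:
 fixes ph :: "real^'d => real^'d"
 assumes ph: "C_k 1 ph" and z0: "ALL x. r < norm x --> ph x = 0"
 shows "cts (weighted_div rh ph)" "r < norm x ==> weighted_div rh ph x = 0"
  "EX B>=0. ALL x. \<bar>weighted_div rh ph x\<bar> <= B"
proof -
 have D: "cts (%x. fder ph (at x) v)"
  "r < norm x ==> fder ph (at x) v = 0" for x v
  using C1_derivative(2,3)[OF ph, of r] z0 by auto
 show c: "cts (weighted_div rh ph)"
  unfolding weighted_div_def[abs_def] by (intro continuous_intros D(1))
 show z: "weighted_div rh ph x = 0" if "r < norm x" for x using D(2)[OF that] by (simp add: weighted_div_def)
 have "bounded (weighted_div rh ph ` cball 0 r)"
  by (intro compact_imp_bounded compact_continuous_image continuous_on_subset[OF c]) auto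
 then obtain B where "B > 0" "!!x. x : cball 0 r ==> \<bar>weighted_div rh ph x\<bar> <= B" by (auto simp: bounded_pos)
 hence "\<bar>weighted_div rh ph x\<bar> <= B" for x using z[of x] by (cases "r < norm x") (auto simp: not_less)
 thus "EX B>=0. ALL x. \<bar>weighted_div rh ph x\<bar> <= B" using \<open>B > 0\<close> by (intro exI[of _ B]) auto
qed

section \<open>Weak limits\<close>

text \<open>The hypotheses of the theorem for Borel representatives extended by zero, so that every
  slice is Borel and all integrals run over the whole space.\<close>

locale kernel_sequence =
 fixes T p M R :: real and Om :: "(real^'d) set" and rh :: "real^'d => real"
  and f :: "nat => real \<times> (real^'d) => real" and j :: "real => real"
 assumes k: "is_kernel rh R" and j: "unit_bump j" and T0: "0 < T" and p: "1 <= p" and Om: "open Om"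
  and fm: "!!n. 1 <= n ==> f n : Bm"
  and f0: "!!n z. 1 <= n ==> z ~: {0<..<T} \<times> Om ==> f n z = 0"
  and fb: "!!n. 1 <= n ==> pil p (f n) <= en M"
  and fe: "!!n. 1 <= n ==> ennreal (real n powr p) * (NI t. kenergy p rh Om n (%x. f n (t, x))) <= en M"
begin

lemma Omb: "Om : sets borel" using Om by simp

lemma fLp: "1 <= n ==> pil p (f n) < \<infinity>"
 using fb by (metis ennreal_less_top infinity_ennreal_def le_less_trans)

definition grad_bound :: real where
 "grad_bound = (LI z. rh z) powr (p - 1) * R powr p * max M 0"

lemma grad_estimate:
 assumes "1 <= n" shows "pil p (kgradt rh Om n (f n)) <= en grad_bound"
proof -
 have n: "0 < n" using assms by simp
 have "pil p (kgradt rh Om n (f n)) <= en ((LI z. rh z) powr (p - 1) * R powr p) *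
  (en (real n powr p) * (NI t. kenergy p rh Om n (%x. f n (t, x))))"
  by (rule kgradt_bound[OF k n p Omb fm[OF assms]])
 also have "... <= en ((LI z. rh z) powr (p - 1) * R powr p) * en (max M 0)"
  by (intro mult_left_mono order_trans[OF fe[OF assms]] ennreal_leI) auto
 also have "... = en grad_bound" unfolding grad_bound_def by (intro ennreal_mult[symmetric]) auto
 finally show ?thesis .
qed

text \<open>The constant depends neither on \<open>n\<close> nor on \<open>w\<close>. Hence
  uniformly small changes of a test function, such as replacing \<open>ktheta\<close> by its limit,
  do not affect limits of pairings.\<close>

lemma local_L1_bound:
 "EX C>=0. ALL n w e. 1 <= n --> w : Bm --> (ALL z. \<bar>w z\<bar> <= e) -->
  (ALL z. r < norm z --> w z = 0) --> \<bar>(LI z. f n z * w z)\<bar> <= C * e"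
proof -
 define S where "S = cball (0 :: real \<times> (real^'d)) r"
 define m where "m = measure lborel S"
 have Sm[measurable]: "S : sets borel" by (simp add: S_def)
 have m: "emeasure lborel S = en m"
  using emeasure_bounded_finite[of S] unfolding m_def S_def by (intro emeasure_eq_ennreal_measure) auto
 define C where "C = (m powr (p - 1) * max M 0) powr (1 / p)"
 show ?thesis
 proof (intro exI[of _ C] conjI allI impI)
  show "C >= 0" by (simp add: C_def)
  fix n :: nat and w :: "real \<times> (real^'d) => real" and e :: real
  assume n: "1 <= n" and w[measurable]: "w : Bm"
  and we': "ALL z. \<bar>w z\<bar> <= e" and w0: "ALL z. r < norm z --> w z = 0"
  have we: "\<bar>w z\<bar> <= e" for z using we' by (rule spec)
  have e0: "e >= 0" by (rule order_trans[OF abs_ge_zero we[of 0]])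
  note fm[OF n, measurable]
  have "en (norm (LI z. f n z * w z) powr p) <= en (m powr (p - 1)) * pil p (%z. f n z * w z)"
  by (rule jensen_powr_support[where A = S]) (use p m w0 in \<open>auto simp: S_def\<close>)
  also have "pil p (%z. f n z * w z) <= pil p (%z. e *R f n z)"
  unfolding pint_def
  proof (intro nn_integral_mono ennreal_leI powr_mono2)
  fix z show "norm (f n z * w z) <= norm (e *R f n z)"
  using mult_left_mono[OF we[of z], of "\<bar>f n z\<bar>"] e0 by (simp add: abs_mult mult.commute)
  qed (use p in auto)
  also have "pil p (%z. e *R f n z) = en (e powr p) * pil p (f n)"
  using e0 by (subst pint_cmult) auto
  also have "... <= en (e powr p) * en (max M 0)"
  by (intro mult_left_mono order_trans[OF fb[OF n]] ennreal_leI) auto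
  finally have "en (norm (LI z. f n z * w z) powr p) <= en (m powr (p - 1) * (e powr p * max M 0))"
  by (simp add: ennreal_mult mult_left_mono)
  hence "norm (LI z. f n z * w z) powr p <= m powr (p - 1) * (e powr p * max M 0)"
  by (subst (asm) ennreal_le_iff) auto
  hence "(norm (LI z. f n z * w z) powr p) powr (1 / p) <= (m powr (p - 1) * (e powr p * max M 0)) powr (1 / p)"
  using p by (intro powr_mono2) auto
  thus "\<bar>(LI z. f n z * w z)\<bar> <= C * e"
  using p e0 by (simp add: powr_powr powr_mult C_def mult_ac)
 qed
qed

end

text \<open>The functionals in \<open>weak\<close> are those given by bounded functions of bounded
  support; \<open>bounded_pairing_dual\<close> shows that they belong to the dual.\<close>

locale weak_limit = kernel_sequence T p M R Om rh f j
 for T p M R :: real and Om :: "(real^'d) set" and rh f j +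
 fixes g :: "real \<times> (real^'d) => real"
 assumes gm: "g : Bm" and g0: "!!z. z ~: {0<..<T} \<times> Om ==> g z = 0"
  and gp: "pil p g < \<infinity>"
  and weak: "!!w B r. w : Bm ==> (!!z. \<bar>w z\<bar> <= B) ==> (!!z. r < norm z ==> w z = 0) ==>
  (%n. (LI z. f n z * w z)) \<longlonglongrightarrow> (LI z. g z * w z)"
begin

text \<open>The kernel is transposed onto the test field, where the convergence is uniform, and the
  result is paired with the weakly convergent \<open>f n\<close>: a strong limit against a weak
  one.\<close>

lemma pairing_limit:
 fixes ph :: "real^'d => real^'d"
 assumes A: "A : sets borel" and AT: "A <= {0<..<T}"
  and ph: "C_k 1 ph" and phs: "compact (supp ph)" "supp ph <= Om"
 shows "(%n. (LI z. kgradt rh Om n (f n) z \<bullet> (ind A (fst z) *R ph (snd z))))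
  \<longlonglongrightarrow> - (LI z. g z * (ind A (fst z) * weighted_div rh ph (snd z)))"
proof -
 have R: "R > 0" by (rule kernel_props[OF k])
 have Ab: "A <= cball 0 T" using AT by (auto simp: dist_real_def)
 obtain b where b: "b > 0" "!!x. x : supp ph ==> norm x <= b" using compact_imp_bounded[OF phs(1)] by (auto simp: bounded_pos)
 have ph0: "ph x = 0" if "b < norm x" for x using that b(2)[of x] not_in_supp[of x ph] by force
 have phc: "cts ph" by (rule C_k_continuous[OF ph])
 have phm: "ph : Bm" using phc by (rule bm_contI)
 have ph0': "ALL x. b < norm x --> ph x = 0" using ph0 by simp
 note W = weighted_div_props[OF ph ph0', where rh = rh]
 obtain B where B: "B >= 0" "!!x. \<bar>weighted_div rh ph x\<bar> <= B" using W(3) by blast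
 have Wm: "weighted_div rh ph : Bm" using W(1) by (rule bm_contI)
 have Am: "(ind A :: real => real) : Bm" using A by simp
 define w where "w z = ind A (fst z) * weighted_div rh ph (snd z)" for z
 have wm: "w : Bm" unfolding w_def using measurable_fst_snd[OF Am Wm] by simp
 have wB: "\<bar>w z\<bar> <= B" for z using B by (auto simp: w_def indicator_def)
 have w0: "w z = 0" if "T + b < norm z" for z
  using support_fst_snd[OF Ab, of b "fst z" "snd z"] that W(2) by (auto simp: w_def indicator_def)
 have lim1: "(%n. (LI z. f n z * w z)) \<longlonglongrightarrow> (LI z. g z * w z)"
  by (rule weak[OF wm wB w0])
 from local_L1_bound[of "T + (b + R)"] obtain C where C': "C >= 0 & (ALL n w e. 1 <= n --> w : Bm --> (ALL z. \<bar>w z\<bar> <= e) -->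
  (ALL z. T + (b + R) < norm z --> w z = 0) --> \<bar>(LI z. f n z * w z)\<bar> <= C * e)"
  by (elim exE)
 have C: "C >= 0" "!!n v e. 1 <= n ==> v : Bm ==> (!!z. \<bar>v z\<bar> <= e) ==>
  (!!z. T + (b + R) < norm z ==> v z = 0) ==> \<bar>(LI z. f n z * v z)\<bar> <= C * e"
  using C' by simp_all
 obtain d where d: "0 < d" "(\<Union>x\<in>supp ph. cball x d) <= Om"
  using compact_subset_open_imp_cball_epsilon_subset[OF phs(1) Om phs(2)] by auto
 \<comment> \<open>From \<open>Nd\<close> on, the neighbourhood of radius \<open>R / n\<close> of
   the support of \<open>ph\<close> stays inside the domain.\<close>
 obtain Nd :: nat where Nd: "R / d < real Nd" using reals_Archimedean2 by blast
 have Nd0: "Nd > 0" using Nd R d(1) by (metis divide_pos_pos less_asym of_nat_0 neq0_conv)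
 obtain N1 where N1: "0 < N1" "!!n x. n >= N1 ==> \<bar>ktheta rh n ph x + weighted_div rh ph x\<bar> <= 1"
  by (rule ktheta_uniform[OF k ph, where r = b and e = 1]) (use ph0 that in auto)
 have pair: "(LI z. kgradt rh Om n (f n) z \<bullet> (ind A (fst z) *R ph (snd z)))
  = (LI z. f n z * (ind A (fst z) * ktheta rh n ph (snd z)))"
  if n: "n >= max Nd N1" for n
 proof (rule kgradt_pairing[OF k _ p Omb fm _ fLp _ phc not_in_supp[of _ ph] phs(1) _ A Ab])
  have n1: "1 <= n" and n0: "0 < n" using n N1(1) by auto
  show "0 < n" "1 <= n" "1 <= n" using n0 n1 by auto
  show "f n (t, x) = 0" if "x ~: Om" for t x using f0[OF n1] that by auto
  show "pil p (kgradt rh Om n (f n)) < \<infinity>"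
  using grad_estimate[OF n1] by (metis ennreal_less_top infinity_ennreal_def le_less_trans)
  show "x : Om" if "y : supp ph" "norm (x - y) <= R / real n" for x y
  proof -
  have "R / d < real n" using Nd n by linarith
  hence "R / real n < d" using n0 d(1) by (simp add: field_simps)
  hence "x : cball y d" using that(2) by (simp add: dist_norm norm_minus_commute)
  thus ?thesis using d(2) that(1) by blast
  qed
  show "\<bar>ktheta rh n ph x\<bar> <= B + 1" for x
  using N1(2)[of n x] B(2)[of x] n by simp
 qed
 have "(%n. (LI z. f n z * (ind A (fst z) * ktheta rh n ph (snd z))) + (LI z. f n z * w z)) \<longlonglongrightarrow> 0"
 proof (rule LIMSEQ_I)
  fix e :: real assume e: "0 < e"
  define e1 where "e1 = e / (2 * (C + 1))"
  have e1: "e1 > 0" using e C(1) by (simp add: e1_def)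
  obtain N2 where N2: "0 < N2" "!!n x. n >= N2 ==> \<bar>ktheta rh n ph x + weighted_div rh ph x\<bar> <= e1"
  by (rule ktheta_uniform[OF k ph, where r = b and e = e1]) (use ph0 e1 that in auto)
  have "norm ((LI z. f n z * (ind A (fst z) * ktheta rh n ph (snd z))) + (LI z. f n z * w z) - 0) < e"
  if n: "n >= max N1 N2" for n
  proof -
  have n1: "1 <= n" and n0: "0 < n" using n N1(1) by auto
  have tm: "ktheta rh n ph : Bm" by (rule ktheta_measurable[OF k phm])
  define v1 where "v1 z = ind A (fst z) * ktheta rh n ph (snd z)" for z
  have v1m: "v1 : Bm" unfolding v1_def using measurable_fst_snd[OF Am tm] by simp
  have v10: "v1 z = 0" if "T + (b + R) < norm z" for z
  using support_fst_snd[OF Ab, of "b + R" "fst z" "snd z"] that ktheta_support[OF k, of b ph n "snd z"] ph0 n0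
  by (auto simp: v1_def indicator_def)
  have v1B: "\<bar>v1 z\<bar> <= B + 1" for z
  using N1(2)[of n "snd z"] B(2)[of "snd z"] B(1) n by (auto simp: v1_def indicator_def)
  have i1: "intl (%z. f n z * v1 z)"
  using integrable_Lp_times_bounded[OF p fm[OF n1] fLp[OF n1] v1m v1B v10] by (simp add: mult.commute)
  have i2: "intl (%z. f n z * w z)"
  using integrable_Lp_times_bounded[OF p fm[OF n1] fLp[OF n1] wm wB w0] by (simp add: mult.commute)
  have "(LI z. f n z * v1 z) + (LI z. f n z * w z) = (LI z. f n z * (v1 z + w z))"
  using i1 i2 by (simp add: distrib_left)
  moreover have "\<bar>(LI z. f n z * (v1 z + w z))\<bar> <= C * e1"
  proof (rule C(2)[OF n1])
  show "(%z. v1 z + w z) : Bm" using v1m wm by simp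
  show "\<bar>v1 z + w z\<bar> <= e1" for z
  using N2(2)[of n "snd z"] n e1 by (auto simp: v1_def w_def indicator_def)
  show "v1 z + w z = 0" if "T + (b + R) < norm z" for z using v10[OF that] w0[of z] that R by simp
  qed
  moreover have "C * e1 < e"
  proof -
  have "C * e1 <= (C + 1) * e1" using e1 by simp
  also have "... = e / 2"
  proof -
  have "C + 1 ~= 0" using C(1) by simp
  moreover have "c * (e / (2 * c)) = e / 2" if "c ~= 0" for c :: real using that by simp
  ultimately show ?thesis unfolding e1_def by blast
  qed
  finally show ?thesis using e by simp
  qed
  ultimately show ?thesis by (simp add: v1_def)
  qed
  thus "EX N. ALL n>=N. norm ((LI z. f n z * (ind A (fst z) * ktheta rh n ph (snd z))) + (LI z. f n z * w z) - 0) < e"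
  by blast
 qed
 from tendsto_diff[OF this lim1]
 have "(%n. (LI z. f n z * (ind A (fst z) * ktheta rh n ph (snd z)))) \<longlonglongrightarrow> - (LI z. g z * w z)" by simp
 thus ?thesis unfolding w_def
  by (rule Lim_transform_eventually) (rule eventually_sequentiallyI[of "max Nd N1"], rule pair[symmetric])
qed

text \<open>A field with a single nonzero component isolates one partial derivative in
  \<open>weighted_div\<close>.\<close>

lemma scalar_field:
 assumes ph: "ph : tests Om"
 shows "C_k 1 (%x. ph x *R axis i 1 :: real^'d)" "compact (supp (%x. ph x *R axis i 1 :: real^'d))"
  "supp (%x. ph x *R axis i 1 :: real^'d) <= Om"
  "weighted_div rh (%x. ph x *R axis i 1) x = kernel_moment rh i * fder ph (at x) (axis i 1)"
proof -
 have ph': "smooth ph" "compact (supp ph)" "supp ph <= Om" using ph by (auto simp: test_functions_def)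
 show "C_k 1 (%x. ph x *R axis i 1 :: real^'d)"
  by (rule C_k_bounded_linear_compose[OF bounded_linear_scaleR_left smooth_C_k[OF ph'(1)]])
 have s: "compact (supp (%x. ph x *R axis i 1 :: real^'d))" "supp (%x. ph x *R axis i 1 :: real^'d) <= supp ph"
  using compact_suppI[OF ph'(2), of "%x. ph x *R axis i 1 :: real^'d"] not_in_supp[of _ ph] by auto
 thus "compact (supp (%x. ph x *R axis i 1 :: real^'d))" "supp (%x. ph x *R axis i 1 :: real^'d) <= Om"
  using ph'(3) by auto
 have "((%x. ph x *R axis i 1 :: real^'d) has_derivative (%v. fder ph (at x) v *R axis i 1)) (at x)"
  by (rule bounded_linear.has_derivative[OF bounded_linear_scaleR_left smooth_has_derivative[OF ph'(1)]])
 hence d: "fder (%x. ph x *R axis i 1 :: real^'d) (at x) = (%v. fder ph (at x) v *R axis i 1)"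
  by (rule frechet_derivative_at[symmetric])
 have "weighted_div rh (%x. ph x *R axis i 1) x
  = (\<Sum>l\<in>UNIV. if l = i then kernel_moment rh i * fder ph (at x) (axis i 1) else 0)"
  unfolding weighted_div_def d by (intro sum.cong) (auto simp: axis_def)
 thus "weighted_div rh (%x. ph x *R axis i 1) x = kernel_moment rh i * fder ph (at x) (axis i 1)"
  by simp
qed

text \<open>Weak closedness is applied with the products of a time set, a test function and a
  coordinate vector as tests. The limit is a gradient weighted by the moments, which are then
  divided out.\<close>

lemma joint_gradient:
 assumes p1: "1 < p"
 obtains Ga :: "real \<times> (real^'d) => real^'d" where "Ga : Bm" "pil p Ga < \<infinity>"
  "!!A ph i. A : sets borel ==> A <= {0<..<T} ==> ph : tests Om ==>
  (LI z. ind A (fst z) * (Ga z $ i * ph (snd z)))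
  = - (LI z. ind A (fst z) * (g z * fder ph (at (snd z)) (axis i 1)))"
proof -
 define I where "I = {(A, ph, i :: 'd). A : sets borel & A <= {0<..<T} & ph : tests Om}"
 define Ph where "Ph = (%(A :: real set, ph :: real^'d => real, i :: 'd) z. ind A (fst z) *R (ph (snd z) *R axis i 1) :: real^'d)"
 define L where "L = (%(A :: real set, ph :: real^'d => real, i :: 'd). - (LI z. g z * (ind A (fst z) * weighted_div rh (%x. ph x *R axis i 1) (snd z))))"
 have p0: "p >= 1" using p1 by simp
 obtain G where G: "G : Lp_space p lborel" "!!a. a : I ==> (LI z. G z \<bullet> Ph a z) = L a"
 proof (rule weak_closedness[OF p1, of "%n. kgradt rh Om (Suc n) (f (Suc n))" lborel grad_bound I Ph L])
  show "kgradt rh Om (Suc n) (f (Suc n)) : borel_measurable lborel" for n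
  using kgradt_measurable[OF k Omb fm[of "Suc n"]] by simp
  show "pil p (kgradt rh Om (Suc n) (f (Suc n))) <= en grad_bound" for n
  by (rule grad_estimate) simp
  fix a assume "a : I"
  then obtain A ph i where a: "a = (A, ph, i)" "A : sets borel" "A <= {0<..<T}" "ph : tests Om"
  by (auto simp: I_def)
  have ph': "smooth ph" "compact (supp ph)" using a by (auto simp: test_functions_def)
  have phc: "cts ph" by (rule smooth_continuous[OF ph'(1)])
  have vm: "(%x. ph x *R axis i 1 :: real^'d) : Bm"
  by (intro bm_contI continuous_intros phc)
  have Am: "(ind A :: real => real) : Bm" using a by simp
  have "Ph a : Bm" unfolding Ph_def a using measurable_fst_snd[OF Am vm] by simp
  thus "Ph a : borel_measurable lborel" by simp
  obtain b where b: "b > 0" "!!x. x : supp ph ==> norm x <= b" using compact_imp_bounded[OF ph'(2)] by (auto simp: bounded_pos)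
  have ph0: "ph x = 0" if "b < norm x" for x using that b(2)[of x] not_in_supp[of x ph] by force
  have "bounded (ph ` cball 0 b)"
  by (intro compact_imp_bounded compact_continuous_image continuous_on_subset[OF phc]) auto
  then obtain C where C: "C > 0" "!!x. x : cball 0 b ==> \<bar>ph x\<bar> <= C" by (auto simp: bounded_pos)
  have Cb: "\<bar>ph x\<bar> <= C" for x using C ph0[of x] by (cases "b < norm x") (auto simp: not_less)
  show "EX K. ALL x. norm (Ph a x) <= K"
  using Cb C(1) by (intro exI[of _ C]) (auto simp: Ph_def a indicator_def)
  have Ab: "A <= cball 0 T" using a by (auto simp: dist_real_def)
  have z: "Ph a z = 0" if "T + b < norm z" for z
  using support_fst_snd[OF Ab, of b "fst z" "snd z"] that ph0 by (auto simp: Ph_def a indicator_def)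
  show "EX S:sets lborel. emeasure lborel S < \<infinity> & (ALL x:space lborel - S. Ph a x = 0)"
  by (rule bexI[of _ "cball 0 (T + b)"]) (use z emeasure_bounded_finite[of "cball 0 (T + b)"] in auto)
  show "(%n. (LI x. kgradt rh Om (Suc n) (f (Suc n)) x \<bullet> Ph a x)) \<longlonglongrightarrow> L a"
  using LIMSEQ_Suc[OF pairing_limit[OF a(2,3) scalar_field(1-3)[OF a(4), of i]]] by (simp add: Ph_def L_def a)
 qed auto
 have Gm[measurable]: "G : Bm" and Gp: "pil p G < \<infinity>" using G(1) by (auto simp: Lp_space_iff)
 define Ga where "Ga z = (\<chi> i. G z $ i / kernel_moment rh i)" for z
 have mom: "kernel_moment rh i > 0" for i by (rule kernel_moment_pos[OF k])
 have Gae: "Ga z = (\<Sum>i\<in>UNIV. ((G z \<bullet> axis i 1) / kernel_moment rh i) *R axis i 1)" for z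
  unfolding inner_axis by (simp add: vec_eq_iff Ga_def axis_def if_distrib sum.delta cong: if_cong)
 show ?thesis
 proof (rule that[of Ga])
  show "Ga : Bm" unfolding Gae[abs_def] by measurable
  define c where "c = (\<Sum>i\<in>UNIV. 1 / kernel_moment rh i)"
  have c0: "c >= 0" unfolding c_def using mom by (intro sum_nonneg) (simp add: less_imp_le)
  have "norm (Ga z) <= norm (c *R G z)" for z
  proof -
  have "norm (Ga z) <= (\<Sum>i\<in>UNIV. \<bar>Ga z $ i\<bar>)" by (rule norm_le_l1_cart)
  also have "... <= (\<Sum>i\<in>UNIV. (1 / kernel_moment rh i) * norm (G z))"
  using mom component_le_norm_cart[of "G z"]
  by (intro sum_mono) (simp add: Ga_def abs_divide less_imp_le divide_right_mono)
  also have "... = norm (c *R G z)" using c0 by (simp add: c_def sum_distrib_right)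
  finally show ?thesis .
  qed
  hence "pil p Ga <= pil p (%z. c *R G z)"
  unfolding pint_def using p0 by (intro nn_integral_mono ennreal_leI powr_mono2) auto
  also have "... < \<infinity>" using Gp by (subst pint_cmult) (auto simp: ennreal_mult_less_top)
  finally show "pil p Ga < \<infinity>" .
  fix A ph i assume a: "A : sets borel" "A <= {0<..<T}" "ph : tests Om"
  let ?c = "kernel_moment rh i"
  have "(LI z. G z \<bullet> Ph (A, ph, i) z) = L (A, ph, i)" by (rule G(2)) (use a in \<open>simp add: I_def\<close>)
  moreover have "(LI z. G z \<bullet> Ph (A, ph, i) z) = (LI z. ?c * (ind A (fst z) * (Ga z $ i * ph (snd z))))"
  using mom[of i] by (intro lint_cong) (auto simp: Ph_def Ga_def inner_axis)
  moreover have "L (A, ph, i) = - (LI z. ?c * (ind A (fst z) * (g z * fder ph (at (snd z)) (axis i 1))))"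
  unfolding L_def by (simp add: scalar_field(4)[OF a(3)] mult_ac)
  ultimately have "?c * (LI z. ind A (fst z) * (Ga z $ i * ph (snd z)))
  = ?c * - (LI z. ind A (fst z) * (g z * fder ph (at (snd z)) (axis i 1)))" by simp
  thus "(LI z. ind A (fst z) * (Ga z $ i * ph (snd z)))
  = - (LI z. ind A (fst z) * (g z * fder ph (at (snd z)) (axis i 1)))"
  using mom[of i] unfolding mult_cancel_left by simp
 qed
qed

end

section \<open>Slices of the joint gradient\<close>

lemma locally_integrable_Lp:
 fixes u v :: "'a::euclidean_space => 'b::euclidean_space"
 assumes u: "u : Bm" and p: "1 <= p" and fin: "pil p u < \<infinity>"
  and Om: "open Om" and ae: "AE x in lborel. x : Om --> v x = u x"
 shows "locally_integrable_on Om v"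
 unfolding locally_integrable_on_def
proof (intro allI impI)
 fix K assume K: "compact K & K <= Om"
 hence Kb: "K : sets borel" by (simp add: borel_compact)
 obtain r where "!!x. x : K ==> norm x <= r" using K compact_imp_bounded[of K] by (auto simp: bounded_iff)
 hence r: "K <= cball 0 r" by auto
 have "intl (%x. ind K x *R (ind (cball 0 r) x *R u x))"
  using Kb by (intro integrable_mult_indicator integrable_bounded_region[OF u p fin]) auto
 moreover have "ind K x *R (ind (cball 0 r) x *R u x) = ind K x *R u x" for x
  using r by (auto simp: indicator_def)
 ultimately have i: "intl (%x. ind K x *R u x)" by (simp only:)
 have "AE x in lborel. x : K --> v x = u x" using ae by eventually_elim (use K in auto)
 from lebesgue_on_AE_eq(3)[OF Kb u this] i show "integrable (leb K) v" by simp
qed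

lemma test_function_bounds:
 assumes "ph : tests Om"
 shows "cts ph" "cts (%x. fder ph (at x) v)"
  "EX r>0. ALL x. r < norm x --> ph x = 0 & fder ph (at x) v = 0"
  "x ~: Om ==> ph x = 0" "x ~: Om ==> fder ph (at x) v = 0"
proof -
 have ph: "smooth ph" "compact (supp ph)" "supp ph <= Om" using assms by (auto simp: test_functions_def)
 show "cts ph" by (rule smooth_continuous[OF ph(1)])
 show "cts (%x. fder ph (at x) v)"
  using C_k_continuous[OF C_k_SucD(2)[OF smooth_C_k[OF ph(1)]]] .
 obtain b where b: "b > 0" "!!x. x : supp ph ==> norm x <= b" using compact_imp_bounded[OF ph(2)] by (auto simp: bounded_pos)
 have "x ~: supp ph" if "b < norm x" for x using b(2)[of x] that by auto
 thus "EX r>0. ALL x. r < norm x --> ph x = 0 & fder ph (at x) v = 0"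
  using b(1) not_in_supp[of _ ph] frechet_derivative_outside_supp[of _ ph v] by (intro exI[of _ b]) auto
 show "x ~: Om ==> ph x = 0" "x ~: Om ==> fder ph (at x) v = 0"
  using ph(3) not_in_supp[of x ph] frechet_derivative_outside_supp[of x ph v] by auto
qed

lemma has_weak_gradientI_borel:
 fixes u v :: "real^'d => real"
 assumes u: "u : Bm" and G: "G : Bm" and p: "1 <= p"
  and fin: "pil p u < \<infinity>" "pil p G < \<infinity>"
  and Om: "open Om" and ae: "AE x in lborel. x : Om --> v x = u x"
  and eq: "!!ph i. ph : tests Om ==>
  (LI x. u x * fder ph (at x) (axis i 1)) = - (LI x. G x $ i * ph x)"
 shows "has_weak_gradient Om v G"
 unfolding has_weak_gradient_def
proof (intro conjI ballI allI)
 show "locally_integrable_on Om v" by (rule locally_integrable_Lp[OF u p fin(1) Om ae])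
 show "locally_integrable_on Om G" by (rule locally_integrable_Lp[OF G p fin(2) Om]) simp
 fix ph and i :: 'd assume ph: "ph : tests Om"
 note t = test_function_bounds(1)[OF ph] test_function_bounds(2)[OF ph, of "axis i 1"]
  test_function_bounds(3)[OF ph, of "axis i 1"] test_function_bounds(4)[OF ph]
  test_function_bounds(5)[OF ph, where v = "axis i 1"]
 have Omb: "Om : sets borel" using Om by simp
 have m: "ph : Bm" "(%x. fder ph (at x) (axis i 1)) : Bm"
  using t(1,2) by (auto intro: bm_contI)
 have "(\<integral>x. v x * fder ph (at x) (axis i 1) \<partial>leb Om)
  = (LI x. ind Om x *R (u x * fder ph (at x) (axis i 1)))"
  by (rule lebesgue_on_AE_eq(2)[OF Omb]) (use u m ae in \<open>auto elim: eventually_mono\<close>)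
 also have "... = (LI x. u x * fder ph (at x) (axis i 1))"
  using t(5) by (intro lint_cong) (auto simp: indicator_def)
 also have "... = - (LI x. G x $ i * ph x)" by (rule eq[OF ph])
 also have "(LI x. G x $ i * ph x) = (LI x. ind Om x *R (G x $ i * ph x))"
  using t(4) by (intro lint_cong) (auto simp: indicator_def)
 also have "... = (\<integral>x. G x $ i * ph x \<partial>leb Om)"
 proof (rule lebesgue_on_AE_eq(2)[OF Omb, symmetric])
  have "(%x. G x \<bullet> axis i 1) : Bm" using G by simp
  thus "(%x. G x $ i * ph x) : Bm" using m by (simp add: inner_axis)
 qed simp
 finally show "(\<integral>x. v x * fder ph (at x) (axis i 1) \<partial>leb Om) = - (\<integral>x. G x $ i * ph x \<partial>leb Om)" .
qed

text \<open>Integrals over strips above a time interval are integrals of the slice integrals, so the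
  criterion for vanishing box integrals applies in t.\<close>

lemma AE_zero_time_sets:
 fixes W :: "real \<times> 'a::euclidean_space => real"
 assumes W: "intl W"
  and z: "!!A. A : sets borel ==> (LI z. ind A (fst z) * W z) = 0"
 shows "AE t in lborel. (LI x. W (t, x)) = 0"
proof (rule AE_zero_box_integrals)
 show "intl (%t. (LI x. W (t, x)))" by (rule integral_prod_fst(3)[OF W])
 fix a b :: real
 have "fst -` box a b : sets (borel :: (real \<times> 'a) measure)"
  by (intro borel_open open_vimage_fst) simp
 hence i: "intl (%z. ind (fst -` box a b) z *R W z)"
  by (intro integrable_mult_indicator W) simp
 have "(LI t. ind (box a b) t * (LI x. W (t, x)))
  = (LI t. (LI x. ind (fst -` box a b) (t, x) *R W (t, x)))"
  by (intro lint_cong) (auto simp: indicator_def)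
 also have "... = (LI z. ind (fst -` box a b) z *R W z)"
  by (rule integral_prod_fst(1)[OF i, symmetric])
 also have "... = (LI z. ind (box a b) (fst z) * W z)"
  by (intro lint_cong) (auto simp: indicator_def)
 also have "... = 0" by (rule z) simp
 finally show "(LI t. ind (box a b) t * (LI x. W (t, x))) = 0" .
qed

lemma integral_close_uniform:
 fixes u a b :: "'a::euclidean_space => real"
 assumes u: "intl (%x. ind (cball 0 r) x *R u x)"
  and m: "a : Bm" "b : Bm"
  and e: "!!x. \<bar>a x - b x\<bar> <= e" and B: "!!x. \<bar>a x\<bar> <= B"
  and z: "!!x. r < norm x ==> a x = 0 & b x = 0"
 shows "\<bar>(LI x. u x * a x) - (LI x. u x * b x)\<bar> <= e * (LI x. \<bar>ind (cball 0 r) x *R u x\<bar>)"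
proof -
 have ia: "intl (%x. a x *R u x)"
  by (rule bounded_times_integrable[OF m(1) u B]) (use z in auto)
 have b: "\<bar>b x\<bar> <= B + e" for x using e[of x] B[of x] by linarith
 have ib: "intl (%x. b x *R u x)"
  by (rule bounded_times_integrable[OF m(2) u b]) (use z in auto)
 have "(LI x. u x * a x) - (LI x. u x * b x) = (LI x. a x *R u x - b x *R u x)"
  using ia ib by (simp add: mult.commute)
 moreover have "\<bar>(LI x. a x *R u x - b x *R u x)\<bar> <= (LI x. e * \<bar>ind (cball 0 r) x *R u x\<bar>)"
 proof (rule integral_abs_bound_integral)
  show "intl (%x. a x *R u x - b x *R u x)" using ia ib by simp
  show "intl (%x. e * \<bar>ind (cball 0 r) x *R u x\<bar>)"
  using integrable_norm[OF u] by simp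
  fix x
  have "\<bar>(a x - b x) * u x\<bar> <= e * \<bar>u x\<bar>" unfolding abs_mult by (intro mult_right_mono e) auto
  thus "\<bar>a x *R u x - b x *R u x\<bar> <= e * \<bar>ind (cball 0 r) x *R u x\<bar>"
  using z[of x] by (cases "r < norm x") (auto simp: left_diff_distrib not_less)
 qed
 ultimately show ?thesis by simp
qed

lemma continuous_bounded_support_bound:
 fixes a :: "'a::euclidean_space => 'b::euclidean_space"
 assumes c: "cts a" and z: "ALL x. r < norm x --> a x = 0"
 shows "EX B>0. ALL x. norm (a x) <= B"
proof -
 have "bounded (a ` cball 0 r)"
  by (intro compact_imp_bounded compact_continuous_image continuous_on_subset[OF c]) auto
 then obtain B where "B > 0" "!!x. x : cball 0 r ==> norm (a x) <= B" by (auto simp: bounded_pos)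
 hence "norm (a x) <= B" for x using z by (cases "r < norm x") (auto simp: not_less)
 thus ?thesis using \<open>B > 0\<close> by blast
qed

context weak_limit
begin

text \<open>For a single test function the joint identity gives the slice identity off a null set
  that depends on it. A countable uniformly dense family makes the null set common, and finite slice
  norms carry the identity over to all test functions.\<close>

lemma slice_gradient:
 fixes Ga :: "real \<times> (real^'d) => real^'d"
 assumes Gam: "Ga : Bm" and Gap: "pil p Ga < \<infinity>"
  and eq: "!!A ph i. A : sets borel ==> A <= {0<..<T} ==> ph : tests Om ==>
  (LI z. ind A (fst z) * (Ga z $ i * ph (snd z)))
  = - (LI z. ind A (fst z) * (g z * fder ph (at (snd z)) (axis i 1)))"
 shows "AE t in lborel. t : {0<..<T} --> (ALL ph:tests Om. ALL i.
  (LI x. g (t, x) * fder ph (at x) (axis i 1)) = - (LI x. Ga (t, x) $ i * ph x))"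
proof -
 have Tm: "{0<..<T} : sets borel" by simp
 have Gaim: "(%z. Ga z $ i) : Bm" for i
 proof -
  have "(%z. Ga z \<bullet> axis i 1) : Bm" using Gam by simp
  thus ?thesis by (simp add: inner_axis)
 qed
 have Gaip: "pil p (%z. Ga z $ i) < \<infinity>" for i
 proof -
  have "pil p (%z. Ga z $ i) <= pil p Ga"
  unfolding pint_def using p component_le_norm_cart[of "Ga _" i]
  by (intro nn_integral_mono ennreal_leI powr_mono2) auto
  thus ?thesis using Gap by simp
 qed
 have main: "AE t in lborel. t : {0<..<T} --> (ALL ph:tests Om.
  (LI x. g (t, x) * fder ph (at x) (axis i 1)) = - (LI x. Ga (t, x) $ i * ph x))" for i
 proof -
 define S where "S = tests Om"
 \<comment> \<open>Pairing \<open>ph\<close> with its derivative makes the countable family dense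
   for both at once.\<close>
 define Ph where "Ph ph x = (ph x, fder ph (at x) (axis i 1))" for ph :: "real^'d => real" and x
 have Phc: "cts (Ph s)" if "s : S" for s
  using that test_function_bounds(1,2) by (auto simp: S_def Ph_def intro!: continuous_on_Pair)
 have Phz: "EX r. ALL x. r < norm x --> Ph s x = 0" if s: "s : S" for s
  using test_function_bounds(3)[of s Om "axis i 1"] s by (auto simp: S_def Ph_def zero_prod_def)
 obtain D where D: "countable D" "D <= S"
  "!!s. s : S ==> EX r. ALL e>0. EX s':D. (ALL x. dist (Ph s x) (Ph s' x) < e) & (ALL x. r < norm x --> Ph s x = 0 & Ph s' x = 0)"
  by (rule countable_uniformly_dense[of S Ph]) (use Phc Phz in auto)
 define Q where "Q t ph \<longleftrightarrow> (LI x. g (t, x) * fder ph (at x) (axis i 1)) = - (LI x. Ga (t, x) $ i * ph x)" for t ph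
 have AEQ: "AE t in lborel. t : {0<..<T} --> Q t s" if s: "s : S" for s
 proof -
  define ph where "ph = s"
  have ph: "ph : tests Om" using s by (simp add: ph_def S_def)
  note t = test_function_bounds(1)[OF ph] test_function_bounds(2)[OF ph, of "axis i 1"]
  test_function_bounds(3)[OF ph, of "axis i 1"]
  obtain r where r: "r > 0" "!!x. r < norm x ==> ph x = 0 & fder ph (at x) (axis i 1) = 0" using t(3) by blast
  obtain B1 where B1: "B1 > 0" "!!x. norm (ph x) <= B1" using continuous_bounded_support_bound[OF t(1), of r] r(2) by blast
  obtain B2 where B2: "B2 > 0" "!!x. norm (fder ph (at x) (axis i 1)) <= B2" using continuous_bounded_support_bound[OF t(2), of r] r(2) by blast
  have m: "ph : Bm" "(%x. fder ph (at x) (axis i 1)) : Bm"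
  using t(1,2) by (auto intro: bm_contI)
  have Ib: "{0<..<T} <= cball 0 T" by (auto simp: dist_real_def)
  have Im: "(ind {0<..<T} :: real => real) : Bm" by simp
  have w: "intl (%z. (ind {0<..<T} (fst z) *R h (snd z)) *R U z)"
  if h: "h : Bm" "!!x. norm (h x) <= B" "!!x. r < norm x ==> h x = 0"
  and U: "U : Bm" "pil p U < \<infinity>" for h :: "real^'d => real" and U :: "real \<times> (real^'d) => real" and B
  proof (rule integrable_Lp_times_bounded[OF p U, where B = "\<bar>B\<bar>" and r = "T + r"])
  show "(%z. ind {0<..<T} (fst z) *R h (snd z)) : Bm"
  by (rule measurable_fst_snd[OF Im h(1)])
  show "\<bar>ind {0<..<T} (fst z) *R h (snd z)\<bar> <= \<bar>B\<bar>" for z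
  using h(2)[of "snd z"] by (auto simp: indicator_def)
  show "ind {0<..<T} (fst z) *R h (snd z) = 0" if "T + r < norm z" for z
  using support_fst_snd[OF Ib, of r "fst z" "snd z"] that h(3) by (auto simp: indicator_def)
  qed
  define W1 where "W1 z = ind {0<..<T} (fst z) * (Ga z $ i * ph (snd z))" for z
  define W2 where "W2 z = ind {0<..<T} (fst z) * (g z * fder ph (at (snd z)) (axis i 1))" for z
  have W1: "intl W1"
  using w[OF m(1) B1(2) _ Gaim Gaip] r(2) by (simp add: W1_def[abs_def] mult_ac)
  have W2: "intl W2"
  using w[OF m(2) B2(2) _ gm gp] r(2) by (simp add: W2_def[abs_def] mult_ac)
  have "AE t in lborel. (LI x. W1 (t, x) + W2 (t, x)) = 0"
  proof (rule AE_zero_time_sets)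
  show "intl (%z. W1 z + W2 z)" using W1 W2 by simp
  fix A :: "real set" assume A: "A : sets borel"
  have Af: "fst -` A : sets (borel :: (real \<times> (real^'d)) measure)"
  proof -
  have "fst : (borel :: (real \<times> (real^'d)) measure) \<rightarrow>\<^sub>M borel"
  by (intro bm_contI continuous_intros)
  from measurable_sets[OF this A] show ?thesis by simp
  qed
  have iA: "intl (%z. ind A (fst z) * V z)" if "intl V" for V :: "real \<times> (real^'d) => real"
  using integrable_mult_indicator[of "fst -` A" lborel V] Af that by (simp add: indicator_vimage[unfolded comp_def])
  have "(LI z. ind A (fst z) * (W1 z + W2 z))
  = (LI z. ind A (fst z) * W1 z) + (LI z. ind A (fst z) * W2 z)"
  using iA[OF W1] iA[OF W2] by (simp add: distrib_left)
  also have "(LI z. ind A (fst z) * W1 z) = (LI z. ind (A \<inter> {0<..<T}) (fst z) * (Ga z $ i * ph (snd z)))"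
  by (simp add: W1_def indicator_inter_arith mult.assoc)
  also have "(LI z. ind A (fst z) * W2 z) = (LI z. ind (A \<inter> {0<..<T}) (fst z) * (g z * fder ph (at (snd z)) (axis i 1)))"
  by (simp add: W2_def indicator_inter_arith mult.assoc)
  finally show "(LI z. ind A (fst z) * (W1 z + W2 z)) = 0"
  using eq[of "A \<inter> {0<..<T}" ph i] A ph by simp
  qed
  moreover have "AE t in lborel. intl (%x. W1 (t, x))" by (rule integral_prod_fst(2)[OF W1])
  moreover have "AE t in lborel. intl (%x. W2 (t, x))" by (rule integral_prod_fst(2)[OF W2])
  ultimately show ?thesis
  proof eventually_elim
  case (elim t)
  show ?case
  proof
  assume "t : {0<..<T}"
  hence e: "W1 (t, x) = Ga (t, x) $ i * ph x" "W2 (t, x) = g (t, x) * fder ph (at x) (axis i 1)" for x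
  by (auto simp: W1_def W2_def)
  have "(LI x. W1 (t, x)) + (LI x. W2 (t, x)) = 0" using elim by simp
  thus "Q t s" unfolding e by (simp add: Q_def ph_def)
  qed
  qed
 qed
 have "AE t in lborel. ALL s:D. t : {0<..<T} --> Q t s"
  using AEQ D(1,2) by (intro AE_ball_countable[THEN iffD2]) auto
 moreover have "AE t in lborel. pil p (%x. g (t, x)) < \<infinity>" by (rule AE_slice_finite[OF gm gp])
 moreover have "AE t in lborel. pil p (%x. Ga (t, x) $ i) < \<infinity>" by (rule AE_slice_finite[OF Gaim Gaip])
 ultimately show ?thesis
 proof eventually_elim
  case (elim t)
  have "Q t s" if t: "t : {0<..<T}" and s: "s : S" for s
  proof -
  obtain r where "ALL e>0. EX s':D. (ALL x. dist (Ph s x) (Ph s' x) < e) & (ALL x. r < norm x --> Ph s x = 0 & Ph s' x = 0)"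
  using D(3)[OF s] by (elim exE)
  hence r: "EX s':D. (ALL x. dist (Ph s x) (Ph s' x) < e) & (ALL x. r < norm x --> Ph s x = 0 & Ph s' x = 0)" if "e > 0" for e
  using that by (elim allE impE)
  have ph: "s : tests Om" using s by (simp add: S_def)
  have iu: "intl (%x. ind (cball 0 r) x *R g (t, x))"
  using elim by (intro integrable_bounded_region[OF slice_measurable[OF gm] p]) simp
  have iw: "intl (%x. ind (cball 0 r) x *R Ga (t, x) $ i)"
  using elim by (intro integrable_bounded_region[OF slice_measurable[OF Gaim] p]) simp
  define c where "c = (LI x. \<bar>ind (cball 0 r) x *R g (t, x)\<bar>) + (LI x. \<bar>ind (cball 0 r) x *R Ga (t, x) $ i\<bar>)"
  have c0: "c >= 0" unfolding c_def by (intro add_nonneg_nonneg integral_nonneg) auto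
  define X where "X ph = (LI x. g (t, x) * fder ph (at x) (axis i 1)) + (LI x. Ga (t, x) $ i * ph x)" for ph
  \<comment> \<open>The defect of \<open>s'\<close> is 0, and passing from \<open>s'\<close> to
    \<open>s\<close> costs \<open>e\<close> times the local L1 norms collected in
    \<open>c\<close>.\<close>
  have small: "\<bar>X s\<bar> <= e * c" if e: "e > 0" for e
  proof -
  obtain s' where s': "s' : D" "!!x. dist (Ph s x) (Ph s' x) < e" "!!x. r < norm x ==> Ph s x = 0 & Ph s' x = 0"
  using r[OF e] by blast
  have ph': "s' : tests Om" using s'(1) D(2) by (auto simp: S_def)
  have "Q t s'" using elim t s'(1) by simp
  hence X0: "X s' = 0" by (simp add: X_def Q_def)
  have d: "\<bar>s x - s' x\<bar> <= e" "\<bar>fder s (at x) (axis i 1) - fder s' (at x) (axis i 1)\<bar> <= e" for x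
  using s'(2)[of x] dist_fst_le[of "Ph s x" "Ph s' x"] dist_snd_le[of "Ph s x" "Ph s' x"] by (auto simp: Ph_def dist_real_def)
  have m: "ps : Bm" "(%x. fder ps (at x) (axis i 1)) : Bm"
  if "ps : tests Om" for ps
  using test_function_bounds(1,2)[OF that] by (auto intro: bm_contI)
  have zz: "s x = 0 & s' x = 0" "fder s (at x) (axis i 1) = 0 & fder s' (at x) (axis i 1) = 0" if "r < norm x" for x
  using s'(3)[OF that] by (auto simp: Ph_def zero_prod_def)
  obtain B1 where B1: "!!x. norm (s x) <= B1"
  using continuous_bounded_support_bound[OF test_function_bounds(1)[OF ph], of r] zz(1) by blast
  obtain B2 where B2: "!!x. norm (fder s (at x) (axis i 1)) <= B2"
  using continuous_bounded_support_bound[OF test_function_bounds(2)[OF ph, of "axis i 1"], of r] zz(2) by blast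
  have "\<bar>(LI x. g (t, x) * fder s (at x) (axis i 1)) - (LI x. g (t, x) * fder s' (at x) (axis i 1))\<bar>
  <= e * (LI x. \<bar>ind (cball 0 r) x *R g (t, x)\<bar>)"
  by (rule integral_close_uniform[OF iu m(2)[OF ph] m(2)[OF ph'] d(2) _ zz(2), where B = B2]) (use B2 in auto)
  moreover have "\<bar>(LI x. Ga (t, x) $ i * s x) - (LI x. Ga (t, x) $ i * s' x)\<bar>
  <= e * (LI x. \<bar>ind (cball 0 r) x *R Ga (t, x) $ i\<bar>)"
  by (rule integral_close_uniform[OF iw m(1)[OF ph] m(1)[OF ph'] d(1) _ zz(1), where B = B1]) (use B1 in auto)
  ultimately have "\<bar>X s - X s'\<bar> <= e * c" unfolding X_def c_def distrib_left by linarith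
  thus ?thesis using X0 by simp
  qed
  have "\<bar>X s\<bar> <= 0"
  proof (rule field_le_epsilon)
  fix e :: real assume e: "0 < e"
  have "\<bar>X s\<bar> <= (e / (c + 1)) * c" using e c0 by (intro small) simp
  also have "... <= e" using e c0 by (simp add: field_simps)
  finally show "\<bar>X s\<bar> <= 0 + e" by simp
  qed
  thus ?thesis by (simp add: X_def Q_def)
  qed
  thus ?case by (auto simp: Q_def S_def)
 qed
 qed
 have "AE t in lborel. ALL i:UNIV. t : {0<..<T} --> (ALL ph:tests Om.
  (LI x. g (t, x) * fder ph (at x) (axis i 1)) = - (LI x. Ga (t, x) $ i * ph x))"
  by (intro AE_ball_countable[THEN iffD2] ballI main countable_finite finite)
 thus ?thesis by eventually_elim blast
qed

text \<open>Slices are identified with pairs of function and gradient in Lp, which is separable. The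
  simple functions assign to t the nearest among finitely many members of a dense sequence of
  slices; all their values are slices of \<open>h\<close> and hence lie in
  \<open>W1_space\<close>.\<close>

lemma strongly_measurable_in_W1:
 fixes Ga :: "real \<times> (real^'d) => real^'d" and h :: "real \<times> (real^'d) => real"
 assumes Gam: "Ga : Bm" and Gap: "pil p Ga < \<infinity>"
  and h: "AE z in lborel. z : {0<..<T} \<times> Om --> h z = g z"
  and grad: "AE t in lborel. t : {0<..<T} --> (ALL ph:tests Om. ALL i.
  (LI x. g (t, x) * fder ph (at x) (axis i 1)) = - (LI x. Ga (t, x) $ i * ph x))"
 shows "(%t x. h (t, x)) : bochner_space p (leb {0<..<T}) (W1_space p Om) (W1_norm p Om)"
proof -
 \<comment> \<open>At good times the representative agrees with \<open>h\<close>, the norms are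
   finite and the weak gradient exists; almost all times in (0,T) are good.\<close>
 define good where "good t \<longleftrightarrow> t : {0<..<T} & (AE x in lborel. x : Om --> h (t, x) = g (t, x)) &
  pil p (%x. g (t, x)) < \<infinity> & pil p (%x. Ga (t, x)) < \<infinity> &
  has_weak_gradient Om (%x. h (t, x)) (%x. Ga (t, x))" for t
 have Tb: "{0<..<T} : sets borel" by simp
 have "AE t in lborel. AE x in lborel. (t, x) : {0<..<T} \<times> Om --> h (t, x) = g (t, x)"
 proof (rule lborel_pair.AE_pair)
  show "AE z in lborel \<Otimes>\<^sub>M lborel. z : {0<..<T} \<times> Om --> h z = g z" unfolding lborel_prod by (rule h)
 qed
 hence AEgood: "AE t in lborel. t : {0<..<T} --> good t"
  using grad AE_slice_finite[OF gm gp] AE_slice_finite[OF Gam Gap]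
 proof eventually_elim
  case (elim t)
  show ?case
  proof
  assume t: "t : {0<..<T}"
  have ae: "AE x in lborel. x : Om --> h (t, x) = g (t, x)" using elim(1) t by simp
  have "has_weak_gradient Om (%x. h (t, x)) (%x. Ga (t, x))"
  by (rule has_weak_gradientI_borel[OF slice_measurable[OF gm] slice_measurable[OF Gam] p elim(3,4) Om ae])
  (use elim(2) t in blast)
  thus "good t" using t ae elim unfolding good_def by simp
  qed
 qed
 have hm: "(%x. h (t, x)) : borel_measurable (leb Om)" if "good t" for t
  using lebesgue_on_AE_eq(1)[OF Omb slice_measurable[OF gm]] that by (auto simp: good_def)
 have Galm: "(%x. Ga (t, x)) : borel_measurable (leb Om)" for t
  using lebesgue_on_AE_eq(1)[OF Omb slice_measurable[OF Gam, of t]] by simp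
 have pint_on: "pint p (leb Om) v <= pil p u"
  if "AE x in lborel. x : Om --> v x = u x" for u v :: "real^'d => 'b::euclidean_space"
  unfolding pint_def nn_integral_lebesgue_on[OF Omb]
  by (intro nn_integral_mono_AE) (use that in \<open>eventually_elim, auto simp: indicator_def\<close>)
 have W1: "(%x. h (t, x)) : W1_space p Om" if t: "good t" for t
 proof -
  have "(%x. h (t, x)) : Lp_space p (leb Om)"
  using hm[OF t] pint_on[of "%x. h (t, x)" "%x. g (t, x)"] t by (auto simp: Lp_space_iff good_def intro: le_less_trans)
  moreover have "(%x. Ga (t, x)) : Lp_space p (leb Om)"
  using Galm pint_on[of "%x. Ga (t, x)" "%x. Ga (t, x)"] t by (auto simp: Lp_space_iff good_def intro: le_less_trans)
  ultimately show ?thesis using t unfolding W1_space_def good_def by blast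
 qed
 define V where "V z = (g z, Ga z)" for z
 have Vm: "V : Bm" unfolding V_def[abs_def] using gm Gam by (rule borel_measurable_Pair)
 have normV: "norm (a, b) powr p <= 2 powr p * (norm a powr p + norm b powr p)" for a :: real and b :: "real^'d"
  using norm_add_powr_le[of p "(a, 0)" "(0, b)"] p by simp
 have pintV: "pil p (%x. (u x, w x)) < \<infinity>"
  if "u : Bm" "w : Bm" "pil p u < \<infinity>" "pil p w < \<infinity>"
  for u :: "'z::euclidean_space => real" and w :: "'z => real^'d"
 proof -
  have "pil p (%x. (u x, w x)) = pil p (%x. (u x, 0) + (0, w x))" by simp
  also have "... <= en (2 powr p) * (pil p (%x. (u x, 0 :: real^'d)) + pil p (%x. (0 :: real, w x)))"
  using that(1,2) p by (intro pint_add_le) auto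
  also have "... < \<infinity>" using that(3,4) by (auto simp: pint_def ennreal_mult_less_top)
  finally show ?thesis .
 qed
 have ne: "{t. good t} ~= {}"
 proof
  assume "{t. good t} = {}"
  hence "AE t in lborel. t ~: {0<..<T}" using AEgood by simp
  hence "{0<..<T} : null_sets lborel" by (subst AE_iff_null_sets) auto
  thus False using T0 by (auto simp: null_sets_def)
 qed
 obtain ta :: "nat => real" where ta: "!!l. good (ta l)"
  "!!t e. good t ==> 0 < e ==> EX l. pil p (%x. V (ta l, x) - V (t, x)) < en e"
 proof (rule dense_sequence_in_Lp_family[OF p ne, of "%t x. V (t, x)"])
  fix t assume "t : {t. good t}"
  thus "(%x. V (t, x)) : Bm" "pil p (%x. V (t, x)) < \<infinity>"
  using slice_measurable[OF Vm] pintV[OF slice_measurable[OF gm] slice_measurable[OF Gam]] by (auto simp: good_def V_def)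
 qed auto
 define E where "E l t = pil p (%x. V (ta l, x) - V (t, x))" for l t
 have Em[measurable]: "E l : Bm" for l
 proof -
  have "(%z. V (ta l, snd z) - V z) : borel_measurable (borel \<Otimes>\<^sub>M borel)"
  proof -
  note slice_measurable[OF Vm, measurable]
  have [measurable]: "V : borel_measurable (borel \<Otimes>\<^sub>M borel)" using Vm by (simp add: borel_prod)
  show ?thesis by measurable
  qed
  hence "(%z. V (ta l, snd z) - V z) : Bm" by (simp add: borel_prod)
  from pint_slice_measurable[OF this, of p] show ?thesis by (simp add: E_def[abs_def])
 qed
 \<comment> \<open>Taking the least index among the minimisers makes the choice a measurable
   function of t.\<close>
 define ka where "ka n t = (LEAST i. i <= n & (ALL l<=n. E i t <= E l t))" for n t
 have kaex: "EX i. i <= n & (ALL l<=n. E i t <= E l t)" for n t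
 proof -
  have "finite ((%l. E l t) ` {..n})" "(%l. E l t) ` {..n} ~= {}" by auto
  from Min_in[OF this] obtain i where i: "Min ((%l. E l t) ` {..n}) = E i t" "i : {..n}"
  by (rule imageE)
  show ?thesis
  proof (intro exI[of _ i] conjI allI impI)
  show "i <= n" using i(2) by simp
  fix l assume "l <= n"
  hence "Min ((%l. E l t) ` {..n}) <= E l t" by (intro Min_le) auto
  thus "E i t <= E l t" using i(1) by simp
  qed
 qed
 have ka: "ka n t <= n" "!!l. l <= n ==> E (ka n t) t <= E l t" for n t
  using LeastI_ex[OF kaex[of n t]] unfolding ka_def by auto
 have kam: "ka n : measurable borel (count_space UNIV)" for n
  unfolding ka_def[abs_def] by measurable
 define s where "s n t = (%x. h (ta (ka n t), x))" for n t
 have kas: "simple_function (leb {0<..<T}) (ka n)" for n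
  unfolding simple_function_def
 proof (intro conjI ballI)
  show "finite (ka n ` space (leb {0<..<T}))"
  by (rule finite_subset[of _ "{..n}"]) (use ka(1) in auto)
  fix y
  have "ka n -` {y} : sets borel" using measurable_sets[OF kam, of "{y}" n] by simp
  hence "ka n -` {y} : sets lebesgue" by (rule sets_lebesgue_borel)
  thus "ka n -` {y} \<inter> space (leb {0<..<T}) : sets (leb {0<..<T})"
  using sets_lebesgue_borel[OF Tb] by (subst sets_restrict_space_iff) auto
 qed
 have ss: "simple_function (leb {0<..<T}) (s n)" for n
  using simple_function_compose1[OF kas[of n], of "%l x. h (ta l, x)"] by (simp add: s_def[abs_def])
 have normN: "W1_norm p Om (%x. s n t x - h (t, x)) powr p <= 2 * enn2real (E (ka n t) t)"
  if t: "good t" for n t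
 proof -
  let ?q = "ta (ka n t)"
  have q: "good ?q" by (rule ta(1))
  have W: "has_weak_gradient Om (%x. 1 * h (?q, x) + (-1) * h (t, x)) (%x. 1 *R Ga (?q, x) + (-1) *R Ga (t, x))"
  using q t by (intro has_weak_gradient_lincomb[OF Om]) (auto simp: good_def)
  have ae1: "AE x in lborel. x : Om --> h (?q, x) - h (t, x) = g (?q, x) - g (t, x)"
  proof -
  have "AE x in lborel. x : Om --> h (?q, x) = g (?q, x)" "AE x in lborel. x : Om --> h (t, x) = g (t, x)"
  using q t by (auto simp: good_def)
  thus ?thesis by eventually_elim auto
  qed
  have fin: "E (ka n t) t < \<infinity>"
  proof -
  have "E (ka n t) t <= en (2 powr p) * (pil p (%x. V (?q, x)) + pil p (%x. V (t, x)))"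
  unfolding E_def using p slice_measurable[OF Vm] by (intro pint_diff_le) auto
  also have "... < \<infinity>"
  using pintV[OF slice_measurable[OF gm, of ?q] slice_measurable[OF Gam, of ?q]]
  pintV[OF slice_measurable[OF gm, of t] slice_measurable[OF Gam, of t]] q t
  by (auto simp: good_def V_def ennreal_mult_less_top)
  finally show ?thesis .
  qed
  have b1: "pint p (leb Om) (%x. h (?q, x) - h (t, x)) <= E (ka n t) t"
  proof -
  have "pint p (leb Om) (%x. h (?q, x) - h (t, x)) <= pil p (%x. g (?q, x) - g (t, x))"
  by (rule pint_on[OF ae1])
  also have "... <= E (ka n t) t" unfolding E_def pint_def V_def
  proof (intro nn_integral_mono ennreal_leI powr_mono2)
  fix x
  show "norm (g (?q, x) - g (t, x)) <= norm ((g (?q, x), Ga (?q, x)) - (g (t, x), Ga (t, x)))"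
  using norm_fst_le[of "g (?q, x) - g (t, x)" "Ga (?q, x) - Ga (t, x)"] by simp
  qed (use p in auto)
  finally show ?thesis .
  qed
  have b2: "pint p (leb Om) (%x. Ga (?q, x) - Ga (t, x)) <= E (ka n t) t"
  proof -
  have "pint p (leb Om) (%x. Ga (?q, x) - Ga (t, x)) <= pil p (%x. Ga (?q, x) - Ga (t, x))"
  by (rule pint_on) simp
  also have "... <= E (ka n t) t" unfolding E_def pint_def V_def
  using p by (intro nn_integral_mono ennreal_leI powr_mono2) (auto intro: norm_snd_le)
  finally show ?thesis .
  qed
  have "W1_norm p Om (%x. s n t x - h (t, x)) powr p =
  (\<integral>x. \<bar>h (?q, x) - h (t, x)\<bar> powr p \<partial>leb Om) + (\<integral>x. norm (Ga (?q, x) - Ga (t, x)) powr p \<partial>leb Om)"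
  using W1_norm_powr[OF j Om p W] by (simp add: s_def)
  also have "(\<integral>x. \<bar>h (?q, x) - h (t, x)\<bar> powr p \<partial>leb Om) = enn2real (pint p (leb Om) (%x. h (?q, x) - h (t, x)))"
  using integral_eq_pint[of "%x. h (?q, x) - h (t, x)" "leb Om" p] hm[OF q] hm[OF t] by simp
  also have "(\<integral>x. norm (Ga (?q, x) - Ga (t, x)) powr p \<partial>leb Om) = enn2real (pint p (leb Om) (%x. Ga (?q, x) - Ga (t, x)))"
  using Galm by (intro integral_eq_pint) simp
  also have "enn2real (pint p (leb Om) (%x. h (?q, x) - h (t, x))) <= enn2real (E (ka n t) t)"
  using b1 fin by (intro enn2real_mono) auto
  also have "enn2real (pint p (leb Om) (%x. Ga (?q, x) - Ga (t, x))) <= enn2real (E (ka n t) t)"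
  using b2 fin by (intro enn2real_mono) auto
  finally show ?thesis by simp
 qed
 have conv: "(%n. W1_norm p Om (%x. s n t x - h (t, x))) \<longlonglongrightarrow> 0" if t: "good t" for t
 proof (rule LIMSEQ_I)
  fix e :: real assume e: "0 < e"
  define e1 where "e1 = (e / 2) powr p / 2"
  have e1: "e1 > 0" using e by (simp add: e1_def)
  obtain l where l: "E l t < en e1" using ta(2)[OF t e1] by (auto simp: E_def)
  have "norm (W1_norm p Om (%x. s n t x - h (t, x)) - 0) < e" if n: "n >= l" for n
  proof -
  have W0: "W1_norm p Om (%x. s n t x - h (t, x)) >= 0" by (simp add: W1_norm_def)
  have "E (ka n t) t < en e1" using ka(2)[OF n, of t] l by (rule le_less_trans)
  hence "enn2real (E (ka n t) t) <= e1" using e1 by (intro enn2real_leI) auto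
  hence "W1_norm p Om (%x. s n t x - h (t, x)) powr p <= (e / 2) powr p"
  using normN[OF t, of n] by (simp add: e1_def)
  hence "W1_norm p Om (%x. s n t x - h (t, x)) <= e / 2"
  using p e powr_less_mono2[of p "e / 2" "W1_norm p Om (%x. s n t x - h (t, x))"] by (auto simp: not_le[symmetric])
  thus ?thesis using W0 e by simp
  qed
  thus "EX n0. ALL n>=n0. norm (W1_norm p Om (%x. s n t x - h (t, x)) - 0) < e" by blast
 qed
 have goodL: "AE t in leb {0<..<T}. good t" using AEgood unfolding AE_lebesgue_on_iff[OF Tb] .
 have "strongly_measurable (leb {0<..<T}) (W1_space p Om) (W1_norm p Om) (%t x. h (t, x))"
  unfolding strongly_measurable_def
 proof (intro conjI exI[of _ s] allI)
  show "AE t in leb {0<..<T}. (%x. h (t, x)) : W1_space p Om" using goodL by eventually_elim (rule W1)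
  show "simple_function (leb {0<..<T}) (s k)" for k by (rule ss)
  show "s k ` space (leb {0<..<T}) <= W1_space p Om" for k using W1[OF ta(1)] by (auto simp: s_def)
  show "AE t in leb {0<..<T}. (%k. W1_norm p Om (%x. s k t x - h (t, x))) \<longlonglongrightarrow> 0"
  using goodL by eventually_elim (rule conv)
 qed
 moreover have "integrable (leb {0<..<T}) (%t. W1_norm p Om (%x. h (t, x)) powr p)"
 proof -
  \<comment> \<open>At good times \<open>F\<close> is the p-th power of the norm, in a form whose
    measurability in t is evident.\<close>
  define F where "F t = enn2real (NI x. en (norm (g (t, x)) powr p) * ind Om x) + enn2real (NI x. en (norm (Ga (t, x)) powr p) * ind Om x)" for t
  have [measurable]: "g : borel_measurable (borel \<Otimes>\<^sub>M borel)" "Ga : borel_measurable (borel \<Otimes>\<^sub>M borel)"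
  using gm Gam by (simp_all add: borel_prod)
  note Omb[measurable]
  have Fm: "F : Bm" unfolding F_def by measurable
  have WF: "W1_norm p Om (%x. h (t, x)) powr p = F t" if t: "good t" for t
  proof -
  have "W1_norm p Om (%x. h (t, x)) powr p = (\<integral>x. \<bar>h (t, x)\<bar> powr p \<partial>leb Om) + (\<integral>x. norm (Ga (t, x)) powr p \<partial>leb Om)"
  using t by (intro W1_norm_powr[OF j Om p]) (simp add: good_def)
  also have "(\<integral>x. \<bar>h (t, x)\<bar> powr p \<partial>leb Om) = enn2real (pint p (leb Om) (%x. h (t, x)))"
  using integral_eq_pint[OF hm[OF t], of p] by simp
  also have "pint p (leb Om) (%x. h (t, x)) = (NI x. en (norm (g (t, x)) powr p) * ind Om x)"
  unfolding pint_def nn_integral_lebesgue_on[OF Omb]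
  proof (rule nn_integral_cong_AE)
  have "AE x in lborel. x : Om --> h (t, x) = g (t, x)" using t by (simp add: good_def)
  thus "AE x in lborel. en (norm (h (t, x)) powr p) * ind Om x = en (norm (g (t, x)) powr p) * ind Om x"
  by eventually_elim (auto simp: indicator_def)
  qed
  also have "(\<integral>x. norm (Ga (t, x)) powr p \<partial>leb Om) = enn2real (pint p (leb Om) (%x. Ga (t, x)))"
  by (rule integral_eq_pint[OF Galm])
  finally show ?thesis by (simp add: F_def pint_def nn_integral_lebesgue_on[OF Omb])
  qed
  have aeF: "AE t in lborel. t : {0<..<T} --> W1_norm p Om (%x. h (t, x)) powr p = F t"
  using AEgood by eventually_elim (use WF in blast)
  have "intl (%t. ind {0<..<T} t *R F t)"
  proof (rule integrableI_bounded)
  show "(%t. ind {0<..<T} t *R F t) : borel_measurable lborel" using Fm by simp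
  have enn_le: "en (enn2real a) <= a" for a by (cases a) auto
  have "(NI t. en (norm (ind {0<..<T} t *R F t)))
  <= (NI t. pil p (%x. g (t, x)) + pil p (%x. Ga (t, x)))"
  proof (rule nn_integral_mono)
  fix t
  have "en (norm (ind {0<..<T} t *R F t)) <= en (F t)"
  by (intro ennreal_leI) (auto simp: indicator_def F_def)
  also have "... <= (NI x. en (norm (g (t, x)) powr p) * ind Om x) + (NI x. en (norm (Ga (t, x)) powr p) * ind Om x)"
  unfolding F_def by (subst ennreal_plus) (auto intro!: add_mono enn_le)
  also have "... <= pil p (%x. g (t, x)) + pil p (%x. Ga (t, x))"
  unfolding pint_def by (intro add_mono nn_integral_mono) (auto simp: indicator_def)
  finally show "en (norm (ind {0<..<T} t *R F t)) <= pil p (%x. g (t, x)) + pil p (%x. Ga (t, x))" .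
  qed
  also have "... = pil p g + pil p Ga"
  unfolding pint_prod[OF gm] pint_prod[OF Gam]
  using pint_slice_measurable[OF gm, of p] pint_slice_measurable[OF Gam, of p] by (intro nn_integral_add) auto
  also have "... < \<infinity>" using gp Gap by simp
  finally show "(NI t. en (norm (ind {0<..<T} t *R F t))) < \<infinity>" .
  qed
  thus ?thesis using lebesgue_on_AE_eq(3)[OF Tb Fm aeF] by simp
 qed
 ultimately show ?thesis by (simp add: bochner_space_def)
qed

end

section \<open>Bounded variation of slices\<close>

context weak_limit
begin

text \<open>Dividing by the moments turns \<open>weighted_div\<close> into the ordinary divergence,
  so that limits of pairings become the integrals in \<open>variations\<close>.\<close>

definition unweight :: "(real^'d => real^'d) => real^'d => real^'d" where
 "unweight ph x = (\<chi> i. ph x $ i / kernel_moment rh i)"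

definition unweight_bound :: real where
 "unweight_bound = (\<Sum>i\<in>UNIV. 1 / kernel_moment rh i)"

lemma unweight_bound_nonneg: "0 <= unweight_bound"
 unfolding unweight_bound_def using kernel_moment_pos[OF k] by (intro sum_nonneg) (simp add: less_imp_le)

lemma norm_unweight: "norm (unweight ph x) <= unweight_bound * norm (ph x)"
proof -
 have mom: "kernel_moment rh i > 0" for i by (rule kernel_moment_pos[OF k])
 have "norm (unweight ph x) <= (\<Sum>i\<in>UNIV. \<bar>unweight ph x $ i\<bar>)" by (rule norm_le_l1_cart)
 also have "... <= (\<Sum>i\<in>UNIV. (1 / kernel_moment rh i) * norm (ph x))"
  using mom component_le_norm_cart[of "ph x"]
  by (intro sum_mono) (simp add: unweight_def abs_divide less_imp_le divide_right_mono)
 finally show ?thesis by (simp add: unweight_bound_def sum_distrib_right)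
qed

lemma unweight_props:
 assumes ph: "ph : C_k_c 1 Om"
 shows "C_k 1 (unweight ph)" "compact (supp (unweight ph))" "supp (unweight ph) <= Om"
  "weighted_div rh (unweight ph) x = divergence ph x"
proof -
 have ph': "C_k 1 ph" "compact (supp ph)" "supp ph <= Om" using ph by (auto simp: C_k_c_def)
 define L where "L v = (\<Sum>i\<in>UNIV. ((v \<bullet> axis i 1) / kernel_moment rh i) *R (axis i 1 :: real^'d))" for v :: "real^'d"
 have L: "unweight ps y = L (ps y)" for ps :: "real^'d => real^'d" and y
  unfolding L_def inner_axis by (simp add: vec_eq_iff unweight_def axis_def if_distrib sum.delta cong: if_cong)
 have bl: "bounded_linear L"
  unfolding L_def divide_inverse
  by (intro bounded_linear_sum bounded_linear_scaleR_left[THEN bounded_linear_compose]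
  bounded_linear_mult_left[THEN bounded_linear_compose] bounded_linear_inner_left)
 have Le: "unweight ph = (%y. L (ph y))" using L by (simp add: fun_eq_iff)
 show "C_k 1 (unweight ph)" unfolding Le by (rule C_k_bounded_linear_compose[OF bl ph'(1)])
 have z: "unweight ph y = 0" if "y ~: supp ph" for y
  using not_in_supp[OF that] by (simp add: unweight_def vec_eq_iff)
 show "compact (supp (unweight ph))" "supp (unweight ph) <= Om"
  using compact_suppI[OF ph'(2), of "unweight ph"] z ph'(3) by auto
 have "(ph has_derivative fder ph (at x)) (at x)" using C_k_SucD(1)[of 0 ph] ph'(1) by simp
 hence "(unweight ph has_derivative (%v. L (fder ph (at x) v))) (at x)"
  unfolding Le by (rule bounded_linear.has_derivative[OF bl])
 hence d: "fder (unweight ph) (at x) = (%v. L (fder ph (at x) v))"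
  by (rule frechet_derivative_at[symmetric])
 have Li: "L v $ i = v $ i / kernel_moment rh i" for v i
  using L[of "%_. v" x] by (simp add: unweight_def vec_eq_iff)
 show "weighted_div rh (unweight ph) x = divergence ph x"
  unfolding weighted_div_def d divergence_def Li
 proof (rule sum.cong)
  fix i :: 'd assume "i : UNIV"
  have "kernel_moment rh i > 0" by (rule kernel_moment_pos[OF k])
  thus "kernel_moment rh i * (fder ph (at x) (axis i 1) $ i / kernel_moment rh i) = fder ph (at x) (axis i 1) $ i"
  by simp
 qed simp
qed

lemma divergence_props:
 assumes ph: "ph : C_k_c 1 Om"
 shows "cts (divergence ph)" "EX r. ALL x. r < norm x --> divergence ph x = 0" "x ~: Om ==> divergence ph x = 0"
proof -
 have C: "C_k (Suc 0) ph" and s: "compact (supp ph)" "supp ph <= Om" using ph by (auto simp: C_k_c_def)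
 have "cts (%x. fder ph (at x) v)" for v using C_k_SucD(2)[OF C] by simp
 thus "cts (divergence ph)" unfolding divergence_def[abs_def] by (intro continuous_intros)
 have z: "divergence ph x = 0" if "x ~: supp ph" for x
  using frechet_derivative_outside_supp[OF that] by (simp add: divergence_def)
 obtain b where b: "b > 0" "!!x. x : supp ph ==> norm x <= b" using compact_imp_bounded[OF s(1)] by (auto simp: bounded_pos)
 have "x ~: supp ph" if "b < norm x" for x using b(2)[of x] that by auto
 thus "EX r. ALL x. r < norm x --> divergence ph x = 0" using z by blast
 show "x ~: Om ==> divergence ph x = 0" using z[of x] s(2) by blast
qed

definition unit_fields :: "(real^'d => real^'d) set" where
 "unit_fields = {ph : C_k_c 1 Om. ALL x. norm (ph x) <= 1}"

definition var_pair :: "(real^'d => real^'d) => real => real" where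
 "var_pair ph t = (LI x. g (t, x) * divergence ph x)"

lemma var_pair_joint:
 assumes ph: "ph : C_k_c 1 Om" and A: "A : sets borel" and AT: "A <= {0<..<T}"
 shows "intl (%z. g z * (ind A (fst z) * divergence ph (snd z)))"
  "(LI z. g z * (ind A (fst z) * divergence ph (snd z))) = (LI t. ind A t * var_pair ph t)"
  "intl (%t. ind A t * var_pair ph t)"
proof -
 note d = divergence_props[OF ph]
 obtain r where r: "ALL x. r < norm x --> divergence ph x = 0" using d(2) by blast
 obtain B where B: "B > 0" "ALL x. norm (divergence ph x) <= B" using continuous_bounded_support_bound[OF d(1) r] by blast
 have Ab: "A <= cball 0 T" using AT by (auto simp: dist_real_def)
 have dm: "divergence ph : Bm" using d(1) by (rule bm_contI)
 have Am: "(ind A :: real => real) : Bm" using A by simp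
 have "intl (%z. (ind A (fst z) *R divergence ph (snd z)) *R g z)"
 proof (rule integrable_Lp_times_bounded[OF p gm gp, where B = B and r = "T + r"])
  show "(%z. ind A (fst z) *R divergence ph (snd z)) : Bm" by (rule measurable_fst_snd[OF Am dm])
  show "\<bar>ind A (fst z) *R divergence ph (snd z)\<bar> <= B" for z using B by (auto simp: indicator_def)
  show "ind A (fst z) *R divergence ph (snd z) = 0" if "T + r < norm z" for z
  using support_fst_snd[OF Ab, of r "fst z" "snd z"] that r by (auto simp: indicator_def)
 qed
 thus i: "intl (%z. g z * (ind A (fst z) * divergence ph (snd z)))"
  by (simp add: mult.commute)
 have e: "(LI x. g (t, x) * (ind A (fst (t, x)) * divergence ph (snd (t, x)))) = ind A t * var_pair ph t" for t
  by (cases "t : A") (auto simp: var_pair_def)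
 show "(LI z. g z * (ind A (fst z) * divergence ph (snd z))) = (LI t. ind A t * var_pair ph t)"
  using integral_prod_fst(1)[OF i] by (simp only: e)
 show "intl (%t. ind A t * var_pair ph t)"
  using integral_prod_fst(3)[OF i] by (simp only: e)
qed

text \<open>Fields attached to disjoint time sets combine into one time-dependent field with the
  bound of a single one. Its pairing with \<open>kgradt\<close> is bounded by the L1 norm, uniformly
  in \<open>n\<close>, and the limit keeps the bound. This permits a supremum under the time
  integral.\<close>

lemma var_pair_partition:
 fixes ph :: "nat => real^'d => real^'d"
 assumes p1: "p = 1" and ph: "!!l. ph l : unit_fields"
  and A: "!!l. A l : sets borel" "!!l. A l <= {0<..<T}" "disjoint_family A"
 shows "(\<Sum>l\<le>N. (LI t. ind (A l) t * var_pair (ph l) t)) <= unweight_bound * grad_bound"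
proof -
 have phC: "ph l : C_k_c 1 Om" "norm (ph l x) <= 1" for l x using ph[of l] by (auto simp: unit_fields_def)
 let ?H = "%n z. kgradt rh Om n (f n) z"
 have lim: "(%n. - (\<Sum>l\<le>N. (LI z. ?H n z \<bullet> (ind (A l) (fst z) *R unweight (ph l) (snd z)))))
  \<longlonglongrightarrow> - (\<Sum>l\<le>N. - (LI z. g z * (ind (A l) (fst z) * weighted_div rh (unweight (ph l)) (snd z))))"
  by (intro tendsto_minus tendsto_sum pairing_limit A unweight_props phC)
 have "- (\<Sum>l\<le>N. - (LI z. g z * (ind (A l) (fst z) * weighted_div rh (unweight (ph l)) (snd z))))
  = (\<Sum>l\<le>N. (LI t. ind (A l) t * var_pair (ph l) t))"
  using var_pair_joint(2)[OF phC(1) A(1,2)] by (simp add: unweight_props(4)[OF phC(1)] sum_negf)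
 moreover have "- (\<Sum>l\<le>N. (LI z. ?H n z \<bullet> (ind (A l) (fst z) *R unweight (ph l) (snd z)))) <= unweight_bound * grad_bound"
  if n: "n >= 1" for n
 proof -
  have Hm[measurable]: "?H n : Bm" by (rule kgradt_measurable[OF k Omb fm[OF n]])
  have H1: "(NI z. en (norm (?H n z))) <= en grad_bound"
  using grad_estimate[OF n] p1 by (simp add: pint_def)
  have gb0: "grad_bound >= 0" by (simp add: grad_bound_def)
  have Hi: "intl (?H n)"
  using H1 by (intro integrableI_bounded) (auto intro: le_less_trans)
  have HI: "(LI z. norm (?H n z)) <= grad_bound"
  using H1 Hi gb0 by (simp add: nn_integral_eq_integral)
  have vm: "(%z. ind (A l) (fst z) *R unweight (ph l) (snd z)) : Bm" for l
  by (intro measurable_fst_snd borel_measurable_indicator A(1) bm_contI C_k_continuous[OF unweight_props(1)[OF phC(1)]])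
  have vb: "norm (unweight (ph l) x) <= unweight_bound" for l x
  using norm_unweight[of "ph l" x] mult_left_mono[OF phC(2)[of l x] unweight_bound_nonneg] by simp
  have ptb: "\<bar>?H n z \<bullet> (ind (A l) (fst z) *R unweight (ph l) (snd z))\<bar> <= ind (A l) (fst z) * (unweight_bound * norm (?H n z))" for l z
  using Cauchy_Schwarz_ineq2[of "?H n z" "unweight (ph l) (snd z)"] mult_left_mono[OF vb[of l "snd z"] norm_ge_zero[of "?H n z"]]
  by (auto simp: indicator_def mult.commute)
  have ii: "intl (%z. ?H n z \<bullet> (ind (A l) (fst z) *R unweight (ph l) (snd z)))" for l
  proof (rule lint_bound[where f = "%z. unweight_bound *R ?H n z"])
  show "intl (%z. unweight_bound *R ?H n z)" using Hi by simp
  show "(%z. ?H n z \<bullet> (ind (A l) (fst z) *R unweight (ph l) (snd z))) : borel_measurable lborel"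
  using borel_measurable_inner[OF Hm vm[of l]] by simp
  show "AE z in lborel. norm (?H n z \<bullet> (ind (A l) (fst z) *R unweight (ph l) (snd z))) <= norm (unweight_bound *R ?H n z)"
  proof (rule AE_I2)
  fix z
  have "ind (A l) (fst z) * (unweight_bound * norm (?H n z)) <= 1 * (unweight_bound * norm (?H n z))"
  using unweight_bound_nonneg by (intro mult_right_mono) (auto simp: indicator_def)
  thus "norm (?H n z \<bullet> (ind (A l) (fst z) *R unweight (ph l) (snd z))) <= norm (unweight_bound *R ?H n z)"
  using ptb[of z l] unweight_bound_nonneg unfolding real_norm_def norm_scaleR by linarith
  qed
  qed
  have "- (\<Sum>l\<le>N. (LI z. ?H n z \<bullet> (ind (A l) (fst z) *R unweight (ph l) (snd z))))
  = (LI z. - (\<Sum>l\<le>N. ?H n z \<bullet> (ind (A l) (fst z) *R unweight (ph l) (snd z))))"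
  unfolding integral_minus by (subst Bochner_Integration.integral_sum) (rule ii, rule refl)
  also have "... <= (LI z. unweight_bound * norm (?H n z))"
  proof (rule integral_mono)
  show "intl (%z. - (\<Sum>l\<le>N. ?H n z \<bullet> (ind (A l) (fst z) *R unweight (ph l) (snd z))))"
  using ii by (intro integrable_minus Bochner_Integration.integrable_sum)
  show "intl (%z. unweight_bound * norm (?H n z))" using Hi by simp
  fix z
  have "- (\<Sum>l\<le>N. ?H n z \<bullet> (ind (A l) (fst z) *R unweight (ph l) (snd z)))
  <= (\<Sum>l\<le>N. ind (A l) (fst z) * (unweight_bound * norm (?H n z)))"
  unfolding sum_negf[symmetric] using ptb[of z] by (intro sum_mono) (meson abs_le_iff)
  also have "... = (\<Sum>l\<le>N. ind (A l) (fst z)) * (unweight_bound * norm (?H n z))"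
  by (rule sum_distrib_right[symmetric])
  \<comment> \<open>By disjointness at most one summand is nonzero at any time, so the number of
    fields does not enter the bound.\<close>
  also have "(\<Sum>l\<le>N. ind (A l) (fst z) :: real) = ind (\<Union>l\<le>N. A l) (fst z)"
  by (rule indicator_UN_disjoint[symmetric]) (use A(3) in \<open>auto simp: disjoint_family_on_def\<close>)
  also have "ind (\<Union>l\<le>N. A l) (fst z) * (unweight_bound * norm (?H n z)) <= unweight_bound * norm (?H n z)"
  using unweight_bound_nonneg by (auto simp: indicator_def)
  finally show "- (\<Sum>l\<le>N. ?H n z \<bullet> (ind (A l) (fst z) *R unweight (ph l) (snd z))) <= unweight_bound * norm (?H n z)" .
  qed
  also have "... <= unweight_bound * grad_bound"
  using HI unweight_bound_nonneg by (simp add: mult_left_mono)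
  finally show ?thesis .
 qed
 ultimately show ?thesis
  using LIMSEQ_le_const2[OF lim, of "unweight_bound * grad_bound"] by auto
qed

text \<open>For finitely many fields, (0,T) is partitioned by the index of the largest pairing and
  the partition bound applies; monotone convergence handles the sequence. The zero field makes the
  maxima nonnegative.\<close>

lemma sup_var_pair_integral:
 fixes ph :: "nat => real^'d => real^'d"
 assumes p1: "p = 1" and ph: "!!l. ph l : unit_fields" and ph0: "ph 0 = (%x. 0)"
 shows "(NI t. ind {0<..<T} t * (SUP l. en (var_pair (ph l) t))) <= en (unweight_bound * grad_bound)"
proof -
 have phC: "ph l : C_k_c 1 Om" for l using ph[of l] by (auto simp: unit_fields_def)
 define V where "V l t = ind {0<..<T} t * var_pair (ph l) t" for l t
 have Vi: "intl (V l)" for l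
  using var_pair_joint(3)[OF phC, of "{0<..<T}" l] by (simp add: V_def[abs_def])
 have [measurable]: "V l : Bm" for l using borel_measurable_integrable[OF Vi[of l]] by simp
 have V0: "V 0 t = 0" for t
 proof -
  have "((%x. 0 :: real^'d) has_derivative (%v. 0)) (at x)" for x :: "real^'d" by simp
  hence "divergence (%x. 0 :: real^'d) x = 0" for x :: "real^'d"
  using frechet_derivative_at[of "%x. 0 :: real^'d" "%v. 0" x] by (simp add: divergence_def fun_eq_iff)
  thus ?thesis by (simp add: V_def var_pair_def ph0)
 qed
 define m where "m N t = Max ((%l. V l t) ` {..N})" for N t
 have mge: "V l t <= m N t" if "l <= N" for l N t unfolding m_def using that by (intro Max_ge) auto
 have m0: "0 <= m N t" for N t using mge[of 0 N t] V0 by simp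
 define ka where "ka N t = (LEAST l. l <= N & (ALL i<=N. V i t <= V l t))" for N t
 have kaex: "EX l. l <= N & (ALL i<=N. V i t <= V l t)" for N t
 proof -
  have "m N t : (%l. V l t) ` {..N}" unfolding m_def by (rule Max_in) auto
  then obtain l where l: "m N t = V l t" "l : {..N}" by (rule imageE)
  thus ?thesis using mge[of _ N t] by (intro exI[of _ l]) auto
 qed
 have ka: "ka N t <= N" "i <= N ==> V i t <= V (ka N t) t" for N t i
  using LeastI_ex[OF kaex[of N t]] unfolding ka_def by auto
 have mka: "m N t = V (ka N t) t" for N t
  unfolding m_def using ka by (intro Max_eqI) auto
 have kam[measurable]: "ka N : measurable borel (count_space UNIV)" for N
  unfolding ka_def[abs_def] by measurable
 have mN: "(NI t. en (m N t)) <= en (unweight_bound * grad_bound)" for N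
 proof -
  define A where "A l = {t : {0<..<T}. ka N t = l}" for l
  have Am[measurable]: "A l : sets borel" for l
  proof -
  have "{0<..<T} \<inter> ka N -` {l} : sets borel" using measurable_sets[OF kam, of "{l}" N] by simp
  moreover have "{0<..<T} \<inter> ka N -` {l} = A l" by (auto simp: A_def)
  ultimately show ?thesis by (simp only:)
  qed
  have msum: "m N t = (\<Sum>l\<le>N. ind (A l) t * var_pair (ph l) t)" for t
  proof (cases "t : {0<..<T}")
  case True
  have "(\<Sum>l\<le>N. ind (A l) t * var_pair (ph l) t) = (\<Sum>l\<le>N. if l = ka N t then var_pair (ph (ka N t)) t else 0)"
  using True by (intro sum.cong) (auto simp: A_def)
  also have "... = var_pair (ph (ka N t)) t" using ka(1)[of N t] by simp
  finally show ?thesis using True mka[of N t] by (simp add: V_def)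
  next
  case False
  hence "m N t = 0" using mka[of N t] by (simp add: V_def)
  moreover have "t ~: A l" for l using False by (auto simp: A_def)
  ultimately show ?thesis by simp
  qed
  have mi: "intl (m N)" unfolding msum[abs_def]
  by (intro Bochner_Integration.integrable_sum var_pair_joint(3)[OF phC Am]) (auto simp: A_def)
  have "(LI t. m N t) = (\<Sum>l\<le>N. (LI t. ind (A l) t * var_pair (ph l) t))"
  unfolding msum[abs_def]
  by (intro Bochner_Integration.integral_sum var_pair_joint(3)[OF phC Am]) (auto simp: A_def)
  also have "... <= unweight_bound * grad_bound"
  by (rule var_pair_partition[OF p1 ph Am]) (auto simp: A_def disjoint_family_on_def)
  finally have "(LI t. m N t) <= unweight_bound * grad_bound" .
  moreover have "(NI t. en (m N t)) = en (LI t. m N t)"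
  using mi m0 by (intro nn_integral_eq_integral) auto
  ultimately show ?thesis by (simp add: ennreal_leI)
 qed
 have mm[measurable]: "m N : Bm" for N
  unfolding m_def[abs_def] by (intro borel_measurable_Max) auto
 have "(NI t. (SUP N. en (m N t))) = (SUP N. (NI t. en (m N t)))"
 proof (rule nn_integral_monotone_convergence_SUP)
  show "incseq (%N t. en (m N t))"
  proof (rule incseq_SucI, rule le_funI, rule ennreal_leI)
  fix N t show "m N t <= m (Suc N) t" unfolding m_def by (intro Max_mono) auto
  qed
 qed simp
 also have "... <= en (unweight_bound * grad_bound)" by (rule SUP_least) (rule mN)
 finally have 1: "(NI t. (SUP N. en (m N t))) <= en (unweight_bound * grad_bound)" .
 have "(NI t. ind {0<..<T} t * (SUP l. en (var_pair (ph l) t))) <= (NI t. (SUP N. en (m N t)))"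
 proof (rule nn_integral_mono)
  fix t
  show "ind {0<..<T} t * (SUP l. en (var_pair (ph l) t)) <= (SUP N. en (m N t))"
  proof (cases "t : {0<..<T}")
  case True
  have "(SUP l. en (var_pair (ph l) t)) <= (SUP N. en (m N t))"
  proof (rule SUP_mono)
  fix l
  have "var_pair (ph l) t <= m l t" using mge[of l l t] True by (simp add: V_def)
  thus "EX N:UNIV. en (var_pair (ph l) t) <= en (m N t)" by (intro bexI[of _ l] ennreal_leI) auto
  qed
  thus ?thesis using True by simp
  qed simp
 qed
 thus ?thesis using 1 by (rule order_trans)
qed

text \<open>The variation of a slice is an uncountable supremum, whose measurability in t is not
  evident. A sequence of fields with uniformly dense divergences gives the same supremum, now
  measurable with finite integral.\<close>

lemma in_L1_BV:
 fixes h :: "real \<times> (real^'d) => real"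
 assumes p1: "p = 1" and h: "AE z in lborel. z : {0<..<T} \<times> Om --> h z = g z"
  and hL: "h : Lp_space 1 (leb ({0<..<T} \<times> Om))"
 shows "h : L1_BV_space T Om"
proof -
 have Tb: "{0<..<T} : sets borel" by simp
 have zero: "(%x. 0) : unit_fields"
  by (simp add: unit_fields_def C_k_c_def supp_def C_k_const del: C_k.simps)
 obtain D where D: "countable D" "D <= unit_fields"
  "!!s. s : unit_fields ==> EX r. ALL e>0. EX s':D. (ALL x. dist (divergence s x) (divergence s' x) < e) &
  (ALL x. r < norm x --> divergence s x = 0 & divergence s' x = 0)"
  by (rule countable_uniformly_dense[of unit_fields divergence])
  (use divergence_props in \<open>auto simp: unit_fields_def\<close>)
 \<comment> \<open>The zero field sits at index 0, as the maximal argument requires; inserting it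
   into \<open>D\<close> makes the enumerated set nonempty.\<close>
 define ph where "ph l = (case l of 0 => (%x. 0) | Suc l => from_nat_into (insert (%x. 0) D) l)" for l
 have cD: "countable (insert (%x. 0) D)" using D(1) by simp
 have ph: "ph l : unit_fields" for l
 proof (cases l)
  case (Suc i)
  have "from_nat_into (insert (%x. 0) D) i : insert (%x. 0) D" by (rule from_nat_into) simp
  thus ?thesis using zero D(2) Suc by (auto simp: ph_def)
 qed (use zero in \<open>simp add: ph_def\<close>)
 have phD: "EX l. ph l = s" if "s : D" for s
  using from_nat_into_to_nat_on[OF cD, of s] that by (intro exI[of _ "Suc (to_nat_on (insert (%x. 0) D) s)"]) (simp add: ph_def)
 have ph0: "ph 0 = (%x. 0)" by (simp add: ph_def)
 have phC: "ph l : C_k_c 1 Om" for l using ph[of l] by (auto simp: unit_fields_def)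
 define S where "S t = (SUP l. en (var_pair (ph l) t))" for t
 have Vm: "(%t. ind {0<..<T} t * var_pair (ph l) t) : Bm" for l
  using borel_measurable_integrable[OF var_pair_joint(3)[OF phC Tb order_refl]] by simp
 \<comment> \<open>With the indicator inside, measurability holds on the whole line; for
   \<open>var_pair\<close> it is known on (0,T) only.\<close>
 define S' where "S' t = (SUP l. en (ind {0<..<T} t * var_pair (ph l) t))" for t
 have S'm[measurable]: "S' : Bm" unfolding S'_def[abs_def] using Vm by measurable
 have S'e: "S' t = ind {0<..<T} t * S t" for t by (cases "t : {0<..<T}") (auto simp: S'_def S_def)
 have Sint: "(NI t. S' t) < \<infinity>"
  using sup_var_pair_integral[of ph, OF p1 ph ph0] unfolding S'e S_def by (auto intro: le_less_trans)
 have AES: "AE t in lborel. S' t ~= \<infinity>" using Sint by (intro nn_integral_PInf_AE) auto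
 have "AE t in lborel. AE x in lborel. (t, x) : {0<..<T} \<times> Om --> h (t, x) = g (t, x)"
 proof (rule lborel_pair.AE_pair)
  show "AE z in lborel \<Otimes>\<^sub>M lborel. z : {0<..<T} \<times> Om --> h z = g z" unfolding lborel_prod by (rule h)
 qed
 define good where "good t \<longleftrightarrow> t : {0<..<T} & (AE x in lborel. x : Om --> h (t, x) = g (t, x)) &
  pint 1 lborel (%x. g (t, x)) < \<infinity> & S t < \<infinity>" for t
 have AEgood: "AE t in lborel. t : {0<..<T} --> good t"
  using \<open>AE t in lborel. AE x in lborel. _ t x\<close> AES AE_slice_finite[OF gm gp]
 proof eventually_elim
  case (elim t)
  thus ?case by (auto simp: good_def p1 S'e less_top)
 qed
 have hm: "(%x. h (t, x)) : borel_measurable (leb Om)" if "good t" for t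
  using lebesgue_on_AE_eq(1)[OF Omb slice_measurable[OF gm]] that by (auto simp: good_def)
 have var_eq: "(\<integral>x. h (t, x) * divergence s x \<partial>leb Om) = var_pair s t" if t: "good t" and s: "s : C_k_c 1 Om" for t s
 proof -
  have dm: "divergence s : Bm" using divergence_props(1)[OF s] by (rule bm_contI)
  have "(\<integral>x. h (t, x) * divergence s x \<partial>leb Om) = (LI x. ind Om x *R (g (t, x) * divergence s x))"
  proof (rule lebesgue_on_AE_eq(2)[OF Omb])
  show "(%x. g (t, x) * divergence s x) : Bm" using slice_measurable[OF gm] dm by simp
  have "AE x in lborel. x : Om --> h (t, x) = g (t, x)" using t by (simp add: good_def)
  thus "AE x in lborel. x : Om --> h (t, x) * divergence s x = g (t, x) * divergence s x" by eventually_elim auto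
  qed
  also have "... = var_pair s t" unfolding var_pair_def
  using divergence_props(3)[OF s] by (intro lint_cong) (auto simp: indicator_def)
  finally show ?thesis .
 qed
 have vars: "variations Om (%x. h (t, x)) = {var_pair s t |s. s : unit_fields}" if t: "good t" for t
  unfolding variations_def unit_fields_def
  by (rule Collect_cong, rule ex_cong1) (auto simp: var_eq[OF t] simp del: One_nat_def)
 have S0: "en (var_pair (ph l) t) <= S t" for l t unfolding S_def by (rule SUP_upper) simp
 have le: "var_pair s t <= enn2real (S t)" if t: "good t" and s: "s : unit_fields" for t s
 proof (rule field_le_epsilon)
  fix e :: real assume e: "0 < e"
  have sC: "s : C_k_c 1 Om" using s by (simp add: unit_fields_def)
  obtain r where "ALL e>0. EX s':D. (ALL x. dist (divergence s x) (divergence s' x) < e) &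
  (ALL x. r < norm x --> divergence s x = 0 & divergence s' x = 0)" using D(3)[OF s] by (elim exE)
  hence r: "EX s':D. (ALL x. dist (divergence s x) (divergence s' x) < e) &
  (ALL x. r < norm x --> divergence s x = 0 & divergence s' x = 0)" if "e > 0" for e using that by (elim allE impE)
  have iu: "intl (%x. ind (cball 0 r) x *R g (t, x))"
  using t p1 by (intro integrable_bounded_region[OF slice_measurable[OF gm] p]) (simp add: good_def)
  define c where "c = (LI x. \<bar>ind (cball 0 r) x *R g (t, x)\<bar>)"
  have c0: "c >= 0" unfolding c_def by simp
  define d where "d = e / (c + 1)"
  have d: "d > 0" using e c0 by (simp add: d_def)
  obtain s' where s': "s' : D" "!!x. dist (divergence s x) (divergence s' x) < d"
  "!!x. r < norm x ==> divergence s x = 0 & divergence s' x = 0" using r[OF d] by blast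
  have s'C: "s' : C_k_c 1 Om" using s'(1) D(2) by (auto simp: unit_fields_def)
  have m: "divergence q : Bm" if "q : C_k_c 1 Om" for q
  using divergence_props(1)[OF that] by (rule bm_contI)
  obtain B where B: "!!x. norm (divergence s x) <= B"
  using continuous_bounded_support_bound[OF divergence_props(1)[OF sC], of r] s'(3) by blast
  have "\<bar>(LI x. g (t, x) * divergence s x) - (LI x. g (t, x) * divergence s' x)\<bar> <= d * c"
  unfolding c_def
  by (rule integral_close_uniform[OF iu m[OF sC] m[OF s'C] _ _ s'(3), where B = B])
  (use s'(2) B in \<open>auto simp: dist_real_def intro: less_imp_le\<close>)
  hence "var_pair s t <= var_pair s' t + d * c" unfolding var_pair_def by linarith
  moreover have "var_pair s' t <= enn2real (S t)"
  proof -
  obtain l where l: "ph l = s'" using phD[OF s'(1)] by blast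
  have "en (var_pair s' t) <= S t" using S0[of l t] l by simp
  also have "S t = en (enn2real (S t))" using t by (simp add: good_def)
  finally show ?thesis by (subst (asm) ennreal_le_iff) auto
  qed
  moreover have "d * c <= e" using e c0 unfolding d_def by (simp add: field_simps)
  ultimately show "var_pair s t <= enn2real (S t) + e" by linarith
 qed
 have bdd: "bdd_above (variations Om (%x. h (t, x)))" if "good t" for t
  unfolding vars[OF that] using le[OF that] by (intro bdd_aboveI[of _ "enn2real (S t)"]) auto
 have sup: "Sup (variations Om (%x. h (t, x))) = enn2real (S t)" if t: "good t" for t
 proof (rule antisym)
  have ne: "variations Om (%x. h (t, x)) ~= {}" unfolding vars[OF t] using zero by blast
  show "Sup (variations Om (%x. h (t, x))) <= enn2real (S t)"
  using ne unfolding vars[OF t] by (intro cSup_least) (auto intro: le[OF t])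
  define q where "q = Sup (variations Om (%x. h (t, x)))"
  have up: "var_pair (ph l) t <= q" for l
  unfolding q_def using bdd[OF t] ph by (intro cSup_upper) (auto simp: vars[OF t])
  have "S t <= en q" unfolding S_def by (rule SUP_least) (rule ennreal_leI[OF up])
  moreover have "0 <= q"
  proof -
  have "((%x. 0 :: real^'d) has_derivative (%v. 0)) (at x)" for x :: "real^'d" by simp
  hence "divergence (%x. 0 :: real^'d) x = 0" for x :: "real^'d"
  using frechet_derivative_at[of "%x. 0 :: real^'d" "%v. 0" x] by (simp add: divergence_def fun_eq_iff)
  thus ?thesis using up[of 0] by (simp add: ph0 var_pair_def)
  qed
  ultimately show "enn2real (S t) <= Sup (variations Om (%x. h (t, x)))"
  unfolding q_def[symmetric] by (intro enn2real_leI)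
 qed
 have L1: "(%x. h (t, x)) : Lp_space 1 (leb Om)" "Lp_norm 1 (leb Om) (%x. h (t, x)) = enn2real (NI x. en (norm (g (t, x))) * ind Om x)"
  if t: "good t" for t
 proof -
  have e: "pint 1 (leb Om) (%x. h (t, x)) = (NI x. en (norm (g (t, x))) * ind Om x)"
  unfolding pint_def nn_integral_lebesgue_on[OF Omb]
  proof (rule nn_integral_cong_AE)
  have "AE x in lborel. x : Om --> h (t, x) = g (t, x)" using t by (simp add: good_def)
  thus "AE x in lborel. en (norm (h (t, x)) powr 1) * ind Om x = en (norm (g (t, x))) * ind Om x"
  by eventually_elim (auto simp: indicator_def)
  qed
  have "(NI x. en (norm (g (t, x))) * ind Om x) <= pint 1 lborel (%x. g (t, x))"
  unfolding pint_def by (intro nn_integral_mono) (auto simp: indicator_def)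
  thus "(%x. h (t, x)) : Lp_space 1 (leb Om)"
  using hm[OF t] t unfolding Lp_space_iff e by (auto simp: good_def intro: le_less_trans)
  show "Lp_norm 1 (leb Om) (%x. h (t, x)) = enn2real (NI x. en (norm (g (t, x))) * ind Om x)"
  using integral_eq_pint[OF hm[OF t], of 1] unfolding e[symmetric] by (simp add: Lp_norm_def)
 qed
 have goodL: "AE t in leb {0<..<T}. good t" using AEgood unfolding AE_lebesgue_on_iff[OF Tb] .
 have BVae: "AE t in leb {0<..<T}. (%x. h (t, x)) : BV_space Om"
  using goodL by eventually_elim (use L1 bdd in \<open>auto simp: BV_space_def\<close>)
 define F where "F t = enn2real (NI x. en (norm (g (t, x))) * ind Om x) + enn2real (S' t)" for t
 have [measurable]: "g : borel_measurable (borel \<Otimes>\<^sub>M borel)" using gm by (simp add: borel_prod)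
 note Omb[measurable]
 have Fm: "F : Bm" unfolding F_def by measurable
 have aeF: "AE t in lborel. t : {0<..<T} --> BV_norm Om (%x. h (t, x)) = F t"
  using AEgood
 proof eventually_elim
  case (elim t)
  thus ?case using L1(2)[of t] sup[of t] by (auto simp: BV_norm_def F_def S'e)
 qed
 have "intl (%t. ind {0<..<T} t *R F t)"
 proof (rule integrableI_bounded)
  show "(%t. ind {0<..<T} t *R F t) : borel_measurable lborel" using Fm by simp
  have enn_le: "en (enn2real a) <= a" for a by (cases a) auto
  have "(NI t. en (norm (ind {0<..<T} t *R F t)))
  <= (NI t. pint 1 lborel (%x. g (t, x)) + S' t)"
  proof (rule nn_integral_mono)
  fix t
  have "en (norm (ind {0<..<T} t *R F t)) <= en (F t)"
  by (intro ennreal_leI) (auto simp: indicator_def F_def)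
  also have "... <= (NI x. en (norm (g (t, x))) * ind Om x) + S' t"
  unfolding F_def by (subst ennreal_plus) (auto intro!: add_mono enn_le)
  also have "... <= pint 1 lborel (%x. g (t, x)) + S' t"
  unfolding pint_def by (intro add_mono nn_integral_mono) (auto simp: indicator_def)
  finally show "en (norm (ind {0<..<T} t *R F t)) <= pint 1 lborel (%x. g (t, x)) + S' t" .
  qed
  also have "... = pint 1 lborel g + (NI t. S' t)"
  unfolding pint_prod[OF gm] using pint_slice_measurable[OF gm, of 1] by (intro nn_integral_add) auto
  also have "... < \<infinity>" using gp p1 Sint by simp
  finally show "(NI t. en (norm (ind {0<..<T} t *R F t))) < \<infinity>" .
 qed
 hence "integrable (leb {0<..<T}) (%t. BV_norm Om (%x. h (t, x)))"
  using lebesgue_on_AE_eq(3)[OF Tb Fm aeF] by simp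
 thus ?thesis using hL BVae by (simp add: L1_BV_space_def)
qed

end

section \<open>Transfer to Borel representatives\<close>

lemma AE_slices:
 fixes h g :: "real \<times> 'a::euclidean_space => 'b"
 assumes "AE z in lborel. z : A \<times> B --> h z = g z"
 shows "AE t in lborel. t : A --> (AE x in lborel. x : B --> h (t, x) = g (t, x))"
proof -
 have "AE t in lborel. AE x in lborel. (t, x) : A \<times> B --> h (t, x) = g (t, x)"
 proof (rule lborel_pair.AE_pair)
  show "AE z in lborel \<Otimes>\<^sub>M lborel. z : A \<times> B --> h z = g z" unfolding lborel_prod by (rule assms)
 qed
 thus ?thesis by eventually_elim auto
qed

lemma is_kernel_exists:
 fixes rh :: "real^'d => real"
 assumes "!!x. 0 <= rh x" "smooth rh" "radial rh" "compact (supp rh)" "EX x. rh x ~= 0"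
 obtains R where "is_kernel rh R"
proof -
 obtain R where R: "R > 0" "!!x. x : supp rh ==> norm x <= R"
  using compact_imp_bounded[OF assms(4)] by (auto simp: bounded_pos)
 have "rh x = 0" if "R < norm x" for x
  using R(2)[of x] that not_in_supp[of x rh] by force
 hence "is_kernel rh R" unfolding is_kernel_def
  using assms(1,3,5) smooth_continuous[OF assms(2)] R(1) by blast
 thus ?thesis by (rule that)
qed

text \<open>Changing each \<open>f n\<close> on a null set alters neither bound: for almost every t
  the slices agree almost everywhere, which the double integral in x and y respects as well.\<close>

lemma kernel_sequence_representative:
 fixes f :: "nat => real \<times> (real^'d) => real" and Om :: "(real^'d) set"
 assumes k: "is_kernel rh R" and j: "unit_bump j" and T0: "0 < T" and p: "1 <= p" and Om: "open Om"
  and fL: "!!n. 1 <= n ==> f n : Lp_space p (leb ({0<..<T} \<times> Om))"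
  and fb: "!!n. 1 <= n ==>
  (\<integral>\<^sup>+ t. (\<integral>\<^sup>+ x. en (\<bar>f n (t, x)\<bar> powr p) \<partial>leb Om) \<partial>leb {0<..<T}) <= en M"
  and fe: "!!n. 1 <= n ==> ennreal (real n powr p) *
  (\<integral>\<^sup>+ t. (\<integral>\<^sup>+ y. (\<integral>\<^sup>+ x. en (rescaled rh n (x - y) * \<bar>f n (t, x) - f n (t, y)\<bar> powr p)
  \<partial>leb Om) \<partial>leb Om) \<partial>leb {0<..<T}) <= en M"
 obtains f' where "kernel_sequence T p M R Om rh f' j"
  "ALL n>=1. AE z in lborel. z : {0<..<T} \<times> Om --> f n z = f' n z"
proof -
 let ?S = "{0<..<T} \<times> Om"
 have Omb: "Om : sets borel" and Tb: "{0<..<T} : sets borel" using Om by auto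
 have Sb: "?S : sets borel" using Om by (intro borel_open open_Times) auto
 define P where "P n g \<longleftrightarrow> g : Bm & (ALL z. z ~: ?S --> g z = 0) &
  (AE z in lborel. z : ?S --> f n z = g z)" for n g
 have ex: "EX g. P n g" if "1 <= n" for n
 proof -
  have fnm: "f n : borel_measurable (leb ?S)" using fL[OF that] by (simp add: Lp_space_iff)
  obtain g where "g : Bm" "!!x. x ~: ?S ==> g x = 0" "AE x in lborel. x : ?S --> f n x = g x"
  using borel_representative_real[OF Sb fnm] by blast
  thus ?thesis unfolding P_def by blast
 qed
 define f' where "f' n = (SOME g. P n g)" for n
 have P: "P n (f' n)" if "1 <= n" for n unfolding f'_def by (rule someI_ex[OF ex[OF that]])
 have fm: "f' n : Bm" if "1 <= n" for n using P[OF that] by (simp add: P_def)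
 have f0: "f' n z = 0" if "1 <= n" "z ~: ?S" for n z using P[OF that(1)] that(2) unfolding P_def by blast
 have ae: "AE z in lborel. z : ?S --> f n z = f' n z" if "1 <= n" for n using P[OF that] by (simp add: P_def)
 have "pil p (f' n) <= en M" if n: "1 <= n" for n
 proof -
  have "pil p (f' n) = (NI t. pil p (%x. f' n (t, x)))" by (rule pint_prod[OF fm[OF n]])
  also have "... = (NI t. (NI x. en (\<bar>f n (t, x)\<bar> powr p) * ind Om x) * ind {0<..<T} t)"
  proof (rule nn_integral_cong_AE)
  show "AE t in lborel. pil p (%x. f' n (t, x)) =
  (NI x. en (\<bar>f n (t, x)\<bar> powr p) * ind Om x) * ind {0<..<T} t"
  using AE_slices[OF ae[OF n]]
  proof eventually_elim
  case (elim t)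
  show ?case
  proof (cases "t : {0<..<T}")
  case True
  hence "AE x in lborel. x : Om --> f n (t, x) = f' n (t, x)" using elim by simp
  hence "AE x in lborel. en (norm (f' n (t, x)) powr p) = en (\<bar>f n (t, x)\<bar> powr p) * ind Om x"
  by eventually_elim (use f0[OF n] in \<open>auto simp: indicator_def\<close>)
  thus ?thesis using True unfolding pint_def by (simp cong: nn_integral_cong_AE)
  next
  case False
  hence "f' n (t, x) = 0" for x by (intro f0[OF n]) auto
  thus ?thesis using False by (simp add: pint_def)
  qed
  qed
  qed
  also have "... <= en M" using fb[OF n] by (simp add: nn_integral_lebesgue_on[OF Omb] nn_integral_lebesgue_on[OF Tb])
  finally show ?thesis .
 qed
 moreover have "en (real n powr p) * (NI t. kenergy p rh Om n (%x. f' n (t, x))) <= en M" if n: "1 <= n" for n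
 proof -
  have "(NI t. kenergy p rh Om n (%x. f' n (t, x))) =
  (NI t. (NI y. (NI x. en (rescaled rh n (x - y) * \<bar>f n (t, x) - f n (t, y)\<bar> powr p) * ind Om x) * ind Om y) * ind {0<..<T} t)"
  proof (rule nn_integral_cong_AE)
  show "AE t in lborel. kenergy p rh Om n (%x. f' n (t, x)) =
  (NI y. (NI x. en (rescaled rh n (x - y) * \<bar>f n (t, x) - f n (t, y)\<bar> powr p) * ind Om x) * ind Om y) * ind {0<..<T} t"
  using AE_slices[OF ae[OF n]]
  proof eventually_elim
  case (elim t)
  show ?case
  proof (cases "t : {0<..<T}")
  case True
  hence aex: "AE x in lborel. x : Om --> f n (t, x) = f' n (t, x)" using elim by simp
  have "kenergy p rh Om n (%x. f' n (t, x)) =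
  (NI y. (NI x. en (rescaled rh n (x - y) * \<bar>f n (t, x) - f n (t, y)\<bar> powr p) * ind Om x) * ind Om y)"
  unfolding kenergy_def
  proof (rule nn_integral_cong_AE)
  show "AE y in lborel. (NI x. ind Om x * ind Om y * en (rescaled rh n (x - y) * \<bar>f' n (t, x) - f' n (t, y)\<bar> powr p))
  = (NI x. en (rescaled rh n (x - y) * \<bar>f n (t, x) - f n (t, y)\<bar> powr p) * ind Om x) * ind Om y"
  using aex
  proof eventually_elim
  case (elim y)
  show ?case
  proof (cases "y : Om")
  case True
  hence fy: "f n (t, y) = f' n (t, y)" using elim by simp
  have "AE x in lborel. ind Om x * ind Om y * en (rescaled rh n (x - y) * \<bar>f' n (t, x) - f' n (t, y)\<bar> powr p)
  = en (rescaled rh n (x - y) * \<bar>f n (t, x) - f n (t, y)\<bar> powr p) * ind Om x"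
  using aex by eventually_elim (use True fy in \<open>auto simp: indicator_def\<close>)
  thus ?thesis using nn_integral_cong_AE[of _ _ lborel] True by simp
  qed simp
  qed
  qed
  thus ?thesis using True by simp
  next
  case False
  hence "f' n (t, x) = 0" for x by (intro f0[OF n]) auto
  thus ?thesis using False by (simp add: kenergy_def)
  qed
  qed
  qed
  thus ?thesis using fe[OF n] by (simp add: nn_integral_lebesgue_on[OF Omb] nn_integral_lebesgue_on[OF Tb])
 qed
 ultimately have "kernel_sequence T p M R Om rh f' j"
  unfolding kernel_sequence_def using k j T0 p Om fm f0 by blast
 thus ?thesis using ae by (intro that) auto
qed

text \<open>Boundedness on Lp follows from Jensen's inequality on the part of \<open>S\<close> that
  carries \<open>w\<close>.\<close>

lemma bounded_pairing_dual:
 fixes S :: "'a::euclidean_space set" and w :: "'a => real"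
 assumes S: "S : sets borel" and p: "1 <= p" and w: "w : Bm"
  and B: "!!z. \<bar>w z\<bar> <= B" and z: "!!z. r < norm z ==> w z = 0"
 shows "(%u. \<integral>z. u z * w z \<partial>leb S) : dual_space (Lp_space p (leb S)) (Lp_norm p (leb S))"
proof -
 let ?N = "leb S"
 have SL: "S : sets lebesgue" by (rule sets_lebesgue_borel[OF S])
 have B0: "0 <= B" using B[of 0] by linarith
 define A where "A = cball 0 r \<inter> S"
 define m where "m = measure lebesgue (cball (0::'a) r)"
 have AL: "A : sets lebesgue" using SL unfolding A_def by (intro sets.Int sets_lebesgue_borel[of "cball 0 r"] SL) auto
 have A: "A : sets ?N" using AL SL by (auto simp: sets_restrict_space_iff A_def)
 have "emeasure ?N A = emeasure lebesgue A" using SL by (intro emeasure_restrict_space) (auto simp: A_def)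
 also have "... <= emeasure lebesgue (cball (0::'a) r)" by (intro emeasure_mono sets_lebesgue_borel) (auto simp: A_def)
 also have "... = en m" unfolding m_def by (intro emeasure_eq_measure2 lmeasurable_cball)
 finally have Am: "emeasure ?N A <= en m" .
 have wm: "w : borel_measurable ?N" by (intro measurable_restrict_space1 borel_measurable_lebesgue_of_borel w)
 have pw: "pint p ?N (%z. u z * w z) <= en (B powr p) * pint p ?N u" if u: "u : borel_measurable ?N" for u :: "'a => real"
 proof -
  have "pint p ?N (%z. u z * w z) <= (\<integral>\<^sup>+z. en (B powr p) * en (norm (u z) powr p) \<partial>?N)"
  unfolding pint_def
  proof (rule nn_integral_mono)
  fix z
  have "norm (u z * w z) powr p = \<bar>w z\<bar> powr p * norm (u z) powr p" by (simp add: abs_mult powr_mult mult.commute)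
  also have "... <= B powr p * norm (u z) powr p" using p B[of z] by (intro mult_right_mono powr_mono2) auto
  finally show "en (norm (u z * w z) powr p) <= en (B powr p) * en (norm (u z) powr p)"
  by (simp add: ennreal_mult[symmetric] ennreal_leI)
  qed
  also have "... = en (B powr p) * pint p ?N u" unfolding pint_def using u by (intro nn_integral_cmult) auto
  finally show ?thesis .
 qed
 have uw0: "u x * w x = 0" if "x : space ?N" "x ~: A" for u x
  using that z[of x] by (auto simp: A_def space_restrict_space)
 have int: "integrable ?N (%z. u z * w z)" if u: "u : Lp_space p ?N" for u
 proof (rule integrable_Lp_support[OF _ A p])
  have um: "u : borel_measurable ?N" "pint p ?N u < \<infinity>" using u by (auto simp: Lp_space_iff)
  show "(%z. u z * w z) : borel_measurable ?N" using um(1) wm by simp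
  show "emeasure ?N A < \<infinity>" using Am by (rule le_less_trans) simp
  show "pint p ?N (%z. u z * w z) < \<infinity>" using pw[OF um(1)] um(2) by (auto simp: ennreal_mult_less_top intro: le_less_trans)
 qed (use uw0 in auto)
 define K where "K = m powr (p - 1) * B powr p"
 have K0: "0 <= K" by (simp add: K_def)
 have bd: "\<bar>\<integral>z. u z * w z \<partial>?N\<bar> <= K powr (1 / p) * Lp_norm p ?N u" if u: "u : Lp_space p ?N" for u
 proof -
  have um: "u : borel_measurable ?N" using u by (auto simp: Lp_space_iff)
  have uwm: "(%z. u z * w z) : borel_measurable ?N" using um wm by simp
  define I where "I = (\<integral>x. norm (u x) powr p \<partial>?N)"
  have I0: "0 <= I" by (simp add: I_def)
  have "en (norm (\<integral>z. u z * w z \<partial>?N) powr p) <= en (m powr (p - 1)) * pint p ?N (%z. u z * w z)"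
  by (rule jensen_powr_support[OF uwm A p Am]) (rule uw0)
  also have "... <= en (m powr (p - 1)) * (en (B powr p) * en I)"
  using pw[OF um] unfolding pint_eq_integral[OF u] I_def by (rule mult_left_mono) simp
  also have "... = en (K * I)" using I0 by (simp add: K_def ennreal_mult[symmetric] mult.assoc)
  finally have "\<bar>\<integral>z. u z * w z \<partial>?N\<bar> powr p <= K * I" using K0 I0 by simp
  hence "(\<bar>\<integral>z. u z * w z \<partial>?N\<bar> powr p) powr (1 / p) <= (K * I) powr (1 / p)"
  using p by (intro powr_mono2) auto
  thus ?thesis using p K0 I0 by (simp add: powr_powr powr_mult Lp_norm_def I_def)
 qed
 have "(\<integral>z. (a * u z + b * v z) * w z \<partial>?N) = a * (\<integral>z. u z * w z \<partial>?N) + b * (\<integral>z. v z * w z \<partial>?N)"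
  if u: "u : Lp_space p ?N" "v : Lp_space p ?N" for u v a b
 proof -
  have "(\<integral>z. (a * u z + b * v z) * w z \<partial>?N) = (\<integral>z. a * (u z * w z) + b * (v z * w z) \<partial>?N)"
  by (simp add: algebra_simps)
  also have "... = (\<integral>z. a * (u z * w z) \<partial>?N) + (\<integral>z. b * (v z * w z) \<partial>?N)"
  using int[OF u(1)] int[OF u(2)] by (intro Bochner_Integration.integral_add integrable_mult_right)
  finally show ?thesis by simp
 qed
 thus ?thesis unfolding dual_space_def using bd by blast
qed

text \<open>Weak convergence passes to the representatives through pairings with bounded functions,
  and the regularity found for the representative of the limit returns to \<open>g\<close>, which
  agrees with it almost everywhere.\<close>

lemma weak_limit_regularity:
 fixes f :: "nat => real \<times> (real^'d) => real" and Om :: "(real^'d) set"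
 assumes ks: "kernel_sequence T p M R Om rh f' j"
  and ae: "ALL n>=1. AE z in lborel. z : {0<..<T} \<times> Om --> f n z = f' n z"
  and w: "weakly_converges_in (Lp_space p (leb ({0<..<T} \<times> Om))) (Lp_norm p (leb ({0<..<T} \<times> Om))) f g"
 shows "p > 1 ==> (%t x. g (t, x)) : bochner_space p (leb {0<..<T}) (W1_space p Om) (W1_norm p Om)"
  and "p = 1 ==> g : L1_BV_space T Om"
proof -
 let ?S = "{0<..<T} \<times> Om"
 interpret ks: kernel_sequence T p M R Om rh f' j by (rule ks)
 have Sb: "?S : sets borel" using ks.Om by (intro borel_open open_Times) auto
 have gL: "g : Lp_space p (leb ?S)" using w by (simp add: weakly_converges_in_def)
 hence gLm: "g : borel_measurable (leb ?S)" by (simp add: Lp_space_iff)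
 obtain g' where g': "g' : Bm" "!!z. z ~: ?S ==> g' z = 0" "AE z in lborel. z : ?S --> g z = g' z"
  using borel_representative_real[OF Sb gLm] by blast
 have "pil p g' = pint p (leb ?S) g"
  unfolding pint_def nn_integral_lebesgue_on[OF Sb]
 proof (rule nn_integral_cong_AE)
  show "AE z in lborel. en (norm (g' z) powr p) = en (norm (g z) powr p) * ind ?S z"
  using g'(3) by eventually_elim (use g'(2) in \<open>auto simp: indicator_def\<close>)
 qed
 hence gp: "pil p g' < \<infinity>" using gL by (simp add: Lp_space_iff)
 have weak: "(%n. (LI z. f' n z * v z)) \<longlonglongrightarrow> (LI z. g' z * v z)"
  if v: "v : Bm" "!!z. \<bar>v z\<bar> <= B" "!!z. r < norm z ==> v z = 0" for v B r
 proof -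
  have eq: "(\<integral>z. u z * v z \<partial>leb ?S) = (LI z. u' z * v z)"
  if u: "u' : Bm" "!!z. z ~: ?S ==> u' z = 0" "AE z in lborel. z : ?S --> u z = u' z" for u u'
  proof -
  have m: "(%z. u' z * v z) : Bm" using u(1) v(1) by simp
  have "AE z in lborel. z : ?S --> u z * v z = u' z * v z" using u(3) by eventually_elim auto
  from lebesgue_on_AE_eq(2)[OF Sb m this]
  have "(\<integral>z. u z * v z \<partial>leb ?S) = (LI z. ind ?S z *R (u' z * v z))" .
  also have "... = (LI z. u' z * v z)"
  using u(2) by (intro lint_cong) (auto simp: indicator_def)
  finally show ?thesis .
  qed
  have "(%u. \<integral>z. u z * v z \<partial>leb ?S) : dual_space (Lp_space p (leb ?S)) (Lp_norm p (leb ?S))"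
  by (rule bounded_pairing_dual[OF Sb ks.p v])
  hence "(%n. \<integral>z. f n z * v z \<partial>leb ?S) \<longlonglongrightarrow> (\<integral>z. g z * v z \<partial>leb ?S)"
  using bspec[OF conjunct2[OF w[unfolded weakly_converges_in_def]]] by blast
  hence "(%n. \<integral>z. f n z * v z \<partial>leb ?S) \<longlonglongrightarrow> (LI z. g' z * v z)"
  using eq[OF g'] by simp
  thus ?thesis
  proof (rule Lim_transform_eventually)
  show "\<forall>\<^sub>F n in sequentially. (\<integral>z. f n z * v z \<partial>leb ?S) = (LI z. f' n z * v z)"
  using eventually_ge_at_top[of 1]
  by eventually_elim (intro eq ks.fm ks.f0, use ae in auto)
  qed
 qed
 interpret wl: weak_limit T p M R Om rh f' j g'
 proof (unfold_locales, rule g'(1), rule g'(2), assumption, rule gp)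
  fix v :: "real \<times> (real^'d) => real" and B r :: real
  assume a: "v : Bm" "!!z. \<bar>v z\<bar> <= B" "!!z. r < norm z ==> v z = 0"
  show "(%n. (LI z. f' n z * v z)) \<longlonglongrightarrow> (LI z. g' z * v z)"
  by (rule weak[of v B r]) (fact a)+
 qed
 show "(%t x. g (t, x)) : bochner_space p (leb {0<..<T}) (W1_space p Om) (W1_norm p Om)" if p1: "p > 1"
 proof -
  obtain Ga :: "real \<times> (real^'d) => real^'d" where Ga: "Ga : Bm" "pil p Ga < \<infinity>"
  "!!A ph i. A : sets borel ==> A <= {0<..<T} ==> ph : tests Om ==>
  (LI z. ind A (fst z) * (Ga z $ i * ph (snd z)))
  = - (LI z. ind A (fst z) * (g' z * fder ph (at (snd z)) (axis i 1)))"
  by (rule wl.joint_gradient[OF p1], rule that)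
  show ?thesis
  by (rule wl.strongly_measurable_in_W1[OF Ga(1,2) g'(3) wl.slice_gradient[OF Ga]])
 qed
 show "g : L1_BV_space T Om" if p1: "p = 1"
  by (rule wl.in_L1_BV[OF p1 g'(3)]) (use gL p1 in simp)
qed

section \<open>Cones in smooth domains\<close>

lemma smooth_Lipschitz_on_cball:
 fixes ga :: "'a::euclidean_space => real"
 assumes "smooth ga"
 obtains L where "0 <= L" "!!x y. norm x <= K ==> norm y <= K ==> \<bar>ga x - ga y\<bar> <= L * norm (x - y)"
proof -
 have C1: "C_k (Suc 0) ga" using assms by (rule smooth_C_k)
 have c: "cts (%x. fder ga (at x) b)" for b
  by (rule C_k_continuous[OF C_k_SucD(2)[OF C1]])
 have d: "(ga has_derivative fder ga (at x)) (at x)" for x by (rule C_k_SucD(1)[OF C1])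
 have "EX B. ALL x:cball 0 K. \<bar>fder ga (at x) b\<bar> <= B" for b
 proof -
  have "bounded ((%x. fder ga (at x) b) ` cball 0 K)"
  by (intro compact_imp_bounded compact_continuous_image continuous_on_subset[OF c]) auto
  thus ?thesis by (auto simp: bounded_iff)
 qed
 then obtain B where B: "!!b x. x : cball 0 K ==> \<bar>fder ga (at x) b\<bar> <= B b" by metis
 define L where "L = (\<Sum>b\<in>Basis. \<bar>B b\<bar>)"
 have on: "onorm (fder ga (at x)) <= L" if x: "x : cball 0 K" for x
 proof (rule onorm_le)
  fix v :: 'a
  have lin: "linear (fder ga (at x))" using d by (rule has_derivative_linear)
  have "fder ga (at x) v = fder ga (at x) (\<Sum>b\<in>Basis. (v \<bullet> b) *R b)"
  by (simp add: euclidean_representation)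
  also have "... = (\<Sum>b\<in>Basis. (v \<bullet> b) * fder ga (at x) b)"
  by (simp add: linear_sum[OF lin] linear_cmul[OF lin])
  also have "\<bar>...\<bar> <= (\<Sum>b\<in>Basis. \<bar>(v \<bullet> b) * fder ga (at x) b\<bar>)" by (rule sum_abs)
  also have "... <= (\<Sum>b\<in>Basis. norm v * \<bar>B b\<bar>)"
  proof (rule sum_mono)
  fix b :: 'a assume "b : Basis"
  hence "\<bar>v \<bullet> b\<bar> <= norm v" by (rule Basis_le_norm)
  moreover have "\<bar>fder ga (at x) b\<bar> <= \<bar>B b\<bar>" using B[OF x, of b] by linarith
  ultimately show "\<bar>(v \<bullet> b) * fder ga (at x) b\<bar> <= norm v * \<bar>B b\<bar>"
  unfolding abs_mult by (intro mult_mono) auto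
  qed
  also have "... = L * norm v" by (simp add: L_def sum_distrib_left mult.commute)
  finally show "norm (fder ga (at x) v) <= L * norm v" by simp
 qed
 show ?thesis
 proof (rule that[of L])
  show "0 <= L" by (simp add: L_def sum_nonneg)
  fix x y :: 'a assume "norm x <= K" "norm y <= K"
  hence "norm (ga x - ga y) <= L * norm (x - y)"
  by (intro differentiable_bound[of "cball 0 K" ga "%x. fder ga (at x)" L] on has_derivative_at_withinI[OF d]) auto
  thus "\<bar>ga x - ga y\<bar> <= L * norm (x - y)" by simp
 qed
qed

text \<open>The directions fill a ball around \<open>e\<close>, so that averages over them make
  sense. \<open>s = 0\<close> is included, which puts \<open>V\<close> itself inside the domain, and
  \<open>th <= 1\<close> bounds the directions by 2.\<close>

definition cone_condition :: "(real^'d) set => (real^'d) set => real^'d => real => real => bool" where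
 "cone_condition Om V e th s0 \<longleftrightarrow> norm e = 1 & 0 < th & th <= 1 & 0 < s0 &
  (ALL x:V. ALL w:ball e th. ALL s. 0 <= s & s <= s0 --> x + s *R w : Om)"

lemma cone_ball_norm:
 fixes e :: "real^'d"
 assumes "cone_condition Om V e th s0" "w : ball e th"
 shows "norm w <= 2"
proof -
 have "norm w <= norm e + norm (w - e)" by (metis add.commute diff_add_cancel norm_triangle_ineq)
 thus ?thesis using assms by (auto simp: cone_condition_def dist_norm norm_minus_commute)
qed

text \<open>At an interior point any direction will do. Near a boundary point, moving along
  \<open>e\<close> gains height without moving the base point under the graph, and directions close
  to \<open>e\<close> still gain height faster than the Lipschitz graph can rise.\<close>

lemma smooth_domain_cone:
 fixes Om :: "(real^'d) set"
 assumes Om: "smooth_bounded_domain Om" and x0: "x0 : closure Om"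
 shows "EX r>0. EX e th s0. cone_condition Om (Om \<inter> ball x0 r) e th s0"
proof (cases "x0 : Om")
 case True
 have "open Om" using Om by (simp add: smooth_bounded_domain_def)
 then obtain r where r: "r > 0" "ball x0 r <= Om" using True open_contains_ball by blast
 obtain e :: "real^'d" where e: "norm e = 1" using vector_choose_size[of 1] by auto
 have "x + s *R w : Om" if x: "x : ball x0 (r / 2)" and w: "w : ball e 1" and s: "0 <= s" "s <= r / 4" for x w s
 proof -
  have "norm w <= norm e + norm (w - e)" by (metis add.commute diff_add_cancel norm_triangle_ineq)
  hence w2: "norm w <= 2" using w e by (simp add: dist_norm norm_minus_commute)
  have "norm (s *R w) <= (r / 4) * 2" unfolding norm_scaleR using s w2 r by (intro mult_mono) auto
  moreover have "norm (x0 - (x + s *R w)) <= norm (x0 - x) + norm (s *R w)" by (metis diff_diff_eq norm_triangle_ineq4)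
  ultimately show ?thesis using x r(2) by (auto simp: dist_norm intro!: subsetD[OF r(2)])
 qed
 hence "cone_condition Om (Om \<inter> ball x0 (r / 2)) e 1 (r / 4)"
  using e r(1) by (auto simp: cone_condition_def)
 thus ?thesis using r(1) by (intro exI[of _ "r / 2"]) auto
next
 case False
 have op: "open Om" using Om by (simp add: smooth_bounded_domain_def)
 hence fr: "x0 : frontier Om" using False x0 by (simp add: frontier_def interior_open)
 have "EX r>0. EX e. EX ga :: real^'d => real. norm e = 1 & smooth ga &
  Om \<inter> ball x0 r = {x : ball x0 r. x \<bullet> e > ga (x - (x \<bullet> e) *R e)}"
  using Om unfolding smooth_bounded_domain_def by (elim conjE) (rule bspec[OF _ fr])
 then obtain r e ga where r: "r > 0" and e: "norm e = 1" and ga: "smooth (ga :: real^'d => real)"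
  and graph: "Om \<inter> ball x0 r = {x : ball x0 r. x \<bullet> e > ga (x - (x \<bullet> e) *R e)}"
  by (elim exE conjE) (rule that)
 define P where "P x = x - (x \<bullet> e) *R e" for x
 have Pn: "norm (P x) <= 2 * norm x" for x
 proof -
  have "norm (P x) <= norm x + norm ((x \<bullet> e) *R e)" unfolding P_def by (rule norm_triangle_ineq4)
  also have "norm ((x \<bullet> e) *R e) <= norm x" using Cauchy_Schwarz_ineq2[of x e] e by simp
  finally show ?thesis by simp
 qed
 obtain L where L: "0 <= L" "!!x y. norm x <= 2 * (norm x0 + r) ==> norm y <= 2 * (norm x0 + r) ==> \<bar>ga x - ga y\<bar> <= L * norm (x - y)"
  using smooth_Lipschitz_on_cball[OF ga, of "2 * (norm x0 + r)"] by blast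
 \<comment> \<open>Along \<open>s *R w\<close> the height grows by at least
   \<open>s * (1 - th)\<close> and the graph by at most \<open>s * (2 * L * th)\<close>; the choice
   ensures \<open>th * (2 * L + 1) <= 1\<close>.\<close>
 define th where "th = 1 / (2 * L + 2)"
 have th: "0 < th" "th <= 1" "th * (2 * L + 1) <= 1" using L(1) by (auto simp: th_def field_simps)
 have "x + s *R w : Om" if x: "x : Om" "x : ball x0 (r / 2)" and w: "w : ball e th" and s: "0 <= s" "s <= r / 4" for x w s
 proof -
  have we: "norm (w - e) < th" using w by (simp add: dist_norm norm_minus_commute)
  have "norm w <= norm e + norm (w - e)" by (metis add.commute diff_add_cancel norm_triangle_ineq)
  hence w2: "norm w <= 2" using we e th by simp
  have "norm (s *R w) <= (r / 4) * 2" unfolding norm_scaleR using s w2 r by (intro mult_mono) auto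
  moreover have "norm (x0 - (x + s *R w)) <= norm (x0 - x) + norm (s *R w)" by (metis diff_diff_eq norm_triangle_ineq4)
  ultimately have in_ball: "x + s *R w : ball x0 r" using x(2) by (simp add: dist_norm)
  have xb: "x : ball x0 r" using x(2) r by simp
  hence gx: "x \<bullet> e > ga (P x)" using x(1) graph unfolding P_def by blast
  have bd: "norm (P y) <= 2 * (norm x0 + r)" if "y : ball x0 r" for y
  proof -
  have "norm y <= norm x0 + norm (y - x0)" by (metis add.commute diff_add_cancel norm_triangle_ineq)
  thus ?thesis using Pn[of y] that by (simp add: dist_norm norm_minus_commute)
  qed
  \<comment> \<open>Since \<open>P e = 0\<close>, the base point moves only with the small vector
    \<open>w - e\<close>.\<close>
  have Pe: "P e = 0" using e by (simp add: P_def dot_square_norm)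
  have Plin: "P (x + s *R w) - P x = s *R P (w - e)"
  using e by (simp add: P_def inner_add_left inner_diff_left algebra_simps dot_square_norm)
  have "\<bar>ga (P (x + s *R w)) - ga (P x)\<bar> <= L * norm (P (x + s *R w) - P x)"
  by (rule L(2)[OF bd[OF in_ball] bd[OF xb]])
  also have "... = L * (s * norm (P (w - e)))" unfolding Plin using s by simp
  also have "... <= L * (s * (2 * th))"
  using Pn[of "w - e"] we s L(1) by (intro mult_left_mono) auto
  finally have 1: "ga (P (x + s *R w)) <= ga (P x) + s * (2 * L * th)" by (simp add: algebra_simps abs_le_iff)
  have "\<bar>(w - e) \<bullet> e\<bar> <= th" using Cauchy_Schwarz_ineq2[of "w - e" e] e we by simp
  hence "w \<bullet> e >= 1 - th" using e by (simp add: inner_diff_left dot_square_norm)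
  hence 2: "(x + s *R w) \<bullet> e >= x \<bullet> e + s * (1 - th)" using s by (simp add: inner_add_left mult_left_mono)
  have "s * (2 * L * th) <= s * (1 - th)" using th(3) s by (intro mult_left_mono) (auto simp: algebra_simps)
  hence "(x + s *R w) \<bullet> e > ga (P (x + s *R w))" using 1 2 gx by linarith
  thus ?thesis using graph in_ball unfolding P_def by blast
 qed
 hence "cone_condition Om (Om \<inter> ball x0 (r / 2)) e th (r / 4)"
  using e r th by (auto simp: cone_condition_def)
 thus ?thesis using r by (intro exI[of _ "r / 2"]) auto
qed

section \<open>Increments along cones\<close>

lemma sum_powr_le:
 fixes a :: "nat => real"
 assumes p: "1 <= p"
 shows "\<bar>\<Sum>i<k. a i\<bar> powr p <= real k powr (p - 1) * (\<Sum>i<k. \<bar>a i\<bar> powr p)"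
proof -
 have "en (norm (\<integral>i. a i \<partial>count_space {..<k}) powr p) <=
  en (real k powr (p - 1)) * (\<integral>\<^sup>+i. en (norm (a i) powr p) \<partial>count_space {..<k})"
  by (intro jensen_powr p) (auto simp: ennreal_of_nat_eq_real_of_nat)
 hence "en (\<bar>\<Sum>i<k. a i\<bar> powr p) <= en (real k powr (p - 1)) * en (\<Sum>i<k. \<bar>a i\<bar> powr p)"
  by (simp add: lebesgue_integral_count_space_finite nn_integral_count_space_finite sum_ennreal)
 thus ?thesis by (simp add: ennreal_mult[symmetric] sum_nonneg)
qed

text \<open>For fixed \<open>w\<close> the base point is translated by \<open>ta *R w\<close>, which
  the cone keeps in the domain. For a fixed base point \<open>y\<close> the substitution
  \<open>x = y + de *R w\<close> turns the average over directions into the kernel energy, since the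
  rescaled argument lies where the kernel is at least \<open>c0\<close>.\<close>

lemma increment_estimate:
 fixes rh u :: "real^'d => real"
 assumes k: "is_kernel rh R" and c0: "0 < c0" and r: "!!x. norm x <= r ==> c0 <= rh x"
  and Om[measurable]: "Om : sets borel" and V[measurable]: "V : sets borel" and u[measurable]: "u : Bm"
  and cone: "cone_condition Om V e th s0" and ta: "0 <= ta" "ta + de <= s0" and de: "0 < de" "de * real n * 2 <= r" and n: "0 < n"
 shows "(NI w. ind (ball e th) w * (NI x. ind V x *
  en (\<bar>u (x + (ta + de) *R w) - u (x + ta *R w)\<bar> powr p)))
  <= en (1 / ((de * real n) ^ CARD('d) * c0)) * kenergy p rh Om n u"
proof -
 note kernel_props(3)[OF k, measurable]
 have [measurable]: "ball e th : sets borel" by simp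
 let ?W = "ball e th"
 let ?d = "CARD('d)"
 have co: "x + s *R w : Om" if "x : V" "w : ?W" "0 <= s" "s <= s0" for x w s
  using cone that by (auto simp: cone_condition_def)
 define G where "G w y = ind Om y * ind Om (y + de *R w) * en (\<bar>u (y + de *R w) - u y\<bar> powr p)" for w y
 have inner: "(NI x. ind V x * en (\<bar>u (x + (ta + de) *R w) - u (x + ta *R w)\<bar> powr p)) <= (NI y. G w y)"
  if w: "w : ?W" for w
 proof -
  have "(NI x. ind V x * en (\<bar>u (x + (ta + de) *R w) - u (x + ta *R w)\<bar> powr p))
  <= (NI x. G w (ta *R w + 1 *R x))"
  proof (rule nn_integral_mono)
  fix x
  show "ind V x * en (\<bar>u (x + (ta + de) *R w) - u (x + ta *R w)\<bar> powr p) <= G w (ta *R w + 1 *R x)"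
  proof (cases "x : V")
  case True
  have "x + ta *R w : Om" "x + (ta + de) *R w : Om" using co[OF True w] ta de by auto
  moreover have e: "ta *R w + 1 *R x = x + ta *R w" "x + ta *R w + de *R w = x + (ta + de) *R w"
  by (simp_all add: algebra_simps)
  ultimately show ?thesis using True unfolding G_def e by simp
  qed simp
  qed
  also have "... = (NI y. G w y)"
  proof -
  have "G w : Bm" unfolding G_def by measurable
  from nn_integral_lborel_affine[OF this, of 1 "ta *R w"] show ?thesis by simp
  qed
  finally show ?thesis .
 qed
 have Wn: "norm w <= 2" if "w : ?W" for w by (rule cone_ball_norm[OF cone that])
 \<comment> \<open>The power of \<open>de\<close> is the Jacobian of the substitution; the power of
   \<open>n\<close> and \<open>c0\<close> come from the lower bound for the rescaled kernel.\<close>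
 define C where "C = 1 / ((de * real n) ^ ?d * c0)"
 have C0: "0 <= C" using c0 de by (simp add: C_def)
 have slice: "(NI w. ind ?W w * G w y) <= en C *
  (NI x. ind Om x * ind Om y * en (rescaled rh n (x - y) * \<bar>u x - u y\<bar> powr p))" for y
 proof -
  define H where "H x = ind Om x * ind Om y * en (rescaled rh n (x - y) * \<bar>u x - u y\<bar> powr p)" for x
  have Hm[measurable]: "H : Bm"
  unfolding H_def using rescaled_measurable[OF kernel_props(3)[OF k], of n, measurable] by measurable
  have "(NI w. ind ?W w * G w y) <= (NI w. en (1 / (real n ^ ?d * c0)) * H (y + de *R w))"
  proof (rule nn_integral_mono)
  fix w
  show "ind ?W w * G w y <= en (1 / (real n ^ ?d * c0)) * H (y + de *R w)"
  proof (cases "w : ?W")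
  case True
  have "norm (real n *R (de *R w)) = (de * real n) * norm w" using de by simp
  also have "... <= (de * real n) * 2" using Wn[OF True] de by (intro mult_left_mono) auto
  finally have "c0 <= rh (real n *R (de *R w))" by (intro r order_trans[OF _ de(2)])
  hence "1 <= 1 / (real n ^ ?d * c0) * rescaled rh n (de *R w)"
  using n c0 by (simp add: rescaled_def field_simps)
  from mult_right_mono[OF this, of "\<bar>u (y + de *R w) - u y\<bar> powr p"]
  have "en (\<bar>u (y + de *R w) - u y\<bar> powr p) <= en (1 / (real n ^ ?d * c0) * (rescaled rh n (de *R w) * \<bar>u (y + de *R w) - u y\<bar> powr p))"
  by (intro ennreal_leI) (simp add: mult.assoc)
  also have "... = en (1 / (real n ^ ?d * c0)) * en (rescaled rh n (de *R w) * \<bar>u (y + de *R w) - u y\<bar> powr p)"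
  using c0 by (intro ennreal_mult') simp
  finally show ?thesis using True by (auto simp: G_def H_def indicator_def)
  qed simp
  qed
  also have "... = en (1 / (real n ^ ?d * c0)) * (NI w. H (y + de *R w))"
  by (intro nn_integral_cmult) measurable
  also have "(NI w. H (y + de *R w)) = en (1 / de ^ ?d) * (en (de ^ ?d) * (NI w. H (y + de *R w)))"
  using de(1) by (simp add: mult.assoc[symmetric] ennreal_mult[symmetric])
  also have "en (de ^ ?d) * (NI w. H (y + de *R w)) = (NI x. H x)"
  using nn_integral_lborel_affine[of H de y] de(1) by simp
  also have "en (1 / (real n ^ ?d * c0)) * (en (1 / de ^ ?d) * (NI x. H x)) = en C * (NI x. H x)"
  proof -
  have "1 / (real n ^ ?d * c0) * (1 / de ^ ?d) = C" by (simp add: C_def power_mult_distrib mult_ac)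
  hence "en (1 / (real n ^ ?d * c0)) * en (1 / de ^ ?d) = en C"
  using ennreal_mult[of "1 / (real n ^ ?d * c0)" "1 / de ^ ?d"] de(1) c0 by simp
  thus ?thesis by (simp only: mult.assoc[symmetric])
  qed
  finally show ?thesis by (simp add: H_def)
 qed
 have "(NI w. ind ?W w * (NI x. ind V x *
  en (\<bar>u (x + (ta + de) *R w) - u (x + ta *R w)\<bar> powr p)))
  <= (NI w. (NI y. ind ?W w * G w y))"
 proof (rule nn_integral_mono)
  fix w
  show "ind ?W w * (NI x. ind V x * en (\<bar>u (x + (ta + de) *R w) - u (x + ta *R w)\<bar> powr p))
  <= (NI y. ind ?W w * G w y)"
  using inner[of w] by (cases "w : ?W") auto
 qed
 also have "... = (NI y. (NI w. ind ?W w * G w y))"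
  by (rule lborel_pair.Fubini') (simp add: G_def, measurable)
 also have "... <= (NI y. en C *
  (NI x. ind Om x * ind Om y * en (rescaled rh n (x - y) * \<bar>u x - u y\<bar> powr p)))"
  by (intro nn_integral_mono slice)
 also have "... = en C * kenergy p rh Om n u"
  unfolding kenergy_def using rescaled_measurable[OF kernel_props(3)[OF k], of n, measurable] by (intro nn_integral_cmult) measurable
 finally show ?thesis by (simp add: C_def)
qed

text \<open>All steps of the chain from \<open>x\<close> to \<open>x + \<epsilon> w\<close> are multiples of the same \<open>w\<close>, so each is a translate of the first.\<close>

lemma chain_estimate:
 fixes rh u :: "real^'d => real"
 assumes k: "is_kernel rh R" and c0: "0 < c0" and r0: "0 < r" and r: "!!x. norm x <= r ==> c0 <= rh x"
  and Om: "Om : sets borel" and V[measurable]: "V : sets borel" and u[measurable]: "u : Bm"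
  and cone: "cone_condition Om V e th s0" and ep: "0 < ep" "ep <= s0" and n: "r <= 2 * ep * real n" and p: "1 <= p"
 shows "(NI w. ind (ball e th) w * (NI x. ind V x *
  en (\<bar>u (x + ep *R w) - u x\<bar> powr p)))
  <= en ((4 / r) powr p * (4 / r) ^ CARD('d) / c0 * ep powr p) * (en (real n powr p) * kenergy p rh Om n u)"
proof -
 have [measurable]: "ball e th : sets borel" by simp
 let ?W = "ball e th"
 let ?d = "CARD('d)"
 define q where "q = 2 * ep * real n / r"
 have q1: "1 <= q" using n r0 by (simp add: q_def)
 have n0: "0 < n" using n r0 by (cases "n = 0") auto
 \<comment> \<open>Rounding up at most doubles, as \<open>q >= 1\<close>. Hence
   \<open>de * real n\<close> lies between \<open>r / 4\<close> and \<open>r / 2\<close>: short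
   enough for the lower bound of the kernel, long enough to keep the constants uniform.\<close>
 define K where "K = nat \<lceil>q\<rceil>"
 have K: "q <= real K" "real K <= 2 * q" "0 < K" using q1 unfolding K_def by linarith+
 define de where "de = ep / real K"
 have de0: "0 < de" using ep K by (simp add: de_def)
 have qr: "q * r = 2 * ep * real n" using r0 by (simp add: q_def)
 have den: "de * real n * 2 <= r"
 proof -
  have "2 * ep * real n <= real K * r" unfolding qr[symmetric] using K(1) r0 by simp
  thus ?thesis using K(3) by (simp add: de_def field_simps)
 qed
 have den': "r / 4 <= de * real n"
 proof -
  have "real K * r <= 2 * (q * r)" using K(2) r0 by simp
  thus ?thesis unfolding qr using K(3) by (simp add: de_def field_simps)
 qed
 let ?I = "%i w. (NI x. ind V x * en (\<bar>u (x + (real i * de + de) *R w) - u (x + (real i * de) *R w)\<bar> powr p))"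
 have pt: "en (\<bar>u (x + ep *R w) - u x\<bar> powr p) <= en (real K powr (p - 1)) *
  (\<Sum>i<K. en (\<bar>u (x + (real i * de + de) *R w) - u (x + (real i * de) *R w)\<bar> powr p))" for x w
 proof -
  have "(\<Sum>i<K. u (x + (real (Suc i) * de) *R w) - u (x + (real i * de) *R w)) = u (x + (real K * de) *R w) - u (x + (real 0 * de) *R w)"
  by (rule sum_lessThan_telescope)
  also have "... = u (x + ep *R w) - u x" using K(3) by (simp add: de_def)
  finally have "u (x + ep *R w) - u x = (\<Sum>i<K. u (x + (real i * de + de) *R w) - u (x + (real i * de) *R w))"
  by (simp add: algebra_simps)
  thus ?thesis
  using sum_powr_le[OF p, of "%i. u (x + (real i * de + de) *R w) - u (x + (real i * de) *R w)" K]
  by (simp add: sum_ennreal ennreal_mult[symmetric] sum_nonneg ennreal_leI)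
 qed
 have "(NI w. ind ?W w * (NI x. ind V x * en (\<bar>u (x + ep *R w) - u x\<bar> powr p)))
  <= (NI w. ind ?W w * (en (real K powr (p - 1)) * (\<Sum>i<K. ?I i w)))"
 proof (intro nn_integral_mono mult_left_mono)
  fix w
  have "(NI x. ind V x * en (\<bar>u (x + ep *R w) - u x\<bar> powr p))
  <= (NI x. en (real K powr (p - 1)) * (\<Sum>i<K. ind V x * en (\<bar>u (x + (real i * de + de) *R w) - u (x + (real i * de) *R w)\<bar> powr p)))"
  using pt[of _ w] by (intro nn_integral_mono) (auto simp: indicator_def)
  also have "... = en (real K powr (p - 1)) * (\<Sum>i<K. ?I i w)"
  by (subst nn_integral_cmult, measurable) (subst nn_integral_sum, measurable)
  finally show "(NI x. ind V x * en (\<bar>u (x + ep *R w) - u x\<bar> powr p))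
  <= en (real K powr (p - 1)) * (\<Sum>i<K. ?I i w)" .
 qed simp
 also have "... = (NI w. en (real K powr (p - 1)) * (\<Sum>i<K. ind ?W w * ?I i w))"
  by (intro nn_integral_cong) (simp add: indicator_def)
 also have "... = en (real K powr (p - 1)) * (\<Sum>i<K. (NI w. ind ?W w * ?I i w))"
  by (subst nn_integral_cmult, measurable) (subst nn_integral_sum, measurable)
 also have "... <= en (real K powr (p - 1)) * (\<Sum>i<K. en (1 / ((de * real n) ^ ?d * c0)) * kenergy p rh Om n u)"
 proof (intro mult_left_mono sum_mono)
  fix i assume i: "i : {..<K}"
  have "real i * de + de = real (Suc i) * de" by (simp add: algebra_simps)
  also have "... <= real K * de" using i de0 by (intro mult_right_mono) auto
  also have "... = ep" using K(3) by (simp add: de_def)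
  finally have "real i * de + de <= s0" using ep by simp
  thus "(NI w. ind ?W w * ?I i w) <= en (1 / ((de * real n) ^ ?d * c0)) * kenergy p rh Om n u"
  using de0 by (intro increment_estimate[OF k c0 r Om V u cone _ _ de0 den n0]) auto
 qed simp
 also have "... = en (real K powr (p - 1) * real K * (1 / ((de * real n) ^ ?d * c0))) * kenergy p rh Om n u"
 proof -
  have "en (a * b * c) = en a * (en b * en c)" if "0 <= a" "0 <= b" "0 <= c" for a b c :: real
  using that by (simp add: ennreal_mult mult.assoc)
  from this[of "real K powr (p - 1)" "real K" "1 / ((de * real n) ^ ?d * c0)"]
  have *: "en (real K powr (p - 1) * real K * (1 / ((de * real n) ^ ?d * c0))) =
  en (real K powr (p - 1)) * (en (real K) * en (1 / ((de * real n) ^ ?d * c0)))" using c0 de0 by simp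
  show ?thesis unfolding * by (simp add: ennreal_of_nat_eq_real_of_nat mult.assoc)
 qed
 also have "... <= en ((4 / r) powr p * (4 / r) ^ ?d / c0 * ep powr p * real n powr p) * kenergy p rh Om n u"
 proof (intro mult_right_mono ennreal_leI)
  \<comment> \<open>Splitting the power of a sum costs \<open>real K powr (p - 1)\<close> and there
    are \<open>K\<close> increments; as \<open>K\<close> is at most of order
    \<open>ep * real n\<close>, the total is of order \<open>ep powr p\<close> times the scaled
    energy.\<close>
  have "real K powr (p - 1) * real K = real K powr p" using K(3) by (simp add: powr_diff)
  also have "... <= (4 / r * (ep * real n)) powr p"
  using K(2) p r0 by (intro powr_mono2) (auto simp: q_def)
  also have "... = (4 / r) powr p * ep powr p * real n powr p"
  proof -
  have "(a * (b * c)) powr p = a powr p * b powr p * c powr p" if "0 <= a" "0 <= b" "0 <= c" for a b c :: real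
  using that by (simp add: powr_mult)
  from this[of "4 / r" ep "real n"] show ?thesis using r0 ep by simp
  qed
  finally have 1: "real K powr (p - 1) * real K <= (4 / r) powr p * ep powr p * real n powr p" .
  have "1 / (de * real n) <= 4 / r" using den' de0 n0 r0 by (simp add: field_simps)
  hence "(1 / (de * real n)) ^ ?d <= (4 / r) ^ ?d" using de0 by (intro power_mono) auto
  hence 2: "1 / ((de * real n) ^ ?d * c0) <= (4 / r) ^ ?d / c0"
  proof -
  have "1 / ((de * real n) ^ ?d * c0) = (1 / (de * real n)) ^ ?d / c0" by (simp add: power_divide)
  thus ?thesis using \<open>(1 / (de * real n)) ^ ?d <= (4 / r) ^ ?d\<close> c0 by (simp only: divide_right_mono less_imp_le)
  qed
  show "real K powr (p - 1) * real K * (1 / ((de * real n) ^ ?d * c0)) <= (4 / r) powr p * (4 / r) ^ ?d / c0 * ep powr p * real n powr p"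
  using mult_mono[OF 1 2] c0 de0 by (simp add: mult_ac)
 qed simp
 also have "... = en ((4 / r) powr p * (4 / r) ^ ?d / c0 * ep powr p) * (en (real n powr p) * kenergy p rh Om n u)"
  using c0 r0 by (subst ennreal_mult) (auto simp: mult.assoc)
 finally show ?thesis .
qed

text \<open>As \<open>et\<close> has integral 1, the error is an average of
  \<open>u x - u (x + ep *R w)\<close>; Jensen's inequality bounds its power, and Tonelli's theorem
  exchanges x and w.\<close>

lemma mollification_error:
 fixes u et :: "real^'d => real"
 assumes p: "1 <= p" and V[measurable]: "V : sets borel" and u[measurable]: "u : Bm"
  and fin: "pil p u < \<infinity>" and et[measurable]: "et : Bm"
  and etb: "!!w. 0 <= et w" "!!w. et w <= B" and et0: "!!w. w ~: ball e th ==> et w = 0" and et1: "(LI w. et w) = 1"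
  and ep: "0 < ep"
 shows "(NI x. ind V x * en (\<bar>u x - (LI w. et w * u (x + ep *R w))\<bar> powr p))
  <= en (measure lborel (ball e th) powr (p - 1) * B powr p) *
  (NI w. ind (ball e th) w * (NI x. ind V x * en (\<bar>u (x + ep *R w) - u x\<bar> powr p)))"
  and "intl (%w. et w * u (x + ep *R w))"
proof -
 let ?W = "ball e th"
 have [measurable]: "?W : sets borel" by simp
 define m where "m = measure lborel ?W"
 have mW: "emeasure lborel ?W <= en m" unfolding m_def using emeasure_lborel_ball_finite[of e th] by (simp add: emeasure_eq_ennreal_measure less_top)
 have B0: "0 <= B" using etb[of 0] by linarith
 have eti: "intl et" using et1 not_integrable_integral_eq by fastforce
 have ets: "et w = 0" if "norm e + \<bar>th\<bar> < norm w" for w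
 proof (rule et0)
  have "norm w <= norm e + norm (w - e)" by (metis add.commute diff_add_cancel norm_triangle_ineq)
  thus "w ~: ?W" using that by (auto simp: dist_norm norm_minus_commute)
 qed
 have int: "intl (%w. et w * u (x + ep *R w))" for x
 proof -
  have um: "(%w. u (x + ep *R w)) : Bm" by measurable
  have "pil p u = en (ep ^ CARD('d)) * pil p (%w. u (x + ep *R w))"
  unfolding pint_def using nn_integral_lborel_affine[of "%w. en (norm (u w) powr p)" ep x] ep by simp
  hence "pil p (%w. u (x + ep *R w)) < \<infinity>"
  using fin ep by (auto simp: ennreal_mult_less_top less_top[symmetric] ennreal_top_mult ennreal_mult_eq_top_iff)
  from integrable_Lp_times_bounded[OF p um this et, of B "norm e + \<bar>th\<bar>"]
  show ?thesis using etb ets by simp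
 qed
 thus "intl (%w. et w * u (x + ep *R w))" .
 have pt: "en (\<bar>u x - (LI w. et w * u (x + ep *R w))\<bar> powr p)
  <= en (m powr (p - 1) * B powr p) * (NI w. ind ?W w * en (\<bar>u (x + ep *R w) - u x\<bar> powr p))" for x
 proof -
  define F where "F w = et w * (u x - u (x + ep *R w))" for w
  have Fm[measurable]: "F : Bm" unfolding F_def by measurable
  have "(LI w. F w) = (LI w. et w * u x - et w * u (x + ep *R w))"
  by (simp add: F_def algebra_simps)
  also have "... = (LI w. et w * u x) - (LI w. et w * u (x + ep *R w))"
  by (rule Bochner_Integration.integral_diff) (use eti int in auto)
  finally have "u x - (LI w. et w * u (x + ep *R w)) = (LI w. F w)" by (simp add: et1)
  hence "en (\<bar>u x - (LI w. et w * u (x + ep *R w))\<bar> powr p) = en (norm (LI w. F w) powr p)" by simp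
  also have "... <= en (m powr (p - 1)) * pil p F"
  by (rule jensen_powr_support[of _ _ ?W]) (use p mW et0 in \<open>auto simp: F_def\<close>)
  also have "pil p F <= (NI w. en (B powr p) * (ind ?W w * en (\<bar>u (x + ep *R w) - u x\<bar> powr p)))"
  unfolding pint_def
  proof (rule nn_integral_mono)
  fix w
  show "en (norm (F w) powr p) <= en (B powr p) * (ind ?W w * en (\<bar>u (x + ep *R w) - u x\<bar> powr p))"
  proof (cases "w : ?W")
  case True
  have "norm (F w) powr p = \<bar>et w\<bar> powr p * \<bar>u (x + ep *R w) - u x\<bar> powr p"
  unfolding F_def by (simp add: abs_mult powr_mult abs_minus_commute)
  also have "... <= B powr p * \<bar>u (x + ep *R w) - u x\<bar> powr p"
  using etb[of w] p by (intro mult_right_mono powr_mono2) auto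
  finally show ?thesis using True by (simp add: ennreal_mult[symmetric] ennreal_leI)
  next
  case False
  thus ?thesis using et0[OF False] by (simp add: F_def)
  qed
  qed
  also have "... = en (B powr p) * (NI w. ind ?W w * en (\<bar>u (x + ep *R w) - u x\<bar> powr p))"
  by (rule nn_integral_cmult) measurable
  finally show ?thesis
  by (simp add: ennreal_mult mult.assoc mult_left_mono)
 qed
 have "(NI x. ind V x * en (\<bar>u x - (LI w. et w * u (x + ep *R w))\<bar> powr p))
  <= (NI x. en (m powr (p - 1) * B powr p) * (NI w. ind V x * (ind ?W w * en (\<bar>u (x + ep *R w) - u x\<bar> powr p))))"
 proof (rule nn_integral_mono)
  fix x
  show "ind V x * en (\<bar>u x - (LI w. et w * u (x + ep *R w))\<bar> powr p)
  <= en (m powr (p - 1) * B powr p) * (NI w. ind V x * (ind ?W w * en (\<bar>u (x + ep *R w) - u x\<bar> powr p)))"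
  using pt[of x] by (cases "x : V") auto
 qed
 also have "... = en (m powr (p - 1) * B powr p) * (NI x. (NI w. ind V x * (ind ?W w * en (\<bar>u (x + ep *R w) - u x\<bar> powr p))))"
  by (rule nn_integral_cmult) measurable
 also have "(NI x. (NI w. ind V x * (ind ?W w * en (\<bar>u (x + ep *R w) - u x\<bar> powr p))))
  = (NI w. (NI x. ind V x * (ind ?W w * en (\<bar>u (x + ep *R w) - u x\<bar> powr p))))"
  by (rule lborel_pair.Fubini'[symmetric]) measurable
 also have "... = (NI w. ind ?W w * (NI x. ind V x * en (\<bar>u (x + ep *R w) - u x\<bar> powr p)))"
 proof (rule nn_integral_cong)
  fix w
  show "(NI x. ind V x * (ind ?W w * en (\<bar>u (x + ep *R w) - u x\<bar> powr p)))
  = ind ?W w * (NI x. ind V x * en (\<bar>u (x + ep *R w) - u x\<bar> powr p))"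
  by (cases "w : ?W") auto
 qed
 finally show "(NI x. ind V x * en (\<bar>u x - (LI w. et w * u (x + ep *R w))\<bar> powr p))
  <= en (measure lborel (ball e th) powr (p - 1) * B powr p) *
  (NI w. ind (ball e th) w * (NI x. ind V x * en (\<bar>u (x + ep *R w) - u x\<bar> powr p)))"
  unfolding m_def .
qed

section \<open>Time regularity of pairings\<close>

text \<open>The difference quotients have integral 0 by translation invariance and converge
  pointwise to the derivative; the mean value theorem supplies a common bound and a common
  support.\<close>

lemma integral_derivative_zero:
 fixes ps :: "'a::euclidean_space => real"
 assumes C: "C_k 1 ps" and z: "!!x. r < norm x ==> ps x = 0"
 shows "(LI x. fder ps (at x) v) = 0"
proof -
 define D where "D x = fder ps (at x) v" for x
 have hd: "(ps has_derivative fder ps (at x)) (at x)" for x by (rule C1_derivative(1)[OF C z])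
 have Dc: "cts D" unfolding D_def by (rule C1_derivative(2)[OF C z])
 have D0: "D x = 0" if "r < norm x" for x unfolding D_def by (rule C1_derivative(3)[OF C z that])
 obtain B where B: "!!x. norm (D x) <= B" using continuous_bounded_support_bound[OF Dc, of r] D0 by blast
 have B0: "0 <= B" using B[of 0] norm_ge_zero[of "D 0"] by linarith
 have psm[measurable]: "ps : Bm" by (rule bm_contI[OF C_k_continuous[OF C]])
 have Dm: "D : Bm" by (rule bm_contI[OF Dc])
 have psi: "intl ps"
 proof -
  obtain B' where "!!x. norm (ps x) <= B'" using continuous_bounded_support_bound[OF C_k_continuous[OF C], of r] z by blast
  thus ?thesis by (intro integrable_bounded_support[OF psm, of B' r] z)
 qed
 define s where "s n x = real (Suc n) * (ps (x + (1 / real (Suc n)) *R v) - ps x)" for n x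
 have mv: "EX t. 0 <= t & t <= 1 / real (Suc n) & s n x = D (x + t *R v)" for n x
 proof -
  have "((%t. ps (x + t *R v)) has_real_derivative D (x + t *R v)) (at t)" for t
  proof -
  have "((%t. x + t *R v) has_derivative (%h. h *R v)) (at t)" by (auto intro!: derivative_eq_intros)
  from has_derivative_compose[OF this hd]
  have "((%t. ps (x + t *R v)) has_derivative (%h. fder ps (at (x + t *R v)) (h *R v))) (at t)" .
  moreover have "fder ps (at (x + t *R v)) (h *R v) = D (x + t *R v) * h" for h
  using linear_cmul[OF has_derivative_linear[OF hd[of "x + t *R v"]], of h v] by (simp add: D_def)
  ultimately show ?thesis by (simp add: has_field_derivative_def)
  qed
  then obtain t where t: "0 < t" "t < 1 / real (Suc n)"
  "ps (x + (1 / real (Suc n)) *R v) - ps (x + 0 *R v) = (1 / real (Suc n) - 0) * D (x + t *R v)"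
  using MVT2[of 0 "1 / real (Suc n)" "%t. ps (x + t *R v)" "%t. D (x + t *R v)"] by auto
  have "s n x = D (x + t *R v)" using t(3) by (simp add: s_def)
  thus ?thesis using t by (intro exI[of _ t]) auto
 qed
 have s0: "(LI x. s n x) = 0" for n
 proof -
  have tr: "intl (%x. ps (h + x))" "(LI x. ps (h + x)) = (LI x. ps x)" for h
  using integrable_lborel_affine[OF psi, of 1 h] integral_lborel_affine[OF psm, of 1 h] by simp_all
  show ?thesis unfolding s_def using tr[of "(1 / real (Suc n)) *R v"] psi by (simp add: add.commute)
 qed
 have "(%n. (LI x. s n x)) \<longlonglongrightarrow> (LI x. D x)"
 proof (rule integral_dominated_convergence[where w = "%x. B * ind (cball 0 (r + norm v)) x"])
  show "D : borel_measurable lborel" using Dm by simp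
  show "s n : borel_measurable lborel" for n unfolding s_def by measurable
  show "intl (%x::'a. B * ind (cball 0 (r + norm v)) x)"
  using emeasure_lborel_cball_finite[of "0::'a" "r + norm v"] by (intro integrable_mult_right integrable_real_indicator) auto
  show "AE x in lborel. (%n. s n x) \<longlonglongrightarrow> D x"
  proof (rule AE_I2)
  fix x
  obtain t where t: "!!n. 0 <= t n" "!!n. t n <= 1 / real (Suc n)" "!!n. s n x = D (x + t n *R v)"
  using mv[of _ x] by metis
  have "t \<longlonglongrightarrow> 0"
  proof (rule tendsto_sandwich[OF _ _ tendsto_const])
  show "(%n. 1 / real (Suc n)) \<longlonglongrightarrow> 0" using LIMSEQ_inverse_real_of_nat by (simp add: inverse_eq_divide)
  qed (use t in auto)
  hence "(%n. x + t n *R v) \<longlonglongrightarrow> x + 0 *R v" by (intro tendsto_intros)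
  hence lim: "(%n. x + t n *R v) \<longlonglongrightarrow> x" by simp
  have "isCont D x" using Dc by (simp add: continuous_on_eq_continuous_at)
  from isCont_tendsto_compose[OF this lim] show "(%n. s n x) \<longlonglongrightarrow> D x" by (simp add: t(3))
  qed
  show "AE x in lborel. norm (s n x) <= B * ind (cball 0 (r + norm v)) x" for n
  proof (rule AE_I2)
  fix x
  obtain t where t: "0 <= t" "t <= 1 / real (Suc n)" "s n x = D (x + t *R v)" using mv[of n x] by auto
  show "norm (s n x) <= B * ind (cball 0 (r + norm v)) x"
  proof (cases "norm x <= r + norm v")
  case True
  thus ?thesis using B[of "x + t *R v"] t(3) by simp
  next
  case False
  have "1 / real (Suc n) <= 1" by simp
  hence "t <= 1" using t(2) by linarith
  hence "t * norm v <= 1 * norm v" by (intro mult_right_mono) auto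
  moreover have "norm x <= norm (x + t *R v) + norm (t *R v)" by (metis add_diff_cancel norm_triangle_ineq4)
  ultimately have "r < norm (x + t *R v)" using False t(1) by simp
  thus ?thesis using D0 t(3) B0 by simp
  qed
  qed
 qed
 hence "(%n. 0::real) \<longlonglongrightarrow> (LI x. D x)" unfolding s0 .
 thus ?thesis unfolding D_def using LIMSEQ_unique[OF tendsto_const] by metis
qed

section \<open>Pairing of W^{-1,p} with test functions\<close>

lemma test_function_bounded:
 assumes "ph : tests Om"
 shows "EX r B. 0 < B & (ALL x. \<bar>ph x\<bar> <= B) & (ALL x. r < norm x --> ph x = 0)"
proof -
 obtain r where r: "ALL x. r < norm x --> ph x = 0" using test_function_bounds(3)[OF assms, of 0] by blast
 obtain B where "B > 0" "ALL x. norm (ph x) <= B"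
  using continuous_bounded_support_bound[OF test_function_bounds(1)[OF assms] r] by blast
 thus ?thesis using r by auto
qed

text \<open>Integration by parts, in the form that the derivative of a product of two test functions
  has integral 0.\<close>

lemma has_weak_gradient_test_function:
 fixes ze :: "real^'d => real"
 assumes Om: "open Om" and ze: "ze : tests Om" and q: "1 <= q"
 shows "has_weak_gradient Om ze (%x. \<chi> i. fder ze (at x) (axis i 1))" (is "has_weak_gradient Om ze ?G")
  and "ze : W1_space q Om"
proof -
 have Omb: "Om : sets borel" using Om by simp
 have sm: "smooth ze" using ze by (simp add: test_functions_def)
 note tb = test_function_bounds[OF ze]
 have zem: "ze : Bm" by (rule bm_contI[OF tb(1)])
 have Gc: "cts ?G" by (intro continuous_on_vec_lambda tb(2))
 have Gm: "?G : Bm" by (rule bm_contI[OF Gc])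
 have fin: "pil q h < \<infinity>" if c: "cts h" and z: "ALL x. r < norm x --> h x = 0"
  for h :: "real^'d => 'x::euclidean_space" and r
 proof -
  obtain B where B: "ALL x. norm (h x) <= B" using continuous_bounded_support_bound[OF c z] by blast
  have "pil q h <= en (B powr q) * emeasure lborel (cball (0::real^'d) r)"
  by (rule pint_bounded_support_finite[OF q]) (use z B in auto)
  also have "... < \<infinity>" using emeasure_lborel_cball_finite[of "0::real^'d" r] by (simp add: ennreal_mult_less_top)
  finally show ?thesis .
 qed
 obtain r where r: "compact (supp ze)" "ALL x:supp ze. norm x <= r"
  using ze compact_imp_bounded[of "supp ze"] by (auto simp: test_functions_def bounded_iff)
 have ns: "x ~: supp ze" if "r < norm x" for x using r(2) that by force
 have z: "ALL x. r < norm x --> ze x = 0" "ALL x. r < norm x --> ?G x = 0"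
  using not_in_supp[OF ns] frechet_derivative_outside_supp[OF ns] by (simp_all add: vec_eq_iff)
 have f1: "pil q ze < \<infinity>" and f2: "pil q ?G < \<infinity>"
  by (rule fin[OF tb(1) z(1)], rule fin[OF Gc z(2)])
 show wg: "has_weak_gradient Om ze ?G"
 proof (rule has_weak_gradientI_borel[OF zem Gm q f1 f2 Om])
  fix ph :: "real^'d => real" and i :: 'd assume ph: "ph : tests Om"
  note pb = test_function_bounds[OF ph]
  have smp: "smooth ph" using ph by (simp add: test_functions_def)
  let ?a = "axis i 1 :: real^'d"
  define A where "A x = ze x * fder ph (at x) ?a" for x
  define B where "B x = fder ze (at x) ?a * ph x" for x
  have i: "intl A" "intl B"
  proof -
  have int: "intl h" if c: "cts h" and z: "ALL x. r < norm x --> h x = 0" for h :: "real^'d => real"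
  proof -
  obtain B where "ALL x. norm (h x) <= B" using continuous_bounded_support_bound[OF c z] by blast
  thus ?thesis using z by (intro integrable_bounded_support[of h B r] bm_contI c) auto
  qed
  show "intl A" unfolding A_def by (rule int) (intro continuous_intros tb(1) pb(2), use z(1) in simp)
  show "intl B" unfolding B_def
  by (rule int) (intro continuous_intros tb(2) pb(1), use z(2) in \<open>simp add: vec_eq_iff\<close>)
  qed
  have "fder (%x. ze x * ph x) (at x) ?a = A x + B x" for x
  proof -
  have "((%x. ze x * ph x) has_derivative (%v. ze x * fder ph (at x) v + fder ze (at x) v * ph x)) (at x)"
  by (rule has_derivative_mult[OF smooth_has_derivative[OF sm] smooth_has_derivative[OF smp]])
  from fun_cong[OF frechet_derivative_at[OF this], of ?a] show ?thesis by (simp add: A_def B_def)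
  qed
  moreover have "(LI x. fder (%x. ze x * ph x) (at x) ?a) = 0"
  by (rule integral_derivative_zero[of _ r]) (use z(1) smooth_C_k[OF smooth_mult[OF sm smp]] in auto)
  ultimately have "(LI x. A x + B x) = 0" by simp
  hence "(LI x. A x) = - (LI x. B x)" using i by simp
  thus "(LI x. ze x * fder ph (at x) ?a) = - (LI x. ?G x $ i * ph x)"
  by (simp add: A_def B_def)
 qed simp
 have Lp: "h : Lp_space q (leb Om)" if "h : Bm" "pil q h < \<infinity>" for h :: "real^'d => 'x::euclidean_space"
 proof -
  have "pint q (leb Om) h <= pil q h"
  unfolding pint_def nn_integral_lebesgue_on[OF Omb] by (intro nn_integral_mono) (simp add: indicator_def)
  thus ?thesis using that unfolding Lp_space_iff
  by (intro conjI measurable_restrict_space1 borel_measurable_lebesgue_of_borel) (auto intro: le_less_trans)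
 qed
 show "ze : W1_space q Om" unfolding W1_space_def using Lp[OF zem f1] Lp[OF Gm f2] wg by blast
qed

text \<open>The dual norm is a supremum over the unit ball, so \<open>ze\<close> is scaled into that
  ball.\<close>

lemma W_neg1_pairing_bound:
 fixes ze :: "real^'d => real"
 assumes j: "unit_bump j" and Om: "open Om" and ze: "ze : tests Om" and p: "1 < p"
 obtains Z where "0 < Z" "!!F. F : W_neg1_space p Om ==> \<bar>F ze\<bar> <= Z * W_neg1_norm p Om F"
proof -
 define q where "q = conjugate_exponent p"
 have q: "1 <= q" using p by (simp add: q_def conjugate_exponent_def)
 define G where "G x = (\<chi> i. fder ze (at x) (axis i 1))" for x
 have wg: "has_weak_gradient Om ze G" using has_weak_gradient_test_function(1)[OF Om ze q] by (simp add: G_def[abs_def])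
 define I where "I = (\<integral>x. \<bar>ze x\<bar> powr q \<partial>leb Om) + (\<integral>x. norm (G x) powr q \<partial>leb Om)"
 have I0: "0 <= I" by (simp add: I_def)
 \<comment> \<open>\<open>Z\<close> is at least 1 and exceeds the q-th power \<open>I\<close> of the
   norm, hence \<open>I <= Z powr q\<close> and the scaled function has norm at most 1. Division by
   a norm that may vanish is avoided.\<close>
 define Z where "Z = 1 + I"
 have Z: "1 <= Z" using I0 by (simp add: Z_def)
 define ze' where "ze' x = (1 / Z) * ze x" for x
 have ze': "ze' : tests Om"
 proof (rule test_functionI[of _ "supp ze"])
  show "smooth ze'" unfolding ze'_def using ze by (intro smooth_mult smooth_const) (simp add: test_functions_def)
 qed (use ze not_in_supp[of _ ze] in \<open>auto simp: test_functions_def ze'_def\<close>)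
 have "has_weak_gradient Om (%x. (1 / Z) * ze x + 0 * ze x) (%x. (1 / Z) *R G x + 0 *R G x)"
  by (rule has_weak_gradient_lincomb[OF Om wg wg])
 hence "has_weak_gradient Om ze' (%x. (1 / Z) *R G x)" by (simp add: ze'_def[abs_def])
 from W1_norm_powr[OF j Om q this]
 have "W1_norm q Om ze' powr q = (\<integral>x. (1 / Z) powr q * \<bar>ze x\<bar> powr q \<partial>leb Om) + (\<integral>x. (1 / Z) powr q * norm (G x) powr q \<partial>leb Om)"
  using Z by (simp add: ze'_def abs_mult powr_mult powr_divide)
 also have "... = (1 / Z) powr q * I" by (simp add: I_def distrib_left)
 also have "... <= (1 / Z) powr q * Z powr q"
 proof (rule mult_left_mono)
  have "I <= Z powr 1" using I0 by (simp add: Z_def)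
  also have "... <= Z powr q" using Z q by (intro powr_mono) auto
  finally show "I <= Z powr q" .
 qed simp
 also have "... = 1" using Z by (simp add: powr_divide)
 finally have N1: "W1_norm q Om ze' <= 1"
  using q powr_less_mono2[of q 1 "W1_norm q Om ze'"] by (auto simp: not_le[symmetric])
 have "tests Om <= W1_space q Om" using has_weak_gradient_test_function(2)[OF Om _ q] by blast
 hence sub: "tests Om <= W1_0_space q Om"
  unfolding W1_0_space_def by (intro closure_of_subset) (simp add: topspace_norm_topology)
 have "\<bar>F ze\<bar> <= Z * W_neg1_norm p Om F" if F: "F : W_neg1_space p Om" for F
 proof -
  have Fd: "F : dual_space (W1_0_space q Om) (W1_norm q Om)" using F by (simp add: W_neg1_space_def q_def)
  hence lin: "F (%x. a * u x + b * v x) = a * F u + b * F v" if "u : W1_0_space q Om" "v : W1_0_space q Om" for u v a b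
  using that unfolding dual_space_def by blast
  obtain C where C: "ALL u:W1_0_space q Om. \<bar>F u\<bar> <= C * W1_norm q Om u" using Fd unfolding dual_space_def by blast
  have X': "ze' : W1_0_space q Om" using sub ze' by blast
  have "ze = (%x. Z * ze' x + 0 * ze' x)" using Z by (simp add: ze'_def fun_eq_iff)
  hence Fz: "F ze = Z * F ze'" using lin[OF X' X', of Z 0] by simp
  have "\<bar>F ze'\<bar> <= (SUP u\<in>{u\<in>W1_0_space q Om. W1_norm q Om u <= 1}. \<bar>F u\<bar>)"
  proof (rule cSUP_upper)
  show "ze' : {u\<in>W1_0_space q Om. W1_norm q Om u <= 1}" using X' N1 by simp
  show "bdd_above ((%u. \<bar>F u\<bar>) ` {u\<in>W1_0_space q Om. W1_norm q Om u <= 1})"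
  proof (rule bdd_aboveI2)
  fix u assume u: "u : {u\<in>W1_0_space q Om. W1_norm q Om u <= 1}"
  have "W1_norm q Om u >= 0" by (simp add: W1_norm_def)
  hence "C * W1_norm q Om u <= \<bar>C\<bar> * 1" using u by (intro mult_mono) auto
  thus "\<bar>F u\<bar> <= \<bar>C\<bar>" using C u by force
  qed
  qed
  hence "\<bar>F ze'\<bar> <= W_neg1_norm p Om F" by (simp add: W_neg1_norm_def dual_norm_def q_def)
  thus ?thesis unfolding Fz using Z by (simp add: abs_mult mult_left_mono)
 qed
 thus ?thesis using Z by (intro that[of Z]) auto
qed

lemma W_neg1_diff:
 assumes "F : W_neg1_space p Om" "G : W_neg1_space p Om"
 shows "(%u. F u - G u) : W_neg1_space p Om"
proof -
 let ?X = "W1_0_space (conjugate_exponent p) Om" and ?N = "W1_norm (conjugate_exponent p) Om"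
 have d: "F : dual_space ?X ?N" "G : dual_space ?X ?N" using assms by (auto simp: W_neg1_space_def)
 obtain C1 C2 where C: "ALL u:?X. \<bar>F u\<bar> <= C1 * ?N u" "ALL u:?X. \<bar>G u\<bar> <= C2 * ?N u" using d unfolding dual_space_def by blast
 have "ALL u:?X. \<bar>F u - G u\<bar> <= (C1 + C2) * ?N u"
 proof
  fix u assume "u : ?X"
  hence "\<bar>F u\<bar> <= C1 * ?N u" "\<bar>G u\<bar> <= C2 * ?N u" using C by auto
  thus "\<bar>F u - G u\<bar> <= (C1 + C2) * ?N u" unfolding distrib_right by linarith
 qed
 moreover have "ALL u:?X. ALL v:?X. ALL a b. F (%x. a * u x + b * v x) - G (%x. a * u x + b * v x) = a * (F u - G u) + b * (F v - G v)"
  using d unfolding dual_space_def by (simp add: algebra_simps)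
 ultimately show ?thesis unfolding W_neg1_space_def dual_space_def by blast
qed

text \<open>Evaluation at \<open>ze\<close> is continuous on the dual, so the evaluated map is a
  limit of simple functions and has a Borel version; the Bochner bound on \<open>F\<close> becomes
  an Lp bound.\<close>

lemma bochner_pairing:
 fixes ze :: "real^'d => real" and T :: real and F :: "real => (real^'d => real) => real"
 assumes p: "1 < p" and Z: "0 < Z" "!!F. F : W_neg1_space p Om ==> \<bar>F ze\<bar> <= Z * W_neg1_norm p Om F"
  and F: "F : bochner_space p (leb {0<..<T}) (W_neg1_space p Om) (W_neg1_norm p Om)"
  and M: "bochner_norm p (leb {0<..<T}) (W_neg1_norm p Om) F <= M"
 obtains k where "k : Bm" "!!t. t ~: {0<..<T} ==> k t = 0"
  "AE t in lborel. t : {0<..<T} --> F t ze = k t & F t : W_neg1_space p Om"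
  "pil p k <= en (Z powr p * M powr p)"
proof -
 let ?L = "leb {0<..<T}" and ?X = "W_neg1_space p Om" and ?N = "W_neg1_norm p Om"
 have Tb: "{0<..<T} : sets borel" by simp
 have sF: "strongly_measurable ?L ?X ?N F" and iF: "integrable ?L (%t. ?N (F t) powr p)"
  using F by (auto simp: bochner_space_def)
 obtain s where s: "!!k::nat. simple_function ?L (s k)" "!!k. s k ` space ?L <= ?X"
  "AE t in ?L. (%k. ?N (%x. s k t x - F t x)) \<longlonglongrightarrow> 0" "AE t in ?L. F t : ?X"
  using sF unfolding strongly_measurable_def by blast
 have "EX g. g : Bm & (AE t in lborel. t : {0<..<T} --> s k t ze = g t)" for k
 proof -
  have "simple_function ?L (%t. s k t ze)" using simple_function_compose1[OF s(1), of "%G. G ze"] by simp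
  hence "(%t. s k t ze) : borel_measurable ?L" by (rule borel_measurable_simple_function)
  from borel_representative_real[OF Tb this] show ?thesis by blast
 qed
 then obtain g where g: "!!k. g k : Bm" "!!k. AE t in lborel. t : {0<..<T} --> s k t ze = g k t" by metis
 define k where "k t = ind {0<..<T} t * lim (%i. g i t)" for t
 have km: "k : Bm" unfolding k_def
  using borel_measurable_lim_metric[of g borel] g(1) by measurable
 have s3: "AE t in lborel. t : {0<..<T} --> (%k. ?N (%x. s k t x - F t x)) \<longlonglongrightarrow> 0"
  and s4: "AE t in lborel. t : {0<..<T} --> F t : ?X" using s(3,4) unfolding AE_lebesgue_on_iff[OF Tb] .
 have "AE t in lborel. ALL k. t : {0<..<T} --> s k t ze = g k t" by (subst AE_all_countable) (use g(2) in blast)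
 hence ae: "AE t in lborel. t : {0<..<T} --> F t ze = k t & F t : ?X" using s3 s4
 proof eventually_elim
  case (elim t)
  show ?case
  proof
  assume t: "t : {0<..<T}"
  have FX: "F t : ?X" using elim t by simp
  have sX: "s i t : ?X" for i using s(2)[of i] t by (auto simp: space_restrict_space)
  have "(%i. s i t ze - F t ze) \<longlonglongrightarrow> 0"
  proof (rule Lim_null_comparison)
  show "\<forall>\<^sub>F i in sequentially. norm (s i t ze - F t ze) <= Z * ?N (%x. s i t x - F t x)"
  using Z(2)[OF W_neg1_diff[OF sX FX]] by simp
  show "(%i. Z * ?N (%x. s i t x - F t x)) \<longlonglongrightarrow> 0"
  using elim t tendsto_mult_right_zero by blast
  qed
  hence "(%i. g i t) \<longlonglongrightarrow> F t ze" using elim t by (simp add: LIM_zero_iff)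
  hence "k t = F t ze" using t by (simp add: k_def limI)
  thus "F t ze = k t & F t : ?X" using FX by simp
  qed
 qed
 define I where "I = (\<integral>t. ?N (F t) powr p \<partial>?L)"
 have I0: "0 <= I" by (simp add: I_def)
 have IM: "I <= M powr p"
 proof -
  have "I powr (1 / p) <= M" using M by (simp add: bochner_norm_def I_def)
  hence "(I powr (1 / p)) powr p <= M powr p" using p by (intro powr_mono2) auto
  thus ?thesis using p I0 by (simp add: powr_powr)
 qed
 have "pil p k = (\<integral>\<^sup>+t. en (\<bar>k t\<bar> powr p) \<partial>?L)"
  unfolding pint_def nn_integral_lebesgue_on[OF Tb] by (intro nn_integral_cong) (auto simp: k_def indicator_def)
 also have "... <= (\<integral>\<^sup>+t. en (Z powr p * (?N (F t) powr p)) \<partial>?L)"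
 proof (rule nn_integral_mono_AE)
  have "AE t in ?L. F t ze = k t & F t : ?X" unfolding AE_lebesgue_on_iff[OF Tb] by (rule ae)
  thus "AE t in ?L. en (\<bar>k t\<bar> powr p) <= en (Z powr p * (?N (F t) powr p))"
  proof eventually_elim
  case (elim t)
  have b: "\<bar>k t\<bar> <= Z * ?N (F t)" using Z(2)[of "F t"] elim by simp
  hence "0 <= Z * ?N (F t)" using abs_ge_zero[of "k t"] by linarith
  hence n0: "0 <= ?N (F t)" using Z(1) by (simp add: zero_le_mult_iff)
  have "\<bar>k t\<bar> powr p <= (Z * ?N (F t)) powr p" using b p by (intro powr_mono2) auto
  also have "... = Z powr p * ?N (F t) powr p" using Z(1) n0 by (simp add: powr_mult)
  finally show ?case by (rule ennreal_leI)
  qed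
 qed
 also have "... = en (\<integral>t. Z powr p * (?N (F t) powr p) \<partial>?L)"
  using iF by (intro nn_integral_eq_integral) auto
 also have "... = en (Z powr p * I)" by (simp add: I_def)
 also have "... <= en (Z powr p * M powr p)" using IM by (intro ennreal_leI mult_left_mono) auto
 finally have "pil p k <= en (Z powr p * M powr p)" .
 thus ?thesis using km ae by (intro that[of k]) (auto simp: k_def)
qed

section \<open>Primitives in time\<close>

lemma antiderivative_support_below:
 fixes xi :: "real => real"
 assumes xi: "smooth xi" and z: "!!s. s < a ==> xi s = 0"
 obtains X where "smooth X" "!!s. (X has_real_derivative xi s) (at s)" "!!s. X s = (LI t. (if t <= s then xi t else 0))"
proof -
 have ic: "isCont xi s" for s using smooth_continuous[OF xi] by (simp add: continuous_on_eq_continuous_at)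
 obtain F where "ALL s. (- \<infinity> :: ereal) < ereal s --> ereal s < \<infinity> --> (F has_vector_derivative xi s) (at s)"
  using einterval_antiderivative[of "- \<infinity>" "\<infinity>" xi] ic by auto
 hence F: "(F has_real_derivative xi s) (at s)" for s by (simp add: has_real_derivative_iff_has_vector_derivative)
 define X where "X s = F s - F (a - 1)" for s
 have Xd: "(X has_real_derivative xi s) (at s)" for s
  unfolding X_def by (auto intro!: derivative_eq_intros F)
 have "X s = (LI t. (if t <= s then xi t else 0))" for s
 proof -
  \<comment> \<open>\<open>b\<close> lies at or below \<open>s\<close> and below the support, so
    that both increments of \<open>F\<close> start at a common point even if \<open>s\<close> is far
    to the left.\<close>
  define b where "b = min s (a - 1)"
  have "(LI t. xi t * ind {b..a - 1} t) = F (a - 1) - F b"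
  by (rule integral_FTC_Icc_real) (auto simp: b_def F ic)
  moreover have "(LI t. xi t * ind {b..a - 1} t) = (LI (t::real). 0)"
  by (intro lint_cong refl) (auto simp: indicator_def z)
  moreover have "(LI t. xi t * ind {b..s} t) = F s - F b"
  by (rule integral_FTC_Icc_real) (auto simp: b_def F ic)
  moreover have "(LI t. xi t * ind {b..s} t) = (LI t. (if t <= s then xi t else 0))"
  proof (intro lint_cong refl)
  fix t
  show "xi t * ind {b..s} t = (if t <= s then xi t else 0)"
  by (cases "t < b") (auto simp: b_def indicator_def intro!: z)
  qed
  ultimately show ?thesis by (simp add: X_def)
 qed
 thus ?thesis using that smooth_antiderivative[OF xi Xd] Xd by blast
qed

text \<open>Enlarging the interval to contain T/4 and 3T/4 puts the transition region of
  \<open>time_step\<close> inside it.\<close>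

lemma compact_subset_open_interval:
 fixes K :: "real set"
 assumes K: "compact K" and sub: "K <= {0<..<T}" and T: "0 < T"
 obtains a b where "0 < a" "a <= T / 4" "3 * T / 4 <= b" "b < T" "K <= {a..b}"
proof -
 let ?K = "K \<union> {T / 4, 3 * T / 4}"
 have c: "compact ?K" "?K ~= {}" using K by (auto intro!: compact_Un)
 have s: "?K <= {0<..<T}" using sub T by auto
 obtain a where a: "a : ?K" "!!t. t : ?K ==> a <= t" using compact_attains_inf[OF c] by blast
 obtain b where b: "b : ?K" "!!t. t : ?K ==> t <= b" using compact_attains_sup[OF c] by blast
 show ?thesis
 proof (rule that[of a b])
  show "0 < a" "b < T" using s a(1) b(1) by auto
  show "a <= T / 4" using a(2)[of "T / 4"] by simp
  show "3 * T / 4 <= b" using b(2)[of "3 * T / 4"] by simp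
  show "K <= {a..b}" using a(2) b(2) by auto
 qed
qed

lemma W_neg1_cmult:
 assumes Om: "open Om" and p: "1 < p" and ze: "ze : tests Om" and F: "F : W_neg1_space p Om"
 shows "F (%x. a * ze x) = a * F ze"
proof -
 have q: "1 <= conjugate_exponent p" using p by (simp add: conjugate_exponent_def)
 have "tests Om <= W1_space (conjugate_exponent p) Om" using has_weak_gradient_test_function(2)[OF Om _ q] by blast
 hence "tests Om <= W1_0_space (conjugate_exponent p) Om"
  unfolding W1_0_space_def by (intro closure_of_subset) (simp add: topspace_norm_topology)
 hence X: "ze : W1_0_space (conjugate_exponent p) Om" using ze by blast
 have "F (%x. a * ze x + 0 * ze x) = a * F ze + 0 * F ze"
  using F X unfolding W_neg1_space_def dual_space_def by blast
 thus ?thesis by simp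
qed

text \<open>A bump of integral 1 that vanishes off (T/4, 3T/4); \<open>time_step\<close> is its
  primitive.\<close>

definition time_bump :: "(real => real) => real => real => real" where
 "time_bump j T s = 4 / T * j (- 2 + 4 / T * s)"

definition time_step :: "(real => real) => real => real => real" where
 "time_step j T s = unit_step j (- 2 + 4 / T * s)"

lemma time_bump_props:
 assumes j: "unit_bump j" and T: "0 < T"
 shows "smooth (time_bump j T)" "smooth (time_step j T)" "(time_step j T has_real_derivative time_bump j T s) (at s)"
  "s <= T / 4 ==> time_step j T s = 0" "3 * T / 4 <= s ==> time_step j T s = 1" "0 <= time_step j T s" "time_step j T s <= 1"
  "T < \<bar>s\<bar> ==> time_bump j T s = 0"
proof -
 have bl: "bounded_linear (%s::real. 4 / T * s)" by (rule bounded_linear_mult_right)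
 have js: "smooth j" using j by (simp add: unit_bump_def)
 show "smooth (time_step j T)" unfolding time_step_def[abs_def]
  by (rule smooth_affine_compose[OF bl unit_step_props(1)[OF j]])
 show "smooth (time_bump j T)" unfolding time_bump_def[abs_def]
  by (intro smooth_mult smooth_const smooth_affine_compose[OF bl js])
 have "((%s. - 2 + 4 / T * s) has_real_derivative 4 / T) (at s)" using T by (auto intro!: derivative_eq_intros)
 from DERIV_chain2[OF unit_step_derivative[OF j] this]
 show "(time_step j T has_real_derivative time_bump j T s) (at s)"
  unfolding time_step_def[abs_def] time_bump_def mult.commute[of _ "4 / T"] .
 show "time_step j T s = 0" if "s <= T / 4" unfolding time_step_def
 proof (rule unit_step_props(2)[OF j])
  have "4 / T * s <= 4 / T * (T / 4)" using that T by (intro mult_left_mono) auto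
  thus "- 2 + 4 / T * s <= - 1" using T by simp
 qed
 show "time_step j T s = 1" if "3 * T / 4 <= s" unfolding time_step_def
 proof (rule unit_step_props(3)[OF j])
  have "4 / T * (3 * T / 4) <= 4 / T * s" using that T by (intro mult_left_mono) auto
  thus "1 <= - 2 + 4 / T * s" using T by simp
 qed
 show "0 <= time_step j T s" "time_step j T s <= 1" unfolding time_step_def using unit_step_props(4,5)[OF j] by auto
 show "time_bump j T s = 0" if "T < \<bar>s\<bar>"
 proof -
  have "s < - T \<or> T < s" using that by linarith
  hence "4 / T * s <= -4 \<or> 4 <= 4 / T * s" using T by (auto simp: field_simps)
  hence "1 <= \<bar>- 2 + 4 / T * s\<bar>" by linarith
  thus ?thesis using j by (simp add: unit_bump_def time_bump_def)
 qed
qed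

lemma slice_pairing:
 fixes f :: "real \<times> (real^'d) => real" and a :: "real => real"
 assumes p: "1 <= p" and fm: "f : Bm" and fp: "pil p f < \<infinity>" and ze: "ze : tests Om"
  and a: "a : Bm" "!!t. \<bar>a t\<bar> <= A" "!!t. ra < \<bar>t\<bar> ==> a t = 0"
 shows "intl (%t. a t * (LI x. f (t, x) * ze x))"
  "(LI z. f z * (a (fst z) * ze (snd z))) = (LI t. a t * (LI x. f (t, x) * ze x))"
proof -
 obtain r B where B: "0 < B" "ALL x. \<bar>ze x\<bar> <= B" "ALL x. r < norm x --> ze x = 0" using test_function_bounded[OF ze] by blast
 have zem: "ze : Bm" by (rule bm_contI[OF test_function_bounds(1)[OF ze]])
 have wm: "(%z. a (fst z) * ze (snd z)) : Bm" using measurable_fst_snd[OF a(1) zem] by simp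
 have "intl (%z. (a (fst z) * ze (snd z)) *R f z)"
 proof (rule integrable_Lp_times_bounded[OF p fm fp wm, of "A * B" "ra + r"])
  fix z :: "real \<times> (real^'d)"
  have "0 <= A" using a(2)[of 0] by linarith
  thus "\<bar>a (fst z) * ze (snd z)\<bar> <= A * B" unfolding abs_mult using a(2) B by (intro mult_mono) auto
  assume n: "ra + r < norm z"
  have "norm z <= \<bar>fst z\<bar> + norm (snd z)" using norm_Pair_le[of "fst z" "snd z"] by simp
  hence "ra < \<bar>fst z\<bar> \<or> r < norm (snd z)" using n by linarith
  thus "a (fst z) * ze (snd z) = 0" using a(3) B(3) by auto
 qed
 hence i: "intl (%z. f z * (a (fst z) * ze (snd z)))" by (simp add: mult.commute)
 have e: "(LI x. f (t, x) * (a t * ze x)) = a t * (LI x. f (t, x) * ze x)" for t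
 proof -
  have "(LI x. f (t, x) * (a t * ze x)) = (LI x. a t * (f (t, x) * ze x))" by (simp add: mult_ac)
  thus ?thesis by simp
 qed
 show "intl (%t. a t * (LI x. f (t, x) * ze x))"
  "(LI z. f z * (a (fst z) * ze (snd z))) = (LI t. a t * (LI x. f (t, x) * ze x))"
  using integral_prod_fst(1,3)[OF i] by (simp_all add: e)
qed

lemma tensor_test_function:
 fixes ze :: "real^'d => real" and ps :: "real => real"
 assumes ps: "ps : tests A" and d: "!!s. (ps has_real_derivative ps' s) (at s)" and ze: "ze : tests Om"
 shows "(%z. ps (fst z) * ze (snd z)) : tests (A \<times> Om)"
  "fder (%z. ps (fst z) * ze (snd z)) (at z) (1, 0) = ps' (fst z) * ze (snd z)"
proof -
 have s: "smooth ps" "compact (supp ps)" "supp ps <= A" "smooth ze" "compact (supp ze)" "supp ze <= Om"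
  using ps ze by (auto simp: test_functions_def)
 show "(%z. ps (fst z) * ze (snd z)) : tests (A \<times> Om)"
 proof (rule test_functionI[of _ "supp ps \<times> supp ze"])
  show "smooth (%z::real \<times> (real^'d). ps (fst z) * ze (snd z))"
  using smooth_affine_compose[OF bounded_linear_fst s(1), of 0] smooth_affine_compose[OF bounded_linear_snd s(4), of 0]
  by (intro smooth_mult) simp_all
  show "compact (supp ps \<times> supp ze)" by (intro compact_Times s)
  show "supp ps \<times> supp ze <= A \<times> Om" using s by blast
  fix z assume "z ~: supp ps \<times> supp ze"
  thus "ps (fst z) * ze (snd z) = 0" using not_in_supp[of "fst z" ps] not_in_supp[of "snd z" ze] by (cases z) auto
 qed
 have 1: "((%z::real \<times> (real^'d). ps (fst z)) has_derivative (%v. ps' (fst z) * fst v)) (at z)"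
  using has_derivative_compose[OF has_derivative_fst[OF has_derivative_ident] d[unfolded has_field_derivative_def]] .
 have 2: "((%z::real \<times> (real^'d). ze (snd z)) has_derivative (%v. fder ze (at (snd z)) (snd v))) (at z)"
  using has_derivative_compose[OF has_derivative_snd[OF has_derivative_ident] smooth_has_derivative[OF s(4)]] .
 have "fder ze (at (snd z)) 0 = 0"
  using has_derivative_linear[OF smooth_has_derivative[OF s(4)]] by (rule linear_0)
 thus "fder (%z. ps (fst z) * ze (snd z)) (at z) (1, 0) = ps' (fst z) * ze (snd z)"
  using fun_cong[OF frechet_derivative_at[OF has_derivative_mult[OF 1 2]], of "(1, 0)"] by simp
qed

lemma tail_integral_measurable:
 fixes k :: "real => real"
 assumes km[measurable]: "k : Bm" and ki: "intl k"
 shows "(%t. (LI s. (if t <= s then k s else 0))) : Bm"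
  "\<bar>(LI s. (if t <= s then k s else 0))\<bar> <= (LI s. \<bar>k s\<bar>)"
  "intl (%s. if t <= s then k s else 0)"
proof -
 have "(%t. (LI s. (if t <= s then k s else 0))) : borel_measurable lborel"
  by (rule lborel.borel_measurable_lebesgue_integral) measurable
 thus "(%t. (LI s. (if t <= s then k s else 0))) : Bm" by simp
 show i: "intl (%s. if t <= s then k s else 0)" for t
  by (rule lint_bound[OF ki]) auto
 show "\<bar>(LI s. (if t <= s then k s else 0))\<bar> <= (LI s. \<bar>k s\<bar>)"
  by (rule integral_abs_bound_integral[OF i]) (use ki in auto)
qed

text \<open>
  Tested with the antiderivative of a test function of \<open>t\<close>, made compactly supported by subtracting a
  multiple of the fixed \<open>time_step\<close>.
\<close>

lemma distributional_primitive:
 fixes f g :: "real \<times> (real^'d) => real" and F :: "real => (real^'d => real) => real"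
 assumes j: "unit_bump j" and T: "0 < T" and Om: "open Om" and p: "1 < p"
  and fm: "f : Bm" and f0: "!!z. z ~: {0<..<T} \<times> Om ==> f z = 0" and fp: "pil p f < \<infinity>"
  and ae: "AE z in lborel. z : {0<..<T} \<times> Om --> g z = f z" and ze: "ze : tests Om"
  and km[measurable]: "k : Bm" and k0: "!!t. t ~: {0<..<T} ==> k t = 0" and ki: "intl k"
  and kF: "AE t in lborel. t : {0<..<T} --> F t ze = k t & F t : W_neg1_space p Om"
  and dt: "has_distributional_time_derivative T Om g F"
 shows "AE t in lborel. t : {0<..<T} --> (LI x. f (t, x) * ze x) =
  (LI z. f z * (time_bump j T (fst z) * ze (snd z))) + (LI s. time_step j T s * k s)
  - (LI s. (if t <= s then k s else 0))"
proof -
 have p1: "1 <= p" using p by simp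
 have Tb: "{0<..<T} : sets borel" by simp
 have Sb: "{0<..<T} \<times> Om : sets borel" using Om by (intro borel_open open_Times) auto
 note tb = time_bump_props[OF j T]
 define h where "h t = (LI x. f (t, x) * ze x)" for t
 define ka where "ka t = (LI s. (if t <= s then k s else 0))" for t
 have kam: "ka : Bm" and kab: "\<bar>ka t\<bar> <= (LI s. \<bar>k s\<bar>)" for t
  unfolding ka_def[abs_def] by (rule tail_integral_measurable[OF km ki])+
 note sp = slice_pairing[OF p1 fm fp ze, folded h_def]
 have contb: "EX A. ALL t. \<bar>a t\<bar> <= A" if "cts a" "!!t. ra < \<bar>t\<bar> ==> a t = 0" for a :: "real => real" and ra
  using continuous_bounded_support_bound[OF that(1), of ra] that(2) by auto
 \<comment> \<open>Products of a time and a space test function turn the distributional derivative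
   in (0,T) \<times> \<Omega> into that of the scalar function \<open>h\<close>, with
   \<open>k\<close> in the place of \<open>F\<close>.\<close>
 have weakeq: "(LI t. ps' t * h t) = - (LI t. ps t * k t)"
  if ps: "ps : tests {0<..<T}" and d: "!!s. (ps has_real_derivative ps' s) (at s)" and c: "cts ps'"
  and z: "!!t. T < \<bar>t\<bar> ==> ps' t = 0" for ps ps'
 proof -
  obtain A where A: "!!t. \<bar>ps' t\<bar> <= A" using contb[OF c z] by blast
  have ps'm: "ps' : Bm" by (rule bm_contI[OF c])
  have psm[measurable]: "ps : Bm" by (rule bm_contI[OF test_function_bounds(1)[OF ps]])
  have zem: "ze : Bm" by (rule bm_contI[OF test_function_bounds(1)[OF ze]])
  have "(%z. ps' (fst z) * ze (snd z)) : Bm" using measurable_fst_snd[OF ps'm zem] by simp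
  hence m: "(%z. f z * (ps' (fst z) * ze (snd z))) : Bm" using fm by simp
  have "(\<integral>z. g z * (ps' (fst z) * ze (snd z)) \<partial>leb ({0<..<T} \<times> Om)) =
  - (\<integral>t. F t (%x. ps t * ze x) \<partial>leb {0<..<T})"
  using dt tensor_test_function(1)[OF ps d ze] unfolding has_distributional_time_derivative_def
  by (auto simp: tensor_test_function(2)[OF ps d ze] dest!: bspec)
  also have "(\<integral>t. F t (%x. ps t * ze x) \<partial>leb {0<..<T}) = (LI t. ind {0<..<T} t *R (ps t * k t))"
  proof (rule lebesgue_on_AE_eq(2)[OF Tb])
  show "AE t in lborel. t : {0<..<T} --> F t (%x. ps t * ze x) = ps t * k t"
  using kF
  proof eventually_elim
  case (elim t)
  thus ?case using W_neg1_cmult[OF Om p ze, of "F t" "ps t"] by auto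
  qed
  qed simp
  also have "... = (LI t. ps t * k t)"
  by (intro lint_cong) (use k0 in \<open>auto simp: indicator_def\<close>)
  finally have 1: "(\<integral>z. g z * (ps' (fst z) * ze (snd z)) \<partial>leb ({0<..<T} \<times> Om)) = - (LI t. ps t * k t)" .
  have "AE z in lborel. z : {0<..<T} \<times> Om --> g z * (ps' (fst z) * ze (snd z)) = f z * (ps' (fst z) * ze (snd z))"
  using ae by eventually_elim auto
  from lebesgue_on_AE_eq(2)[OF Sb m this]
  have "(\<integral>z. g z * (ps' (fst z) * ze (snd z)) \<partial>leb ({0<..<T} \<times> Om)) = (LI z. ind ({0<..<T} \<times> Om) z *R (f z * (ps' (fst z) * ze (snd z))))" .
  also have "... = (LI z. f z * (ps' (fst z) * ze (snd z)))"
  by (intro lint_cong refl) (use f0 in \<open>auto simp: indicator_def\<close>)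
  also have "... = (LI t. ps' t * h t)" by (rule sp(2)[OF ps'm A z])
  finally show ?thesis using 1 by simp
 qed
 have tbc: "cts (time_bump j T)" "cts (time_step j T)" using tb(1,2) by (auto intro: smooth_continuous)
 have tbm[measurable]: "time_bump j T : Bm" "time_step j T : Bm"
  using tbc by (auto intro: bm_contI)
 obtain A0 where A0: "!!t. \<bar>time_bump j T t\<bar> <= A0" using contb[OF tbc(1) tb(8)] by blast
 have i0: "intl (%t. time_bump j T t * h t)" by (rule sp(1)[OF tbm(1) A0 tb(8)])
 have i1: "intl (%s. time_step j T s * k s)"
 proof (rule lint_bound[OF ki])
  show "AE s in lborel. norm (time_step j T s * k s) <= norm (k s)"
  using tb(6,7) by (intro AE_I2) (simp add: abs_mult mult_left_le_one_le)
 qed simp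
 \<comment> \<open>The constant of integration, which the derivative leaves open, is fixed by
   testing with \<open>time_bump\<close>.\<close>
 define c where "c = (LI t. time_bump j T t * h t) + (LI s. time_step j T s * k s)"
 have c_eq: "(LI z. f z * (time_bump j T (fst z) * ze (snd z))) = (LI t. time_bump j T t * h t)"
  by (rule sp(2)[OF tbm(1) A0 tb(8)])
 have main: "(LI t. xi t * (h t - c + ka t)) = 0" if xi: "xi : tests {0<..<T}" for xi
 proof -
  have s: "smooth xi" "compact (supp xi)" "supp xi <= {0<..<T}" using xi by (auto simp: test_functions_def)
  obtain a b where ab: "0 < a" "a <= T / 4" "3 * T / 4 <= b" "b < T" "supp xi <= {a..b}"
  using compact_subset_open_interval[OF s(2,3) T] by blast
  have xi0: "xi t = 0" if "t < a \<or> b < t" for t using not_in_supp[of t xi] ab(5) that by force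
  have xic: "cts xi" by (rule smooth_continuous[OF s(1)])
  have xim[measurable]: "xi : Bm" by (rule bm_contI[OF xic])
  have xiT: "xi t = 0" if "T < \<bar>t\<bar>" for t using that ab by (intro xi0) auto
  obtain A where A: "!!t. \<bar>xi t\<bar> <= A" using contb[OF xic xiT] by blast
  have xii: "intl xi" using A xiT by (intro integrable_bounded_support[of xi A T]) auto
  obtain X where X: "smooth X" "!!s. (X has_real_derivative xi s) (at s)" "!!s. X s = (LI t. (if t <= s then xi t else 0))"
  using antiderivative_support_below[OF s(1), of a] xi0 by blast
  define C where "C = (LI t. xi t)"
  \<comment> \<open>To the right of the support of \<open>xi\<close> the antiderivative equals
    \<open>C\<close>, which \<open>C * time_step\<close> cancels; to the left both terms
    vanish.\<close>
  define ps where "ps s = X s - C * time_step j T s" for s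
  have Xa: "X s = 0" if "s < a" for s
  proof -
  have "X s = (LI (t::real). 0)" unfolding X(3) by (intro lint_cong refl) (use that xi0 in auto)
  thus ?thesis by simp
  qed
  have Xb: "X s = C" if "b < s" for s
  unfolding X(3) C_def by (intro lint_cong refl) (use that xi0 in auto)
  have pst: "ps : tests {0<..<T}"
  proof (rule test_functionI[of _ "{a..b}"])
  show "smooth ps" unfolding ps_def by (intro smooth_diff smooth_mult smooth_const X tb)
  show "{a..b} <= {0<..<T}" using ab by auto
  fix s assume "s ~: {a..b}"
  then consider "s < a" | "b < s" by fastforce
  thus "ps s = 0" using Xa Xb tb(4,5) ab by cases (auto simp: ps_def)
  qed simp
  have d: "(ps has_real_derivative xi s - C * time_bump j T s) (at s)" for s
  unfolding ps_def by (rule DERIV_diff[OF X(2) DERIV_cmult[OF tb(3)]])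
  have Xm[measurable]: "X : Bm" by (rule bm_contI[OF smooth_continuous[OF X(1)]])
  have Xbd: "\<bar>X s\<bar> <= (LI t. \<bar>xi t\<bar>)" for s
  unfolding X(3) by (rule integral_abs_bound_integral)
  (use xii in \<open>auto intro: lint_bound[OF xii]\<close>)
  have iX: "intl (%s. X s * k s)"
  proof (rule lint_bound[of lborel "%s. (LI t. \<bar>xi t\<bar>) * k s"])
  show "AE s in lborel. norm (X s * k s) <= norm ((LI t. \<bar>xi t\<bar>) * k s)"
  using Xbd by (intro AE_I2) (simp add: abs_mult mult_right_mono)
  qed (use ki in auto)
  have ich: "intl (%t. xi t * h t)" by (rule sp(1)[OF xim A xiT])
  have "(LI t. (xi t - C * time_bump j T t) * h t) = - (LI t. ps t * k t)"
  proof (rule weakeq[OF pst d])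
  show "cts (%t. xi t - C * time_bump j T t)" by (intro continuous_intros xic tbc)
  qed (simp add: xiT tb(8))
  moreover have "(LI t. (xi t - C * time_bump j T t) * h t) = (LI t. xi t * h t) - C * (LI t. time_bump j T t * h t)"
  proof -
  have "(LI t. (xi t - C * time_bump j T t) * h t) = (LI t. xi t * h t - C * (time_bump j T t * h t))"
  by (simp add: algebra_simps)
  also have "... = (LI t. xi t * h t) - (LI t. C * (time_bump j T t * h t))"
  using ich i0 by (intro Bochner_Integration.integral_diff integrable_mult_right)
  finally show ?thesis by simp
  qed
  moreover have "(LI t. ps t * k t) = (LI t. X t * k t) - C * (LI t. time_step j T t * k t)"
  proof -
  have "(LI t. ps t * k t) = (LI t. X t * k t - C * (time_step j T t * k t))"
  by (simp add: ps_def algebra_simps)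
  also have "... = (LI t. X t * k t) - (LI t. C * (time_step j T t * k t))"
  using iX i1 by (intro Bochner_Integration.integral_diff integrable_mult_right)
  finally show ?thesis by simp
  qed
  \<comment> \<open>Fubini's theorem on t \<le> s moves the primitive from the test function to
    \<open>k\<close>.\<close>
  moreover have "(LI s. X s * k s) = (LI t. xi t * ka t)"
  proof -
  have prod: "integrable (lborel \<Otimes>\<^sub>M lborel) (%z::real \<times> real. xi (fst z) * k (snd z))"
  proof (rule lborel_pair.Fubini_integrable)
  show "intl (%x. (LI y. norm (xi (fst (x, y)) * k (snd (x, y)))))"
  using xii by (simp add: abs_mult)
  qed (use ki in auto)
  have pi: "integrable (lborel \<Otimes>\<^sub>M lborel) (case_prod (%t s. if t <= s then xi t * k s else 0))"
  proof (rule lint_bound[OF prod])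
  show "case_prod (%t s. if t <= s then xi t * k s else 0) : borel_measurable (lborel \<Otimes>\<^sub>M lborel)" by measurable
  qed (auto simp: split_beta)
  have "(LI s. X s * k s) = (LI s. (LI t. (if t <= s then xi t * k s else 0)))"
  proof (intro lint_cong refl)
  fix s
  have "X s * k s = (LI t. (if t <= s then xi t else 0) * k s)" unfolding X(3) by simp
  also have "... = (LI t. (if t <= s then xi t * k s else 0))"
  by (intro lint_cong refl) auto
  finally show "X s * k s = (LI t. (if t <= s then xi t * k s else 0))" .
  qed
  also have "... = (LI t. (LI s. (if t <= s then xi t * k s else 0)))"
  by (rule lborel_pair.Fubini_integral[OF pi])
  also have "... = (LI t. xi t * ka t)"
  proof (intro lint_cong refl)
  fix t
  have "(LI s. (if t <= s then xi t * k s else 0)) = (LI s. xi t * (if t <= s then k s else 0))"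
  by (intro lint_cong refl) auto
  thus "(LI s. (if t <= s then xi t * k s else 0)) = xi t * ka t" by (simp add: ka_def)
  qed
  finally show ?thesis .
  qed
  ultimately have eq: "(LI t. xi t * h t) - C * c + (LI t. xi t * ka t) = 0"
  by (simp add: c_def algebra_simps)
  have ika: "intl (%t. xi t * ka t)"
  proof (rule lint_bound[of lborel "%t. (LI s. \<bar>k s\<bar>) * xi t"])
  show "AE t in lborel. norm (xi t * ka t) <= norm ((LI s. \<bar>k s\<bar>) * xi t)"
  proof (rule AE_I2)
  fix t
  show "norm (xi t * ka t) <= norm ((LI s. \<bar>k s\<bar>) * xi t)"
  using mult_left_mono[OF kab[of t] abs_ge_zero[of "xi t"]] by (simp add: abs_mult mult.commute)
  qed
  qed (use xii kam in auto)
  have "(LI t. xi t * (h t - c + ka t)) = (LI t. (xi t * h t - c * xi t) + xi t * ka t)"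
  by (simp add: algebra_simps)
  also have "... = (LI t. xi t * h t - c * xi t) + (LI t. xi t * ka t)"
  using ich xii ika by (intro Bochner_Integration.integral_add Bochner_Integration.integrable_diff integrable_mult_right)
  also have "(LI t. xi t * h t - c * xi t) = (LI t. xi t * h t) - c * C"
  using ich xii by (simp add: C_def)
  finally show ?thesis using eq by (simp add: mult.commute)
 qed
 define u where "u t = ind {0<..<T} t * (h t - c + ka t)" for t
 have ui: "intl u"
 proof -
  have "intl (%t. ind {0<..<T} t * h t)"
  by (rule sp(1)[of "ind {0<..<T}" 1 T]) (auto simp: indicator_def)
  moreover have "intl (%t. ind {0<..<T} t * (ka t - c))"
  proof (rule integrable_bounded_support[of _ "(LI s. \<bar>k s\<bar>) + \<bar>c\<bar>" T])
  show "norm (ind {0<..<T} t * (ka t - c)) <= (LI s. \<bar>k s\<bar>) + \<bar>c\<bar>" for t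
  using kab[of t] by (auto simp: indicator_def)
  qed (use kam T in \<open>auto simp: indicator_def\<close>)
  ultimately have "intl (%t. ind {0<..<T} t * h t + ind {0<..<T} t * (ka t - c))"
  by (rule Bochner_Integration.integrable_add)
  thus ?thesis unfolding u_def by (simp add: algebra_simps)
 qed
 have um: "u : Bm" using borel_measurable_integrable[OF ui] by simp
 have "AE t in leb {0<..<T}. u t = 0"
 proof (rule fundamental_lemma[OF j])
  show "locally_integrable_on {0<..<T} u" unfolding locally_integrable_on_def
  proof (intro allI impI)
  fix K :: "real set" assume K: "compact K & K <= {0<..<T}"
  hence Kb: "K : sets borel" by (simp add: borel_compact)
  have "intl (%t. ind K t *R u t)" using Kb ui by (intro integrable_mult_indicator) auto
  thus "integrable (leb K) u" using lebesgue_on_AE_eq(3)[OF Kb um, of u] by simp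
  qed
  fix xi :: "real => real" assume xi: "xi : tests {0<..<T}"
  have xim: "xi : Bm" by (rule bm_contI[OF test_function_bounds(1)[OF xi]])
  have "(\<integral>t. u t * xi t \<partial>leb {0<..<T}) = (LI t. ind {0<..<T} t *R (u t * xi t))"
  using um xim by (intro lebesgue_on_AE_eq(2)[OF Tb]) auto
  also have "... = (LI t. xi t * (h t - c + ka t))"
  by (intro lint_cong refl) (use test_function_bounds(4)[OF xi] in \<open>auto simp: indicator_def u_def\<close>)
  finally show "(\<integral>t. u t * xi t \<partial>leb {0<..<T}) = 0" using main[OF xi] by simp
 qed simp
 hence "AE t in lborel. t : {0<..<T} --> u t = 0" unfolding AE_lebesgue_on_iff[OF Tb] .
 thus ?thesis
 proof eventually_elim
  case (elim t)
  thus ?case unfolding c_eq h_def[symmetric] ka_def[symmetric] by (auto simp: u_def c_def)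
 qed
qed

text \<open>Trades a p-th root for an additive 1, which is enough for bounds that only have to be
  uniform in \<open>n\<close>.\<close>

lemma le_one_plus_of_powr_le:
 fixes x :: real
 assumes "0 <= x" "1 <= p" "x powr p <= K"
 shows "x <= 1 + K"
proof (cases "x <= 1")
 case True
 have "0 <= x powr p" by simp
 thus ?thesis using True assms(3) by linarith
next
 case False
 hence "x powr 1 <= x powr p" using assms(2) by (intro powr_mono) auto
 thus ?thesis using False assms(3) by simp
qed

lemma small_powr:
 fixes Q e s0 :: real
 assumes "0 <= Q" "0 < e" "0 < s0" "0 < p"
 obtains ep where "0 < ep" "ep <= s0" "Q * ep powr p <= e"
proof -
 define d where "d = e / (Q + 1)"
 have d: "0 < d" using assms by (simp add: d_def)
 define ep where "ep = min s0 (d powr (1 / p))"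
 have ep: "0 < ep" "ep <= s0" "ep <= d powr (1 / p)" using assms d by (auto simp: ep_def)
 have "ep powr p <= (d powr (1 / p)) powr p" using ep assms by (intro powr_mono2) auto
 also have "... = d" using assms d by (simp add: powr_powr)
 finally have "Q * ep powr p <= Q * d" using assms by (intro mult_left_mono) auto
 also have "... <= e" using assms by (simp add: d_def field_simps)
 finally show ?thesis using ep that by blast
qed

text \<open>The primitive \<open>c - ka t\<close> is an everywhere defined version of the pairing.
  Its increments are integrals of \<open>k\<close> over [s,t), and Jensen's inequality gives the
  Hoelder bound from the Lp bound on \<open>k\<close>; the constants do not depend on
  \<open>n\<close>.\<close>

lemma slice_pairing_regularity:
 fixes f g :: "nat => real \<times> (real^'d) => real"
 assumes ks: "kernel_sequence T p M R Om rh f j" and pg: "1 < p" and ze: "ze : tests Om"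
  and ae: "ALL n>=1. AE z in lborel. z : {0<..<T} \<times> Om --> g n z = f n z"
  and gF: "ALL n>=1. EX F : bochner_space p (leb {0<..<T}) (W_neg1_space p Om) (W_neg1_norm p Om).
  has_distributional_time_derivative T Om (g n) F & bochner_norm p (leb {0<..<T}) (W_neg1_norm p Om) F <= M"
 shows "EX B D. 0 <= D & (ALL n>=1. EX H. (ALL t. \<bar>H t\<bar> <= B) &
  (ALL s t. s <= t --> \<bar>H t - H s\<bar> powr p <= (t - s) powr (p - 1) * D) &
  (AE t in lborel. t : {0<..<T} --> (LI x. f n (t, x) * ze x) = H t))"
proof -
 interpret kernel_sequence T p M R Om rh f j by (rule ks)
 have p1: "1 <= p" using pg by simp
 note tb = time_bump_props[OF j T0]
 obtain Z where Z: "0 < Z" "!!F. F : W_neg1_space p Om ==> \<bar>F ze\<bar> <= Z * W_neg1_norm p Om F"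
  using W_neg1_pairing_bound[OF j Om ze pg] by blast
 define D where "D = Z powr p * M powr p"
 have D0: "0 <= D" by (simp add: D_def)
 define w where "w z = time_bump j T (fst z) * ze (snd z)" for z :: "real \<times> (real^'d)"
 obtain r B where B: "0 < B" "ALL x. \<bar>ze x\<bar> <= B" "ALL x. r < norm x --> ze x = 0" using test_function_bounded[OF ze] by blast
 have tbm: "time_bump j T : Bm" by (rule bm_contI[OF smooth_continuous[OF tb(1)]])
 have zem: "ze : Bm" by (rule bm_contI[OF test_function_bounds(1)[OF ze]])
 have wm[measurable]: "w : Bm" unfolding w_def using measurable_fst_snd[OF tbm zem] by simp
 obtain A0 where A0: "ALL t. \<bar>time_bump j T t\<bar> <= A0"
  using continuous_bounded_support_bound[OF smooth_continuous[OF tb(1)], of T] tb(8) by auto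
 have A00: "0 <= A0" using A0[rule_format, of 0] by linarith
 have wb: "\<bar>w z\<bar> <= A0 * B" for z unfolding w_def abs_mult using A0 B A00 by (intro mult_mono) auto
 have w0: "w z = 0" if n: "T + r < norm z" for z
 proof -
  have "norm z <= \<bar>fst z\<bar> + norm (snd z)" using norm_Pair_le[of "fst z" "snd z"] by simp
  hence "T < \<bar>fst z\<bar> \<or> r < norm (snd z)" using n by linarith
  thus ?thesis using tb(8) B(3) by (auto simp: w_def)
 qed
 define m where "m = measure lborel (cball (0::real \<times> (real^'d)) (T + r))"
 have mb: "emeasure lborel (cball (0::real \<times> (real^'d)) (T + r)) <= en m"
  unfolding m_def using emeasure_lborel_cball_finite[of "0::real \<times> (real^'d)" "T + r"] by (simp add: emeasure_eq_ennreal_measure less_top)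
 define K1 where "K1 = m powr (p - 1) * ((A0 * B) powr p * \<bar>M\<bar>)"
 have fw: "\<bar>(LI z. f n z * w z)\<bar> <= 1 + K1" if n: "1 <= n" for n
 proof (rule le_one_plus_of_powr_le[OF _ p1])
  have [measurable]: "f n : Bm" by (rule fm[OF n])
  have "en (norm (LI z. f n z * w z) powr p) <= en (m powr (p - 1)) * pil p (%z. f n z * w z)"
  by (rule jensen_powr_support[of _ _ "cball 0 (T + r)"]) (use p1 mb w0 in auto)
  also have "pil p (%z. f n z * w z) <= (NI z. en ((A0 * B) powr p) * en (norm (f n z) powr p))"
  unfolding pint_def
  proof (rule nn_integral_mono)
  fix z
  have "norm (f n z * w z) powr p = \<bar>w z\<bar> powr p * norm (f n z) powr p" by (simp add: abs_mult powr_mult mult.commute)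
  also have "... <= (A0 * B) powr p * norm (f n z) powr p" using p1 wb[of z] by (intro mult_right_mono powr_mono2) auto
  finally show "en (norm (f n z * w z) powr p) <= en ((A0 * B) powr p) * en (norm (f n z) powr p)"
  by (simp add: ennreal_mult[symmetric] ennreal_leI)
  qed
  also have "... = en ((A0 * B) powr p) * pil p (f n)" unfolding pint_def by (rule nn_integral_cmult) measurable
  also have "... <= en ((A0 * B) powr p) * en \<bar>M\<bar>"
  using fb[OF n] by (intro mult_left_mono) (auto intro: order_trans ennreal_leI)
  also have "en (m powr (p - 1)) * (en ((A0 * B) powr p) * en \<bar>M\<bar>) = en K1"
  by (simp add: K1_def ennreal_mult)
  finally have "en (norm (LI z. f n z * w z) powr p) <= en K1" by (simp add: mult_left_mono)
  moreover have "0 <= K1" by (simp add: K1_def)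
  ultimately show "\<bar>(LI z. f n z * w z)\<bar> powr p <= K1" by simp
 qed simp
 define K2 where "K2 = 1 + T powr (p - 1) * D"
 have "EX H. (ALL t. \<bar>H t\<bar> <= (1 + K1) + 2 * K2) &
  (ALL s t. s <= t --> \<bar>H t - H s\<bar> powr p <= (t - s) powr (p - 1) * D) &
  (AE t in lborel. t : {0<..<T} --> (LI x. f n (t, x) * ze x) = H t)" if n: "1 <= n" for n
 proof -
  obtain F where F: "F : bochner_space p (leb {0<..<T}) (W_neg1_space p Om) (W_neg1_norm p Om)"
  "has_distributional_time_derivative T Om (g n) F" "bochner_norm p (leb {0<..<T}) (W_neg1_norm p Om) F <= M"
  using gF n by blast
  obtain k where k: "k : Bm" "!!t. t ~: {0<..<T} ==> k t = 0"
  "AE t in lborel. t : {0<..<T} --> F t ze = k t & F t : W_neg1_space p Om" "pil p k <= en D"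
  using bochner_pairing[OF pg Z F(1,3)] unfolding D_def by blast
  note k(1)[measurable]
  have ki: "intl k"
  by (rule integrable_Lp_support[of _ _ "{0<..<T}" p]) (use p1 k T0 in \<open>auto intro: le_less_trans\<close>)
  have k1: "(LI s. \<bar>k s\<bar>) <= K2" unfolding K2_def
  proof (rule le_one_plus_of_powr_le[OF _ p1])
  have "en (norm (LI s. \<bar>k s\<bar>) powr p) <= en (T powr (p - 1)) * pil p (%s. \<bar>k s\<bar>)"
  by (rule jensen_powr_support[of _ _ "{0<..<T}"]) (use p1 k(2) T0 in auto)
  also have "... <= en (T powr (p - 1)) * en D" using k(4) by (intro mult_left_mono) (auto simp: pint_def)
  also have "... = en (T powr (p - 1) * D)" using D0 by (simp add: ennreal_mult)
  finally show "(LI s. \<bar>k s\<bar>) powr p <= T powr (p - 1) * D" using D0 by simp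
  qed simp
  define ka where "ka t = (LI s. (if t <= s then k s else 0))" for t
  note tail = tail_integral_measurable[OF k(1) ki]
  define c where "c = (LI z. f n z * w z) + (LI s. time_step j T s * k s)"
  have c2: "\<bar>(LI s. time_step j T s * k s)\<bar> <= (LI s. \<bar>k s\<bar>)"
  proof (rule integral_abs_bound_integral)
  show b: "\<bar>time_step j T s * k s\<bar> <= \<bar>k s\<bar>" for s using tb(6,7)[of s] by (simp add: abs_mult mult_left_le_one_le)
  have [measurable]: "time_step j T : Bm"
  by (rule bm_contI[OF smooth_continuous[OF tb(2)]])
  show "intl (%s. time_step j T s * k s)"
  by (rule lint_bound[OF ki]) (use b in auto)
  qed (use ki in simp)
  show ?thesis
  proof (intro exI[of _ "%t. c - ka t"] conjI allI impI)
  show "\<bar>c - ka t\<bar> <= (1 + K1) + 2 * K2" for t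
  using fw[OF n] c2 tail(2)[of t] k1 unfolding c_def ka_def by linarith
  show "\<bar>c - ka t - (c - ka s)\<bar> powr p <= (t - s) powr (p - 1) * D" if st: "s <= t" for s t
  proof -
  define q where "q x = (if s <= x & x < t then k x else 0)" for x
  have qm[measurable]: "q : Bm" unfolding q_def by measurable
  have "ka s - ka t = (LI x. (if s <= x then k x else 0) - (if t <= x then k x else 0))"
  unfolding ka_def by (rule Bochner_Integration.integral_diff[symmetric]) (rule tail(3))+
  also have "... = (LI x. q x)"
  by (intro lint_cong refl) (use st in \<open>auto simp: q_def\<close>)
  finally have e: "c - ka t - (c - ka s) = (LI x. q x)" by simp
  have "en (norm (LI x. q x) powr p) <= en ((t - s) powr (p - 1)) * pil p q"
  by (rule jensen_powr_support[of _ _ "{s..<t}"]) (use p1 st in \<open>auto simp: q_def\<close>)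
  also have "pil p q <= pil p k" unfolding pint_def by (intro nn_integral_mono) (simp add: q_def)
  also have "... <= en D" by (rule k(4))
  also have "en ((t - s) powr (p - 1)) * en D = en ((t - s) powr (p - 1) * D)" using D0 by (simp add: ennreal_mult)
  finally show ?thesis unfolding e using D0 by (simp add: mult_left_mono)
  qed
  show "AE t in lborel. t : {0<..<T} --> (LI x. f n (t, x) * ze x) = c - ka t"
  unfolding c_def ka_def w_def
  by (rule distributional_primitive[OF j T0 Om pg fm[OF n] f0[OF n] fLp[OF n] _ ze k(1,2) ki k(3) F(2)])
  (use ae n in auto)
  qed
 qed
 thus ?thesis using D0 by blast
qed

section \<open>Total boundedness\<close>

text \<open>
  The indices split into finitely many classes on which \<open>Q\<close> holds: total boundedness of a sequence, in a
  form that is stable under finite conjunctions.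
\<close>

definition finite_classes :: "(nat => nat => bool) => bool" where
 "finite_classes Q \<longleftrightarrow> (EX c :: nat => nat. finite (range c) & (ALL m n. c m = c n --> Q m n))"

lemma finite_classesI:
 fixes c :: "nat => 'c"
 assumes fin: "finite (range c)" and Q: "!!m n. c m = c n ==> Q m n"
 shows "finite_classes Q"
proof -
 obtain h :: "'c => nat" and N where h: "h ` range c = {i. i < N}" "inj_on h (range c)"
  using finite_imp_inj_to_nat_seg[OF fin] by blast
 have "range (%n. h (c n)) = {i. i < N}" using h(1) by (simp add: image_image)
 hence "finite (range (%n. h (c n)))" by simp
 moreover have "ALL m n. h (c m) = h (c n) --> Q m n" using h(2) Q by (auto simp: inj_on_def)
 ultimately show ?thesis unfolding finite_classes_def by (intro exI[of _ "%n. h (c n)"]) simp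
qed

lemma finite_classes_mono:
 assumes "finite_classes P" "!!m n. P m n ==> Q m n" shows "finite_classes Q"
 using assms unfolding finite_classes_def by blast

lemma finite_classes_conj:
 assumes "finite_classes P" "finite_classes Q" shows "finite_classes (%m n. P m n & Q m n)"
proof -
 obtain c d :: "nat => nat" where cd: "finite (range c)" "ALL m n. c m = c n --> P m n" "finite (range d)" "ALL m n. d m = d n --> Q m n"
  using assms unfolding finite_classes_def by blast
 show ?thesis
 proof (rule finite_classesI[of "%n. (c n, d n)"])
  show "finite (range (%n. (c n, d n)))" by (rule finite_subset[of _ "range c \<times> range d"]) (use cd in auto)
 qed (use cd in auto)
qed

lemma finite_classes_ball:
 assumes "finite J" "!!i. i : J ==> finite_classes (Q i)"
 shows "finite_classes (%m n. ALL i:J. Q i m n)"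
 using assms
proof (induction J)
 case empty
 show ?case by (rule finite_classesI[of "%_. ()"]) auto
next
 case (insert x J)
 hence "finite_classes (%m n. Q x m n & (ALL i:J. Q i m n))" by (intro finite_classes_conj) auto
 thus ?case by (rule finite_classes_mono) auto
qed

text \<open>A number is coded by the cell of length \<open>ka\<close> that contains it.\<close>

lemma finite_classes_bounded_real:
 fixes a :: "nat => real"
 assumes B: "!!n. \<bar>a n\<bar> <= B" and ka: "0 < ka"
 shows "finite_classes (%m n. \<bar>a m - a n\<bar> <= ka)"
proof (rule finite_classesI[of "%n. \<lfloor>a n / ka\<rfloor>"])
 have "range (%n. \<lfloor>a n / ka\<rfloor>) <= {\<lfloor>- B / ka\<rfloor>..\<lfloor>B / ka\<rfloor>}"
 proof clarify
  fix n
  have "- B <= a n" "a n <= B" using B[of n] by auto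
  hence "- B / ka <= a n / ka" "a n / ka <= B / ka" using ka divide_right_mono[of "- B" "a n" ka] divide_right_mono[of "a n" B ka] by simp_all
  thus "\<lfloor>a n / ka\<rfloor> : {\<lfloor>- B / ka\<rfloor>..\<lfloor>B / ka\<rfloor>}" by (auto intro: floor_mono)
 qed
 thus "finite (range (%n. \<lfloor>a n / ka\<rfloor>))" by (rule finite_subset) simp
 fix m n assume "\<lfloor>a m / ka\<rfloor> = \<lfloor>a n / ka\<rfloor>"
 hence "\<bar>a m / ka - a n / ka\<bar> < 1" by linarith
 hence "\<bar>(a m - a n) / ka\<bar> < 1" by (simp add: diff_divide_distrib)
 thus "\<bar>a m - a n\<bar> <= ka" using ka by (simp add: abs_divide field_simps)
qed

text \<open>The Arzela-Ascoli argument in coded form: values on a grid are coded up to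
  \<open>ka / 3\<close>, and the common modulus of continuity accounts for the other two
  thirds.\<close>

lemma finite_classes_equicontinuous:
 fixes H :: "nat => real => real"
 assumes p: "1 < p" and D: "0 <= D" and ka: "0 < ka" and B: "!!n t. \<bar>H n t\<bar> <= B"
  and Hc: "!!n s t. s <= t ==> \<bar>H n t - H n s\<bar> powr p <= (t - s) powr (p - 1) * D"
 shows "finite_classes (%m n. ALL t:{0<..<T}. \<bar>H m t - H n t\<bar> <= ka)"
proof -
 obtain si where si: "0 < si" "D * si powr (p - 1) <= (ka / 3) powr p"
  using small_powr[of D "(ka / 3) powr p" 1 "p - 1"] D ka p by auto
 define N where "N = nat \<lceil>T / si\<rceil>"
 have "finite_classes (%m n. ALL i:{..N}. \<bar>H m (real i * si) - H n (real i * si)\<bar> <= ka / 3)"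
 proof (rule finite_classes_ball[OF finite_atMost])
  fix i
  show "finite_classes (%m n. \<bar>H m (real i * si) - H n (real i * si)\<bar> <= ka / 3)"
  by (rule finite_classes_bounded_real[of "%n. H n (real i * si)" B]) (use B ka in auto)
 qed
 thus ?thesis
 proof (rule finite_classes_mono, intro ballI)
  fix m n t assume g: "ALL i:{..N}. \<bar>H m (real i * si) - H n (real i * si)\<bar> <= ka / 3" and t: "t : {0<..<T}"
  define i where "i = nat \<lfloor>t / si\<rfloor>"
  have q: "0 <= t / si" "t / si <= T / si" using t si by (auto intro!: divide_right_mono)
  have iN: "i <= N" using q unfolding i_def N_def by linarith
  have "real i <= t / si" "t / si < real i + 1" using q unfolding i_def by linarith+
  hence i: "real i * si <= t" "t - real i * si <= si" using si(1) by (auto simp: field_simps)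
  have near: "\<bar>H l t - H l (real i * si)\<bar> <= ka / 3" for l
  proof -
  have "\<bar>H l t - H l (real i * si)\<bar> powr p <= (t - real i * si) powr (p - 1) * D" by (rule Hc[OF i(1)])
  also have "... <= si powr (p - 1) * D" using i p D by (intro mult_right_mono powr_mono2) auto
  also have "... <= (ka / 3) powr p" using si(2) by (simp add: mult.commute)
  finally show ?thesis using p ka powr_less_mono2[of p "ka / 3" "\<bar>H l t - H l (real i * si)\<bar>"] by (auto simp: not_le[symmetric])
  qed
  have "\<bar>H m (real i * si) - H n (real i * si)\<bar> <= ka / 3" using g iN by simp
  thus "\<bar>H m t - H n t\<bar> <= ka" using near[of m] near[of n] by linarith
 qed
qed

section \<open>Averaging over cones\<close>

text \<open>The kernel, moved to \<open>e\<close>, rescaled from radius \<open>R\<close> to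
  \<open>th / 2\<close> and normalised, serves as mollifier. The closed ball of half the radius
  keeps its support compactly inside the open set of directions.\<close>

lemma cone_mollifier:
 fixes rh :: "real^'d => real" and e :: "real^'d"
 assumes k: "is_kernel rh R" and s: "smooth rh" and th: "0 < th"
 obtains et :: "real^'d => real" and B :: real where "smooth et" "!!w. 0 <= et w" "!!w. et w <= B" "!!w. w ~: cball e (th / 2) ==> et w = 0" "(LI w. et w) = 1"
proof -
 have R: "0 < R" by (rule kernel_props(4)[OF k])
 have rh0: "0 <= rh x" for x by (rule kernel_props(1)[OF k])
 have rhm: "rh : Bm" by (rule kernel_props(3)[OF k])
 obtain B where B: "ALL x. rh x <= B" using kernel_props(7)[OF k] by blast
 define ta where "ta = 2 * R / th"
 have ta: "0 < ta" using R th by (simp add: ta_def)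
 define rh' where "rh' w = rh (- ta *R e + ta *R w)" for w
 define J where "J = (LI w. rh' w)"
 have J0: "0 <= J" unfolding J_def rh'_def using rh0 by simp
 have "J ~= 0"
 proof
  assume "J = 0"
  hence "(LI x. rh x) = 0"
  using integral_lborel_affine[OF rhm, of ta "- ta *R e"] ta by (simp add: J_def rh'_def)
  moreover have "intl rh" using kernel_moment_integrable[OF k, of "%_. 1 :: real"] by simp
  ultimately have "AE x in lborel. rh x = 0" using integral_nonneg_eq_0_iff_AE[of lborel rh] rh0 by simp
  hence "AE x in lborel. rh x * (x $ i)\<^sup>2 = 0" for i by eventually_elim auto
  hence "kernel_moment rh i = 0" for i unfolding kernel_moment_def by (rule integral_eq_zero_AE)
  thus False using kernel_moment_pos[OF k] less_irrefl by metis
 qed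
 hence J: "0 < J" using J0 by simp
 show ?thesis
 proof (rule that[of "%w. (1 / J) * rh' w" "(1 / J) * B"])
  have bl: "bounded_linear (%w::real^'d. ta *R w)" by (rule bounded_linear_scaleR_right)
  show "smooth (%w. (1 / J) * rh' w)" unfolding rh'_def
  by (intro smooth_mult smooth_const smooth_affine_compose[OF bl s])
  show "0 <= (1 / J) * rh' w" for w using J rh0 by (simp add: rh'_def)
  show "(1 / J) * rh' w <= (1 / J) * B" for w using J B by (intro mult_left_mono) (auto simp: rh'_def)
  show "(1 / J) * rh' w = 0" if "w ~: cball e (th / 2)" for w
  proof -
  have "R = ta * (th / 2)" using th by (simp add: ta_def)
  also have "... < ta * norm (w - e)" using that ta by (intro mult_strict_left_mono) (auto simp: dist_norm norm_minus_commute)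
  also have "... = norm (ta *R (w - e))" using ta by simp
  finally have "rh (ta *R (w - e)) = 0" by (rule kernel_props(5)[OF k])
  thus ?thesis by (simp add: rh'_def algebra_simps)
  qed
  show "(LI w. (1 / J) * rh' w) = 1" using J by (simp add: J_def)
 qed
qed

lemma four_powr_eq: "(4::real) powr p = 2 powr p * 2 powr p"
 using powr_mult[of 2 2 p] by simp

lemma four_point_powr_le:
 fixes a b c d :: real
 assumes p: "0 <= p"
 shows "\<bar>a - d\<bar> powr p <= 4 powr p * (\<bar>a - b\<bar> powr p + \<bar>d - c\<bar> powr p + \<bar>b - c\<bar> powr p)"
proof -
 have 2: "1 <= (2::real) powr p" using p by (simp add: ge_one_powr_ge_zero)
 have "\<bar>a - d\<bar> powr p <= 2 powr p * (\<bar>a - b\<bar> powr p + \<bar>b - d\<bar> powr p)"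
  using norm_diff_powr_le[OF p, of a d b] by simp
 also have "... <= 2 powr p * (2 powr p * \<bar>a - b\<bar> powr p + 2 powr p * (\<bar>b - c\<bar> powr p + \<bar>d - c\<bar> powr p))"
 proof (intro mult_left_mono add_mono)
  show "\<bar>a - b\<bar> powr p <= 2 powr p * \<bar>a - b\<bar> powr p" using mult_right_mono[OF 2, of "\<bar>a - b\<bar> powr p"] by simp
  show "\<bar>b - d\<bar> powr p <= 2 powr p * (\<bar>b - c\<bar> powr p + \<bar>d - c\<bar> powr p)"
  using norm_diff_powr_le[OF p, of b d c] by (simp add: abs_minus_commute)
 qed simp
 also have "... = 4 powr p * (\<bar>a - b\<bar> powr p + \<bar>d - c\<bar> powr p + \<bar>b - c\<bar> powr p)"
  unfolding four_powr_eq by (simp add: algebra_simps)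
 finally show ?thesis .
qed

lemma sum_bound_powr_le:
 fixes x :: real
 assumes p: "0 <= p" and x: "0 <= x" "x <= om * (A + A') + ka" and nn: "0 <= om" "0 <= A" "0 <= A'" "0 <= ka"
 shows "x powr p <= 4 powr p * (om powr p * (A powr p + A' powr p) + ka powr p)"
proof -
 have 2: "1 <= (2::real) powr p" using p by (simp add: ge_one_powr_ge_zero)
 have "x powr p <= (om * (A + A') + ka) powr p" using x p by (intro powr_mono2) auto
 also have "... <= 2 powr p * ((om * (A + A')) powr p + ka powr p)"
  using norm_add_powr_le[OF p, of "om * (A + A')" ka] nn by simp
 also have "(om * (A + A')) powr p = om powr p * (A + A') powr p" using nn by (simp add: powr_mult)
 also have "2 powr p * (om powr p * (A + A') powr p + ka powr p)
  <= 2 powr p * (om powr p * (2 powr p * (A powr p + A' powr p)) + 2 powr p * ka powr p)"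
 proof (intro mult_left_mono add_mono)
  show "(A + A') powr p <= 2 powr p * (A powr p + A' powr p)" using norm_add_powr_le[OF p, of A A'] nn by simp
  show "ka powr p <= 2 powr p * ka powr p" using mult_right_mono[OF 2, of "ka powr p"] by simp
 qed auto
 also have "... = 4 powr p * (om powr p * (A powr p + A' powr p) + ka powr p)"
  unfolding four_powr_eq by (simp add: algebra_simps)
 finally show ?thesis .
qed

text \<open>As a function of \<open>y\<close> this is the mollifier transported to the cone of size
  \<open>ep\<close> with vertex \<open>x\<close>; pairing with it gives the cone average at
  \<open>x\<close>.\<close>

definition scaled_bump :: "(real^'d => real) => real => real^'d => real^'d => real" where
 "scaled_bump et ep x y = (1 / ep ^ CARD('d)) * et ((- (1 / ep)) *R x + (1 / ep) *R y)"

text \<open>The cone condition places the support in the domain, however close \<open>x\<close> is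
  to the boundary.\<close>

lemma scaled_bump_test_function:
 assumes et: "smooth et" "!!w. w ~: cball e (th / 2) ==> et w = 0"
  and cone: "cone_condition Om V e th s0" and ep: "0 < ep" "ep <= s0" and x: "x : V"
 shows "scaled_bump et ep x : tests Om"
proof (rule test_functionI[of _ "(%w. x + ep *R w) ` cball e (th / 2)"])
 have bl: "bounded_linear (%y. (1 / ep) *R y)" by (rule bounded_linear_scaleR_right)
 show "smooth (scaled_bump et ep x)" unfolding scaled_bump_def[abs_def]
  by (intro smooth_mult smooth_const smooth_affine_compose[OF bl et(1)])
 show "compact ((%w. x + ep *R w) ` cball e (th / 2))" by (intro compact_continuous_image continuous_intros) auto
 show "(%w. x + ep *R w) ` cball e (th / 2) <= Om"
 proof clarify
  fix w assume "w : cball e (th / 2)"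
  hence "w : ball e th" using cone by (auto simp: cone_condition_def)
  thus "x + ep *R w : Om" using cone x ep by (auto simp: cone_condition_def)
 qed
 fix y assume y: "y ~: (%w. x + ep *R w) ` cball e (th / 2)"
 have "y = x + ep *R ((- (1 / ep)) *R x + (1 / ep) *R y)" using ep by (simp add: algebra_simps)
 hence nb: "(- (1 / ep)) *R x + (1 / ep) *R y ~: cball e (th / 2)" using y by blast
 show "scaled_bump et ep x y = 0" unfolding scaled_bump_def et(2)[OF nb] by simp
qed

lemma scaled_bump_pairing:
 fixes u et :: "real^'d => real"
 assumes ep: "0 < ep" and u: "u : Bm" and et: "et : Bm"
 shows "(LI y. u y * scaled_bump et ep x y) = (LI w. et w * u (x + ep *R w))"
proof -
 note u[measurable] et[measurable]
 have m: "(%y. u y * scaled_bump et ep x y) : Bm" unfolding scaled_bump_def by measurable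
 have "(LI y. u y * scaled_bump et ep x y) = ep ^ CARD('d) * (LI w. u (x + ep *R w) * scaled_bump et ep x (x + ep *R w))"
  using integral_lborel_affine[OF m, of ep x] ep by simp
 also have "... = (LI w. ep ^ CARD('d) * (u (x + ep *R w) * scaled_bump et ep x (x + ep *R w)))" by simp
 also have "... = (LI w. et w * u (x + ep *R w))"
 proof (intro lint_cong refl)
  fix w
  have "(- (1 / ep)) *R x + (1 / ep) *R (x + ep *R w) = w" using ep by (simp add: scaleR_right_distrib)
  thus "ep ^ CARD('d) * (u (x + ep *R w) * scaled_bump et ep x (x + ep *R w)) = et w * u (x + ep *R w)"
  using ep by (simp add: scaled_bump_def)
 qed
 finally show ?thesis .
qed

lemma finite_classes_slice_pairing:
 fixes f g :: "nat => real \<times> (real^'d) => real"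
 assumes ks: "kernel_sequence T p M R Om rh f j" and pg: "1 < p" and ze: "ze : tests Om"
  and ae: "ALL n>=1. AE z in lborel. z : {0<..<T} \<times> Om --> g n z = f n z"
  and gF: "ALL n>=1. EX F : bochner_space p (leb {0<..<T}) (W_neg1_space p Om) (W_neg1_norm p Om).
  has_distributional_time_derivative T Om (g n) F & bochner_norm p (leb {0<..<T}) (W_neg1_norm p Om) F <= M"
  and ka: "0 < ka"
 shows "finite_classes (%m n. 1 <= m --> 1 <= n --> (AE t in lborel. t : {0<..<T} -->
  \<bar>(LI x. f m (t, x) * ze x) - (LI x. f n (t, x) * ze x)\<bar> <= ka))"
proof -
 obtain B D where D: "0 <= D" and ex: "ALL n>=1. EX H. (ALL t. \<bar>H t\<bar> <= B) &
  (ALL s t. s <= t --> \<bar>H t - H s\<bar> powr p <= (t - s) powr (p - 1) * D) &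
  (AE t in lborel. t : {0<..<T} --> (LI x. f n (t, x) * ze x) = H t)"
  using slice_pairing_regularity[OF ks pg ze ae gF] by blast
 define P where "P n H \<longleftrightarrow> (ALL t. \<bar>H t\<bar> <= B) &
  (ALL s t. s <= t --> \<bar>H t - H s\<bar> powr p <= (t - s) powr (p - 1) * D) &
  (AE t in lborel. t : {0<..<T} --> (LI x. f n (t, x) * ze x) = H t)" for n and H :: "real => real"
 define H where "H n = (if 1 <= n then SOME H. P n H else (%_. 0))" for n :: nat
 have P: "P n (H n)" if "1 <= n" for n
 proof -
  have "EX H. P n H" unfolding P_def by (rule ex[rule_format, OF that])
  thus ?thesis using that someI_ex[of "P n"] by (simp add: H_def)
 qed
 have B0: "0 <= B"
 proof -
  have "\<bar>H 1 0\<bar> <= B" using P[of 1] by (simp add: P_def)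
  thus ?thesis by linarith
 qed
 have "finite_classes (%m n. ALL t:{0<..<T}. \<bar>H m t - H n t\<bar> <= ka)"
 proof (rule finite_classes_equicontinuous[OF pg D ka])
  show "\<bar>H n t\<bar> <= B" for n t using P[of n] B0 by (cases "1 <= n") (simp_all add: P_def H_def)
  show "\<bar>H n t - H n s\<bar> powr p <= (t - s) powr (p - 1) * D" if "s <= t" for n s t
  using P[of n] D that by (cases "1 <= n") (simp_all add: P_def H_def)
 qed
 thus ?thesis
 proof (rule finite_classes_mono, intro impI)
  fix m n :: nat
  assume c: "ALL t:{0<..<T}. \<bar>H m t - H n t\<bar> <= ka" and mn: "1 <= m" "1 <= n"
  have "AE t in lborel. t : {0<..<T} --> (LI x. f m (t, x) * ze x) = H m t"
  "AE t in lborel. t : {0<..<T} --> (LI x. f n (t, x) * ze x) = H n t"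
  using P[OF mn(1)] P[OF mn(2)] by (simp_all add: P_def)
  thus "AE t in lborel. t : {0<..<T} -->
  \<bar>(LI x. f m (t, x) * ze x) - (LI x. f n (t, x) * ze x)\<bar> <= ka"
  by eventually_elim (use c in auto)
 qed
qed

text \<open>The average at \<open>x\<close> is compared with that at a point \<open>x'\<close> of a
  net: changing the bump by \<open>om\<close> costs \<open>om\<close> times the L1 norms, and at
  \<open>x'\<close> the pairings of \<open>u\<close> and \<open>v\<close> differ by at most
  \<open>ka\<close>.\<close>

lemma mollified_difference:
 fixes u v et :: "real^'d => real"
 assumes ep: "0 < ep" and et: "et : Bm" "!!w. 0 <= et w" "!!w. et w <= B"
  and u: "intl u" and v: "intl v"
  and om: "!!y. \<bar>scaled_bump et ep x y - scaled_bump et ep x' y\<bar> <= om"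
  and ka: "\<bar>(LI y. u y * scaled_bump et ep x' y) - (LI y. v y * scaled_bump et ep x' y)\<bar> <= ka"
 shows "\<bar>(LI w. et w * u (x + ep *R w)) - (LI w. et w * v (x + ep *R w))\<bar>
  <= om * ((LI y. \<bar>u y\<bar>) + (LI y. \<bar>v y\<bar>)) + ka"
proof -
 note et(1)[measurable]
 have sm[measurable]: "scaled_bump et ep x : Bm" for x unfolding scaled_bump_def[abs_def] by measurable
 have B0: "0 <= B" using et(2,3)[of 0] by linarith
 have sb: "\<bar>scaled_bump et ep x y\<bar> <= 1 / ep ^ CARD('d) * B" for x y
 proof -
  have "\<bar>scaled_bump et ep x y\<bar> = 1 / ep ^ CARD('d) * et ((- (1 / ep)) *R x + (1 / ep) *R y)"
  unfolding scaled_bump_def abs_mult using ep et(2) by simp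
  also have "... <= 1 / ep ^ CARD('d) * B" using ep et(3) by (intro mult_left_mono) auto
  finally show ?thesis .
 qed
 have close: "\<bar>(LI y. h y * scaled_bump et ep x y) - (LI y. h y * scaled_bump et ep x' y)\<bar> <= om * (LI y. \<bar>h y\<bar>)"
  if h: "intl h" for h :: "real^'d => real"
 proof -
  have [measurable]: "h : Bm" using h by simp
  have i: "intl (%y. h y * scaled_bump et ep x y)" for x
  proof (rule lint_bound[of lborel "%y. (1 / ep ^ CARD('d) * B) * h y"])
  show "AE y in lborel. norm (h y * scaled_bump et ep x y) <= norm ((1 / ep ^ CARD('d) * B) * h y)"
  proof (rule AE_I2)
  fix y
  have "\<bar>h y\<bar> * \<bar>scaled_bump et ep x y\<bar> <= \<bar>h y\<bar> * (1 / ep ^ CARD('d) * B)" by (rule mult_left_mono[OF sb]) simp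
  moreover have "0 <= 1 / ep ^ CARD('d) * B" using ep B0 by simp
  ultimately show "norm (h y * scaled_bump et ep x y) <= norm ((1 / ep ^ CARD('d) * B) * h y)"
  unfolding real_norm_def abs_mult[of "h y"] abs_mult[of "1 / ep ^ CARD('d) * B"] by (simp only: abs_of_nonneg mult.commute)
  qed
  qed (use h in auto)
  have "(LI y. h y * scaled_bump et ep x y) - (LI y. h y * scaled_bump et ep x' y)
  = (LI y. h y * scaled_bump et ep x y - h y * scaled_bump et ep x' y)"
  by (rule Bochner_Integration.integral_diff[symmetric]) (rule i)+
  also have "\<bar>...\<bar> <= (LI y. om * \<bar>h y\<bar>)"
  proof (rule integral_abs_bound_integral)
  show "intl (%y. h y * scaled_bump et ep x y - h y * scaled_bump et ep x' y)" by (intro Bochner_Integration.integrable_diff i)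
  show "intl (%y. om * \<bar>h y\<bar>)" using h by simp
  fix y
  have "\<bar>h y * scaled_bump et ep x y - h y * scaled_bump et ep x' y\<bar> = \<bar>h y\<bar> * \<bar>scaled_bump et ep x y - scaled_bump et ep x' y\<bar>"
  by (simp add: abs_mult[symmetric] algebra_simps)
  also have "... <= \<bar>h y\<bar> * om" by (rule mult_left_mono[OF om]) simp
  finally show "\<bar>h y * scaled_bump et ep x y - h y * scaled_bump et ep x' y\<bar> <= om * \<bar>h y\<bar>" by (simp only: mult.commute)
  qed
  also have "... = om * (LI y. \<bar>h y\<bar>)" by simp
  finally show ?thesis .
 qed
 have "u : Bm" "v : Bm" using u v by auto
 thus ?thesis
  using close[OF u] close[OF v] ka by (simp add: scaled_bump_pairing[OF ep _ et(1), symmetric] distrib_left)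
qed

text \<open>The difference of two functions splits into two mollification errors, small for large
  indices by the cone estimates, and the difference of the averages. The latter is reduced to
  finitely many net points by equicontinuity in x, and there the coded pairings in t decide.\<close>

lemma local_total_boundedness:
 fixes f g :: "nat => real \<times> (real^'d) => real"
 assumes ks: "kernel_sequence T p M R Om rh f j" and pg: "1 < p" and sm: "smooth rh"
  and c0: "0 < c0" and r0: "0 < r" and r: "!!x. norm x <= r ==> c0 <= rh x"
  and bd: "bounded Om" and V[measurable]: "V : sets borel" and VOm: "V <= Om" and cone: "cone_condition Om V e th s0"
  and ae: "ALL n>=1. AE z in lborel. z : {0<..<T} \<times> Om --> g n z = f n z"
  and gF: "ALL n>=1. EX F : bochner_space p (leb {0<..<T}) (W_neg1_space p Om) (W_neg1_norm p Om).
  has_distributional_time_derivative T Om (g n) F & bochner_norm p (leb {0<..<T}) (W_neg1_norm p Om) F <= M"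
  and de: "0 < de"
 shows "finite_classes (%m n. 1 <= m --> 1 <= n -->
  (NI t. (NI x. ind V x * en (\<bar>f m (t, x) - f n (t, x)\<bar> powr p))) <= en de)"
proof -
 interpret kernel_sequence T p M R Om rh f j by (rule ks)
 note Omb[measurable]
 have p1: "1 <= p" and p0: "0 <= p" "0 < p" using pg by auto
 have th: "0 < th" and s0: "0 < s0" using cone by (auto simp: cone_condition_def)
 obtain et :: "real^'d => real" and B :: real where et: "smooth et" "!!w. 0 <= et w" "!!w. et w <= B" "!!w. w ~: cball e (th / 2) ==> et w = 0" "(LI w. et w) = 1"
  using cone_mollifier[OF k sm th, of e] by blast
 have etc: "cts et" by (rule smooth_continuous[OF et(1)])
 have etm[measurable]: "et : Bm" by (rule bm_contI[OF etc])
 have etW: "et w = 0" if "w ~: ball e th" for w using that th by (intro et(4)) auto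
 have B0: "0 <= B" using et(2,3)[of 0] by linarith
 have fmp[measurable]: "f n : borel_measurable (borel \<Otimes>\<^sub>M borel)" if "1 <= n" for n using fm[OF that] by (simp add: borel_prod)
 define M0 where "M0 = \<bar>M\<bar>"
 have M0: "0 <= M0" "en M <= en M0" by (auto simp: M0_def ennreal_leI)
 define v where "v = measure lborel Om"
 have v0: "0 <= v" by (simp add: v_def)
 have ev: "emeasure lborel Om <= en v"
  unfolding v_def using emeasure_bounded_finite[OF bd] by (simp add: emeasure_eq_ennreal_measure less_top)
 have eV: "emeasure lborel V <= en v"
  using emeasure_mono[OF VOm, of lborel] ev by auto
 define K1 where "K1 = measure lborel (ball e th) powr (p - 1) * B powr p"
 define K2 where "K2 = (4 / r) powr p * (4 / r) ^ CARD('d) / c0"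
 have K: "0 <= K1" "0 <= K2" using c0 r0 by (auto simp: K1_def K2_def)
 define G where "G ep n t x = (LI w. et w * f n (t, x + ep *R w))" for ep n t x
 define a where "a ep n t = (NI x. ind V x * en (\<bar>f n (t, x) - G ep n t x\<bar> powr p))" for ep n t
 have Gm: "(%z. G ep n (fst z) (snd z)) : borel_measurable (borel \<Otimes>\<^sub>M borel)" if n: "1 <= n" for ep n
  unfolding G_def using fmp[OF n, measurable]
  by (intro lborel.borel_measurable_lebesgue_integral) measurable
 have Gms: "G ep n t : Bm" if n: "1 <= n" for ep n t
  using measurable_compose[OF measurable_Pair1'[of t borel borel] Gm[OF n, of ep]] by simp
 have am: "a ep n : Bm" if n: "1 <= n" for ep n
 proof -
  note Gm[OF n, measurable] fmp[OF n, measurable]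
  have "(%t. (NI x. ind V x * en (\<bar>f n (t, x) - G ep n (fst (t, x)) (snd (t, x))\<bar> powr p))) : Bm"
  by measurable
  thus ?thesis by (simp add: a_def[abs_def])
 qed
 have slice_fin: "AE t in lborel. pil p (%x. f n (t, x)) < \<infinity>" if n: "1 <= n" for n
  by (rule AE_slice_finite[OF fm[OF n] fLp[OF n]])
 have aint: "(NI t. a ep n t) <= en (K1 * K2 * M0 * ep powr p)"
  if n: "1 <= n" "r <= 2 * ep * real n" and ep: "0 < ep" "ep <= s0" for ep n
 proof -
  have em: "(%t. kenergy p rh Om n (%x. f n (t, x))) : Bm"
  using fmp[OF n(1), measurable] rescaled_measurable[OF kernel_props(3)[OF k], of n, measurable]
  unfolding kenergy_def by measurable
  have "(NI t. a ep n t) <= (NI t. en (K1 * (K2 * ep powr p)) * (en (real n powr p) * kenergy p rh Om n (%x. f n (t, x))))"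
  proof (rule nn_integral_mono_AE)
  show "AE t in lborel. a ep n t <= en (K1 * (K2 * ep powr p)) * (en (real n powr p) * kenergy p rh Om n (%x. f n (t, x)))"
  using slice_fin[OF n(1)]
  proof eventually_elim
  case (elim t)
  have um: "(%x. f n (t, x)) : Bm" by (rule slice_measurable[OF fm[OF n(1)]])
  have "a ep n t <= en K1 * (NI w. ind (ball e th) w * (NI x. ind V x *
  en (\<bar>f n (t, x + ep *R w) - f n (t, x)\<bar> powr p)))"
  unfolding a_def G_def K1_def by (rule mollification_error(1)[OF p1 V um elim etm et(2,3) etW et(5) ep(1)])
  also have "... <= en K1 * (en (K2 * ep powr p) * (en (real n powr p) * kenergy p rh Om n (%x. f n (t, x))))"
  unfolding K2_def by (intro mult_left_mono chain_estimate[OF k c0 r0 r Omb V um cone ep n(2) p1]) auto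
  also have "... = en (K1 * (K2 * ep powr p)) * (en (real n powr p) * kenergy p rh Om n (%x. f n (t, x)))"
  using K by (subst ennreal_mult) (auto simp: mult.assoc)
  finally show ?case .
  qed
  qed
  also have "... = en (K1 * (K2 * ep powr p)) * (en (real n powr p) * (NI t. kenergy p rh Om n (%x. f n (t, x))))"
  using em by (simp add: nn_integral_cmult)
  also have "... <= en (K1 * (K2 * ep powr p)) * en M0"
  using order_trans[OF fe[OF n(1)] M0(2)] by (rule mult_left_mono) simp
  also have "... = en (K1 * K2 * M0 * ep powr p)"
  using K M0 by (subst ennreal_mult[symmetric]) (auto simp: mult_ac)
  finally show ?thesis .
 qed
 have de3: "0 < de / 3" using de by simp
 \<comment> \<open>A third of \<open>de\<close> is reserved for the two mollification errors;
   \<open>ep\<close> depends on the uniform bounds only and is chosen before any index.\<close>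
 obtain ep where ep: "0 < ep" "ep <= s0" "(4 powr p * 2 * (K1 * K2 * M0)) * ep powr p <= de / 3"
  using small_powr[OF _ de3 s0 p0(2), of "4 powr p * 2 * (K1 * K2 * M0)"] K M0 by auto
 \<comment> \<open>One factor \<open>4 powr p\<close> comes from splitting the difference at the
   averages, the other from splitting the difference of the averages at a net point.\<close>
 define c16 where "c16 = (4::real) powr p * 4 powr p"
 have c16: "0 <= c16" by (simp add: c16_def)
 obtain om where om: "0 < om" "(c16 * v * v powr (p - 1) * 2 * M0) * om powr p <= de / 3"
  using small_powr[OF _ de3 zero_less_one p0(2), of "c16 * v * v powr (p - 1) * 2 * M0"] c16 v0 M0 by auto
 obtain ka where ka: "0 < ka" "(c16 * v * T) * ka powr p <= de / 3"
  using small_powr[OF _ de3 zero_less_one p0(2), of "c16 * v * T"] c16 v0 T0 by auto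
 have "0 < om * ep ^ CARD('d)" using om ep by simp
 then obtain d where d: "0 < d" "!!x y. dist x y < d ==> dist (et x) (et y) < om * ep ^ CARD('d)"
 proof (rule uniformly_continuous_bounded_support[OF etc, rotated])
  fix x :: "real^'d" assume x: "norm e + th < norm x"
  have "norm x <= norm e + norm (x - e)" by (metis add.commute diff_add_cancel norm_triangle_ineq)
  thus "et x = 0" using x by (intro etW) (auto simp: dist_norm norm_minus_commute)
 qed blast
 have sbc: "\<bar>scaled_bump et ep x y - scaled_bump et ep x' y\<bar> <= om" if "dist x' x < ep * d" for x x' y
 proof -
  let ?A = "%x. (- (1 / ep)) *R x + (1 / ep) *R y"
  have "?A x - ?A x' = (1 / ep) *R (x' - x)" by (simp add: algebra_simps)
  hence "dist (?A x) (?A x') = (1 / ep) * dist x' x" using ep(1) by (simp only: dist_norm norm_scaleR) simp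
  also have "... < d" using that ep(1) by (simp add: field_simps)
  finally have "\<bar>et (?A x) - et (?A x')\<bar> <= om * ep ^ CARD('d)" using d(2)[of "?A x" "?A x'"] by (simp add: dist_norm)
  hence "(1 / ep ^ CARD('d)) * \<bar>et (?A x) - et (?A x')\<bar> <= om" using ep(1) by (simp add: field_simps)
  moreover have "scaled_bump et ep x y - scaled_bump et ep x' y = (1 / ep ^ CARD('d)) * (et (?A x) - et (?A x'))"
  unfolding scaled_bump_def right_diff_distrib ..
  ultimately show ?thesis using ep(1) by (simp add: abs_mult)
 qed
 have epd: "0 < ep * d" using ep(1) d(1) by simp
 \<comment> \<open>The centres are taken in \<open>V\<close>, so that their bumps are test
   functions, while the balls cover the compact closure.\<close>
 have "compact (closure V)" using bounded_subset[OF bd VOm] by (simp add: compact_closure)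
 moreover have "closure V <= (\<Union>x\<in>V. ball x (ep * d))"
 proof
  fix y assume "y : closure V"
  then obtain x where "x : V" "dist x y < ep * d" using epd closure_approachable by blast
  thus "y : (\<Union>x\<in>V. ball x (ep * d))" by auto
 qed
 ultimately obtain X where X: "X <= V" "finite X" "closure V <= (\<Union>x\<in>X. ball x (ep * d))"
  using compactE_image[of "closure V" V "%x. ball x (ep * d)"] by (metis open_ball)
 define hp where "hp n x t = (LI y. f n (t, y) * scaled_bump et ep x y)" for n x t
 \<comment> \<open>The chain estimate asks for \<open>r <= 2 * ep * real n\<close>, which holds from
   \<open>n0\<close> on.\<close>
 define n0 where "n0 = nat \<lceil>r / (2 * ep)\<rceil> + 1"
 have n0: "r <= 2 * ep * real n" if "n0 <= n" for n
 proof -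
  have "r / (2 * ep) <= real n0" unfolding n0_def by linarith
  hence "r / (2 * ep) <= real n" using that by simp
  thus ?thesis using ep(1) by (simp add: field_simps)
 qed
 have fc1: "finite_classes (%m n. ALL x:X. 1 <= m --> 1 <= n --> (AE t in lborel. t : {0<..<T} --> \<bar>hp m x t - hp n x t\<bar> <= ka))"
 proof (rule finite_classes_ball[OF X(2)])
  fix x assume "x : X"
  hence "scaled_bump et ep x : tests Om"
  using X(1) by (intro scaled_bump_test_function[OF et(1,4) cone ep(1,2)]) auto
  from finite_classes_slice_pairing[OF ks pg this ae gF ka(1)]
  show "finite_classes (%m n. 1 <= m --> 1 <= n --> (AE t in lborel. t : {0<..<T} --> \<bar>hp m x t - hp n x t\<bar> <= ka))"
  unfolding hp_def .
 qed
 \<comment> \<open>The finitely many indices below \<open>n0\<close> are singled out, each in a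
   class of its own.\<close>
 have fc0: "finite_classes (%m n. m < n0 \<or> n < n0 --> m = n)"
 proof (rule finite_classesI[of "%n. min n n0"])
  show "finite (range (%n. min n n0))" by (rule finite_subset[of _ "{..n0}"]) auto
 qed auto
 show ?thesis
 proof (rule finite_classes_mono[OF finite_classes_conj[OF fc0 fc1]], intro impI)
  fix m n :: nat
  assume H: "(m < n0 \<or> n < n0 --> m = n) &
  (ALL x:X. 1 <= m --> 1 <= n --> (AE t in lborel. t : {0<..<T} --> \<bar>hp m x t - hp n x t\<bar> <= ka))"
  and m1: "1 <= m" and n1: "1 <= n"
  show "(NI t. (NI x. ind V x * en (\<bar>f m (t, x) - f n (t, x)\<bar> powr p))) <= en de"
  proof (cases "m = n")
  case True
  thus ?thesis by simp
  next
  case False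
  hence mn0: "n0 <= m" "n0 <= n" using H by auto
  have aeX: "AE t in lborel. ALL x:X. t : {0<..<T} --> \<bar>hp m x t - hp n x t\<bar> <= ka"
  using H m1 n1 X(2) by (intro AE_finite_allI) auto
  define P where "P l t = pil p (%x. f l (t, x))" for l t
  have Pm: "P l : Bm" if "1 <= l" for l
  unfolding P_def[abs_def] by (rule pint_slice_measurable[OF fm[OF that]])
  have Pint: "(NI t. P l t) <= en M0" if "1 <= l" for l
  unfolding P_def pint_prod[OF fm[OF that], symmetric] using order_trans[OF fb[OF that] M0(2)] .
  \<comment> \<open>\<open>mid t\<close> bounds \<open>4 powr p\<close> times the integral over
    \<open>V\<close> of the p-th power of the difference of the averages.\<close>
  define mid where "mid t = en c16 * (en (om powr p * v powr (p - 1)) * (P m t + P n t) + en (ka powr p)) * en v" for t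
  have pt: "(NI x. ind V x * en (\<bar>f m (t, x) - f n (t, x)\<bar> powr p))
  <= en (4 powr p) * (a ep m t + a ep n t) + mid t * ind {0<..<T} t"
  if fin: "P m t < \<infinity>" "P n t < \<infinity>" and tX: "ALL x:X. t : {0<..<T} --> \<bar>hp m x t - hp n x t\<bar> <= ka" for t
  proof (cases "t : {0<..<T}")
  case False
  hence "f m (t, x) = 0" "f n (t, x) = 0" for x using f0[OF m1] f0[OF n1] by auto
  thus ?thesis by simp
  next
  case True
  have um[measurable]: "(%x. f l (t, x)) : Bm" if "1 <= l" for l by (rule slice_measurable[OF fm[OF that]])
  note um[OF m1, measurable] um[OF n1, measurable] Gms[OF m1, measurable] Gms[OF n1, measurable]
  have u0: "f l (t, x) = 0" if "1 <= l" "x ~: Om" for l x using f0[OF that(1)] that(2) by auto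
  have ui: "intl (%x. f l (t, x))" if l: "1 <= l" "P l t < \<infinity>" for l
  by (rule integrable_Lp_support[of _ _ Om p])
  (use um[OF l(1)] p1 ev u0[OF l(1)] l(2) in \<open>auto simp: P_def intro: le_less_trans\<close>)
  define A where "A l = (LI y. \<bar>f l (t, y)\<bar>)" for l
  have A0: "0 <= A l" for l by (simp add: A_def)
  have AP: "en (A l powr p) <= en (v powr (p - 1)) * P l t" if l: "1 <= l" for l
  proof -
  have "en (norm (LI y. \<bar>f l (t, y)\<bar>) powr p) <= en (v powr (p - 1)) * pil p (%y. \<bar>f l (t, y)\<bar>)"
  by (rule jensen_powr_support[of _ _ Om]) (use um[OF l] p1 ev u0[OF l] in auto)
  thus ?thesis by (simp add: A_def P_def pint_def)
  qed
  define q where "q = en (4 powr p) * (en (om powr p * v powr (p - 1)) * (P m t + P n t) + en (ka powr p))"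
  have mid_le: "en (\<bar>G ep m t x - G ep n t x\<bar> powr p) <= q" if x: "x : V" for x
  proof -
  have "x : closure V" using x closure_subset by blast
  then obtain x' where x': "x' : X" "dist x' x < ep * d" using X(3) by auto
  have "\<bar>G ep m t x - G ep n t x\<bar> <= om * (A m + A n) + ka"
  unfolding G_def A_def
  proof (rule mollified_difference[OF ep(1) etm et(2,3) ui[OF m1 fin(1)] ui[OF n1 fin(2)]])
  show "\<bar>scaled_bump et ep x y - scaled_bump et ep x' y\<bar> <= om" for y by (rule sbc[OF x'(2)])
  show "\<bar>(LI y. f m (t, y) * scaled_bump et ep x' y) - (LI y. f n (t, y) * scaled_bump et ep x' y)\<bar> <= ka"
  using tX x'(1) True unfolding hp_def by blast
  qed
  hence "\<bar>G ep m t x - G ep n t x\<bar> powr p <= 4 powr p * (om powr p * (A m powr p + A n powr p) + ka powr p)"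
  by (intro sum_bound_powr_le p0 A0) (use om ka in auto)
  hence "en (\<bar>G ep m t x - G ep n t x\<bar> powr p) <= en (4 powr p * (om powr p * (A m powr p + A n powr p) + ka powr p))"
  by (rule ennreal_leI)
  also have "... = en (4 powr p) * (en (om powr p) * (en (A m powr p) + en (A n powr p)) + en (ka powr p))"
  by (simp add: ennreal_mult)
  also have "... <= en (4 powr p) * (en (om powr p) * (en (v powr (p - 1)) * P m t + en (v powr (p - 1)) * P n t) + en (ka powr p))"
  by (intro mult_left_mono add_mono AP m1 n1) auto
  also have "... = q" by (simp add: q_def ennreal_mult distrib_left mult.assoc)
  finally show ?thesis .
  qed
  have "(NI x. ind V x * en (\<bar>f m (t, x) - f n (t, x)\<bar> powr p))
  <= (NI x. en (4 powr p) * (ind V x * en (\<bar>f m (t, x) - G ep m t x\<bar> powr p)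
  + ind V x * en (\<bar>f n (t, x) - G ep n t x\<bar> powr p) + q * ind V x))"
  proof (rule nn_integral_mono)
  fix x
  show "ind V x * en (\<bar>f m (t, x) - f n (t, x)\<bar> powr p) <= en (4 powr p) * (ind V x * en (\<bar>f m (t, x) - G ep m t x\<bar> powr p)
  + ind V x * en (\<bar>f n (t, x) - G ep n t x\<bar> powr p) + q * ind V x)"
  proof (cases "x : V")
  case True
  have "en (\<bar>f m (t, x) - f n (t, x)\<bar> powr p) <= en (4 powr p * (\<bar>f m (t, x) - G ep m t x\<bar> powr p
  + \<bar>f n (t, x) - G ep n t x\<bar> powr p + \<bar>G ep m t x - G ep n t x\<bar> powr p))"
  by (intro ennreal_leI four_point_powr_le p0)
  also have "... = en (4 powr p) * (en (\<bar>f m (t, x) - G ep m t x\<bar> powr p)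
  + en (\<bar>f n (t, x) - G ep n t x\<bar> powr p) + en (\<bar>G ep m t x - G ep n t x\<bar> powr p))"
  by (simp add: ennreal_mult)
  also have "... <= en (4 powr p) * (en (\<bar>f m (t, x) - G ep m t x\<bar> powr p)
  + en (\<bar>f n (t, x) - G ep n t x\<bar> powr p) + q)"
  by (intro mult_left_mono add_left_mono mid_le True) simp
  finally show ?thesis using True by simp
  qed simp
  qed
  also have "... = en (4 powr p) * (a ep m t + a ep n t + q * emeasure lborel V)"
  unfolding a_def
  by (subst nn_integral_cmult, measurable, subst nn_integral_add, measurable, subst nn_integral_add, measurable)
  (simp add: nn_integral_cmult_indicator)
  also have "... <= en (4 powr p) * (a ep m t + a ep n t + q * en v)"
  by (intro mult_left_mono add_left_mono eV) auto
  also have "... = en (4 powr p) * (a ep m t + a ep n t) + mid t"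
  proof -
  have "mid t = en (4 powr p) * (q * en v)"
  by (simp add: mid_def q_def c16_def ennreal_mult mult.assoc)
  thus ?thesis by (simp only: distrib_left add.assoc)
  qed
  finally show ?thesis using True by simp
  qed
  have Sm: "mid : Bm" unfolding mid_def[abs_def] using Pm[OF m1, measurable] Pm[OF n1, measurable] by measurable
  have "(NI t. (NI x. ind V x * en (\<bar>f m (t, x) - f n (t, x)\<bar> powr p)))
  <= (NI t. en (4 powr p) * (a ep m t + a ep n t) + mid t * ind {0<..<T} t)"
  proof (rule nn_integral_mono_AE)
  show "AE t in lborel. (NI x. ind V x * en (\<bar>f m (t, x) - f n (t, x)\<bar> powr p))
  <= en (4 powr p) * (a ep m t + a ep n t) + mid t * ind {0<..<T} t"
  using slice_fin[OF m1] slice_fin[OF n1] aeX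
  by eventually_elim (rule pt, auto simp: P_def)
  qed
  also have "... = en (4 powr p) * ((NI t. a ep m t) + (NI t. a ep n t)) + (NI t. mid t * ind {0<..<T} t)"
  using am[OF m1, of ep, measurable] am[OF n1, of ep, measurable] Sm[measurable]
  by (simp add: nn_integral_add nn_integral_cmult)
  also have "(NI t. mid t * ind {0<..<T} t)
  <= (NI t. en (c16 * v * om powr p * v powr (p - 1)) * (P m t + P n t) + en (c16 * v * ka powr p) * ind {0<..<T} t)"
  proof (rule nn_integral_mono)
  fix t
  have "mid t = en (c16 * v * om powr p * v powr (p - 1)) * (P m t + P n t) + en (c16 * v * ka powr p)"
  using c16 v0 by (simp add: mid_def ennreal_mult algebra_simps)
  thus "mid t * ind {0<..<T} t <= en (c16 * v * om powr p * v powr (p - 1)) * (P m t + P n t) + en (c16 * v * ka powr p) * ind {0<..<T} t"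
  by (auto simp: indicator_def)
  qed
  also have "... = en (c16 * v * om powr p * v powr (p - 1)) * ((NI t. P m t) + (NI t. P n t)) + en (c16 * v * ka powr p) * en T"
  using Pm[OF m1, measurable] Pm[OF n1, measurable] T0
  by (simp add: nn_integral_add nn_integral_cmult nn_integral_cmult_indicator)
  also have "en (4 powr p) * ((NI t. a ep m t) + (NI t. a ep n t)) +
  (en (c16 * v * om powr p * v powr (p - 1)) * ((NI t. P m t) + (NI t. P n t)) + en (c16 * v * ka powr p) * en T)
  <= en (4 powr p) * (en (K1 * K2 * M0 * ep powr p) + en (K1 * K2 * M0 * ep powr p)) +
  (en (c16 * v * om powr p * v powr (p - 1)) * (en M0 + en M0) + en (c16 * v * ka powr p) * en T)"
  by (intro add_mono mult_left_mono aint[OF m1 n0[OF mn0(1)] ep(1,2)] aint[OF n1 n0[OF mn0(2)] ep(1,2)] Pint m1 n1) auto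
  also have "... = en (4 powr p * (K1 * K2 * M0 * ep powr p + K1 * K2 * M0 * ep powr p) +
  (c16 * v * om powr p * v powr (p - 1) * (M0 + M0) + c16 * v * ka powr p * T))"
  using K M0(1) c16 v0 T0 by (simp add: ennreal_mult[symmetric] ennreal_plus[symmetric] del: ennreal_plus)
  also have "... <= en de"
  proof (rule ennreal_leI)
  have "4 powr p * (K1 * K2 * M0 * ep powr p + K1 * K2 * M0 * ep powr p) = (4 powr p * 2 * (K1 * K2 * M0)) * ep powr p"
  by (simp add: algebra_simps)
  moreover have "c16 * v * om powr p * v powr (p - 1) * (M0 + M0) = (c16 * v * v powr (p - 1) * 2 * M0) * om powr p"
  by (simp add: algebra_simps)
  moreover have "c16 * v * ka powr p * T = (c16 * v * T) * ka powr p" by (simp add: algebra_simps)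
  ultimately show "4 powr p * (K1 * K2 * M0 * ep powr p + K1 * K2 * M0 * ep powr p) +
  (c16 * v * om powr p * v powr (p - 1) * (M0 + M0) + c16 * v * ka powr p * T) <= de"
  using ep(3) om(2) ka(2) by linarith
  qed
  finally show ?thesis by (simp add: add_left_mono)
  qed
 qed
qed

section \<open>Covering the domain\<close>

text \<open>Monotonicity makes the value at 0 a maximum, positive because the kernel is not
  identically zero; continuity extends a lower bound to a ball.\<close>

lemma kernel_positive_near_zero:
 fixes rh :: "real^'d => real"
 assumes k: "is_kernel rh R" and mono: "ALL x y. norm x <= norm y --> rh y <= rh x"
 obtains c0 r where "0 < c0" "0 < r" "!!x. norm x <= r ==> c0 <= rh x"
proof -
 obtain x0 where x0: "rh x0 ~= 0" using k by (auto simp: is_kernel_def)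
 have "0 < rh x0" using x0 kernel_props(1)[OF k, of x0] by linarith
 hence pos: "0 < rh 0" using mono[rule_format, of 0 x0] by simp
 have "isCont rh 0" using kernel_props(2)[OF k] by (simp add: continuous_on_eq_continuous_at)
 then obtain d where d: "0 < d" "!!x. dist x 0 < d ==> dist (rh x) (rh 0) < rh 0 / 2"
  using pos unfolding continuous_at_eps_delta by (metis half_gt_zero)
 have "rh 0 / 2 <= rh x" if "norm x <= d / 2" for x
 proof -
  have "dist x 0 < d" using that d(1) by simp
  from d(2)[OF this] show ?thesis unfolding dist_real_def by linarith
 qed
 thus ?thesis using pos d(1) by (intro that[of "rh 0 / 2" "d / 2"]) auto
qed

text \<open>Compactness of the closure yields finitely many cone neighbourhoods, and a finite
  conjunction of local codes is again a code.\<close>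

lemma total_boundedness:
 fixes f g :: "nat => real \<times> (real^'d) => real"
 assumes ks: "kernel_sequence T p M R Om rh f j" and pg: "1 < p" and sm: "smooth rh"
  and mono: "ALL x y. norm x <= norm y --> rh y <= rh x" and dom: "smooth_bounded_domain Om"
  and ae: "ALL n>=1. AE z in lborel. z : {0<..<T} \<times> Om --> g n z = f n z"
  and gF: "ALL n>=1. EX F : bochner_space p (leb {0<..<T}) (W_neg1_space p Om) (W_neg1_norm p Om).
  has_distributional_time_derivative T Om (g n) F & bochner_norm p (leb {0<..<T}) (W_neg1_norm p Om) F <= M"
  and de: "0 < de"
 shows "finite_classes (%m n. 1 <= m --> 1 <= n --> pil p (%z. f m z - f n z) <= en de)"
proof -
 interpret kernel_sequence T p M R Om rh f j by (rule ks)
 have bd: "bounded Om" using dom by (simp add: smooth_bounded_domain_def)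
 obtain c0 r where c0: "0 < c0" "0 < r" "!!x. norm x <= r ==> c0 <= rh x"
  using kernel_positive_near_zero[OF k mono] by blast
 define good where "good x s \<longleftrightarrow> 0 < s & (EX e th s0. cone_condition Om (Om \<inter> ball x s) e th s0)" for x s
 define rad where "rad x = (SOME s. good x s)" for x
 have rad: "good x (rad x)" if "x : closure Om" for x
 proof -
  have "EX s. good x s" using smooth_domain_cone[OF dom that] unfolding good_def by blast
  thus ?thesis unfolding rad_def by (rule someI_ex)
 qed
 have "compact (closure Om)" using bd by (simp add: compact_closure)
 moreover have "closure Om <= (\<Union>x\<in>closure Om. ball x (rad x))"
 proof
  fix x assume x: "x : closure Om"
  hence "x : ball x (rad x)" using rad[OF x] by (simp add: good_def)
  thus "x : (\<Union>x\<in>closure Om. ball x (rad x))" using x by blast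
 qed
 ultimately obtain X where X: "X <= closure Om" "finite X" "closure Om <= (\<Union>x\<in>X. ball x (rad x))"
  using compactE_image[of "closure Om" "closure Om" "%x. ball x (rad x)"] by (metis open_ball)
 define V where "V x = Om \<inter> ball x (rad x)" for x
 have Vm[measurable]: "V x : sets borel" for x unfolding V_def using Omb by simp
 \<comment> \<open>The error is shared among the pieces; the added 1 spares a case distinction on
   the size of the cover.\<close>
 define de' where "de' = de / (real (card X) + 1)"
 have de': "0 < de'" using de by (simp add: de'_def add_nonneg_pos)
 let ?E = "%x m n. (NI t. (NI y. ind (V x) y * en (\<bar>f m (t, y) - f n (t, y)\<bar> powr p)))"
 have "finite_classes (%m n. ALL x:X. 1 <= m --> 1 <= n --> ?E x m n <= en de')"
 proof (rule finite_classes_ball[OF X(2)])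
  fix x assume "x : X"
  hence "good x (rad x)" using X(1) rad by blast
  then obtain e th s0 where cone: "cone_condition Om (V x) e th s0" unfolding good_def V_def by blast
  have sub: "V x <= Om" by (simp add: V_def)
  show "finite_classes (%m n. 1 <= m --> 1 <= n --> ?E x m n <= en de')"
  by (rule local_total_boundedness[OF ks pg sm c0 bd Vm sub cone ae gF de'])
 qed
 thus ?thesis
 proof (rule finite_classes_mono, intro impI)
  fix m n :: nat
  assume H: "ALL x:X. 1 <= m --> 1 <= n --> ?E x m n <= en de'" and m1: "1 <= m" and n1: "1 <= n"
  have [measurable]: "f m : borel_measurable (borel \<Otimes>\<^sub>M borel)" "f n : borel_measurable (borel \<Otimes>\<^sub>M borel)"
  using fm[OF m1] fm[OF n1] by (simp_all add: borel_prod)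
  have dm: "(%z. f m z - f n z) : Bm" using fm[OF m1] fm[OF n1] by simp
  have "pil p (%z. f m z - f n z) = (NI t. (NI y. en (\<bar>f m (t, y) - f n (t, y)\<bar> powr p)))"
  unfolding pint_prod[OF dm] by (simp add: pint_def)
  also have "... <= (NI t. (NI y. (\<Sum>x\<in>X. ind (V x) y * en (\<bar>f m (t, y) - f n (t, y)\<bar> powr p))))"
  proof (intro nn_integral_mono)
  fix t and y :: "real^'d"
  show "en (\<bar>f m (t, y) - f n (t, y)\<bar> powr p) <= (\<Sum>x\<in>X. ind (V x) y * en (\<bar>f m (t, y) - f n (t, y)\<bar> powr p))"
  proof (cases "y : Om")
  case True
  hence "y : closure Om" using closure_subset by blast
  then obtain x where x: "x : X" "y : ball x (rad x)" using X(3) by blast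
  hence "en (\<bar>f m (t, y) - f n (t, y)\<bar> powr p) = ind (V x) y * en (\<bar>f m (t, y) - f n (t, y)\<bar> powr p)"
  using True by (simp add: V_def)
  also have "... <= (\<Sum>x\<in>X. ind (V x) y * en (\<bar>f m (t, y) - f n (t, y)\<bar> powr p))"
  by (rule member_le_sum[OF x(1)]) (use X(2) in auto)
  finally show ?thesis .
  next
  case False
  hence "f m (t, y) = 0" "f n (t, y) = 0" using f0[OF m1] f0[OF n1] by auto
  thus ?thesis by simp
  qed
  qed
  also have "... = (\<Sum>x\<in>X. ?E x m n)"
  by (subst nn_integral_sum[symmetric], measurable, intro nn_integral_cong, subst nn_integral_sum) auto
  also have "... <= (\<Sum>x\<in>X. en de')" using H m1 n1 by (intro sum_mono) auto
  also have "... = en (real (card X) * de')" using de' by (simp add: ennreal_of_nat_eq_real_of_nat ennreal_mult)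
  also have "... <= en de"
  proof (rule ennreal_leI)
  have "real (card X) * de' <= (real (card X) + 1) * de'" using de' by (intro mult_right_mono) auto
  also have "... = de" by (simp add: de'_def)
  finally show "real (card X) * de' <= de" .
  qed
  finally show "pil p (%z. f m z - f n z) <= en de" .
 qed
qed

theorem theorem1p1:
  fixes T p M :: real
    and \<Omega> :: "(real^'d) set"
    and \<rho> :: "real^'d \<Rightarrow> real"
    and f :: "nat \<Rightarrow> real \<times> (real^'d) \<Rightarrow> real"
  assumes "0 < T" and "1 \<le> p" and "open \<Omega>"
    and "\<And>x. 0 \<le> \<rho> x" and "smooth \<rho>" and "radial \<rho>" and "compact (supp \<rho>)" and "\<exists>x. \<rho> x \<noteq> 0"
    and "\<And>n. 1 \<le> n \<Longrightarrow> f n \<in> Lp_space p (lebesgue_on ({0<..<T} \<times> \<Omega>))"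
    and "\<And>n. 1 \<le> n \<Longrightarrow>
      (\<integral>\<^sup>+ t. (\<integral>\<^sup>+ x. ennreal (\<bar>f n (t, x)\<bar> powr p) \<partial>lebesgue_on \<Omega>) \<partial>lebesgue_on {0<..<T})
        \<le> ennreal M"
    and "\<And>n. 1 \<le> n \<Longrightarrow>
      ennreal (real n powr p) *
      (\<integral>\<^sup>+ t. (\<integral>\<^sup>+ y. (\<integral>\<^sup>+ x. ennreal (rescaled \<rho> n (x - y) * \<bar>f n (t, x) - f n (t, y)\<bar> powr p)
         \<partial>lebesgue_on \<Omega>) \<partial>lebesgue_on \<Omega>) \<partial>lebesgue_on {0<..<T})
        \<le> ennreal M"
  shows
    "(\<forall>g. weakly_converges_in
             (Lp_space p (lebesgue_on ({0<..<T} \<times> \<Omega>))) (Lp_norm p (lebesgue_on ({0<..<T} \<times> \<Omega>))) f g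
        \<longrightarrow> (p > 1 \<longrightarrow> (\<lambda>t x. g (t, x)) \<in>
                bochner_space p (lebesgue_on {0<..<T}) (W1_space p \<Omega>) (W1_norm p \<Omega>)) \<and>
            (p = 1 \<longrightarrow> g \<in> L1_BV_space T \<Omega>))
     \<and>
     (p > 1 \<and> smooth_bounded_domain \<Omega> \<and> (\<forall>x y. norm x \<le> norm y \<longrightarrow> \<rho> y \<le> \<rho> x) \<and>
      (\<forall>n\<ge>1. \<exists>F \<in> bochner_space p (lebesgue_on {0<..<T}) (W_neg1_space p \<Omega>) (W_neg1_norm p \<Omega>).
          has_distributional_time_derivative T \<Omega> (f n) F \<and>
          bochner_norm p (lebesgue_on {0<..<T}) (W_neg1_norm p \<Omega>) F \<le> M)
      \<longrightarrow> relatively_compact_in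
            (Lp_space p (lebesgue_on ({0<..<T} \<times> \<Omega>))) (Lp_norm p (lebesgue_on ({0<..<T} \<times> \<Omega>)))
            (f ` {1..}))"
proof -
  let ?S = "{0<..<T} \<times> \<Omega>"
  obtain R where k: "is_kernel \<rho> R" by (rule is_kernel_exists[OF assms(4-8)])
  obtain j where j: "unit_bump j" by (rule unit_bump_exists[OF assms(4-8)])
  obtain f' where ks: "kernel_sequence T p M R \<Omega> \<rho> f' j"
    and ae: "\<forall>n\<ge>1. AE z in lborel. z \<in> ?S \<longrightarrow> f n z = f' n z"
    by (rule kernel_sequence_representative[OF k j assms(1-3,9-11)])
  have Sb: "?S \<in> sets borel" using assms(3) by (intro borel_open open_Times) auto
  have compact: "relatively_compact_in (Lp_space p (lebesgue_on ?S)) (Lp_norm p (lebesgue_on ?S)) (f ` {1..})"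
    if pg: "p > 1" and dom: "smooth_bounded_domain \<Omega>" and mono: "\<forall>x y. norm x \<le> norm y \<longrightarrow> \<rho> y \<le> \<rho> x"
      and gF: "\<forall>n\<ge>1. \<exists>F \<in> bochner_space p (lebesgue_on {0<..<T}) (W_neg1_space p \<Omega>) (W_neg1_norm p \<Omega>).
          has_distributional_time_derivative T \<Omega> (f n) F \<and> bochner_norm p (lebesgue_on {0<..<T}) (W_neg1_norm p \<Omega>) F \<le> M"
  proof (rule Lp_relatively_compact[OF assms(2)])
    show "f n \<in> Lp_space p (lebesgue_on ?S)" if "n \<in> {1..}" for n using that by (intro assms(9)) simp
    fix e :: real assume e: "0 < e"
    \<comment> \<open>Codes found for the representatives serve for \<open>f\<close> as well, since
      distances in Lp ignore null sets.\<close>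
    obtain c :: "nat \<Rightarrow> nat" where c: "finite (range c)"
      "\<forall>m n. c m = c n \<longrightarrow> 1 \<le> m \<longrightarrow> 1 \<le> n \<longrightarrow> pint p lborel (\<lambda>z. f' m z - f' n z) \<le> ennreal e"
      using total_boundedness[OF ks pg assms(5) mono dom ae gF e] unfolding finite_classes_def by blast
    have "pint p (lebesgue_on ?S) (\<lambda>z. f m z - f n z) \<le> ennreal e" if mn: "1 \<le> m" "1 \<le> n" "c m = c n" for m n
    proof -
      have "pint p (lebesgue_on ?S) (\<lambda>z. f m z - f n z) \<le> pint p lborel (\<lambda>z. f' m z - f' n z)"
        unfolding pint_def nn_integral_lebesgue_on[OF Sb]
      proof (rule nn_integral_mono_AE)
        have "AE z in lborel. z \<in> ?S \<longrightarrow> f m z = f' m z" "AE z in lborel. z \<in> ?S \<longrightarrow> f n z = f' n z" using ae mn by auto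
        then show "AE z in lborel. ennreal (norm (f m z - f n z) powr p) * indicator ?S z \<le> ennreal (norm (f' m z - f' n z) powr p)"
          by eventually_elim (auto simp: indicator_def)
      qed
      also have "\<dots> \<le> ennreal e" using c(2) mn by blast
      finally show ?thesis .
    qed
    moreover have "finite (c ` {1..})" by (rule finite_subset[OF _ c(1)]) auto
    ultimately show "\<exists>c :: nat \<Rightarrow> nat. finite (c ` {1..}) \<and>
      (\<forall>m\<in>{1..}. \<forall>n\<in>{1..}. c m = c n \<longrightarrow> pint p (lebesgue_on ?S) (\<lambda>z. f m z - f n z) \<le> ennreal e)"
      by (intro exI[of _ c]) auto
  qed
  show ?thesis
    using weak_limit_regularity[OF ks ae] compact by blast
qed

end
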